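(* Let $n\ge1$ and let $a\in\mathbb Z$ with $a\geq0$ or $-n-1<a<0$. Then the category ${}^{\rm b}_{\rm s}(\mathcal D^E,\mathcal H)^a_{0}$-mod is equivalent to the category of nilpotent $\pi^aB(n+1)\pi^a$-modules.
   Context: Ground field $\mathbb C$. $\mathcal D=\mathcal D(n+1)$ is the Weyl algebra of differential operators on $\mathbb C[t_0,\dots,t_n]$, $\mathcal H=\mathbb C[t_0\partial_0,\dots,t_n\partial_n]$, $\mathcal H'\subset\mathcal H$ the subalgebra generated by all $t_i\partial_i-t_j\partial_j$, $E=\sum_i t_i\partial_i$, $\mathcal D^E$ the centralizer of $E$ in $\mathcal D$. A generalized weight $(\mathcal D^E,\mathcal H)$-module is a $\mathcal D^E$-module $M=\bigoplus_{\lambda\in\mathbb C^{n+1}}M^{(\lambda)}$, $M^{(\lambda)}=\{m:(t_i\partial_i-\lambda_i)^Nm=0\text{ for some }N>0\text{ and all }i\}$. ${}^{\rm b}_{\rm s}(\mathcal D^E,\mathcal H)^a_0$-mod is the category of such modules with finite-dimensional $M^{(\lambda)}$, with support $\{\lambda:M^{(\lambda)}\ne0\}$ in $\mathbb Z^{n+1}$, on which $E-a$ acts locally nilpotently and $\mathcal H'$ acts semisimply. $B(n+1)$ denotes the algebra whose modules are the $\mathbb Z_2^{n+1}$-graded modules over $\mathbb C[\theta_0,\dots,\theta_n]/(\theta_i^2-\theta_j^2)$, where $\theta_i$ has degree the $i$-th generator $\delta_i$ of $\mathbb Z_2^{n+1}$. Equivalently, it is the quotient of the path algebra of the quiver with vertices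 all subsets $J\subset\{0,\dots,n\}$, with one arrow in each direction between any two subsets differing by exactly one element, by the relations identifying any two paths with the same beginning, the same end and the same length. $e_J$ is the idempotent of the vertex $J$. $\mathcal P_a$ is the collection of all proper subsets of $\{0,\dots,n\}$ if $a\ge0$, and of all proper non-empty subsets if $-n-1<a<0$. $\pi^a=\sum_{J\in\mathcal P_a}e_J$. A nilpotent module is a finite-dimensional module annihilated by all elements of $\pi^aB(n+1)\pi^a$ of sufficiently large path length. *)

theory Defs
  imports Complex_Main "HOL-Algebra.Module" "HOL-Algebra.QuotRing"
    "HOL-Library.Poly_Mapping" "HOL-Library.FuncSet" "HOL-Library.Cardinality"
begin

section \<open>Categories and their equivalence\<close>

text \<open>Hom-sets need not be disjoint, so composition and the action of a functor on
  morphisms take the objects involved as arguments.  In \<open>Comp C X Y Z g f\<close> the morphism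
  \<open>f\<close> goes from \<open>X\<close> to \<open>Y\<close> and \<open>g\<close> from \<open>Y\<close> to \<open>Z\<close>.\<close>

record ('o, 'm) category =
  Obj :: "'o set"
  Hom :: "'o \<Rightarrow> 'o \<Rightarrow> 'm set"
  Id :: "'o \<Rightarrow> 'm"
  Comp :: "'o \<Rightarrow> 'o \<Rightarrow> 'o \<Rightarrow> 'm \<Rightarrow> 'm \<Rightarrow> 'm"

definition is_category :: "('o, 'm) category \<Rightarrow> bool" where
  "is_category C \<longleftrightarrow>
     (\<forall>X\<in>Obj C. Id C X \<in> Hom C X X) \<and>
     (\<forall>X\<in>Obj C. \<forall>Y\<in>Obj C. \<forall>Z\<in>Obj C. \<forall>f\<in>Hom C X Y. \<forall>g\<in>Hom C Y Z.
        Comp C X Y Z g f \<in> Hom C X Z) \<and>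
     (\<forall>X\<in>Obj C. \<forall>Y\<in>Obj C. \<forall>f\<in>Hom C X Y.
        Comp C X X Y f (Id C X) = f \<and> Comp C X Y Y (Id C Y) f = f) \<and>
     (\<forall>W\<in>Obj C. \<forall>X\<in>Obj C. \<forall>Y\<in>Obj C. \<forall>Z\<in>Obj C.
        \<forall>f\<in>Hom C W X. \<forall>g\<in>Hom C X Y. \<forall>h\<in>Hom C Y Z.
        Comp C W Y Z h (Comp C W X Y g f) = Comp C W X Z (Comp C X Y Z h g) f)"

definition is_functor ::
  "('o, 'm) category \<Rightarrow> ('p, 'k) category \<Rightarrow> ('o \<Rightarrow> 'p) \<Rightarrow> ('o \<Rightarrow> 'o \<Rightarrow> 'm \<Rightarrow> 'k) \<Rightarrow> bool" where
  "is_functor C D Fo Fm \<longleftrightarrow>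
     (\<forall>X\<in>Obj C. Fo X \<in> Obj D) \<and>
     (\<forall>X\<in>Obj C. \<forall>Y\<in>Obj C. \<forall>f\<in>Hom C X Y. Fm X Y f \<in> Hom D (Fo X) (Fo Y)) \<and>
     (\<forall>X\<in>Obj C. Fm X X (Id C X) = Id D (Fo X)) \<and>
     (\<forall>X\<in>Obj C. \<forall>Y\<in>Obj C. \<forall>Z\<in>Obj C. \<forall>f\<in>Hom C X Y. \<forall>g\<in>Hom C Y Z.
        Fm X Z (Comp C X Y Z g f) = Comp D (Fo X) (Fo Y) (Fo Z) (Fm Y Z g) (Fm X Y f))"

definition is_iso :: "('o, 'm) category \<Rightarrow> 'o \<Rightarrow> 'o \<Rightarrow> 'm \<Rightarrow> bool" where
  "is_iso C X Y f \<longleftrightarrow> f \<in> Hom C X Y \<and>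
     (\<exists>g\<in>Hom C Y X. Comp C X Y X g f = Id C X \<and> Comp C Y X Y f g = Id C Y)"

definition is_natural_iso ::
  "('o, 'm) category \<Rightarrow> ('p, 'k) category \<Rightarrow> ('o \<Rightarrow> 'p) \<Rightarrow> ('o \<Rightarrow> 'o \<Rightarrow> 'm \<Rightarrow> 'k) \<Rightarrow>
   ('o \<Rightarrow> 'p) \<Rightarrow> ('o \<Rightarrow> 'o \<Rightarrow> 'm \<Rightarrow> 'k) \<Rightarrow> ('o \<Rightarrow> 'k) \<Rightarrow> bool" where
  "is_natural_iso C D Fo Fm Go Gm \<eta> \<longleftrightarrow>
     (\<forall>X\<in>Obj C. is_iso D (Fo X) (Go X) (\<eta> X)) \<and>
     (\<forall>X\<in>Obj C. \<forall>Y\<in>Obj C. \<forall>f\<in>Hom C X Y.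
        Comp D (Fo X) (Fo Y) (Go Y) (\<eta> Y) (Fm X Y f) =
        Comp D (Fo X) (Go X) (Go Y) (Gm X Y f) (\<eta> X))"

definition equivalent_categories :: "('o, 'm) category \<Rightarrow> ('p, 'k) category \<Rightarrow> bool" where
  "equivalent_categories C D \<longleftrightarrow> is_category C \<and> is_category D \<and>
     (\<exists>Fo Fm Go Gm \<eta> \<epsilon>. is_functor C D Fo Fm \<and> is_functor D C Go Gm \<and>
        is_natural_iso C C (\<lambda>X. X) (\<lambda>X Y f. f)
          (\<lambda>X. Go (Fo X)) (\<lambda>X Y f. Gm (Fo X) (Fo Y) (Fm X Y f)) \<eta> \<and>
        is_natural_iso D D (\<lambda>X. Fo (Go X)) (\<lambda>X Y f. Fm (Go X) (Go Y) (Gm X Y f))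
          (\<lambda>X. X) (\<lambda>X Y f. f) \<epsilon>)"


section \<open>Modules over complex algebras\<close>

text \<open>The record \<open>module\<close> extends \<open>ring\<close> by a scalar multiplication.  An associative
  complex algebra is represented by a \<open>(complex, 'a) module\<close>, a left module over it by an
  \<open>('a, 'u) module\<close>, whose fields \<open>mult\<close> and \<open>one\<close> are not used.  The library locale
  \<open>module\<close> requires a commutative base ring; the following is its noncommutative version.\<close>

locale left_module = A?: ring A + M?: abelian_group M for A (structure) and M (structure) +
  assumes smult_closed [simp, intro]:
      "\<lbrakk>a \<in> carrier A; x \<in> carrier M\<rbrakk> \<Longrightarrow> a \<odot>\<^bsub>M\<^esub> x \<in> carrier M"
    and smult_l_distr:
      "\<lbrakk>a \<in> carrier A; b \<in> carrier A; x \<in> carrier M\<rbrakk> \<Longrightarrow>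
       (a \<oplus> b) \<odot>\<^bsub>M\<^esub> x = a \<odot>\<^bsub>M\<^esub> x \<oplus>\<^bsub>M\<^esub> b \<odot>\<^bsub>M\<^esub> x"
    and smult_r_distr:
      "\<lbrakk>a \<in> carrier A; x \<in> carrier M; y \<in> carrier M\<rbrakk> \<Longrightarrow>
       a \<odot>\<^bsub>M\<^esub> (x \<oplus>\<^bsub>M\<^esub> y) = a \<odot>\<^bsub>M\<^esub> x \<oplus>\<^bsub>M\<^esub> a \<odot>\<^bsub>M\<^esub> y"
    and smult_assoc:
      "\<lbrakk>a \<in> carrier A; b \<in> carrier A; x \<in> carrier M\<rbrakk> \<Longrightarrow>
       (a \<otimes> b) \<odot>\<^bsub>M\<^esub> x = a \<odot>\<^bsub>M\<^esub> (b \<odot>\<^bsub>M\<^esub> x)"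
    and smult_one [simp]: "x \<in> carrier M \<Longrightarrow> \<one> \<odot>\<^bsub>M\<^esub> x = x"

definition module_hom ::
  "(complex, 'a) module \<Rightarrow> ('a, 'u) module \<Rightarrow> ('a, 'u) module \<Rightarrow> ('u \<Rightarrow> 'u) set" where
  "module_hom A M N = {f \<in> carrier M \<rightarrow>\<^sub>E carrier N.
     (\<forall>x\<in>carrier M. \<forall>y\<in>carrier M. f (x \<oplus>\<^bsub>M\<^esub> y) = f x \<oplus>\<^bsub>N\<^esub> f y) \<and>
     (\<forall>a\<in>carrier A. \<forall>x\<in>carrier M. f (a \<odot>\<^bsub>M\<^esub> x) = a \<odot>\<^bsub>N\<^esub> f x)}"

text \<open>The full subcategory of the category of left \<open>A\<close>-modules given by the property \<open>P\<close>.
  Underlying sets of modules are subsets of the type \<open>'u\<close>, which plays the role of a universe.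
  If \<open>'u\<close> has at least continuum many elements, every module of countable dimension, in
  particular every module in the two categories below, has an isomorphic copy in it.\<close>

definition module_category ::
  "(complex, 'a) module \<Rightarrow> (('a, 'u) module \<Rightarrow> bool) \<Rightarrow> (('a, 'u) module, 'u \<Rightarrow> 'u) category" where
  "module_category A P = \<lparr>Obj = {M. left_module A M \<and> P M}, Hom = module_hom A,
     Id = (\<lambda>M. \<lambda>x\<in>carrier M. x), Comp = (\<lambda>L M N g f. compose (carrier L) g f)\<rparr>"

definition cscale :: "(complex, 'a) module \<Rightarrow> ('a, 'u) module \<Rightarrow> complex \<Rightarrow> 'u \<Rightarrow> 'u" where
  "cscale A M c m = (c \<odot>\<^bsub>A\<^esub> \<one>\<^bsub>A\<^esub>) \<odot>\<^bsub>M\<^esub> m"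

definition finite_dim :: "(complex, 'a) module \<Rightarrow> ('a, 'u) module \<Rightarrow> 'u set \<Rightarrow> bool" where
  "finite_dim A M W \<longleftrightarrow> (\<exists>S. finite S \<and> S \<subseteq> W \<and>
     (\<forall>m\<in>W. \<exists>c. m = (\<Oplus>\<^bsub>M\<^esub>s\<in>S. cscale A M (c s) s)))"

definition is_direct_sum :: "('a, 'u) module \<Rightarrow> ('l \<Rightarrow> 'u set) \<Rightarrow> bool" where
  "is_direct_sum M W \<longleftrightarrow> (\<forall>m\<in>carrier M. \<exists>!f.
     (\<forall>l. f l \<in> W l) \<and> finite {l. f l \<noteq> \<zero>\<^bsub>M\<^esub>} \<and> m = (\<Oplus>\<^bsub>M\<^esub>l\<in>{l. f l \<noteq> \<zero>\<^bsub>M\<^esub>}. f l))"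

definition simple_submodule :: "(complex, 'a) module \<Rightarrow> ('a, 'u) module \<Rightarrow> 'u set \<Rightarrow> bool" where
  "simple_submodule A M S \<longleftrightarrow> submodule S A M \<and> S \<noteq> {\<zero>\<^bsub>M\<^esub>} \<and>
     (\<forall>T. submodule T A M \<longrightarrow> T \<subseteq> S \<longrightarrow> T = {\<zero>\<^bsub>M\<^esub>} \<or> T = S)"

text \<open>A module is semisimple if it is the sum of its simple submodules.\<close>

definition acts_semisimply :: "(complex, 'a) module \<Rightarrow> ('a, 'u) module \<Rightarrow> bool" where
  "acts_semisimply A M \<longleftrightarrow> (\<forall>m\<in>carrier M. \<exists>T. finite T \<and>
     T \<subseteq> \<Union>{S. simple_submodule A M S} \<and> m = (\<Oplus>\<^bsub>M\<^esub>x\<in>T. x))"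


section \<open>Differential operators\<close>

text \<open>The index type \<open>'i\<close> stands for \<open>{0, \<dots>, n}\<close>; polynomials in the variables \<open>t\<^sub>i\<close> are
  finitely supported functions on the exponent vectors.\<close>

type_synonym 'i mpoly = "('i \<Rightarrow>\<^sub>0 nat) \<Rightarrow>\<^sub>0 complex"
type_synonym 'i operator = "'i mpoly \<Rightarrow> 'i mpoly"

definition var :: "'i \<Rightarrow> 'i mpoly" where
  "var i = Poly_Mapping.single (Poly_Mapping.single i 1) 1"

text \<open>For \<open>m i = 0\<close> the truncated difference \<open>m - single i 1\<close> is harmless, as the
  coefficient vanishes.\<close>

definition partial :: "'i \<Rightarrow> 'i operator" where
  "partial i p = (\<Sum>m\<in>Poly_Mapping.keys p. Poly_Mapping.single (m - Poly_Mapping.single i 1)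
     (of_nat (Poly_Mapping.lookup m i) * Poly_Mapping.lookup p m))"

definition scal :: "complex \<Rightarrow> 'i operator" where
  "scal c p = Poly_Mapping.map ((*) c) p"

inductive_set generated_operators :: "'i operator set \<Rightarrow> 'i operator set"
  for S :: "'i operator set" where
  generator: "X \<in> S \<Longrightarrow> X \<in> generated_operators S"
| scalar: "scal c \<in> generated_operators S"
| add: "X \<in> generated_operators S \<Longrightarrow> Y \<in> generated_operators S \<Longrightarrow>
    (\<lambda>p. X p + Y p) \<in> generated_operators S"
| comp: "X \<in> generated_operators S \<Longrightarrow> Y \<in> generated_operators S \<Longrightarrow>
    X \<circ> Y \<in> generated_operators S"

definition operator_algebra :: "'i operator set \<Rightarrow> (complex, 'i operator) module" where
  "operator_algebra S = \<lparr>carrier = S, mult = (\<circ>), one = id, zero = (\<lambda>p. 0),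
     add = (\<lambda>X Y p. X p + Y p), smult = (\<lambda>c X p. scal c (X p))\<rparr>"

definition weyl_algebra :: "'i operator set" where
  "weyl_algebra = generated_operators (range (\<lambda>i p. var i * p) \<union> range partial)"

definition t_partial :: "'i \<Rightarrow> 'i operator" where
  "t_partial i p = var i * partial i p"

definition euler :: "('i::finite) operator" where
  "euler p = (\<Sum>i\<in>UNIV. t_partial i p)"

definition D_E :: "(complex, ('i::finite) operator) module" where
  "D_E = operator_algebra {X \<in> weyl_algebra. X \<circ> euler = euler \<circ> X}"

definition H' :: "(complex, ('i::finite) operator) module" where
  "H' = operator_algebra
     (generated_operators {\<lambda>p. t_partial i p - t_partial j p | i j. True})"


section \<open>Weight modules\<close>

definition weight_space ::
  "(('i::finite) operator, 'u) module \<Rightarrow> ('i \<Rightarrow> complex) \<Rightarrow> 'u set" where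
  "weight_space M \<mu> = {m \<in> carrier M. \<exists>N::nat. N > 0 \<and>
     (\<forall>i. ((\<lambda>p. t_partial i p - scal (\<mu> i) p) [^]\<^bsub>D_E\<^esub> N) \<odot>\<^bsub>M\<^esub> m = \<zero>\<^bsub>M\<^esub>)}"

definition generalized_weight_module :: "(('i::finite) operator, 'u) module \<Rightarrow> bool" where
  "generalized_weight_module M \<longleftrightarrow> left_module D_E M \<and> is_direct_sum M (weight_space M)"

definition weight_support :: "(('i::finite) operator, 'u) module \<Rightarrow> ('i \<Rightarrow> complex) set" where
  "weight_support M = {\<mu>. weight_space M \<mu> \<noteq> {\<zero>\<^bsub>M\<^esub>}}"

definition E_locally_nilpotent :: "complex \<Rightarrow> (('i::finite) operator, 'u) module \<Rightarrow> bool" where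
  "E_locally_nilpotent a M \<longleftrightarrow> (\<forall>m\<in>carrier M. \<exists>N::nat.
     ((\<lambda>p. euler p - scal a p) [^]\<^bsub>D_E\<^esub> N) \<odot>\<^bsub>M\<^esub> m = \<zero>\<^bsub>M\<^esub>)"

definition weight_category ::
  "complex \<Rightarrow> ((('i::finite) operator, 'u) module, 'u \<Rightarrow> 'u) category" where
  "weight_category a = module_category D_E (\<lambda>M.
     generalized_weight_module M \<and>
     (\<forall>\<mu>. finite_dim D_E M (weight_space M \<mu>)) \<and>
     weight_support M \<subseteq> {\<mu>. \<forall>i. \<mu> i \<in> \<int>} \<and>
     E_locally_nilpotent a M \<and>
     acts_semisimply H' M)"


section \<open>The quiver algebra\<close>

text \<open>Since there is exactly one arrow between adjacent vertices in each direction, a path is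
  the nonempty list of the vertices it visits, in order; its length is the number of arrows.\<close>

type_synonym 'i path = "'i set list"

definition adjacent :: "'i set \<Rightarrow> 'i set \<Rightarrow> bool" where
  "adjacent J K \<longleftrightarrow> card (sym_diff J K) = 1"

definition paths :: "('i::finite) path set" where
  "paths = {p. p \<noteq> [] \<and> successively adjacent p}"

definition path_length :: "'i path \<Rightarrow> nat" where
  "path_length p = length p - 1"

text \<open>The product of paths \<open>p\<close> and \<open>q\<close> is ``first \<open>q\<close>, then \<open>p\<close>'' if \<open>q\<close> ends where \<open>p\<close>
  begins, and 0 otherwise.  So left modules are representations of the quiver.\<close>

definition path_algebra :: "(complex, ('i::finite) path \<Rightarrow>\<^sub>0 complex) module" where
  "path_algebra = \<lparr>carrier = {f. Poly_Mapping.keys f \<subseteq> paths},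
     mult = (\<lambda>f g. \<Sum>p\<in>Poly_Mapping.keys f. \<Sum>q\<in>Poly_Mapping.keys g.
       if last q = hd p
       then Poly_Mapping.single (q @ tl p) (Poly_Mapping.lookup f p * Poly_Mapping.lookup g q)
       else 0),
     one = (\<Sum>J\<in>UNIV. Poly_Mapping.single [J] 1),
     zero = 0, add = (+), smult = (\<lambda>c f. Poly_Mapping.map ((*) c) f)\<rparr>"

definition path_ideal :: "(('i::finite) path \<Rightarrow>\<^sub>0 complex) set" where
  "path_ideal = Idl\<^bsub>path_algebra\<^esub>
     {Poly_Mapping.single p 1 - Poly_Mapping.single q 1 | p q. p \<in> paths \<and> q \<in> paths \<and>
        hd p = hd q \<and> last p = last q \<and> path_length p = path_length q}"

definition quotient_algebra :: "(complex, 'a) module \<Rightarrow> 'a set \<Rightarrow> (complex, 'a set) module" where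
  "quotient_algebra A I = ring.extend (A Quot I)
     (module.fields (\<lambda>c X. \<Union>x\<in>X. I +>\<^bsub>A\<^esub> (c \<odot>\<^bsub>A\<^esub> x)))"

definition corner_algebra :: "(complex, 'a) module \<Rightarrow> 'a \<Rightarrow> (complex, 'a) module" where
  "corner_algebra A e = A\<lparr>carrier := {e \<otimes>\<^bsub>A\<^esub> x \<otimes>\<^bsub>A\<^esub> e | x. x \<in> carrier A}, one := e\<rparr>"

definition B :: "(complex, (('i::finite) path \<Rightarrow>\<^sub>0 complex) set) module" where
  "B = quotient_algebra path_algebra path_ideal"

definition path_class ::
  "(('i::finite) path \<Rightarrow>\<^sub>0 complex) \<Rightarrow> ('i path \<Rightarrow>\<^sub>0 complex) set" where
  "path_class f = path_ideal +>\<^bsub>path_algebra\<^esub> f"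

definition vertex_idempotent :: "('i::finite) set \<Rightarrow> ('i path \<Rightarrow>\<^sub>0 complex) set" where
  "vertex_idempotent J = path_class (Poly_Mapping.single [J] 1)"

text \<open>Only used for integers \<open>a > - n - 1\<close>.\<close>

definition vertices :: "int \<Rightarrow> ('i::finite) set set" where
  "vertices a = (if a \<ge> 0 then {J. J \<noteq> UNIV} else {J. J \<noteq> UNIV \<and> J \<noteq> {}})"

definition pi_idempotent :: "int \<Rightarrow> (('i::finite) path \<Rightarrow>\<^sub>0 complex) set" where
  "pi_idempotent a = (\<Oplus>\<^bsub>B\<^esub>J\<in>vertices a. vertex_idempotent J)"

definition pi_B_pi :: "int \<Rightarrow> (complex, (('i::finite) path \<Rightarrow>\<^sub>0 complex) set) module" where
  "pi_B_pi a = corner_algebra B (pi_idempotent a)"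

text \<open>The relations are homogeneous, so path length defines a grading of the quotient.\<close>

definition length_component :: "nat \<Rightarrow> (('i::finite) path \<Rightarrow>\<^sub>0 complex) set set" where
  "length_component l = {path_class f | f. f \<in> carrier path_algebra \<and>
     (\<forall>p\<in>Poly_Mapping.keys f. path_length p = l)}"

definition nilpotent_module ::
  "int \<Rightarrow> ((('i::finite) path \<Rightarrow>\<^sub>0 complex) set, 'u) module \<Rightarrow> bool" where
  "nilpotent_module a M \<longleftrightarrow> finite_dim (pi_B_pi a) M (carrier M) \<and>
     (\<exists>N. \<forall>l\<ge>N. \<forall>x \<in> carrier (pi_B_pi a) \<inter> length_component l. \<forall>m\<in>carrier M.
        x \<odot>\<^bsub>M\<^esub> m = \<zero>\<^bsub>M\<^esub>)"

definition nilpotent_category ::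
  "int \<Rightarrow> (((('i::finite) path \<Rightarrow>\<^sub>0 complex) set, 'u) module, 'u \<Rightarrow> 'u) category" where
  "nilpotent_category a = module_category (pi_B_pi a) (nilpotent_module a)"

end

theory Submission
  imports Defs "HOL-Computational_Algebra.Polynomial_FPS" "HOL-Library.Countable"
begin

text \<open>Both categories are equivalent to the category of finite-dimensional nilpotent representations of
  one linear category over \<open>\<complex>[[z]]\<close>.  Its objects are the \<open>J\<close> in \<open>\<P>\<^sub>a\<close>, its morphisms from \<open>J\<close> to \<open>K\<close>
  are free of rank one on a generator \<open>x\<^sub>K\<^sub>J\<close>, and
  \<open>x\<^sub>L\<^sub>K x\<^sub>K\<^sub>J = z\<^bsup>e\<^esup> x\<^sub>L\<^sub>J\<close> with \<open>e = \<bar>K - J\<bar> + \<bar>L - K\<bar> - \<bar>L - J\<bar>\<close>.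

  A class of paths is determined by its end points and the number of upward steps, so a path from \<open>J\<close> to
  \<open>K\<close> with \<open>u\<close> upward steps has the symbol \<open>z\<^bsup>u\<^esup>\<close>, a multiple of \<open>z\<^bsup>|K - J|\<^esup>\<close>.
  On the other side, a differential operator of degree 0 acts on \<open>t\<^bsup>p + z\<^esup>\<close>, where \<open>p\<close> is an integral
  weight of degree \<open>a\<close> and \<open>z\<close> is added to all exponents, by a matrix over \<open>\<complex>[z]\<close>.  The entry at \<open>(q, p)\<close>
  is a multiple of \<open>z\<^bsup>|K - J|\<^esup>\<close>, where \<open>J\<close> and \<open>K\<close> are the sets of indices at which \<open>p\<close> and
  \<open>q\<close> are negative, and the normally ordered monomial of weight \<open>q - p\<close> attains this up to a unit of \<open>\<complex>[[z]]\<close>.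
  Since \<open>\<H>'\<close> acts semisimply, all \<open>t\<^sub>i \<partial>\<^sub>i - p i\<close> agree on the weight space of \<open>p\<close>; their common
  value is the action of \<open>z\<close>.\<close>

section \<open>Equivalence along a span of fully faithful functors\<close>

text \<open>The two categories consist of modules over different algebras in different universes,
  and what they share is only the shape of their matrix entries. Hence both are reached from a
  category of pure linear algebra. All its spaces live in the one type \<open>complex poly\<close>:
  a space of any finite dimension is the image of a projection of the countably dimensional space of
  polynomials.

  Power series are needed because a differential operator produces, besides the forced power of
  \<open>z\<close>, a product of factors \<open>c + z\<close> with \<open>c \<noteq> 0\<close>. In
  general this is invertible only as a power series, and power series act because \<open>z\<close>
  acts nilpotently on every component.

  The crux of essential surjectivity is that the action of an algebra element between two components
  is determined by its symbol (\<open>keyed\<close>). It is proved along normal forms: paths up to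
  the relations on one side, normally ordered operators on the other. Without semisimplicity of
  \<open>H'\<close> it would fail for operators, since the weight operators would then give several
  commuting nilpotent maps on a component instead of one.\<close>

lemma is_categoryD:
  assumes "is_category C"
  shows "X \<in> Obj C \<Longrightarrow> Id C X \<in> Hom C X X"
    and "X \<in> Obj C \<Longrightarrow> Y \<in> Obj C \<Longrightarrow> Z \<in> Obj C \<Longrightarrow> f \<in> Hom C X Y \<Longrightarrow> g \<in> Hom C Y Z \<Longrightarrow>
           Comp C X Y Z g f \<in> Hom C X Z"
    and "X \<in> Obj C \<Longrightarrow> Y \<in> Obj C \<Longrightarrow> f \<in> Hom C X Y \<Longrightarrow> Comp C X X Y f (Id C X) = f"
    and "X \<in> Obj C \<Longrightarrow> Y \<in> Obj C \<Longrightarrow> f \<in> Hom C X Y \<Longrightarrow> Comp C X Y Y (Id C Y) f = f"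
    and "W \<in> Obj C \<Longrightarrow> X \<in> Obj C \<Longrightarrow> Y \<in> Obj C \<Longrightarrow> Z \<in> Obj C \<Longrightarrow>
           f \<in> Hom C W X \<Longrightarrow> g \<in> Hom C X Y \<Longrightarrow> h \<in> Hom C Y Z \<Longrightarrow>
           Comp C W Y Z h (Comp C W X Y g f) = Comp C W X Z (Comp C X Y Z h g) f"
  using assms unfolding is_category_def by blast+

lemma is_isoE:
  assumes "is_iso C X Y f"
  obtains g where "f \<in> Hom C X Y" "g \<in> Hom C Y X"
    "Comp C X Y X g f = Id C X" "Comp C Y X Y f g = Id C Y"
  using assms unfolding is_iso_def by blast

lemma iso_comp:
  assumes C: "is_category C" and o: "X \<in> Obj C" "Y \<in> Obj C" "Z \<in> Obj C"
    and f: "is_iso C X Y f" and g: "is_iso C Y Z g"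
  shows "is_iso C X Z (Comp C X Y Z g f)"
proof -
  note c = is_categoryD[OF C]
  obtain f' where f': "f \<in> Hom C X Y" "f' \<in> Hom C Y X"
    "Comp C X Y X f' f = Id C X" "Comp C Y X Y f f' = Id C Y" using f by (rule is_isoE)
  obtain g' where g': "g \<in> Hom C Y Z" "g' \<in> Hom C Z Y"
    "Comp C Y Z Y g' g = Id C Y" "Comp C Z Y Z g g' = Id C Z" using g by (rule is_isoE)
  have 1: "Comp C X Z X (Comp C Z Y X f' g') (Comp C X Y Z g f) = Id C X"
  proof -
    have "Comp C X Z X (Comp C Z Y X f' g') (Comp C X Y Z g f)
        = Comp C X Y X f' (Comp C X Z Y g' (Comp C X Y Z g f))"
      by (rule c(5)[symmetric]) (use o f' g' c(2) in auto)
    also have "Comp C X Z Y g' (Comp C X Y Z g f) = Comp C X Y Y (Comp C Y Z Y g' g) f"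
      by (rule c(5)) (use o f' g' in auto)
    finally show ?thesis using f' g' c(4) o by simp
  qed
  have 2: "Comp C Z X Z (Comp C X Y Z g f) (Comp C Z Y X f' g') = Id C Z"
  proof -
    have "Comp C Z X Z (Comp C X Y Z g f) (Comp C Z Y X f' g')
        = Comp C Z Y Z g (Comp C Z X Y f (Comp C Z Y X f' g'))"
      by (rule c(5)[symmetric]) (use o f' g' c(2) in auto)
    also have "Comp C Z X Y f (Comp C Z Y X f' g') = Comp C Z Y Y (Comp C Y X Y f f') g'"
      by (rule c(5)) (use o f' g' in auto)
    finally show ?thesis using f' g' c(4) o by simp
  qed
  show ?thesis unfolding is_iso_def using 1 2 c(2) o f' g' by blast
qed

text \<open>The index set \<open>R\<close> carries no morphisms; it only matches objects of
  \<open>C\<close> with objects of \<open>D\<close>. Since \<open>T'\<close> inherits the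
  compatibility of \<open>T\<close> with identities and composition, the situation is symmetric, and
  the sublocale \<open>dual\<close> below turns each construction of a functor from \<open>C\<close>
  to \<open>D\<close> into one in the other direction.\<close>

locale hom_bijection =
  fixes C :: "('o, 'm) category" and D :: "('p, 'k) category" and R :: "'r set"
    and F :: "'r \<Rightarrow> 'o" and G :: "'r \<Rightarrow> 'p"
    and T :: "'r \<Rightarrow> 'r \<Rightarrow> 'm \<Rightarrow> 'k" and T' :: "'r \<Rightarrow> 'r \<Rightarrow> 'k \<Rightarrow> 'm"
  assumes C: "is_category C" and D: "is_category D"
    and F: "r \<in> R \<Longrightarrow> F r \<in> Obj C" and G: "r \<in> R \<Longrightarrow> G r \<in> Obj D"
    and T: "r \<in> R \<Longrightarrow> s \<in> R \<Longrightarrow> f \<in> Hom C (F r) (F s) \<Longrightarrow> T r s f \<in> Hom D (G r) (G s)"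
    and T': "r \<in> R \<Longrightarrow> s \<in> R \<Longrightarrow> h \<in> Hom D (G r) (G s) \<Longrightarrow> T' r s h \<in> Hom C (F r) (F s)"
    and T'_T: "r \<in> R \<Longrightarrow> s \<in> R \<Longrightarrow> f \<in> Hom C (F r) (F s) \<Longrightarrow> T' r s (T r s f) = f"
    and T_T': "r \<in> R \<Longrightarrow> s \<in> R \<Longrightarrow> h \<in> Hom D (G r) (G s) \<Longrightarrow> T r s (T' r s h) = h"
    and T_id: "r \<in> R \<Longrightarrow> T r r (Id C (F r)) = Id D (G r)"
    and T_comp: "r \<in> R \<Longrightarrow> s \<in> R \<Longrightarrow> t \<in> R \<Longrightarrow> f \<in> Hom C (F r) (F s) \<Longrightarrow>
        g \<in> Hom C (F s) (F t) \<Longrightarrow>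
        T r t (Comp C (F r) (F s) (F t) g f) = Comp D (G r) (G s) (G t) (T s t g) (T r s f)"
    and esC: "X \<in> Obj C \<Longrightarrow> \<exists>r\<in>R. \<exists>f. is_iso C X (F r) f"
    and esD: "Y \<in> Obj D \<Longrightarrow> \<exists>r\<in>R. \<exists>f. is_iso D Y (G r) f"
begin

lemma T'_id: "r \<in> R \<Longrightarrow> T' r r (Id D (G r)) = Id C (F r)"
  using T_id T'_T is_categoryD(1)[OF C] F by metis

lemma T'_comp:
  assumes o: "r \<in> R" "s \<in> R" "t \<in> R" "f \<in> Hom D (G r) (G s)" "g \<in> Hom D (G s) (G t)"
  shows "T' r t (Comp D (G r) (G s) (G t) g f) = Comp C (F r) (F s) (F t) (T' s t g) (T' r s f)"
proof -
  have "Comp D (G r) (G s) (G t) g f = T r t (Comp C (F r) (F s) (F t) (T' s t g) (T' r s f))"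
    using T_comp[OF o(1-3)] T' T_T' o by simp
  moreover have "Comp C (F r) (F s) (F t) (T' s t g) (T' r s f) \<in> Hom C (F r) (F t)"
    by (intro is_categoryD(2)[OF C]) (use o F T' in auto)
  ultimately show ?thesis using T'_T o by simp
qed

lemma iso_T:
  assumes o: "r \<in> R" "s \<in> R" and "is_iso C (F r) (F s) f"
  shows "is_iso D (G r) (G s) (T r s f)"
proof -
  obtain g where g: "f \<in> Hom C (F r) (F s)" "g \<in> Hom C (F s) (F r)"
    "Comp C (F r) (F s) (F r) g f = Id C (F r)" "Comp C (F s) (F r) (F s) f g = Id C (F s)"
    using assms(3) by (rule is_isoE)
  then have "Comp D (G r) (G s) (G r) (T s r g) (T r s f) = Id D (G r)"
    "Comp D (G s) (G r) (G s) (T r s f) (T s r g) = Id D (G s)"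
    using T_comp T_id o by metis+
  then show ?thesis unfolding is_iso_def using g T o by blast
qed

section \<open>Transport of morphisms along chosen isomorphisms\<close>

definition "q X = (SOME r. r \<in> R \<and> (\<exists>f. is_iso C X (F r) f))"
definition "u X = (SOME f. is_iso C X (F (q X)) f)"
definition "v X = (SOME g. g \<in> Hom C (F (q X)) X \<and> Comp C X (F (q X)) X g (u X) = Id C X \<and>
  Comp C (F (q X)) X (F (q X)) (u X) g = Id C (F (q X)))"

lemma q: assumes "X \<in> Obj C" shows "q X \<in> R" "is_iso C X (F (q X)) (u X)"
proof -
  have 1: "q X \<in> R \<and> (\<exists>f. is_iso C X (F (q X)) f)"
    unfolding q_def by (rule someI_ex) (use esC[OF assms] in blast)
  then show "q X \<in> R" by blast
  show "is_iso C X (F (q X)) (u X)"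
    unfolding u_def by (rule someI_ex) (use 1 in blast)
qed

lemma uv:
  assumes "X \<in> Obj C"
  shows "F (q X) \<in> Obj C" "u X \<in> Hom C X (F (q X))" "v X \<in> Hom C (F (q X)) X"
    "Comp C X (F (q X)) X (v X) (u X) = Id C X"
    "Comp C (F (q X)) X (F (q X)) (u X) (v X) = Id C (F (q X))"
proof -
  have 1: "\<exists>g. g \<in> Hom C (F (q X)) X \<and> Comp C X (F (q X)) X g (u X) = Id C X \<and>
    Comp C (F (q X)) X (F (q X)) (u X) g = Id C (F (q X))"
    using q(2)[OF assms] unfolding is_iso_def by blast
  show "F (q X) \<in> Obj C" using q(1)[OF assms] F by simp
  show "u X \<in> Hom C X (F (q X))" using q(2)[OF assms] unfolding is_iso_def by blast
  show "v X \<in> Hom C (F (q X)) X" "Comp C X (F (q X)) X (v X) (u X) = Id C X"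
    "Comp C (F (q X)) X (F (q X)) (u X) (v X) = Id C (F (q X))"
    using someI_ex[OF 1] unfolding v_def by blast+
qed

definition "tw X Y f = Comp C (F (q X)) X (F (q Y)) (Comp C X Y (F (q Y)) (u Y) f) (v X)"
definition "Qo X = G (q X)"
definition "Qm X Y f = T (q X) (q Y) (tw X Y f)"

lemma tw_hom:
  "X \<in> Obj C \<Longrightarrow> Y \<in> Obj C \<Longrightarrow> f \<in> Hom C X Y \<Longrightarrow> tw X Y f \<in> Hom C (F (q X)) (F (q Y))"
  unfolding tw_def by (intro is_categoryD(2)[OF C]) (auto simp: uv)

lemma tw_u:
  assumes "X \<in> Obj C" "Y \<in> Obj C" "f \<in> Hom C X Y"
  shows "Comp C X (F (q X)) (F (q Y)) (tw X Y f) (u X) = Comp C X Y (F (q Y)) (u Y) f"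
proof -
  note c = is_categoryD[OF C]
  note X = uv[OF assms(1)] and Y = uv[OF assms(2)]
  have "Comp C X (F (q X)) (F (q Y)) (tw X Y f) (u X) =
      Comp C X X (F (q Y)) (Comp C X Y (F (q Y)) (u Y) f) (Comp C X (F (q X)) X (v X) (u X))"
    unfolding tw_def by (rule c(5)[symmetric]) (use assms X Y c(2) in auto)
  also have "\<dots> = Comp C X Y (F (q Y)) (u Y) f"
    using c(3) X Y assms c(2) by simp
  finally show ?thesis .
qed

text \<open>Composition with \<open>u X\<close> can be cancelled by \<open>v X\<close>, so the
  commuting square determines \<open>tw X Y f\<close>. Functoriality of \<open>Qm\<close> then
  amounts to pasting squares.\<close>

lemma tw_unique:
  assumes "X \<in> Obj C" "Y \<in> Obj C" "f \<in> Hom C X Y" "h \<in> Hom C (F (q X)) (F (q Y))"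
    and eq: "Comp C X (F (q X)) (F (q Y)) h (u X) = Comp C X Y (F (q Y)) (u Y) f"
  shows "h = tw X Y f"
proof -
  note c = is_categoryD[OF C]
  note X = uv[OF assms(1)] and Y = uv[OF assms(2)]
  have "tw X Y f = Comp C (F (q X)) X (F (q Y)) (Comp C X (F (q X)) (F (q Y)) h (u X)) (v X)"
    by (simp add: eq tw_def)
  also have "\<dots> = Comp C (F (q X)) (F (q X)) (F (q Y)) h (Comp C (F (q X)) X (F (q X)) (u X) (v X))"
    by (rule c(5)[symmetric]) (use assms X Y in auto)
  also have "\<dots> = h" using X Y assms c(3) by simp
  finally show ?thesis by simp
qed

lemma functor_Q: "is_functor C D Qo Qm"
proof -
  note c = is_categoryD[OF C]
  have o: "Qo X \<in> Obj D" if "X \<in> Obj C" for X using that q G by (simp add: Qo_def)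
  have m: "Qm X Y f \<in> Hom D (Qo X) (Qo Y)" if "X \<in> Obj C" "Y \<in> Obj C" "f \<in> Hom C X Y" for X Y f
    using T tw_hom q that unfolding Qo_def Qm_def by blast
  have i: "Qm X X (Id C X) = Id D (Qo X)" if "X \<in> Obj C" for X
  proof -
    note X = uv[OF that]
    have "Id C (F (q X)) = tw X X (Id C X)"
      by (rule tw_unique) (use that c X in auto)
    then show ?thesis using T_id q that unfolding Qm_def Qo_def by metis
  qed
  have k: "Qm X Z (Comp C X Y Z g f) = Comp D (Qo X) (Qo Y) (Qo Z) (Qm Y Z g) (Qm X Y f)"
    if o: "X \<in> Obj C" "Y \<in> Obj C" "Z \<in> Obj C" "f \<in> Hom C X Y" "g \<in> Hom C Y Z" for X Y Z f g
  proof -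
    note X = uv[OF o(1)] and Y = uv[OF o(2)] and Z = uv[OF o(3)]
    note h = tw_hom[OF o(1,2,4)] tw_hom[OF o(2,3,5)]
    have "Comp C (F (q X)) (F (q Y)) (F (q Z)) (tw Y Z g) (tw X Y f) = tw X Z (Comp C X Y Z g f)"
    proof (rule tw_unique)
      have "Comp C X (F (q X)) (F (q Z)) (Comp C (F (q X)) (F (q Y)) (F (q Z)) (tw Y Z g) (tw X Y f)) (u X)
         = Comp C X (F (q Y)) (F (q Z)) (tw Y Z g) (Comp C X (F (q X)) (F (q Y)) (tw X Y f) (u X))"
        by (rule c(5)[symmetric]) (use o X Y Z h in auto)
      also have "\<dots> = Comp C X (F (q Y)) (F (q Z)) (tw Y Z g) (Comp C X Y (F (q Y)) (u Y) f)"
        using tw_u o by simp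
      also have "\<dots> = Comp C X Y (F (q Z)) (Comp C Y (F (q Y)) (F (q Z)) (tw Y Z g) (u Y)) f"
        by (rule c(5)) (use o X Y Z h in auto)
      also have "\<dots> = Comp C X Y (F (q Z)) (Comp C Y Z (F (q Z)) (u Z) g) f"
        using tw_u o by simp
      also have "\<dots> = Comp C X Z (F (q Z)) (u Z) (Comp C X Y Z g f)"
        by (rule c(5)[symmetric]) (use o X Y Z h in auto)
      finally show "Comp C X (F (q X)) (F (q Z)) (Comp C (F (q X)) (F (q Y)) (F (q Z)) (tw Y Z g) (tw X Y f)) (u X)
        = Comp C X Z (F (q Z)) (u Z) (Comp C X Y Z g f)" .
    qed (use o X Y Z h c(2) in auto)
    then show ?thesis unfolding Qm_def Qo_def using T_comp h q o by metis
  qed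
  show ?thesis unfolding is_functor_def using o m i k by auto
qed

sublocale dual: hom_bijection D C R G F T' T
  by unfold_locales (use C D F G T T' T'_T T_T' T'_id T'_comp esC esD in auto)

text \<open>\<open>X\<close> is isomorphic to \<open>F (q X)\<close> by \<open>u X\<close>. The
  object \<open>G (q X)\<close> of \<open>D\<close> has a chosen representative of its own, and the
  chosen isomorphism to it is carried back to \<open>C\<close> by \<open>T'\<close>.\<close>

definition "eta X = Comp C X (F (q X)) (F (dual.q (Qo X)))
  (T' (q X) (dual.q (Qo X)) (dual.u (Qo X))) (u X)"

lemma eta_iso: "X \<in> Obj C \<Longrightarrow> is_iso C X (dual.Qo (Qo X)) (eta X)"
  unfolding eta_def dual.Qo_def
  using dual.q[of "Qo X"] q[of X] F G by (intro iso_comp C dual.iso_T) (auto simp: Qo_def)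

lemma eta_natural:
  assumes o: "X \<in> Obj C" "Y \<in> Obj C" "f \<in> Hom C X Y"
  shows "Comp C X Y (dual.Qo (Qo Y)) (eta Y) f =
    Comp C X (dual.Qo (Qo X)) (dual.Qo (Qo Y)) (dual.Qm (Qo X) (Qo Y) (Qm X Y f)) (eta X)"
proof -
  note c = is_categoryD[OF C]
  note X = uv[OF o(1)] and Y = uv[OF o(2)]
  have oX: "Qo X \<in> Obj D" "Qo Y \<in> Obj D" using o q G by (auto simp: Qo_def)
  have qX: "q X \<in> R" "q Y \<in> R" using o q by auto
  have dq: "dual.q (Qo X) \<in> R" "dual.q (Qo Y) \<in> R" using dual.q oX by auto
  note dX = dual.uv[OF oX(1)] and dY = dual.uv[OF oX(2)]
  have Qm: "Qm X Y f \<in> Hom D (Qo X) (Qo Y)"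
    using functor_Q o unfolding is_functor_def by blast
  have dc: "dual.tw (Qo X) (Qo Y) (Qm X Y f) \<in> Hom D (G (dual.q (Qo X))) (G (dual.q (Qo Y)))"
    using dual.tw_hom[OF oX Qm] .
  have hX: "T' (q X) (dual.q (Qo X)) (dual.u (Qo X)) \<in> Hom C (F (q X)) (F (dual.q (Qo X)))"
    using T' qX dq dX by (simp add: Qo_def)
  have hY: "T' (q Y) (dual.q (Qo Y)) (dual.u (Qo Y)) \<in> Hom C (F (q Y)) (F (dual.q (Qo Y)))"
    using T' qX dq dY by (simp add: Qo_def)
  have cj: "tw X Y f \<in> Hom C (F (q X)) (F (q Y))" using tw_hom o by simp
  have hm: "dual.Qm (Qo X) (Qo Y) (Qm X Y f) \<in> Hom C (F (dual.q (Qo X))) (F (dual.q (Qo Y)))"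
    unfolding dual.Qm_def using T' dq dc by simp
  have oF: "F (q X) \<in> Obj C" "F (q Y) \<in> Obj C" "F (dual.q (Qo X)) \<in> Obj C" "F (dual.q (Qo Y)) \<in> Obj C"
    using F qX dq by auto
  \<comment> \<open>The square for the chosen isomorphisms of \<open>D\<close>
    (\<open>dual.tw_u\<close>) is pulled back along \<open>T'\<close>, which undoes the
    \<open>T\<close> inside \<open>Qm\<close>.\<close>
  have key: "Comp C (F (q X)) (F (dual.q (Qo X))) (F (dual.q (Qo Y))) (dual.Qm (Qo X) (Qo Y) (Qm X Y f))
      (T' (q X) (dual.q (Qo X)) (dual.u (Qo X)))
    = Comp C (F (q X)) (F (q Y)) (F (dual.q (Qo Y))) (T' (q Y) (dual.q (Qo Y)) (dual.u (Qo Y))) (tw X Y f)"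
  proof -
    have "Comp C (F (q X)) (F (dual.q (Qo X))) (F (dual.q (Qo Y))) (dual.Qm (Qo X) (Qo Y) (Qm X Y f))
      (T' (q X) (dual.q (Qo X)) (dual.u (Qo X)))
     = T' (q X) (dual.q (Qo Y)) (Comp D (Qo X) (G (dual.q (Qo X))) (G (dual.q (Qo Y)))
          (dual.tw (Qo X) (Qo Y) (Qm X Y f)) (dual.u (Qo X)))"
      unfolding dual.Qm_def using T'_comp[OF qX(1) dq] dX dc by (simp add: Qo_def)
    also have "\<dots> = T' (q X) (dual.q (Qo Y)) (Comp D (Qo X) (Qo Y) (G (dual.q (Qo Y))) (dual.u (Qo Y)) (Qm X Y f))"
      using dual.tw_u[OF oX Qm] by simp
    also have "\<dots> = Comp C (F (q X)) (F (q Y)) (F (dual.q (Qo Y))) (T' (q Y) (dual.q (Qo Y)) (dual.u (Qo Y)))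
        (T' (q X) (q Y) (Qm X Y f))"
      using T'_comp[OF qX dq(2)] dY Qm by (simp add: Qo_def)
    also have "T' (q X) (q Y) (Qm X Y f) = tw X Y f"
      unfolding Qm_def using T'_T qX cj by simp
    finally show ?thesis .
  qed
  have "Comp C X (dual.Qo (Qo X)) (dual.Qo (Qo Y)) (dual.Qm (Qo X) (Qo Y) (Qm X Y f)) (eta X)
     = Comp C X (F (q X)) (F (dual.q (Qo Y))) (Comp C (F (q X)) (F (dual.q (Qo X))) (F (dual.q (Qo Y)))
        (dual.Qm (Qo X) (Qo Y) (Qm X Y f)) (T' (q X) (dual.q (Qo X)) (dual.u (Qo X)))) (u X)"
    unfolding eta_def dual.Qo_def by (rule c(5)) (use o oF X hX hm in auto)
  also have "\<dots> = Comp C X (F (q X)) (F (dual.q (Qo Y))) (Comp C (F (q X)) (F (q Y)) (F (dual.q (Qo Y)))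
        (T' (q Y) (dual.q (Qo Y)) (dual.u (Qo Y))) (tw X Y f)) (u X)"
    using key by simp
  also have "\<dots> = Comp C X (F (q Y)) (F (dual.q (Qo Y))) (T' (q Y) (dual.q (Qo Y)) (dual.u (Qo Y)))
        (Comp C X (F (q X)) (F (q Y)) (tw X Y f) (u X))"
    by (rule c(5)[symmetric]) (use o oF X hY cj in auto)
  also have "\<dots> = Comp C X (F (q Y)) (F (dual.q (Qo Y))) (T' (q Y) (dual.q (Qo Y)) (dual.u (Qo Y)))
        (Comp C X Y (F (q Y)) (u Y) f)"
    using tw_u o by simp
  also have "\<dots> = Comp C X Y (F (dual.q (Qo Y))) (eta Y) f"
    unfolding eta_def by (rule c(5)) (use o oF Y hY in auto)
  finally show ?thesis unfolding dual.Qo_def by simp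
qed

lemma natural_iso_eta:
  "is_natural_iso C C (\<lambda>X. X) (\<lambda>X Y f. f)
     (\<lambda>X. dual.Qo (Qo X)) (\<lambda>X Y f. dual.Qm (Qo X) (Qo Y) (Qm X Y f)) eta"
  unfolding is_natural_iso_def using eta_iso eta_natural by blast

end

text \<open>The mirror image of \<open>natural_iso_eta\<close> points from the identity to the
  composite, whereas \<open>equivalent_categories\<close> asks for a counit in the other
  direction.\<close>

lemma is_natural_iso_inverse:
  assumes D: "is_category D" and Go: "\<And>X. X \<in> Obj D \<Longrightarrow> Go X \<in> Obj D"
    and Gm: "\<And>X Y f. X \<in> Obj D \<Longrightarrow> Y \<in> Obj D \<Longrightarrow> f \<in> Hom D X Y \<Longrightarrow> Gm X Y f \<in> Hom D (Go X) (Go Y)"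
    and nat: "is_natural_iso D D (\<lambda>X. X) (\<lambda>X Y f. f) Go Gm eta"
  shows "\<exists>eps. is_natural_iso D D Go Gm (\<lambda>X. X) (\<lambda>X Y f. f) eps"
proof -
  note c = is_categoryD[OF D]
  have "\<forall>X\<in>Obj D. \<exists>g. g \<in> Hom D (Go X) X \<and> Comp D X (Go X) X g (eta X) = Id D X \<and>
      Comp D (Go X) X (Go X) (eta X) g = Id D (Go X)"
    using nat unfolding is_natural_iso_def is_iso_def by blast
  then obtain eps where e: "\<And>X. X \<in> Obj D \<Longrightarrow> eps X \<in> Hom D (Go X) X"
    "\<And>X. X \<in> Obj D \<Longrightarrow> Comp D X (Go X) X (eps X) (eta X) = Id D X"
    "\<And>X. X \<in> Obj D \<Longrightarrow> Comp D (Go X) X (Go X) (eta X) (eps X) = Id D (Go X)"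
    by metis
  have h: "\<And>X. X \<in> Obj D \<Longrightarrow> eta X \<in> Hom D X (Go X)"
    using nat unfolding is_natural_iso_def is_iso_def by blast
  have "Comp D (Go X) (Go Y) Y (eps Y) (Gm X Y f) = Comp D (Go X) X Y f (eps X)"
    if o: "X \<in> Obj D" "Y \<in> Obj D" "f \<in> Hom D X Y" for X Y f
  proof -
    have n: "Comp D X Y (Go Y) (eta Y) f = Comp D X (Go X) (Go Y) (Gm X Y f) (eta X)"
      using nat o unfolding is_natural_iso_def by blast
    have "Comp D (Go X) X Y f (eps X) = Comp D (Go X) X Y (Comp D X Y Y (Comp D Y (Go Y) Y (eps Y) (eta Y)) f) (eps X)"
      using e o c by simp
    also have "Comp D X Y Y (Comp D Y (Go Y) Y (eps Y) (eta Y)) f = Comp D X (Go Y) Y (eps Y) (Comp D X Y (Go Y) (eta Y) f)"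
      by (rule c(5)[symmetric]) (use o e h Go in auto)
    also have "\<dots> = Comp D X (Go Y) Y (eps Y) (Comp D X (Go X) (Go Y) (Gm X Y f) (eta X))" using n by simp
    also have "Comp D (Go X) X Y \<dots> (eps X) = Comp D (Go X) (Go Y) Y (eps Y)
        (Comp D (Go X) X (Go Y) (Comp D X (Go X) (Go Y) (Gm X Y f) (eta X)) (eps X))"
      by (rule c(5)[symmetric]) (use o e h Go Gm c(2)[of X "Go X" "Go Y"] in auto)
    also have "Comp D (Go X) X (Go Y) (Comp D X (Go X) (Go Y) (Gm X Y f) (eta X)) (eps X)
       = Comp D (Go X) (Go X) (Go Y) (Gm X Y f) (Comp D (Go X) X (Go X) (eta X) (eps X))"
      by (rule c(5)[symmetric]) (use o e h Go Gm in auto)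
    also have "\<dots> = Gm X Y f" using e o c(3) Go Gm by simp
    finally show ?thesis by simp
  qed
  moreover have "is_iso D (Go X) X (eps X)" if "X \<in> Obj D" for X
    unfolding is_iso_def using e h that by blast
  ultimately show ?thesis unfolding is_natural_iso_def by blast
qed

context hom_bijection
begin

theorem equivalent: "equivalent_categories C D"
proof -
  note Q = functor_Q[unfolded is_functor_def] dual.functor_Q[unfolded is_functor_def]
  have "\<exists>eps. is_natural_iso D D (\<lambda>X. Qo (dual.Qo X))
      (\<lambda>X Y f. Qm (dual.Qo X) (dual.Qo Y) (dual.Qm X Y f)) (\<lambda>X. X) (\<lambda>X Y f. f) eps"
    by (rule is_natural_iso_inverse[OF D _ _ dual.natural_iso_eta]) (use Q in auto)
  then show ?thesis
    unfolding equivalent_categories_def using C D functor_Q dual.functor_Q natural_iso_eta by blast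
qed

end

text \<open>Only the bijections on Hom-sets of the first leg are inverted, not the leg itself:
  \<open>Gm\<close> after the inverse of \<open>Fm\<close> is the \<open>T\<close> of
  \<open>hom_bijection\<close>, with the objects of \<open>S\<close> as indices.\<close>

theorem equivalent_categories_span:
  assumes C: "is_category C" and D: "is_category D" and S: "is_category S"
    and F: "is_functor S C F Fm" and G: "is_functor S D G Gm"
    and ffF: "\<And>r s. r \<in> Obj S \<Longrightarrow> s \<in> Obj S \<Longrightarrow> bij_betw (Fm r s) (Hom S r s) (Hom C (F r) (F s))"
    and ffG: "\<And>r s. r \<in> Obj S \<Longrightarrow> s \<in> Obj S \<Longrightarrow> bij_betw (Gm r s) (Hom S r s) (Hom D (G r) (G s))"
    and esF: "\<And>X. X \<in> Obj C \<Longrightarrow> \<exists>r\<in>Obj S. \<exists>f. is_iso C X (F r) f"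
    and esG: "\<And>Y. Y \<in> Obj D \<Longrightarrow> \<exists>r\<in>Obj S. \<exists>f. is_iso D Y (G r) f"
  shows "equivalent_categories C D"
proof -
  define Fi where "Fi r s = inv_into (Hom S r s) (Fm r s)" for r s
  define Gi where "Gi r s = inv_into (Hom S r s) (Gm r s)" for r s
  note F' = F[unfolded is_functor_def] and G' = G[unfolded is_functor_def] and c = is_categoryD[OF S]
  have Fi: "Fi r s f \<in> Hom S r s" "Fm r s (Fi r s f) = f"
    if "r \<in> Obj S" "s \<in> Obj S" "f \<in> Hom C (F r) (F s)" for r s f
    using ffF[OF that(1,2)] that(3) unfolding Fi_def bij_betw_def
    by (auto simp: inv_into_into f_inv_into_f)
  have Gi: "Gi r s f \<in> Hom S r s" "Gm r s (Gi r s f) = f"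
    if "r \<in> Obj S" "s \<in> Obj S" "f \<in> Hom D (G r) (G s)" for r s f
    using ffG[OF that(1,2)] that(3) unfolding Gi_def bij_betw_def
    by (auto simp: inv_into_into f_inv_into_f)
  have Fi': "Fi r s (Fm r s f) = f" if "r \<in> Obj S" "s \<in> Obj S" "f \<in> Hom S r s" for r s f
    using ffF[OF that(1,2)] that(3) unfolding Fi_def bij_betw_def by simp
  have Gi': "Gi r s (Gm r s f) = f" if "r \<in> Obj S" "s \<in> Obj S" "f \<in> Hom S r s" for r s f
    using ffG[OF that(1,2)] that(3) unfolding Gi_def bij_betw_def by simp
  have Fm: "Fm r s f \<in> Hom C (F r) (F s)" and Gm: "Gm r s f \<in> Hom D (G r) (G s)"
    if "r \<in> Obj S" "s \<in> Obj S" "f \<in> Hom S r s" for r s f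
    using F' G' that by blast+
  have Fi_id: "Fi r r (Id C (F r)) = Id S r" if "r \<in> Obj S" for r
    using Fi'[OF that that c(1)[OF that]] F' that by simp
  have Fi_comp: "Fi r t (Comp C (F r) (F s) (F t) g f) = Comp S r s t (Fi s t g) (Fi r s f)"
    if o: "r \<in> Obj S" "s \<in> Obj S" "t \<in> Obj S" "f \<in> Hom C (F r) (F s)" "g \<in> Hom C (F s) (F t)"
    for r s t f g
  proof -
    have "Fm r t (Comp S r s t (Fi s t g) (Fi r s f)) = Comp C (F r) (F s) (F t) g f"
      using F' Fi o by simp
    then show ?thesis using Fi'[OF o(1,3) c(2)[OF o(1-3)]] Fi o by metis
  qed
  interpret hom_bijection C D "Obj S" F G "\<lambda>r s f. Gm r s (Fi r s f)" "\<lambda>r s g. Fm r s (Gi r s g)"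
    by unfold_locales
      (use C D F' G' Fi Gi Fi' Gi' Fm Gm esF esG Fi_id Fi_comp c(1,2) in auto)
  show ?thesis by (rule equivalent)
qed

section \<open>Categories of modules\<close>

lemma is_category_module_category: "is_category (module_category A P)"
proof -
  have "compose (carrier L) g f \<in> module_hom A L N"
    if "left_module A L" "f \<in> module_hom A L M" "g \<in> module_hom A M N" for L M N f g
  proof -
    interpret L: left_module A L by fact
    show ?thesis using that(2,3) unfolding module_hom_def by (auto simp: compose_def PiE_iff extensional_def)
  qed
  moreover have "(\<lambda>x\<in>carrier M. x) \<in> module_hom A M M" if "left_module A M" for M
  proof -
    interpret M: left_module A M by fact
    show ?thesis unfolding module_hom_def by auto
  qed
  moreover have "x \<in> carrier M \<Longrightarrow> f x \<in> carrier N" "f \<in> extensional (carrier M)"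
    if "f \<in> module_hom A M N" for f M N x
    using that unfolding module_hom_def by (auto simp: PiE_iff)
  ultimately show ?thesis
    unfolding is_category_def module_category_def
    by (auto intro!: compose_Id Id_compose compose_assoc)
qed

lemma is_iso_module_category:
  assumes M: "left_module A M" and f: "f \<in> module_hom A M N" "bij_betw f (carrier M) (carrier N)"
  shows "is_iso (module_category A P) M N f"
proof -
  interpret M: left_module A M by fact
  define g where "g = (\<lambda>y\<in>carrier N. inv_into (carrier M) f y)"
  note fi = bij_betw_inv_into_left[OF f(2)] bij_betw_inv_into_right[OF f(2)]
    bij_betwE[OF bij_betw_inv_into[OF f(2)]]
  have h: "f (x \<oplus>\<^bsub>M\<^esub> y) = f x \<oplus>\<^bsub>N\<^esub> f y" "a \<in> carrier A \<Longrightarrow> f (a \<odot>\<^bsub>M\<^esub> x) = a \<odot>\<^bsub>N\<^esub> f x"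
    if "x \<in> carrier M" "y \<in> carrier M" for x y a
    using f that unfolding module_hom_def by auto
  have g: "g y \<in> carrier M" "f (g y) = y" if "y \<in> carrier N" for y
    using fi that unfolding g_def by auto
  have gf: "g (f x) = x" if "x \<in> carrier M" for x
    using fi that bij_betwE[OF f(2)] unfolding g_def by auto
  have 1: "g (x \<oplus>\<^bsub>N\<^esub> y) = g x \<oplus>\<^bsub>M\<^esub> g y" if "x \<in> carrier N" "y \<in> carrier N" for x y
    using gf[of "g x \<oplus>\<^bsub>M\<^esub> g y"] h(1)[of "g x" "g y"] g that by simp
  have 2: "g (a \<odot>\<^bsub>N\<^esub> x) = a \<odot>\<^bsub>M\<^esub> g x" if "x \<in> carrier N" "a \<in> carrier A" for x a
    using gf[of "a \<odot>\<^bsub>M\<^esub> g x"] h(2)[of "g x" "g x" a] g that by simp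
  have "g \<in> module_hom A N M"
    unfolding module_hom_def using g 1 2 by (auto simp: g_def)
  moreover have "compose (carrier M) g f = (\<lambda>x\<in>carrier M. x)" "compose (carrier N) f g = (\<lambda>x\<in>carrier N. x)"
    using gf g by (auto simp: compose_def fun_eq_iff)
  ultimately show ?thesis using f unfolding is_iso_def module_category_def by auto
qed

context left_module
begin

lemma smult_l_null [simp]: "x \<in> carrier M \<Longrightarrow> \<zero>\<^bsub>A\<^esub> \<odot>\<^bsub>M\<^esub> x = \<zero>\<^bsub>M\<^esub>"
  using smult_l_distr[of "\<zero>\<^bsub>A\<^esub>" "\<zero>\<^bsub>A\<^esub>" x] smult_closed[OF A.zero_closed, of x]
  by (metis A.l_zero A.zero_closed M.add.r_cancel_one')

lemma smult_r_null [simp]: "a \<in> carrier A \<Longrightarrow> a \<odot>\<^bsub>M\<^esub> \<zero>\<^bsub>M\<^esub> = \<zero>\<^bsub>M\<^esub>"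
  using smult_r_distr[of a "\<zero>\<^bsub>M\<^esub>" "\<zero>\<^bsub>M\<^esub>"] smult_closed[of a "\<zero>\<^bsub>M\<^esub>"]
  by (metis M.l_zero M.zero_closed M.add.r_cancel_one')

lemma smult_finsum:
  assumes "a \<in> carrier A" "finite S" "g \<in> S \<rightarrow> carrier M"
  shows "a \<odot>\<^bsub>M\<^esub> (\<Oplus>\<^bsub>M\<^esub>i\<in>S. g i) = (\<Oplus>\<^bsub>M\<^esub>i\<in>S. a \<odot>\<^bsub>M\<^esub> g i)"
  using assms(2,3)
proof (induction S rule: finite_induct)
  case empty then show ?case using assms by simp
next
  case (insert i S)
  then have "g \<in> S \<rightarrow> carrier M" "g i \<in> carrier M" "(\<lambda>i. a \<odot>\<^bsub>M\<^esub> g i) \<in> S \<rightarrow> carrier M"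
    "a \<odot>\<^bsub>M\<^esub> g i \<in> carrier M" using assms(1) by auto
  then show ?case using insert assms(1) by (simp add: smult_r_distr)
qed

end

text \<open>Modules see complex scalars only through \<open>cscale\<close>, that is, through the
  multiples of the identity. Accordingly the axioms say that these form a central image of the
  complex numbers.\<close>

locale complex_algebra = ring A for A :: "(complex, 'a) module" (structure) +
  assumes smult_one_closed: "c \<odot> \<one> \<in> carrier A"
    and smult_one_add: "(c + d) \<odot> \<one> = c \<odot> \<one> \<oplus> d \<odot> \<one>"
    and smult_one_mult: "(c * d) \<odot> \<one> = (c \<odot> \<one>) \<otimes> (d \<odot> \<one>)"
    and one_smult_one: "1 \<odot> \<one> = \<one>"
    and smult_one_central: "a \<in> carrier A \<Longrightarrow> (c \<odot> \<one>) \<otimes> a = a \<otimes> (c \<odot> \<one>)"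

abbreviation "lookup \<equiv> Poly_Mapping.lookup"
abbreviation "keys \<equiv> Poly_Mapping.keys"
abbreviation "single \<equiv> Poly_Mapping.single"

section \<open>Modules on finitely supported functions\<close>

text \<open>A subgroup \<open>S\<close> of an abelian group type on which \<open>A\<close> acts by \<open>\<sigma>\<close>, transported along an
  injection \<open>\<iota>\<close> into the universe.\<close>

definition transported_module ::
  "('t::ab_group_add \<Rightarrow> 'u) \<Rightarrow> 't set \<Rightarrow> ('a \<Rightarrow> 't \<Rightarrow> 't) \<Rightarrow> ('a, 'u) module" where
  "transported_module \<iota> S \<sigma> = \<lparr>carrier = \<iota> ` S, monoid.mult = (\<lambda>x y. x), one = \<iota> 0, zero = \<iota> 0,
     add = (\<lambda>x y. \<iota> (inv_into S \<iota> x + inv_into S \<iota> y)), module.smult = (\<lambda>a x. \<iota> (\<sigma> a (inv_into S \<iota> x)))\<rparr>"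

locale transport =
  fixes A :: "(complex, 'a) module" and \<iota> :: "'t::ab_group_add \<Rightarrow> 'u" and S :: "'t set"
    and \<sigma> :: "'a \<Rightarrow> 't \<Rightarrow> 't"
  assumes ring: "ring A" and inj: "inj_on \<iota> S"
    and zero: "0 \<in> S" and plus: "f \<in> S \<Longrightarrow> g \<in> S \<Longrightarrow> f + g \<in> S" and minus: "f \<in> S \<Longrightarrow> - f \<in> S"
    and act: "a \<in> carrier A \<Longrightarrow> f \<in> S \<Longrightarrow> \<sigma> a f \<in> S"
    and act_plus: "a \<in> carrier A \<Longrightarrow> f \<in> S \<Longrightarrow> g \<in> S \<Longrightarrow> \<sigma> a (f + g) = \<sigma> a f + \<sigma> a g"
    and plus_act: "a \<in> carrier A \<Longrightarrow> b \<in> carrier A \<Longrightarrow> f \<in> S \<Longrightarrow> \<sigma> (a \<oplus>\<^bsub>A\<^esub> b) f = \<sigma> a f + \<sigma> b f"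
    and mult_act: "a \<in> carrier A \<Longrightarrow> b \<in> carrier A \<Longrightarrow> f \<in> S \<Longrightarrow> \<sigma> (a \<otimes>\<^bsub>A\<^esub> b) f = \<sigma> a (\<sigma> b f)"
    and one_act: "f \<in> S \<Longrightarrow> \<sigma> \<one>\<^bsub>A\<^esub> f = f"
begin

abbreviation "N \<equiv> transported_module \<iota> S \<sigma>"

lemma N_simps [simp]:
  "carrier N = \<iota> ` S" "\<zero>\<^bsub>N\<^esub> = \<iota> 0"
  "f \<in> S \<Longrightarrow> g \<in> S \<Longrightarrow> \<iota> f \<oplus>\<^bsub>N\<^esub> \<iota> g = \<iota> (f + g)"
  "f \<in> S \<Longrightarrow> a \<odot>\<^bsub>N\<^esub> \<iota> f = \<iota> (\<sigma> a f)"
  using inj by (auto simp: transported_module_def)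

lemma inj_eq [simp]: "f \<in> S \<Longrightarrow> g \<in> S \<Longrightarrow> \<iota> f = \<iota> g \<longleftrightarrow> f = g"
  using inj by (auto simp: inj_on_def)

lemma left_module_N: "left_module A N"
proof -
  interpret A: ring A by (rule ring)
  have "abelian_group N"
  proof (rule abelian_groupI)
    fix x assume "x \<in> carrier N"
    then obtain f where f: "f \<in> S" "x = \<iota> f" by auto
    show "\<exists>y\<in>carrier N. y \<oplus>\<^bsub>N\<^esub> x = \<zero>\<^bsub>N\<^esub>"
      by (rule bexI[of _ "\<iota> (- f)"]) (use f minus zero in auto)
  qed (use zero plus minus in \<open>auto simp: add_ac\<close>)
  then interpret N: abelian_group N .
  show ?thesis
    by unfold_locales (use act act_plus plus_act mult_act one_act plus in auto)
qed

lemma finsum_N: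
  assumes "finite X" "\<And>b. b \<in> X \<Longrightarrow> F b \<in> S"
  shows "(\<Oplus>\<^bsub>N\<^esub>b\<in>X. \<iota> (F b)) = \<iota> (\<Sum>b\<in>X. F b)" "(\<Sum>b\<in>X. F b) \<in> S"
proof -
  interpret left_module A N by (rule left_module_N)
  have "(\<Oplus>\<^bsub>N\<^esub>b\<in>X. \<iota> (F b)) = \<iota> (\<Sum>b\<in>X. F b) \<and> (\<Sum>b\<in>X. F b) \<in> S"
    using assms
  proof (induction X rule: finite_induct)
    case empty then show ?case using zero by (metis M.finsum_empty N_simps(2) sum.empty)
  next
    case (insert b X)
    have "(\<Oplus>\<^bsub>N\<^esub>b\<in>insert b X. \<iota> (F b)) = \<iota> (F b) \<oplus>\<^bsub>N\<^esub> (\<Oplus>\<^bsub>N\<^esub>b\<in>X. \<iota> (F b))"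
      by (rule M.finsum_insert) (use insert in auto)
    then show ?case using insert plus by simp
  qed
  then show "(\<Oplus>\<^bsub>N\<^esub>b\<in>X. \<iota> (F b)) = \<iota> (\<Sum>b\<in>X. F b)" "(\<Sum>b\<in>X. F b) \<in> S" by auto
qed

lemma minus_N: "f \<in> S \<Longrightarrow> \<ominus>\<^bsub>N\<^esub> \<iota> f = \<iota> (- f)"
proof -
  interpret left_module A N by (rule left_module_N)
  assume f: "f \<in> S"
  show ?thesis by (rule M.minus_equality) (use f minus zero in auto)
qed

end

lemma (in abelian_group) additive_zero:
  assumes "\<And>x y. x \<in> carrier G \<Longrightarrow> y \<in> carrier G \<Longrightarrow> (h (x \<oplus> y) :: 't::ab_group_add) = h x + h y"
  shows "h \<zero> = 0"
  using assms[of \<zero> \<zero>] by simp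

type_synonym 'l coords = "'l \<Rightarrow>\<^sub>0 complex poly"

text \<open>\<open>s a q p\<close> is the matrix entry of \<open>a\<close> from the component \<open>p\<close> to the component \<open>q\<close>; the
  component \<open>p\<close> is the image of the projection \<open>s \<one> p p\<close>.\<close>

locale matrix_rep =
  fixes A :: "(complex, 'a) module" and I :: "'l set"
    and s :: "'a \<Rightarrow> 'l \<Rightarrow> 'l \<Rightarrow> complex poly \<Rightarrow> complex poly"
  assumes ring: "ring A"
    and s_plus: "a \<in> carrier A \<Longrightarrow> s a q p (v + w) = s a q p v + s a q p w"
    and s_smult: "a \<in> carrier A \<Longrightarrow> s a q p (smult c w) = smult c (s a q p w)"
    and s_out: "a \<in> carrier A \<Longrightarrow> p \<notin> I \<or> q \<notin> I \<Longrightarrow> s a q p w = 0"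
    and s_fin: "a \<in> carrier A \<Longrightarrow> \<exists>U. finite U \<and> (\<forall>q. q \<notin> U \<longrightarrow> s a q p w = 0)"
    and s_add: "a \<in> carrier A \<Longrightarrow> b \<in> carrier A \<Longrightarrow> s (a \<oplus>\<^bsub>A\<^esub> b) q p w = s a q p w + s b q p w"
    and s_mult: "a \<in> carrier A \<Longrightarrow> b \<in> carrier A \<Longrightarrow> finite U \<Longrightarrow> (\<And>q. q \<notin> U \<Longrightarrow> s b q p w = 0) \<Longrightarrow>
        s (a \<otimes>\<^bsub>A\<^esub> b) r p w = (\<Sum>q\<in>U. s a r q (s b q p w))"
    and s_one: "q \<noteq> p \<Longrightarrow> s \<one>\<^bsub>A\<^esub> q p w = 0"
    and s_scal: "s (c \<odot>\<^bsub>A\<^esub> \<one>\<^bsub>A\<^esub>) q p w = smult c (s \<one>\<^bsub>A\<^esub> q p w)"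
begin

definition "mcar = {f :: 'l coords. \<forall>p. s \<one>\<^bsub>A\<^esub> p p (lookup f p) = lookup f p}"
definition "mact a f = Abs_poly_mapping (\<lambda>q. \<Sum>p\<in>keys f. s a q p (lookup f p))"

sublocale A: ring A by (rule ring)

lemma s_zero [simp]: "a \<in> carrier A \<Longrightarrow> s a q p 0 = 0"
  using s_plus[of a q p 0 0] by simp

lemma s_sum: "a \<in> carrier A \<Longrightarrow> s a q p (\<Sum>x\<in>X. f x) = (\<Sum>x\<in>X. s a q p (f x))"
  by (induction X rule: infinite_finite_induct) (auto simp: s_plus)

lemma s_minus: "a \<in> carrier A \<Longrightarrow> s a q p (- w) = - s a q p w"
  using s_smult[of a q p "-1" w] by simp

lemma lookup_mact:
  assumes "a \<in> carrier A"
  shows "lookup (mact a f) q = (\<Sum>p\<in>keys f. s a q p (lookup f p))"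
proof -
  have "\<forall>p. \<exists>U. finite U \<and> (\<forall>q. q \<notin> U \<longrightarrow> s a q p (lookup f p) = 0)" using s_fin assms by blast
  then obtain U where U: "\<And>p. finite (U p)" "\<And>p q. q \<notin> U p \<Longrightarrow> s a q p (lookup f p) = 0" by metis
  have "{q. (\<Sum>p\<in>keys f. s a q p (lookup f p)) \<noteq> 0} \<subseteq> (\<Union>p\<in>keys f. U p)"
  proof
    fix q assume "q \<in> {q. (\<Sum>p\<in>keys f. s a q p (lookup f p)) \<noteq> 0}"
    then obtain p where "p \<in> keys f" "s a q p (lookup f p) \<noteq> 0"
      by (metis (mono_tags, lifting) mem_Collect_eq sum.neutral)
    then show "q \<in> (\<Union>p\<in>keys f. U p)" using U(2) by auto
  qed
  then have "finite {q. (\<Sum>p\<in>keys f. s a q p (lookup f p)) \<noteq> 0}"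
    by (rule finite_subset) (use U(1) in auto)
  then show ?thesis unfolding mact_def by (subst lookup_Abs_poly_mapping) auto
qed

lemma lookup_mact':
  assumes "a \<in> carrier A" "finite X" "keys f \<subseteq> X"
  shows "lookup (mact a f) q = (\<Sum>p\<in>X. s a q p (lookup f p))"
  unfolding lookup_mact[OF assms(1)]
  by (rule sum.mono_neutral_left) (use assms in \<open>auto simp: in_keys_iff\<close>)

lemma mact_single:
  "a \<in> carrier A \<Longrightarrow> lookup (mact a (single p w)) q = s a q p w"
  by (subst lookup_mact'[where X = "{p}"]) auto

lemma s_one_left: "a \<in> carrier A \<Longrightarrow> s \<one>\<^bsub>A\<^esub> q q (s a q p w) = s a q p w"
proof -
  assume a: "a \<in> carrier A"
  obtain U where U: "finite U" "\<And>q. q \<notin> U \<Longrightarrow> s a q p w = 0" using s_fin[OF a] by blast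
  have "s a q p w = s (\<one>\<^bsub>A\<^esub> \<otimes>\<^bsub>A\<^esub> a) q p w" using a by simp
  also have "\<dots> = (\<Sum>m\<in>insert q U. s \<one>\<^bsub>A\<^esub> q m (s a m p w))"
    by (rule s_mult) (use a U in auto)
  also have "\<dots> = s \<one>\<^bsub>A\<^esub> q q (s a q p w)"
    by (subst sum.mono_neutral_right[where S = "{q}"]) (use U in \<open>auto simp: s_one s_one[OF not_sym]\<close>)
  finally show ?thesis by simp
qed

lemma s_one_right: "a \<in> carrier A \<Longrightarrow> s a q p (s \<one>\<^bsub>A\<^esub> p p w) = s a q p w"
proof -
  assume a: "a \<in> carrier A"
  have "s a q p w = s (a \<otimes>\<^bsub>A\<^esub> \<one>\<^bsub>A\<^esub>) q p w" using a by simp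
  also have "\<dots> = (\<Sum>m\<in>{p}. s a q m (s \<one>\<^bsub>A\<^esub> m p w))"
    by (rule s_mult) (use a s_one in auto)
  finally show ?thesis by simp
qed

lemma s_one_idem: "s \<one>\<^bsub>A\<^esub> p p (s \<one>\<^bsub>A\<^esub> p p w) = s \<one>\<^bsub>A\<^esub> p p w"
  by (simp add: s_one_left)

lemma s_mult_single:
  assumes "a \<in> carrier A" "b \<in> carrier A" "\<And>m w. m \<noteq> q \<Longrightarrow> s b m p w = 0"
  shows "s (a \<otimes>\<^bsub>A\<^esub> b) r p w = s a r q (s b q p w)"
  using s_mult[of a b "{q}" p w r] assms by simp

lemma mcar_in: "f \<in> mcar \<Longrightarrow> keys f \<subseteq> I"
proof
  fix p assume "f \<in> mcar" "p \<in> keys f"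
  then have "s \<one>\<^bsub>A\<^esub> p p (lookup f p) \<noteq> 0" by (simp add: mcar_def in_keys_iff)
  then show "p \<in> I" using s_out[OF A.one_closed, of p p] by blast
qed

lemma transport:
  assumes "inj_on \<iota> mcar"
  shows "transport A \<iota> mcar mact"
proof
  show "f \<in> mcar \<Longrightarrow> g \<in> mcar \<Longrightarrow> f + g \<in> mcar" for f g
    by (auto simp: mcar_def lookup_add s_plus)
  show "f \<in> mcar \<Longrightarrow> - f \<in> mcar" for f
    by (auto simp: mcar_def s_minus)
  show "mact a f \<in> mcar" if "a \<in> carrier A" for a f
    using that by (auto simp: mcar_def lookup_mact s_sum s_one_left)
  show "mact a (f + g) = mact a f + mact a g" if a: "a \<in> carrier A" for a f g
  proof (rule poly_mapping_eqI)
    fix q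
    have *: "finite (keys f \<union> keys g)" "keys f \<subseteq> keys f \<union> keys g" "keys g \<subseteq> keys f \<union> keys g"
      "keys (f + g) \<subseteq> keys f \<union> keys g" by (auto simp: in_keys_iff lookup_add)
    show "lookup (mact a (f + g)) q = lookup (mact a f + mact a g) q"
      unfolding lookup_add lookup_mact'[OF a *(1,2)] lookup_mact'[OF a *(1,3)] lookup_mact'[OF a *(1,4)]
      by (simp add: s_plus[OF a] sum.distrib)
  qed
  show "mact (a \<oplus>\<^bsub>A\<^esub> b) f = mact a f + mact b f" if "a \<in> carrier A" "b \<in> carrier A" for a b f
    by (rule poly_mapping_eqI) (use that in \<open>simp add: lookup_mact lookup_add s_add sum.distrib\<close>)
  show "mact (a \<otimes>\<^bsub>A\<^esub> b) f = mact a (mact b f)" if ab: "a \<in> carrier A" "b \<in> carrier A" for a b f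
  proof (rule poly_mapping_eqI)
    fix r
    have "\<forall>p. \<exists>U. finite U \<and> (\<forall>q. q \<notin> U \<longrightarrow> s b q p (lookup f p) = 0)" using s_fin ab by blast
    then obtain U where U: "\<And>p. finite (U p)" "\<And>p q. q \<notin> U p \<Longrightarrow> s b q p (lookup f p) = 0" by metis
    define X where "X = (\<Union>p\<in>keys f. U p) \<union> keys (mact b f)"
    have X: "finite X" "keys (mact b f) \<subseteq> X" using U unfolding X_def by auto
    have "lookup (mact (a \<otimes>\<^bsub>A\<^esub> b) f) r = (\<Sum>p\<in>keys f. s (a \<otimes>\<^bsub>A\<^esub> b) r p (lookup f p))"
      using ab by (simp add: lookup_mact)
    also have "\<dots> = (\<Sum>p\<in>keys f. \<Sum>q\<in>X. s a r q (s b q p (lookup f p)))"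
      by (intro sum.cong refl s_mult ab X) (use U in \<open>auto simp: X_def\<close>)
    also have "\<dots> = (\<Sum>q\<in>X. \<Sum>p\<in>keys f. s a r q (s b q p (lookup f p)))"
      by (rule sum.swap)
    also have "\<dots> = lookup (mact a (mact b f)) r"
      unfolding lookup_mact'[OF ab(1) X] lookup_mact[OF ab(2)] s_sum[OF ab(1)] ..
    finally show "lookup (mact (a \<otimes>\<^bsub>A\<^esub> b) f) r = lookup (mact a (mact b f)) r" .
  qed
  show "mact \<one>\<^bsub>A\<^esub> f = f" if f: "f \<in> mcar" for f
  proof (rule poly_mapping_eqI)
    fix q
    have "lookup (mact \<one>\<^bsub>A\<^esub> f) q = (\<Sum>p\<in>insert q (keys f). s \<one>\<^bsub>A\<^esub> q p (lookup f p))"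
      by (rule lookup_mact') auto
    also have "\<dots> = (\<Sum>p\<in>{q}. s \<one>\<^bsub>A\<^esub> q p (lookup f p))"
      by (rule sum.mono_neutral_right) (auto simp: s_one s_one[OF not_sym])
    also have "\<dots> = lookup f q" using f by (simp add: mcar_def)
    finally show "lookup (mact \<one>\<^bsub>A\<^esub> f) q = lookup f q" .
  qed
qed (use assms in \<open>auto simp: mcar_def A.ring_axioms\<close>)

end

text \<open>The composites of \<open>h p\<close> and \<open>h' p\<close> are the projections onto
  the components rather than identities. This suffices because \<open>mcar\<close> consists of the
  functions fixed by the projections.\<close>

lemma matrix_rep_iso:
  assumes s: "matrix_rep A I s" and t: "matrix_rep A I t"
    and h_plus: "\<And>p v w. h p (v + w) = h p v + h p w"
    and h'_plus: "\<And>p v w. h' p (v + w) = h' p v + h' p w"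
    and h'h: "\<And>p w. p \<in> I \<Longrightarrow> h' p (h p w) = s \<one>\<^bsub>A\<^esub> p p w"
    and hh': "\<And>p w. p \<in> I \<Longrightarrow> h p (h' p w) = t \<one>\<^bsub>A\<^esub> p p w"
    and h: "\<And>a q p w. p \<in> I \<Longrightarrow> q \<in> I \<Longrightarrow> a \<in> carrier A \<Longrightarrow> h q (s a q p w) = t a q p (h p w)"
  shows "bij_betw (Poly_Mapping.mapp h) (matrix_rep.mcar A s) (matrix_rep.mcar A t)"
    and "Poly_Mapping.mapp h (f + g) = Poly_Mapping.mapp h f + Poly_Mapping.mapp h g"
    and "f \<in> matrix_rep.mcar A s \<Longrightarrow> a \<in> carrier A \<Longrightarrow>
      Poly_Mapping.mapp h (matrix_rep.mact s a f) = matrix_rep.mact t a (Poly_Mapping.mapp h f)"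
proof -
  interpret s: matrix_rep A I s by fact
  interpret t: matrix_rep A I t by fact
  have h0: "h p 0 = 0" "h' p 0 = 0" for p using h_plus[of p 0 0] h'_plus[of p 0 0] by auto
  have lk: "lookup (Poly_Mapping.mapp h f) p = h p (lookup f p)"
      "lookup (Poly_Mapping.mapp h' f) p = h' p (lookup f p)" for f :: "'b coords" and p
    by (auto simp: lookup_mapp when_def in_keys_iff h0)
  have sum_h: "h p (\<Sum>x\<in>X. F x) = (\<Sum>x\<in>X. h p (F x))" for p X and F :: "'b \<Rightarrow> complex poly"
    by (induction X rule: infinite_finite_induct) (auto simp: h0 h_plus)
  show add: "Poly_Mapping.mapp h (f + g) = Poly_Mapping.mapp h f + Poly_Mapping.mapp h g" for f g
    by (rule poly_mapping_eqI) (simp add: lk lookup_add h_plus)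
  have ts: "h p w = t \<one>\<^bsub>A\<^esub> p p (h p w)" if "s \<one>\<^bsub>A\<^esub> p p w = w" "p \<in> I" for p w
    using h[of p p "\<one>\<^bsub>A\<^esub>" w] that by simp
  have st: "h' p w = s \<one>\<^bsub>A\<^esub> p p (h' p w)" if "t \<one>\<^bsub>A\<^esub> p p w = w" "p \<in> I" for p w
    using h'h[of p "h' p w"] hh'[of p w] that by simp
  have out: "lookup f p = 0" if "f \<in> s.mcar \<or> f \<in> t.mcar" "p \<notin> I" for f p
    using s.mcar_in t.mcar_in that by (meson in_keys_iff subsetD)
  show "bij_betw (Poly_Mapping.mapp h) s.mcar t.mcar"
  proof (rule bij_betwI[where g = "Poly_Mapping.mapp h'"])
    show "Poly_Mapping.mapp h \<in> s.mcar \<rightarrow> t.mcar"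
    proof
      fix f assume f: "f \<in> s.mcar"
      show "Poly_Mapping.mapp h f \<in> t.mcar" unfolding t.mcar_def mem_Collect_eq lk
      proof
        fix p show "t \<one>\<^bsub>A\<^esub> p p (h p (lookup f p)) = h p (lookup f p)"
          using ts[of p] f out[of f p] by (cases "p \<in> I") (auto simp: s.mcar_def h0)
      qed
    qed
    show "Poly_Mapping.mapp h' \<in> t.mcar \<rightarrow> s.mcar"
    proof
      fix f assume f: "f \<in> t.mcar"
      show "Poly_Mapping.mapp h' f \<in> s.mcar" unfolding s.mcar_def mem_Collect_eq lk
      proof
        fix p show "s \<one>\<^bsub>A\<^esub> p p (h' p (lookup f p)) = h' p (lookup f p)"
          using st[of p] f out[of f p] by (cases "p \<in> I") (auto simp: t.mcar_def h0)
      qed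
    qed
    show "Poly_Mapping.mapp h' (Poly_Mapping.mapp h f) = f" if f: "f \<in> s.mcar" for f
    proof (rule poly_mapping_eqI)
      fix p show "lookup (Poly_Mapping.mapp h' (Poly_Mapping.mapp h f)) p = lookup f p"
        using f out[of f p] h'h[of p "lookup f p"] by (cases "p \<in> I") (auto simp: lk h0 s.mcar_def)
    qed
    show "Poly_Mapping.mapp h (Poly_Mapping.mapp h' f) = f" if f: "f \<in> t.mcar" for f
    proof (rule poly_mapping_eqI)
      fix p show "lookup (Poly_Mapping.mapp h (Poly_Mapping.mapp h' f)) p = lookup f p"
        using f out[of f p] hh'[of p "lookup f p"] by (cases "p \<in> I") (auto simp: lk h0 t.mcar_def)
    qed
  qed
  show "Poly_Mapping.mapp h (s.mact a f) = t.mact a (Poly_Mapping.mapp h f)"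
    if f: "f \<in> s.mcar" and a: "a \<in> carrier A"
  proof (rule poly_mapping_eqI)
    fix q
    have k: "keys (Poly_Mapping.mapp h f) \<subseteq> keys f" by (rule keys_mapp_subset)
    have e: "h q (s a q p (lookup f p)) = t a q p (h p (lookup f p))" if "p \<in> keys f" for p
      using h[of p q a] that s.mcar_in[OF f] a s.s_out[OF a] t.s_out[OF a]
      by (cases "q \<in> I") (auto simp: h0)
    show "lookup (Poly_Mapping.mapp h (s.mact a f)) q = lookup (t.mact a (Poly_Mapping.mapp h f)) q"
      using e unfolding lk s.lookup_mact[OF a] t.lookup_mact'[OF a finite_keys k] sum_h
      by (intro sum.cong) auto
  qed
qed

section \<open>The intermediate category\<close>

definition upc :: "'i set \<Rightarrow> 'i set \<Rightarrow> nat" where "upc J K = card (K - J)"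

definition excess :: "'i set \<Rightarrow> 'i set \<Rightarrow> 'i set \<Rightarrow> nat" where
  "excess J K L = upc J K + upc K L - upc J L"

lemma upc_triangle: "upc J L \<le> upc J K + upc K (L :: 'i::finite set)"
proof -
  have "card (L - J) \<le> card ((K - J) \<union> (L - K))" by (rule card_mono) auto
  also have "\<dots> \<le> card (K - J) + card (L - K)" by (rule card_Un_le)
  finally show ?thesis by (simp add: upc_def)
qed

text \<open>The triangle inequality makes the truncated subtraction in \<open>excess\<close> an
  honest one.\<close>

lemma upc_excess: "upc J K + upc K L = upc J L + excess J K (L :: 'i::finite set)"
  using upc_triangle[of L J K] by (simp add: excess_def upc_triangle)

lemma upc_refl [simp]: "upc J J = 0" by (simp add: upc_def)
lemma excess_refl [simp]: "excess J J K = 0" "excess J K K = 0" by (simp_all add: excess_def)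

text \<open>Representations of the category with objects \<open>P\<close> and a morphism \<open>f x\<^sub>K\<^sub>J\<close> from \<open>J\<close> to \<open>K\<close>
  for every power series \<open>f\<close>, where \<open>x\<^sub>L\<^sub>K x\<^sub>K\<^sub>J\<close> is \<open>x\<^sub>L\<^sub>J\<close> times the \<open>e J K L\<close>-th power of the
  variable.  The space attached to \<open>J\<close> is the image of the projection \<open>y 1 J J\<close>.\<close>

locale sys =
  fixes P :: "'s set" and e :: "'s \<Rightarrow> 's \<Rightarrow> 's \<Rightarrow> nat"
    and y :: "complex fps \<Rightarrow> 's \<Rightarrow> 's \<Rightarrow> complex poly \<Rightarrow> complex poly"
  assumes y_add: "y (f + g) K J w = y f K J w + y g K J w"
    and y_plus: "y f K J (v + w) = y f K J v + y f K J w"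
    and y_scale: "y (fps_const c * f) K J w = smult c (y f K J w)"
    and y_smult: "y f K J (smult c w) = smult c (y f K J w)"
    and y_comp: "J \<in> P \<Longrightarrow> K \<in> P \<Longrightarrow> L \<in> P \<Longrightarrow> y f L K (y g K J w) = y (f * g * fps_X ^ e J K L) L J w"
    and y_dim: "J \<in> P \<Longrightarrow> \<exists>d. \<forall>w k. d \<le> k \<longrightarrow> coeff (y 1 J J w) k = 0"
    and y_nil: "J \<in> P \<Longrightarrow> \<exists>N. \<forall>f K w. y (fps_X ^ N * f) K J w = 0"
    and e_refl: "J \<in> P \<Longrightarrow> K \<in> P \<Longrightarrow> e J J K = 0" "J \<in> P \<Longrightarrow> K \<in> P \<Longrightarrow> e J K K = 0"
begin

lemma y_zero [simp]: "y f K J 0 = 0" "y 0 K J w = 0"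
  using y_plus[of f K J 0 0] y_add[of 0 0 K J w] by simp_all

lemma y_sum: "y f K J (\<Sum>x\<in>X. F x) = (\<Sum>x\<in>X. y f K J (F x))"
  by (induction X rule: infinite_finite_induct) (auto simp: y_plus)

lemma y_fsum: "y (\<Sum>x\<in>X. F x) K J w = (\<Sum>x\<in>X. y (F x) K J w)"
  by (induction X rule: infinite_finite_induct) (auto simp: y_add)

lemma y_one_left [simp]: "J \<in> P \<Longrightarrow> K \<in> P \<Longrightarrow> y 1 K K (y f K J w) = y f K J w"
  by (simp add: y_comp e_refl)

lemma y_one_right [simp]: "J \<in> P \<Longrightarrow> K \<in> P \<Longrightarrow> y f K J (y 1 J J w) = y f K J w"
  by (simp add: y_comp e_refl)

lemma y_const: "y (fps_const c) K J w = smult c (y 1 K J w)"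
  using y_scale[of c 1 K J w] by simp

end

type_synonym 's rep = "complex fps \<Rightarrow> 's \<Rightarrow> 's \<Rightarrow> complex poly \<Rightarrow> complex poly"

text \<open>A map between images of projections is encoded as a map on all polynomials that factors
  through the projection, and as zero outside \<open>P\<close>. With this normalization different
  functions are different morphisms, and the identity of \<open>y\<close> is its family of
  projections.\<close>

definition sys_hom :: "'s set \<Rightarrow> 's rep \<Rightarrow> 's rep \<Rightarrow> ('s \<Rightarrow> complex poly \<Rightarrow> complex poly) set" where
  "sys_hom P y y' = {g. (\<forall>J\<in>P. (\<forall>v w. g J (v + w) = g J v + g J w) \<and> (\<forall>c w. g J (smult c w) = smult c (g J w)) \<and>
     (\<forall>w. g J (y 1 J J w) = g J w)) \<and>
     (\<forall>J\<in>P. \<forall>K\<in>P. \<forall>f w. g K (y f K J w) = y' f K J (g J w)) \<and> (\<forall>J. J \<notin> P \<longrightarrow> g J = (\<lambda>w. 0))}"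

definition sys_category ::
  "'s set \<Rightarrow> ('s \<Rightarrow> 's \<Rightarrow> 's \<Rightarrow> nat) \<Rightarrow> ('s rep, 's \<Rightarrow> complex poly \<Rightarrow> complex poly) category" where
  "sys_category P e = \<lparr>Obj = {y. sys P e y}, Hom = sys_hom P,
     Id = (\<lambda>y J. if J \<in> P then y 1 J J else (\<lambda>w. 0)), Comp = (\<lambda>_ _ _ g f J w. g J (f J w))\<rparr>"

lemma sys_homD:
  assumes "g \<in> sys_hom P y y'"
  shows "J \<in> P \<Longrightarrow> g J (v + w) = g J v + g J w" "J \<in> P \<Longrightarrow> g J (smult c w) = smult c (g J w)"
    "J \<in> P \<Longrightarrow> g J (y 1 J J w) = g J w" "J \<in> P \<Longrightarrow> K \<in> P \<Longrightarrow> g K (y f K J w) = y' f K J (g J w)"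
    "J \<notin> P \<Longrightarrow> g J w = 0" "g J 0 = 0" "J \<in> P \<Longrightarrow> y' 1 J J (g J w) = g J w"
proof -
  show 1: "J \<in> P \<Longrightarrow> g J (v + w) = g J v + g J w" for J v w using assms by (auto simp: sys_hom_def)
  show "J \<in> P \<Longrightarrow> g J (smult c w) = smult c (g J w)"
    using assms by (auto simp: sys_hom_def)
  show 2: "J \<in> P \<Longrightarrow> g J (y 1 J J w) = g J w" for J w
    using assms by (auto simp: sys_hom_def)
  show 3: "J \<in> P \<Longrightarrow> K \<in> P \<Longrightarrow> g K (y f K J w) = y' f K J (g J w)" for J K f w
    using assms by (auto simp: sys_hom_def)
  show 4: "J \<notin> P \<Longrightarrow> g J w = 0" for J w using assms by (auto simp: sys_hom_def)
  show "g J 0 = 0" using 1[of J 0 0] 4 by (cases "J \<in> P") simp_all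
  show "J \<in> P \<Longrightarrow> y' 1 J J (g J w) = g J w" using 2 3 by metis
qed

lemma is_category_sys: "is_category (sys_category P e)"
proof -
  have "(\<lambda>J. if J \<in> P then y 1 J J else (\<lambda>w. 0)) \<in> sys_hom P y y" if "sys P e y" for y
  proof -
    interpret sys P e y by fact
    show ?thesis unfolding sys_hom_def by (auto simp: y_plus y_smult)
  qed
  moreover have "(\<lambda>J w. g J (f J w)) \<in> sys_hom P x z"
    if "f \<in> sys_hom P x y" "g \<in> sys_hom P y z" for f g x y z
    unfolding sys_hom_def using sys_homD[OF that(1)] sys_homD[OF that(2)] by auto
  moreover have "(\<lambda>J w. f J ((if J \<in> P then x 1 J J else (\<lambda>w. 0)) w)) = f"
    "(\<lambda>J w. (if J \<in> P then y 1 J J else (\<lambda>w. 0)) (f J w)) = f"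
    if "f \<in> sys_hom P x y" for f x y
    using sys_homD[OF that] by (auto simp: fun_eq_iff)
  ultimately show ?thesis
    unfolding is_category_def sys_category_def by auto
qed

text \<open>Together with \<open>y_nil\<close> this reduces statements about power series acting on
  a component to polynomials, which are built from constants and the variable alone.\<close>

lemma fps_split_power:
  "\<exists>p g. (f :: complex fps) = fps_of_poly p + fps_X ^ N * g"
proof (induction N arbitrary: f)
  case 0 then show ?case by (intro exI[of _ 0] exI[of _ f]) simp
next
  case (Suc N)
  obtain p g where pg: "fps_shift 1 f = fps_of_poly p + fps_X ^ N * g" using Suc by blast
  have "f = fps_const (fps_nth f 0) + fps_X * fps_shift 1 f"
    by (rule fps_ext) simp
  also have "\<dots> = fps_of_poly (pCons (fps_nth f 0) p) + fps_X ^ Suc N * g"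
    unfolding pg by (simp add: fps_of_poly_pCons algebra_simps)
  finally show ?case by blast
qed

section \<open>Algebras with a symbol map\<close>

text \<open>The symbol \<open>\<rho>\<close> is a homomorphism to matrices over power series; \<open>av q p\<close> has a symbol
  generating the possible entries at \<open>(q, p)\<close>, and \<open>bv p\<close> has the variable as its entry at \<open>(p, p)\<close>.\<close>

locale symbol_algebra = complex_algebra A for A :: "(complex, 'a) module" (structure) +
  fixes I :: "'l set" and lab :: "'l \<Rightarrow> 'i::finite set" and P :: "'i set set"
    and \<rho> :: "'a \<Rightarrow> 'l \<Rightarrow> 'l \<Rightarrow> complex fps"
    and av :: "'l \<Rightarrow> 'l \<Rightarrow> 'a" and uv :: "'l \<Rightarrow> 'l \<Rightarrow> complex fps" and bv :: "'l \<Rightarrow> 'a"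
  assumes lab: "lab ` I = P"
    and \<rho>_fin: "a \<in> carrier A \<Longrightarrow> p \<in> I \<Longrightarrow> \<exists>U. finite U \<and> (\<forall>q. q \<notin> U \<longrightarrow> \<rho> a q p = 0)"
    and \<rho>_in: "a \<in> carrier A \<Longrightarrow> p \<in> I \<Longrightarrow> q \<notin> I \<Longrightarrow> \<rho> a q p = 0"
    and \<rho>_add: "a \<in> carrier A \<Longrightarrow> b \<in> carrier A \<Longrightarrow> p \<in> I \<Longrightarrow> q \<in> I \<Longrightarrow>
        \<rho> (a \<oplus> b) q p = \<rho> a q p + \<rho> b q p"
    and \<rho>_mult: "a \<in> carrier A \<Longrightarrow> b \<in> carrier A \<Longrightarrow> p \<in> I \<Longrightarrow> r \<in> I \<Longrightarrow> finite U \<Longrightarrow>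
        (\<And>q. q \<notin> U \<Longrightarrow> \<rho> b q p = 0) \<Longrightarrow> \<rho> (a \<otimes> b) r p = (\<Sum>q\<in>U. \<rho> a r q * \<rho> b q p)"
    and \<rho>_scal: "p \<in> I \<Longrightarrow> q \<in> I \<Longrightarrow> \<rho> (c \<odot> \<one>) q p = (if q = p then fps_const c else 0)"
    and \<rho>_dvd: "a \<in> carrier A \<Longrightarrow> p \<in> I \<Longrightarrow> q \<in> I \<Longrightarrow> fps_X ^ upc (lab p) (lab q) dvd \<rho> a q p"
    and av: "p \<in> I \<Longrightarrow> q \<in> I \<Longrightarrow> av q p \<in> carrier A"
    and \<rho>_av: "p \<in> I \<Longrightarrow> q \<in> I \<Longrightarrow>
        \<rho> (av q p) r p = (if r = q then fps_X ^ upc (lab p) (lab q) * uv q p else 0)"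
    and uv: "p \<in> I \<Longrightarrow> q \<in> I \<Longrightarrow> fps_nth (uv q p) 0 \<noteq> 0"
    and bv: "p \<in> I \<Longrightarrow> bv p \<in> carrier A"
    and \<rho>_bv: "p \<in> I \<Longrightarrow> \<rho> (bv p) p p = fps_X" "p \<in> I \<Longrightarrow> q \<in> I \<Longrightarrow> r \<noteq> q \<Longrightarrow> \<rho> (bv p) r q = 0"
begin

abbreviation "ex p q r \<equiv> excess (lab p) (lab q) (lab r)"

text \<open>The coefficient of the generator of the intermediate category in the entry of
  \<open>a\<close>: by \<open>\<rho>_dvd\<close> the power that is shifted away divides the
  symbol.\<close>

definition "ksym a q p = fps_shift (upc (lab p) (lab q)) (\<rho> a q p)"

lemma ksym: "a \<in> carrier A \<Longrightarrow> p \<in> I \<Longrightarrow> q \<in> I \<Longrightarrow> \<rho> a q p = fps_X ^ upc (lab p) (lab q) * ksym a q p"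
  using \<rho>_dvd[of a p q] unfolding ksym_def dvd_def
  by (auto simp: fps_shift_times_fps_X_power' mult.commute)

lemma ksym_eqI: "\<rho> a q p = fps_X ^ upc (lab p) (lab q) * g \<Longrightarrow> ksym a q p = g"
  unfolding ksym_def by (simp add: fps_shift_times_fps_X_power' mult.commute)

lemma ksym_zero: "\<rho> a q p = 0 \<Longrightarrow> ksym a q p = 0"
  by (simp add: ksym_def)

lemma lab_in: "p \<in> I \<Longrightarrow> lab p \<in> P" using lab by auto

lemma ksym_add: "a \<in> carrier A \<Longrightarrow> b \<in> carrier A \<Longrightarrow> p \<in> I \<Longrightarrow> q \<in> I \<Longrightarrow>
    ksym (a \<oplus> b) q p = ksym a q p + ksym b q p"
  by (simp add: ksym_def \<rho>_add fps_shift_add)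

lemma ksym_scal: "p \<in> I \<Longrightarrow> q \<in> I \<Longrightarrow> ksym (c \<odot> \<one>) q p = (if q = p then fps_const c else 0)"
  by (simp add: ksym_def \<rho>_scal)

lemma ksym_one: "p \<in> I \<Longrightarrow> q \<in> I \<Longrightarrow> ksym \<one> q p = (if q = p then 1 else 0)"
  using ksym_scal[of p q 1] one_smult_one by simp

text \<open>The forced powers of the variable in the two factors exceed the one in the product by
  exactly \<open>ex p q r\<close>, so the coefficients compose by the rule \<open>y_comp\<close> of
  the intermediate category.\<close>

lemma ksym_mult:
  assumes ab: "a \<in> carrier A" "b \<in> carrier A" and pr: "p \<in> I" "r \<in> I" and U: "finite U" "\<And>q. q \<notin> U \<Longrightarrow> \<rho> b q p = 0"
  shows "ksym (a \<otimes> b) r p = (\<Sum>q\<in>U \<inter> I. ksym a r q * ksym b q p * fps_X ^ ex p q r)"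
proof (rule ksym_eqI)
  have "\<rho> (a \<otimes> b) r p = (\<Sum>q\<in>U. \<rho> a r q * \<rho> b q p)"
    by (rule \<rho>_mult) (use assms in auto)
  also have "\<dots> = (\<Sum>q\<in>U \<inter> I. \<rho> a r q * \<rho> b q p)"
    by (rule sum.mono_neutral_right) (use U \<rho>_in[OF ab(2) pr(1)] in auto)
  also have "\<dots> = (\<Sum>q\<in>U \<inter> I. fps_X ^ upc (lab p) (lab r) * (ksym a r q * ksym b q p * fps_X ^ ex p q r))"
  proof (rule sum.cong[OF refl])
    fix q assume "q \<in> U \<inter> I"
    then have q: "q \<in> I" by simp
    have "\<rho> a r q * \<rho> b q p = fps_X ^ (upc (lab p) (lab q) + upc (lab q) (lab r)) * (ksym a r q * ksym b q p)"
      using ksym ab pr q by (simp add: power_add)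
    then show "\<rho> a r q * \<rho> b q p = fps_X ^ upc (lab p) (lab r) * (ksym a r q * ksym b q p * fps_X ^ ex p q r)"
      by (simp add: upc_excess power_add)
  qed
  finally show "\<rho> (a \<otimes> b) r p = fps_X ^ upc (lab p) (lab r) * (\<Sum>q\<in>U \<inter> I. ksym a r q * ksym b q p * fps_X ^ ex p q r)"
    by (simp add: sum_distrib_left)
qed

lemma ksym_mult_single:
  assumes "a \<in> carrier A" "b \<in> carrier A" "p \<in> I" "q \<in> I" "r \<in> I" "\<And>m. m \<noteq> q \<Longrightarrow> \<rho> b m p = 0"
  shows "ksym (a \<otimes> b) r p = ksym a r q * ksym b q p * fps_X ^ ex p q r"
proof -
  have "{q} \<inter> I = {q}" using assms by auto
  then show ?thesis using ksym_mult[OF assms(1,2,3,5), of "{q}"] assms(6) by simp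
qed

lemma ksym_av: "p \<in> I \<Longrightarrow> q \<in> I \<Longrightarrow> ksym (av q p) q p = uv q p"
  by (rule ksym_eqI) (simp add: \<rho>_av)

lemma ksym_bv: "p \<in> I \<Longrightarrow> ksym (bv p) p p = fps_X"
  by (rule ksym_eqI) (simp add: \<rho>_bv)

text \<open>A representation \<open>y\<close> of the intermediate category is pulled back to
  \<open>A\<close>: each index \<open>p\<close> receives its own copy of the space that
  \<open>y\<close> attaches to \<open>lab p\<close>.\<close>

definition smat :: "'i set rep \<Rightarrow>
    'a \<Rightarrow> 'l \<Rightarrow> 'l \<Rightarrow> complex poly \<Rightarrow> complex poly" where
  "smat y a q p w = (if p \<in> I \<and> q \<in> I then y (ksym a q p) (lab q) (lab p) w else 0)"

lemma matrix_rep_smat: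
  assumes y: "sys P excess y"
  shows "matrix_rep A I (smat y)"
proof -
  interpret sys P excess y by fact
  note li = lab_in
  show ?thesis
  proof
    show "smat y a q p (v + w) = smat y a q p v + smat y a q p w" for a q p v w
      by (simp add: smat_def y_plus)
    show "smat y a q p (smult c w) = smult c (smat y a q p w)" for a q p c w
      by (simp add: smat_def y_smult)
    show "smat y a q p w = 0" if "p \<notin> I \<or> q \<notin> I" for a q p w
      using that by (auto simp: smat_def)
    show "\<exists>U. finite U \<and> (\<forall>q. q \<notin> U \<longrightarrow> smat y a q p w = 0)" if a: "a \<in> carrier A" for a p w
    proof (cases "p \<in> I")
      case True
      then show ?thesis using \<rho>_fin[OF a, of p] by (auto simp: smat_def ksym_zero)
    qed (auto simp: smat_def intro: exI[of _ "{}"])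
    show "smat y (a \<oplus> b) q p w = smat y a q p w + smat y b q p w"
      if "a \<in> carrier A" "b \<in> carrier A" for a b q p w
      using that by (simp add: smat_def ksym_add y_add)
    show "smat y \<one> q p w = 0" if "q \<noteq> p" for q p w
      using that by (simp add: smat_def ksym_one)
    show "smat y (c \<odot> \<one>) q p w = smult c (smat y \<one> q p w)" for c q p w
      by (simp add: smat_def ksym_one ksym_scal y_const)
    show "smat y (a \<otimes> b) r p w = (\<Sum>q\<in>U. smat y a r q (smat y b q p w))"
      if ab: "a \<in> carrier A" "b \<in> carrier A" and U: "finite U" "\<And>q. q \<notin> U \<Longrightarrow> smat y b q p w = 0" for a b r p w U
    proof (cases "p \<in> I \<and> r \<in> I")
      case False
      then show ?thesis by (auto simp: smat_def intro!: sum.neutral)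
    next
      case True
      \<comment> \<open>\<open>U\<close> is adapted to the single vector \<open>w\<close>, while off
        \<open>V\<close> the symbols vanish and with them the entries at all vectors. Both sums are
        compared with the one over \<open>U \<union> (V \<inter> I)\<close>.\<close>
      obtain V where V: "finite V" "\<And>q. q \<notin> V \<Longrightarrow> \<rho> b q p = 0" using \<rho>_fin[OF ab(2), of p] True by blast
      have z: "smat y a r q 0 = 0" for q by (simp add: smat_def)
      have 1: "(\<Sum>q\<in>U. smat y a r q (smat y b q p w)) = (\<Sum>q\<in>U \<union> (V \<inter> I). smat y a r q (smat y b q p w))"
        by (rule sum.mono_neutral_left) (use U V z in auto)
      have 2: "(\<Sum>q\<in>V \<inter> I. smat y a r q (smat y b q p w)) = (\<Sum>q\<in>U \<union> (V \<inter> I). smat y a r q (smat y b q p w))"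
      proof (rule sum.mono_neutral_left)
        show "\<forall>q\<in>(U \<union> (V \<inter> I)) - V \<inter> I. smat y a r q (smat y b q p w) = 0"
        proof
          fix q assume "q \<in> (U \<union> (V \<inter> I)) - V \<inter> I"
          then have "q \<notin> V \<or> q \<notin> I" by auto
          then show "smat y a r q (smat y b q p w) = 0"
            using V z True by (auto simp: smat_def ksym_zero)
        qed
      qed (use U V in auto)
      have "smat y (a \<otimes> b) r p w = y (\<Sum>q\<in>V \<inter> I. ksym a r q * ksym b q p * fps_X ^ ex p q r) (lab r) (lab p) w"
        using True ksym_mult[OF ab _ _ V] by (simp add: smat_def)
      also have "\<dots> = (\<Sum>q\<in>V \<inter> I. smat y a r q (smat y b q p w))"
        unfolding y_fsum by (intro sum.cong) (use True in \<open>auto simp: smat_def y_comp li\<close>)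
      finally show ?thesis using 1 2 by simp
    qed
  qed
qed

lemma smat_one: "sys P excess y \<Longrightarrow> p \<in> I \<Longrightarrow> smat y \<one> p p w = y 1 (lab p) (lab p) w"
  by (simp add: smat_def ksym_one)

end

locale symbol_functor = symbol_algebra A I lab P \<rho> av uv bv
  for A :: "(complex, 'a) module" (structure) and I :: "'l set" and lab :: "'l \<Rightarrow> 'i::finite set"
    and P \<rho> av uv bv +
  fixes \<iota> :: "'l coords \<Rightarrow> 'u"
  assumes inj: "inj_on \<iota> {f. keys f \<subseteq> I}"
begin

abbreviation "mc y \<equiv> matrix_rep.mcar A (smat y)"

definition "Fo y = transported_module \<iota> (mc y) (matrix_rep.mact (smat y))"

definition "Fm y y' g = (\<lambda>x\<in>carrier (Fo y). \<iota> (Poly_Mapping.mapp (\<lambda>p. g (lab p)) (inv_into (mc y) \<iota> x)))"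

lemma inj_mcar: "sys P excess y \<Longrightarrow> inj_on \<iota> (mc y)"
  by (rule inj_on_subset[OF inj]) (use matrix_rep.mcar_in[OF matrix_rep_smat] in blast)

lemma transport_Fo: "sys P excess y \<Longrightarrow> transport A \<iota> (mc y) (matrix_rep.mact (smat y))"
  by (rule matrix_rep.transport[OF matrix_rep_smat inj_mcar])

lemma left_module_Fo: "sys P excess y \<Longrightarrow> left_module A (Fo y)"
  unfolding Fo_def by (rule transport.left_module_N[OF transport_Fo])

lemma mc_iff: "sys P excess y \<Longrightarrow> f \<in> mc y \<longleftrightarrow> keys f \<subseteq> I \<and> (\<forall>p\<in>I. y 1 (lab p) (lab p) (lookup f p) = lookup f p)"
proof -
  assume y: "sys P excess y"
  interpret m: matrix_rep A I "smat y" by (rule matrix_rep_smat[OF y])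
  have "smat y \<one> p p (lookup f p) = lookup f p" if "keys f \<subseteq> I" "p \<notin> I" for p
    using that by (auto simp: smat_def in_keys_iff)
  then show ?thesis
    using m.mcar_in[of f] unfolding m.mcar_def by (auto simp: smat_one[OF y]) (metis smat_one[OF y])+
qed

lemma lookup_map_hom: "g \<in> sys_hom P y y' \<Longrightarrow> lookup (Poly_Mapping.mapp (\<lambda>p. g (lab p)) f) p = g (lab p) (lookup f p)"
  by (auto simp: lookup_mapp when_def in_keys_iff sys_homD(6))

lemma mapp_mc:
  assumes "sys P excess y" "sys P excess y'" "g \<in> sys_hom P y y'" "f \<in> mc y"
  shows "Poly_Mapping.mapp (\<lambda>p. g (lab p)) f \<in> mc y'"
  using assms(1,2,4) lab_in keys_mapp_subset[of "\<lambda>p. g (lab p)" f]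
  by (auto simp: mc_iff lookup_map_hom[OF assms(3)] sys_homD(7)[OF assms(3)])

lemma Fm_apply: "sys P excess y \<Longrightarrow> f \<in> mc y \<Longrightarrow> Fm y y' g (\<iota> f) = \<iota> (Poly_Mapping.mapp (\<lambda>p. g (lab p)) f)"
  using inj_mcar[of y] unfolding Fm_def Fo_def by (auto simp: transported_module_def)

lemma Fm_hom:
  assumes y: "sys P excess y" and y': "sys P excess y'" and g: "g \<in> sys_hom P y y'"
  shows "Fm y y' g \<in> module_hom A (Fo y) (Fo y')"
proof -
  interpret t: transport A \<iota> "mc y" "matrix_rep.mact (smat y)" by (rule transport_Fo[OF y])
  interpret t': transport A \<iota> "mc y'" "matrix_rep.mact (smat y')" by (rule transport_Fo[OF y'])
  interpret m: matrix_rep A I "smat y" by (rule matrix_rep_smat[OF y])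
  interpret m': matrix_rep A I "smat y'" by (rule matrix_rep_smat[OF y'])
  let ?m = "Poly_Mapping.mapp (\<lambda>p. g (lab p))"
  note lk = lookup_map_hom[OF g]
  have car: "carrier (Fo y) = \<iota> ` mc y" "carrier (Fo y') = \<iota> ` mc y'" by (auto simp: Fo_def)
  have 1: "?m (f + f') = ?m f + ?m f'" if "f \<in> mc y" "f' \<in> mc y" for f f'
  proof (rule poly_mapping_eqI)
    fix p show "lookup (?m (f + f')) p = lookup (?m f + ?m f') p"
      using sys_homD(1)[OF g] sys_homD(5)[OF g] by (cases "lab p \<in> P") (auto simp: lk lookup_add)
  qed
  have gs: "g J (\<Sum>x\<in>X. F x) = (\<Sum>x\<in>X. g J (F x))" if "J \<in> P" for J X and F :: "'l \<Rightarrow> complex poly"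
    by (induction X rule: infinite_finite_induct) (auto simp: sys_homD[OF g] that)
  have 2: "?m (m.mact a f) = m'.mact a (?m f)" if f: "f \<in> mc y" and a: "a \<in> carrier A" for f a
  proof (rule poly_mapping_eqI)
    fix q
    have k: "keys (?m f) \<subseteq> keys f" by (rule keys_mapp_subset)
    have kI: "keys f \<subseteq> I" using m.mcar_in[OF f] .
    show "lookup (?m (m.mact a f)) q = lookup (m'.mact a (?m f)) q"
    proof (cases "q \<in> I")
      case True
      have "lookup (?m (m.mact a f)) q = (\<Sum>p\<in>keys f. g (lab q) (smat y a q p (lookup f p)))"
        unfolding lk m.lookup_mact[OF a] by (rule gs[OF lab_in[OF True]])
      also have "\<dots> = (\<Sum>p\<in>keys f. smat y' a q p (g (lab p) (lookup f p)))"
      proof (rule sum.cong[OF refl])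
        fix p assume "p \<in> keys f"
        then have "p \<in> I" using kI by auto
        then show "g (lab q) (smat y a q p (lookup f p)) = smat y' a q p (g (lab p) (lookup f p))"
          using True sys_homD(4)[OF g] lab_in by (simp add: smat_def)
      qed
      finally show ?thesis unfolding m'.lookup_mact'[OF a finite_keys k] lk .
    next
      case False
      then show ?thesis unfolding lk m.lookup_mact[OF a] m'.lookup_mact[OF a]
        using m.s_out[OF a] m'.s_out[OF a] sys_homD(6)[OF g] by simp
    qed
  qed
  show ?thesis
    unfolding module_hom_def car
    using mapp_mc[OF y y' g] t.plus t.act 1 2
    by (auto simp: Fm_apply[OF y] Fo_def) (auto simp: Fm_def Fo_def)
qed

lemma functor_F: 
  assumes P: "\<And>y. sys P excess y \<Longrightarrow> Q (Fo y)"
  shows "is_functor (sys_category P excess) (module_category A Q) Fo Fm"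
proof -
  have id: "Fm y y (\<lambda>J. if J \<in> P then y 1 J J else (\<lambda>w. 0)) = (\<lambda>x\<in>carrier (Fo y). x)" if y: "sys P excess y" for y
  proof -
    have g: "(\<lambda>J. if J \<in> P then y 1 J J else (\<lambda>w. 0)) \<in> sys_hom P y y"
      using is_categoryD(1)[OF is_category_sys, of y P excess] y by (simp add: sys_category_def)
    have "Poly_Mapping.mapp (\<lambda>p. (\<lambda>J. if J \<in> P then y 1 J J else (\<lambda>w. 0)) (lab p)) f = f" if "f \<in> mc y" for f
    proof (rule poly_mapping_eqI)
      fix p
      have "lab p \<notin> P \<Longrightarrow> lookup f p = 0" using lab_in that by (auto simp: mc_iff[OF y] in_keys_iff)
      moreover have "p \<notin> I \<Longrightarrow> lookup f p = 0" using that by (auto simp: mc_iff[OF y] in_keys_iff)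
      ultimately show "lookup (Poly_Mapping.mapp (\<lambda>p. (\<lambda>J. if J \<in> P then y 1 J J else (\<lambda>w. 0)) (lab p)) f) p = lookup f p"
        unfolding lookup_map_hom[OF g] using that sys.y_zero[OF y]
        by (cases "p \<in> I") (auto simp: mc_iff[OF y])
    qed
    then have "Fm y y (\<lambda>J. if J \<in> P then y 1 J J else (\<lambda>w. 0)) (\<iota> f) = \<iota> f" if "f \<in> mc y" for f
      using Fm_apply[OF y that, of y "\<lambda>J. if J \<in> P then y 1 J J else (\<lambda>w. 0)"] that by simp
    then show ?thesis by (intro ext) (auto simp: Fo_def transported_module_def Fm_def)
  qed
  have comp: "Fm x z (\<lambda>J w. g J (f J w)) = compose (carrier (Fo x)) (Fm y z g) (Fm x y f)"
    if o: "sys P excess x" "sys P excess y" "sys P excess z" "f \<in> sys_hom P x y" "g \<in> sys_hom P y z" for x y z f g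
  proof
    fix v
    have gf: "(\<lambda>J w. g J (f J w)) \<in> sys_hom P x z"
      using is_categoryD(2)[OF is_category_sys, of x P excess y z f g] o by (simp add: sys_category_def)
    have "Poly_Mapping.mapp (\<lambda>p. g (lab p)) (Poly_Mapping.mapp (\<lambda>p. f (lab p)) u) = Poly_Mapping.mapp (\<lambda>p w. g (lab p) (f (lab p) w)) u" for u
      by (rule poly_mapping_eqI) (simp add: lookup_map_hom[OF o(4)] lookup_map_hom[OF o(5)] lookup_map_hom[OF gf])
    then have "Fm x z (\<lambda>J w. g J (f J w)) (\<iota> u) = Fm y z g (Fm x y f (\<iota> u))" if "u \<in> mc x" for u
      unfolding Fm_apply[OF o(1) that] Fm_apply[OF o(2) mapp_mc[OF o(1,2,4) that]] by simp
    then show "Fm x z (\<lambda>J w. g J (f J w)) v = compose (carrier (Fo x)) (Fm y z g) (Fm x y f) v"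
      by (auto simp: compose_def Fo_def transported_module_def Fm_def)
  qed
  show ?thesis
    unfolding is_functor_def sys_category_def module_category_def
    using left_module_Fo P Fm_hom id comp by auto
qed

lemma sum_singles: "f = (\<Sum>p\<in>keys f. single p (lookup f p))"
  by (rule poly_mapping_eqI) (auto simp: lookup_sum lookup_single when_def in_keys_iff)

text \<open>By \<open>pres\<close> a homomorphism respects components and so is a family
  \<open>h p\<close>. Compatibility with \<open>bv p\<close> yields compatibility with the variable,
  hence with all power series by nilpotency. Compatibility with \<open>av q p\<close>, whose symbol
  differs from the generator by a unit, then yields it for all morphisms of the intermediate
  category, and such a family depends on \<open>lab p\<close> alone.\<close>

lemma fully_faithful:
  assumes y: "sys P excess y" and y': "sys P excess y'"
    and pres: "\<And>F p w. F \<in> module_hom A (Fo y) (Fo y') \<Longrightarrow> p \<in> I \<Longrightarrow> y 1 (lab p) (lab p) w = w \<Longrightarrow>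
       \<exists>w'. y' 1 (lab p) (lab p) w' = w' \<and> F (\<iota> (single p w)) = \<iota> (single p w')"
  shows "bij_betw (Fm y y') (sys_hom P y y') (module_hom A (Fo y) (Fo y'))"
proof -
  interpret y: sys P excess y by (rule y)
  interpret y': sys P excess y' by (rule y')
  interpret t: transport A \<iota> "mc y" "matrix_rep.mact (smat y)" by (rule transport_Fo[OF y])
  interpret t': transport A \<iota> "mc y'" "matrix_rep.mact (smat y')" by (rule transport_Fo[OF y'])
  interpret m: matrix_rep A I "smat y" by (rule matrix_rep_smat[OF y])
  interpret m': matrix_rep A I "smat y'" by (rule matrix_rep_smat[OF y'])
  note l = lab_in
  have car: "carrier (Fo y) = \<iota> ` mc y" "carrier (Fo y') = \<iota> ` mc y'" by (auto simp: Fo_def)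
  have sg: "single p w \<in> mc y" if "p \<in> I" "y 1 (lab p) (lab p) w = w" for p w
    using that by (auto simp: mc_iff[OF y] lookup_single when_def)
  have sg': "single p w \<in> mc y'" if "p \<in> I" "y' 1 (lab p) (lab p) w = w" for p w
    using that by (auto simp: mc_iff[OF y'] lookup_single when_def)
  define \<tau> where "\<tau> J = (SOME p. p \<in> I \<and> lab p = J)" for J
  have \<tau>: "\<tau> J \<in> I" "lab (\<tau> J) = J" if "J \<in> P" for J
    using someI_ex[of "\<lambda>p. p \<in> I \<and> lab p = J"] that lab unfolding \<tau>_def by auto
  have inj: "g = g'" if g: "g \<in> sys_hom P y y'" and g': "g' \<in> sys_hom P y y'" and eq: "Fm y y' g = Fm y y' g'" for g g'
  proof (intro ext)
    fix J w
    show "g J w = g' J w"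
    proof (cases "J \<in> P")
      case True
      let ?f = "single (\<tau> J) (y 1 J J w)"
      have f: "?f \<in> mc y" by (rule sg) (use True \<tau> in auto)
      have "Poly_Mapping.mapp (\<lambda>p. g (lab p)) ?f = Poly_Mapping.mapp (\<lambda>p. g' (lab p)) ?f"
        using t'.inj_eq[OF mapp_mc[OF y y' g f] mapp_mc[OF y y' g' f]] Fm_apply[OF y f, of y' g]
          Fm_apply[OF y f, of y' g'] eq by metis
      then have "g (lab (\<tau> J)) (lookup ?f (\<tau> J)) = g' (lab (\<tau> J)) (lookup ?f (\<tau> J))"
        unfolding lookup_map_hom[OF g, symmetric] lookup_map_hom[OF g', symmetric] by simp
      then show ?thesis using \<tau> True sys_homD(3)[OF g] sys_homD(3)[OF g'] by simp
    qed (simp add: sys_homD(5)[OF g] sys_homD(5)[OF g'])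
  qed
  have surj: "\<exists>g\<in>sys_hom P y y'. Fm y y' g = F" if F: "F \<in> module_hom A (Fo y) (Fo y')" for F
  proof -
    have Fcl: "F (\<iota> f) \<in> \<iota> ` mc y'" if "f \<in> mc y" for f
      using F that unfolding module_hom_def car by auto
    define G where "G f = inv_into (mc y') \<iota> (F (\<iota> f))" for f
    have G: "G f \<in> mc y'" "F (\<iota> f) = \<iota> (G f)" if "f \<in> mc y" for f
      using Fcl[OF that] unfolding G_def by (auto simp: inv_into_into f_inv_into_f)
    have G_plus: "G (f + f') = G f + G f'" if "f \<in> mc y" "f' \<in> mc y" for f f'
    proof -
      have "\<iota> (G (f + f')) = F (\<iota> f \<oplus>\<^bsub>Fo y\<^esub> \<iota> f')"
        using G(2)[OF t.plus[OF that]] that by (simp add: Fo_def)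
      also have "\<dots> = F (\<iota> f) \<oplus>\<^bsub>Fo y'\<^esub> F (\<iota> f')"
        using F that unfolding module_hom_def car by auto
      also have "\<dots> = \<iota> (G f + G f')" using G that by (simp add: Fo_def)
      finally show ?thesis using G t'.plus t.plus that by simp
    qed
    have G_act: "G (m.mact a f) = m'.mact a (G f)" if "a \<in> carrier A" "f \<in> mc y" for a f
    proof -
      have "\<iota> (G (m.mact a f)) = F (a \<odot>\<^bsub>Fo y\<^esub> \<iota> f)"
        using G(2)[OF t.act[OF that]] that by (simp add: Fo_def)
      also have "\<dots> = a \<odot>\<^bsub>Fo y'\<^esub> F (\<iota> f)"
        using F that unfolding module_hom_def car by auto
      also have "\<dots> = \<iota> (m'.mact a (G f))" using G that by (simp add: Fo_def)
      finally show ?thesis using G t'.act t.act that by simp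
    qed
    have G_zero: "G 0 = 0" using G_plus[OF t.zero t.zero] by simp
    have G_sum: "G (\<Sum>x\<in>X. f x) = (\<Sum>x\<in>X. G (f x)) \<and> (\<Sum>x\<in>X. f x) \<in> mc y"
      if "finite X" "\<And>x. x \<in> X \<Longrightarrow> f x \<in> mc y" for X and f :: "'l \<Rightarrow> 'l coords"
      using that
    proof (induction X rule: finite_induct)
      case empty
      show ?case using G_zero t.zero by (auto simp only: sum.empty)
    next
      case (insert x X)
      then have *: "G (sum f X) = (\<Sum>x\<in>X. G (f x))" "sum f X \<in> mc y" "f x \<in> mc y" by auto
      show ?case unfolding sum.insert[OF insert(1,2)] using G_plus[OF *(3,2)] t.plus[OF *(3,2)] *(1) by simp
    qed
    \<comment> \<open>The inner projection makes \<open>h p\<close> a map on all polynomials with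
      the normalization that \<open>sys_hom\<close> prescribes.\<close>
    define h where "h p w = lookup (G (single p (y 1 (lab p) (lab p) w))) p" for p w
    have h_single: "G (single p w) = single p (h p w)" "y' 1 (lab p) (lab p) (h p w) = h p w"
      if pw: "p \<in> I" "y 1 (lab p) (lab p) w = w" for p w
    proof -
      obtain w' where w': "y' 1 (lab p) (lab p) w' = w'" "F (\<iota> (single p w)) = \<iota> (single p w')"
        using pres[OF F pw] by blast
      have "G (single p w) = single p w'"
        using w' G[OF sg[OF pw]] sg'[OF pw(1) w'(1)] by auto
      then show "G (single p w) = single p (h p w)" "y' 1 (lab p) (lab p) (h p w) = h p w"
        using w' pw unfolding h_def by auto
    qed
    have h1: "h p (y 1 (lab p) (lab p) w) = h p w" if "p \<in> I" for p w
      using that l by (simp add: h_def)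
    have h_plus: "h p (v + w) = h p v + h p w" if "p \<in> I" for p v w
    proof -
      let ?y = "y 1 (lab p) (lab p)"
      have "single p (?y (v + w)) = single p (?y v) + single p (?y w)"
        by (simp add: y.y_plus single_add)
      then show ?thesis unfolding h_def using G_plus[OF sg[OF that] sg[OF that], of "?y v" "?y w"] that l
        by (simp add: lookup_add)
    qed
    have h_zero: "h p 0 = 0" if "p \<in> I" for p using h_plus[OF that, of 0 0] by simp
    have h_sym: "h q (y (ksym a q p) (lab q) (lab p) w) = y' (ksym a q p) (lab q) (lab p) (h p w)"
      if a: "a \<in> carrier A" and pq: "p \<in> I" "q \<in> I" for a p q w
    proof -
      define v where "v = y 1 (lab p) (lab p) w"
      have v: "y 1 (lab p) (lab p) v = v" "h p v = h p w"
          "y (ksym a q p) (lab q) (lab p) w = y (ksym a q p) (lab q) (lab p) v"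
        using pq l by (auto simp: v_def h1)
      let ?f = "m.mact a (single p v)"
      have f: "?f \<in> mc y" by (rule t.act[OF a sg[OF pq(1) v(1)]])
      have one: "y 1 (lab r) (lab r) (lookup ?f r) = lookup ?f r" if "r \<in> keys ?f" for r
        using f that by (auto simp: mc_iff[OF y])
      have kI: "keys ?f \<subseteq> I" using f by (auto simp: mc_iff[OF y])
      have "G ?f = G (\<Sum>r\<in>keys ?f. single r (lookup ?f r))" using sum_singles[of ?f] by simp
      also have "\<dots> = (\<Sum>r\<in>keys ?f. G (single r (lookup ?f r)))"
        by (rule conjunct1[OF G_sum]) (use sg one kI in auto)
      also have "\<dots> = (\<Sum>r\<in>keys ?f. single r (h r (lookup ?f r)))"
        by (intro sum.cong refl h_single) (use one kI in auto)
      finally have "lookup (G ?f) q = (\<Sum>r\<in>keys ?f. h r (lookup ?f r) when r = q)"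
        by (simp add: lookup_sum lookup_single)
      also have "\<dots> = h q (lookup ?f q)"
        using h_zero[OF pq(2)] by (auto simp: when_def in_keys_iff)
      finally have 1: "lookup (G ?f) q = h q (y (ksym a q p) (lab q) (lab p) v)"
        using pq by (simp add: m.mact_single[OF a] smat_def)
      have "G ?f = m'.mact a (single p (h p v))"
        using G_act[OF a sg[OF pq(1) v(1)]] h_single(1)[OF pq(1) v(1)] by simp
      then have "lookup (G ?f) q = y' (ksym a q p) (lab q) (lab p) (h p v)"
        using pq by (simp add: m'.mact_single[OF a] smat_def)
      then show ?thesis using 1 v by simp
    qed
    \<comment> \<open>Complex linearity is not among the conditions of \<open>module_hom\<close>; it
      is recovered from the action of \<open>c \<odot> \<one>\<close>.\<close>
    have h_smult: "h p (smult c w) = smult c (h p w)" if "p \<in> I" for p c w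
      using h_sym[OF smult_one_closed that that, of c w] that l h1[OF that] h_single(2)[OF that, of "y 1 (lab p) (lab p) w"]
      by (simp add: ksym_scal y.y_const y'.y_const y.y_smult[symmetric])
    have h_poly: "h p (y (fps_of_poly t) (lab p) (lab p) w) = y' (fps_of_poly t) (lab p) (lab p) (h p w)"
      if p: "p \<in> I" for p t w
    proof (induction t arbitrary: w)
      case 0 then show ?case using h_zero p by simp
    next
      case (pCons c t)
      have split: "y (fps_of_poly (pCons c t)) (lab p) (lab p) w =
          smult c (y 1 (lab p) (lab p) w) + y (fps_of_poly t) (lab p) (lab p) (y fps_X (lab p) (lab p) w)" for w
        using p l by (simp add: fps_of_poly_pCons y.y_add y.y_const y.y_comp)
      have split': "y' (fps_of_poly (pCons c t)) (lab p) (lab p) w =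
          smult c (y' 1 (lab p) (lab p) w) + y' (fps_of_poly t) (lab p) (lab p) (y' fps_X (lab p) (lab p) w)" for w
        using p l by (simp add: fps_of_poly_pCons y'.y_add y'.y_const y'.y_comp)
      have "h p (y fps_X (lab p) (lab p) w) = y' fps_X (lab p) (lab p) (h p w)"
        using h_sym[OF bv[OF p] p p, of w] p by (simp add: ksym_bv)
      moreover have "h p (y 1 (lab p) (lab p) w) = y' 1 (lab p) (lab p) (h p w)"
        using h_sym[OF one_closed p p, of w] p by (simp add: ksym_one)
      ultimately show ?case unfolding split split' using h_plus[OF p] h_smult[OF p] pCons.IH by simp
    qed
    \<comment> \<open>The power series is split into a polynomial and a multiple of a power of the
      variable that annihilates the component in both representations.\<close>
    have h_diag: "h p (y f (lab p) (lab p) w) = y' f (lab p) (lab p) (h p w)" if p: "p \<in> I" for p f w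
    proof -
      obtain N N' where N: "\<And>f K w. y (fps_X ^ N * f) K (lab p) w = 0" "\<And>f K w. y' (fps_X ^ N' * f) K (lab p) w = 0"
        using y.y_nil[OF l[OF p]] y'.y_nil[OF l[OF p]] by blast
      obtain t g where f: "f = fps_of_poly t + fps_X ^ (N + N') * g" using fps_split_power by blast
      have e: "fps_X ^ (N + N') * g = fps_X ^ N * (fps_X ^ N' * g)" "fps_X ^ (N + N') * g = fps_X ^ N' * (fps_X ^ N * g)"
        by (simp_all add: power_add algebra_simps)
      have "y (fps_X ^ (N + N') * g) (lab p) (lab p) w = 0" "y' (fps_X ^ (N + N') * g) (lab p) (lab p) (h p w) = 0"
        unfolding e(1)[THEN arg_cong[where f = y]] e(2)[THEN arg_cong[where f = y']] by (rule N)+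
      then show ?thesis unfolding f y.y_add y'.y_add using h_poly[OF p] by simp
    qed
    \<comment> \<open>The generator times \<open>f\<close> is \<open>av q p\<close> after the power
      series \<open>f\<close> divided by \<open>uv q p\<close>, which acts within the source
      component.\<close>
    have h_all: "h q (y f (lab q) (lab p) w) = y' f (lab q) (lab p) (h p w)" if pq: "p \<in> I" "q \<in> I" for p q f w
    proof -
      have u: "uv q p * (inverse (uv q p) * f) = f"
        using uv[OF pq] by (simp add: mult.assoc[symmetric] inverse_mult_eq_1')
      have "y f (lab q) (lab p) w = y (uv q p) (lab q) (lab p) (y (inverse (uv q p) * f) (lab p) (lab p) w)"
        by (simp only: y.y_comp l pq u excess_refl power_0 mult_1_right)
      moreover have "y' f (lab q) (lab p) (h p w) = y' (uv q p) (lab q) (lab p) (y' (inverse (uv q p) * f) (lab p) (lab p) (h p w))"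
        by (simp only: y'.y_comp l pq u excess_refl power_0 mult_1_right)
      ultimately show ?thesis using h_sym[OF av[OF pq] pq] h_diag[OF pq(1)] by (simp add: ksym_av pq)
    qed
    define g where "g J w = (if J \<in> P then h (\<tau> J) w else 0)" for J w
    have h1': "h (\<tau> J) (y 1 J J w) = h (\<tau> J) w" if "J \<in> P" for J w
      using h1[OF \<tau>(1)[OF that]] \<tau>(2)[OF that] by simp
    have g: "g \<in> sys_hom P y y'"
      unfolding sys_hom_def g_def
      using h_plus h_smult \<tau> h1' h_all[OF \<tau>(1) \<tau>(1)] by (auto simp: fun_eq_iff)
    \<comment> \<open>\<open>p\<close> and the representative of its label carry the same space, and
      \<open>h_all\<close> with \<open>f = 1\<close> between the two says that the maps there
      agree.\<close>
    have hg: "h p w = g (lab p) w" if p: "p \<in> I" and w: "y 1 (lab p) (lab p) w = w" for p w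
    proof -
      have "h p (y 1 (lab p) (lab (\<tau> (lab p))) w) = y' 1 (lab p) (lab (\<tau> (lab p))) (h (\<tau> (lab p)) w)"
        by (rule h_all) (use p \<tau> l in auto)
      then show ?thesis using \<tau> l[OF p] w h_single(2)[OF \<tau>(1)[OF l[OF p]], of w] by (simp add: g_def)
    qed
    have "Fm y y' g (\<iota> f) = F (\<iota> f)" if f: "f \<in> mc y" for f
    proof -
      have one: "y 1 (lab r) (lab r) (lookup f r) = lookup f r" if "r \<in> keys f" for r
        using f that by (auto simp: mc_iff[OF y])
      have kI: "keys f \<subseteq> I" using f by (auto simp: mc_iff[OF y])
      have "G f = G (\<Sum>r\<in>keys f. single r (lookup f r))" using sum_singles[of f] by simp
      also have "\<dots> = (\<Sum>r\<in>keys f. G (single r (lookup f r)))"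
        by (rule conjunct1[OF G_sum]) (use sg one kI in auto)
      also have "\<dots> = (\<Sum>r\<in>keys f. single r (g (lab r) (lookup f r)))"
        using h_single(1) hg one kI by (intro sum.cong) auto
      also have "\<dots> = Poly_Mapping.mapp (\<lambda>p. g (lab p)) f"
      proof (rule poly_mapping_eqI)
        fix q show "lookup (\<Sum>r\<in>keys f. single r (g (lab r) (lookup f r))) q = lookup (Poly_Mapping.mapp (\<lambda>p. g (lab p)) f) q"
          unfolding lookup_map_hom[OF g] lookup_sum lookup_single
          using sys_homD(6)[OF g] by (auto simp: when_def in_keys_iff)
      qed
      finally show ?thesis using Fm_apply[OF y f] G(2)[OF f] by simp
    qed
    then have "Fm y y' g x = F x" for x
      using F unfolding module_hom_def car
      by (cases "x \<in> \<iota> ` mc y") (auto simp: Fm_def car PiE_iff extensional_def)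
    then show ?thesis using g by blast
  qed
  show ?thesis unfolding bij_betw_def
  proof
    show "inj_on (Fm y y') (sys_hom P y y')" using inj by (auto intro: inj_onI)
    show "Fm y y' ` sys_hom P y y' = module_hom A (Fo y) (Fo y')"
      using Fm_hom[OF y y'] surj by blast
  qed
qed

end

section \<open>Coordinates\<close>

locale complex_module = complex_algebra A + left_module A M
  for A :: "(complex, 'a) module" (structure) and M :: "('a, 'u) module"
begin

abbreviation "cs \<equiv> cscale A M"

lemma cs_closed [simp]: "m \<in> carrier M \<Longrightarrow> cs c m \<in> carrier M"
  by (simp add: cscale_def smult_one_closed)

lemma cs_add: "m \<in> carrier M \<Longrightarrow> cs (c + d) m = cs c m \<oplus>\<^bsub>M\<^esub> cs d m"
  by (simp add: cscale_def smult_one_closed smult_one_add smult_l_distr)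

lemma cs_mult: "m \<in> carrier M \<Longrightarrow> cs (c * d) m = cs c (cs d m)"
  by (simp add: cscale_def smult_one_closed smult_one_mult smult_assoc)

lemma cs_one [simp]: "m \<in> carrier M \<Longrightarrow> cs 1 m = m"
  by (simp add: cscale_def one_smult_one)

lemma cs_zero [simp]: "m \<in> carrier M \<Longrightarrow> cs 0 m = \<zero>\<^bsub>M\<^esub>" "cs c \<zero>\<^bsub>M\<^esub> = \<zero>\<^bsub>M\<^esub>"
proof -
  have "cs 0 m \<oplus>\<^bsub>M\<^esub> cs 0 m = cs 0 m" if "m \<in> carrier M" using cs_add[of m 0 0] that by simp
  then show "m \<in> carrier M \<Longrightarrow> cs 0 m = \<zero>\<^bsub>M\<^esub>" by (metis M.add.r_cancel_one' cs_closed)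
  show "cs c \<zero>\<^bsub>M\<^esub> = \<zero>\<^bsub>M\<^esub>" by (simp add: cscale_def smult_one_closed)
qed

lemma smult_cs: "a \<in> carrier A \<Longrightarrow> m \<in> carrier M \<Longrightarrow> a \<odot>\<^bsub>M\<^esub> cs c m = cs c (a \<odot>\<^bsub>M\<^esub> m)"
  by (simp add: cscale_def smult_one_closed smult_assoc[symmetric] smult_one_central)

definition "lin S k = (\<Oplus>\<^bsub>M\<^esub>s\<in>S. cs (k s) s)"

lemma lin_closed [simp]: "S \<subseteq> carrier M \<Longrightarrow> lin S k \<in> carrier M"
  unfolding lin_def by (rule M.finsum_closed) auto

lemma lin_add: "S \<subseteq> carrier M \<Longrightarrow> lin S (\<lambda>s. k s + l s) = lin S k \<oplus>\<^bsub>M\<^esub> lin S l"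
proof -
  assume S: "S \<subseteq> carrier M"
  have "lin S (\<lambda>s. k s + l s) = (\<Oplus>\<^bsub>M\<^esub>s\<in>S. cs (k s) s \<oplus>\<^bsub>M\<^esub> cs (l s) s)"
    unfolding lin_def by (rule M.finsum_cong') (use S in \<open>auto simp: cs_add\<close>)
  also have "\<dots> = lin S k \<oplus>\<^bsub>M\<^esub> lin S l"
    unfolding lin_def by (rule M.finsum_addf) (use S in auto)
  finally show ?thesis .
qed

lemma lin_scale: "finite S \<Longrightarrow> S \<subseteq> carrier M \<Longrightarrow> lin S (\<lambda>s. c * k s) = cs c (lin S k)"
  unfolding lin_def cscale_def[of A M c "finsum M _ _"]
  by (subst smult_finsum) (auto intro!: M.finsum_cong' simp: cs_mult subset_iff smult_one_closed cscale_def[symmetric])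

lemma lin_cong: "S \<subseteq> carrier M \<Longrightarrow> (\<And>s. s \<in> S \<Longrightarrow> k s = l s) \<Longrightarrow> lin S k = lin S l"
  unfolding lin_def by (intro M.finsum_cong') auto

lemma lin_remove:
  assumes "finite S" "S \<subseteq> carrier M" "s \<in> S" "k s = 0"
  shows "lin S k = lin (S - {s}) k"
proof -
  have "lin (insert s (S - {s})) k = cs (k s) s \<oplus>\<^bsub>M\<^esub> lin (S - {s}) k"
    unfolding lin_def by (rule M.finsum_insert) (use assms in auto)
  moreover have "lin (S - {s}) k \<in> carrier M" by (rule lin_closed) (use assms in auto)
  ultimately show ?thesis using assms by (auto simp: insert_absorb subset_iff)
qed

definition "subspace_set W \<longleftrightarrow> W \<subseteq> carrier M \<and> \<zero>\<^bsub>M\<^esub> \<in> W \<and> (\<forall>m\<in>W. \<forall>n\<in>W. m \<oplus>\<^bsub>M\<^esub> n \<in> W) \<and> (\<forall>c. \<forall>m\<in>W. cs c m \<in> W)"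

lemma lin_in: "finite S \<Longrightarrow> S \<subseteq> W \<Longrightarrow> subspace_set W \<Longrightarrow> lin S k \<in> W"
proof (induction S rule: finite_induct)
  case empty then show ?case by (simp add: lin_def subspace_set_def)
next
  case (insert s S)
  have "lin (insert s S) k = cs (k s) s \<oplus>\<^bsub>M\<^esub> lin S k"
    unfolding lin_def by (rule M.finsum_insert) (use insert in \<open>auto simp: subspace_set_def\<close>)
  then show ?case using insert by (auto simp: subspace_set_def)
qed

text \<open>A spanning set of least cardinality is independent: a nontrivial relation would allow
  one of its vectors to be dropped.\<close>

lemma basis_exists:
  assumes W: "subspace_set W" and fd: "finite_dim A M W"
  shows "\<exists>S. finite S \<and> S \<subseteq> W \<and> (\<forall>m\<in>W. \<exists>c. m = lin S c) \<and>
    (\<forall>c c'. lin S c = lin S c' \<longrightarrow> (\<forall>s\<in>S. c s = c' s))"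
proof -
  define sp where "sp S \<longleftrightarrow> finite S \<and> S \<subseteq> W \<and> (\<forall>m\<in>W. \<exists>c. m = lin S c)" for S
  have "\<exists>S. sp S" using fd unfolding finite_dim_def sp_def lin_def by blast
  then obtain S where S: "sp S" "\<And>T. sp T \<Longrightarrow> card S \<le> card T"
    using ex_has_least_nat[of sp _ card] by blast
  have Sc: "S \<subseteq> carrier M" "finite S" using S(1) W unfolding sp_def subspace_set_def by auto
  have "c t = c' t" if eq: "lin S c = lin S c'" and t: "t \<in> S" for c c' t
  proof (rule ccontr)
    assume ne: "c t \<noteq> c' t"
    define d where "d s = c s - c' s" for s
    have "lin S c' \<oplus>\<^bsub>M\<^esub> lin S d = lin S c'"
      using lin_add[OF Sc(1), of c' d] eq by (simp add: d_def)
    then have d0: "lin S d = \<zero>\<^bsub>M\<^esub>" using M.add.l_cancel_one[OF lin_closed[OF Sc(1)] lin_closed[OF Sc(1)]] by blast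
    have "sp (S - {t})" unfolding sp_def
    proof (intro conjI ballI)
      fix m assume "m \<in> W"
      then obtain k where k: "m = lin S k" using S(1) unfolding sp_def by blast
      \<comment> \<open>The multiple of the relation \<open>d\<close> is chosen so that the
        coefficient at \<open>t\<close> cancels.\<close>
      define l where "l s = k s + (- k t / d t) * d s" for s
      have "lin S l = lin S k \<oplus>\<^bsub>M\<^esub> cs (- k t / d t) (lin S d)"
        unfolding l_def using lin_add lin_scale Sc by metis
      then have "lin S l = m" using d0 k Sc by simp
      moreover have "l t = 0" using ne by (simp add: l_def d_def)
      ultimately have "m = lin (S - {t}) l" using lin_remove[OF Sc(2,1) t] by metis
      then show "\<exists>c. m = lin (S - {t}) c" by blast
    qed (use S(1) in \<open>auto simp: sp_def\<close>)
    then have "card S \<le> card (S - {t})" by (rule S(2))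
    then show False using t Sc by (metis card_Diff1_less linorder_not_less)
  qed
  then show ?thesis using S(1) unfolding sp_def by blast
qed

text \<open>The basis is numbered by exponents, so \<open>\<phi>\<close> embeds \<open>W\<close> as
  the polynomials of degree below its dimension. \<open>V\<close> ignores all other coefficients,
  which makes \<open>\<phi> \<circ> V\<close> a projection of the space of polynomials onto that
  image.\<close>

lemma linear_coordinates:
  assumes W: "subspace_set W" and fd: "finite_dim A M W"
  shows "\<exists>(V :: complex poly \<Rightarrow> 'u) \<phi> d. (\<forall>w. V w \<in> W) \<and> (\<forall>v w. V (v + w) = V v \<oplus>\<^bsub>M\<^esub> V w) \<and>
    (\<forall>c w. V (smult c w) = cs c (V w)) \<and>
    (\<forall>m\<in>W. \<forall>n\<in>W. \<phi> (m \<oplus>\<^bsub>M\<^esub> n) = \<phi> m + \<phi> n) \<and> (\<forall>c. \<forall>m\<in>W. \<phi> (cs c m) = smult c (\<phi> m)) \<and>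
    (\<forall>m\<in>W. V (\<phi> m) = m) \<and> (\<forall>m k. d \<le> k \<longrightarrow> coeff (\<phi> m) k = 0)"
proof -
  obtain S where S: "finite S" "S \<subseteq> W" "\<And>m. m \<in> W \<Longrightarrow> \<exists>c. m = lin S c"
    "\<And>c c' s. lin S c = lin S c' \<Longrightarrow> s \<in> S \<Longrightarrow> c s = c' s"
    using basis_exists[OF assms] by blast
  have Sc: "S \<subseteq> carrier M" using S W unfolding subspace_set_def by auto
  obtain e where e: "bij_betw e S {0..<card S}" using ex_bij_betw_finite_nat S(1) by blast
  have ei: "e s = e t \<longleftrightarrow> s = t" if "s \<in> S" "t \<in> S" for s t
    using e that unfolding bij_betw_def inj_on_def by auto
  have ec: "e s < card S" if "s \<in> S" for s using e that unfolding bij_betw_def by auto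
  obtain c where c: "\<And>m. m \<in> W \<Longrightarrow> m = lin S (c m)" using S(3) by metis
  define \<phi> where "\<phi> m = (\<Sum>s\<in>S. monom (c m s) (e s))" for m
  define V where "V w = lin S (\<lambda>s. coeff w (e s))" for w :: "complex poly"
  have co: "coeff (\<phi> m) (e s) = c m s" if "s \<in> S" for m s
  proof -
    have "coeff (\<phi> m) (e s) = (\<Sum>t\<in>S. if t = s then c m t else 0)"
      unfolding \<phi>_def coeff_sum by (intro sum.cong) (use ei that in auto)
    then show ?thesis using S(1) that by simp
  qed
  have "\<phi> (m \<oplus>\<^bsub>M\<^esub> n) = \<phi> m + \<phi> n" if mn: "m \<in> W" "n \<in> W" for m n
  proof -
    have "lin S (c (m \<oplus>\<^bsub>M\<^esub> n)) = lin S (\<lambda>s. c m s + c n s)"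
      using c[OF mn(1)] c[OF mn(2)] c[of "m \<oplus>\<^bsub>M\<^esub> n"] mn W lin_add[OF Sc, of "c m" "c n"]
      unfolding subspace_set_def by metis
    then have "\<And>s. s \<in> S \<Longrightarrow> c (m \<oplus>\<^bsub>M\<^esub> n) s = c m s + c n s" by (rule S(4))
    then show ?thesis by (simp add: \<phi>_def add_monom[symmetric] sum.distrib)
  qed
  moreover have "\<phi> (cs k m) = smult k (\<phi> m)" if m: "m \<in> W" for m k
  proof -
    have "lin S (c (cs k m)) = lin S (\<lambda>s. k * c m s)"
      using c[OF m] c[of "cs k m"] m W lin_scale[OF S(1) Sc, of k "c m"]
      unfolding subspace_set_def by metis
    then have "\<And>s. s \<in> S \<Longrightarrow> c (cs k m) s = k * c m s" by (rule S(4))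
    moreover have "smult k (\<phi> m) = (\<Sum>s\<in>S. monom (k * c m s) (e s))"
      unfolding \<phi>_def by (intro poly_eqI) (auto simp: coeff_sum sum_distrib_left intro!: sum.cong)
    ultimately show ?thesis by (simp add: \<phi>_def)
  qed
  moreover have "V (\<phi> m) = m" if "m \<in> W" for m
    unfolding V_def using c[OF that] lin_cong[OF Sc, of "\<lambda>s. coeff (\<phi> m) (e s)" "c m"] co by simp
  moreover have "coeff (\<phi> m) k = 0" if "card S \<le> k" for m k
    unfolding \<phi>_def coeff_sum by (rule sum.neutral) (use ec that in fastforce)
  moreover have "V w \<in> W" for w unfolding V_def by (rule lin_in[OF S(1,2) W])
  moreover have "V (v + w) = V v \<oplus>\<^bsub>M\<^esub> V w" for v w
    unfolding V_def by (simp add: lin_add[OF Sc])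
  moreover have "V (smult k w) = cs k (V w)" for k w
    unfolding V_def by (simp add: lin_scale[OF S(1) Sc])
  ultimately show ?thesis by blast
qed

end

section \<open>Coordinates adapted to a direct sum decomposition\<close>

locale decomposed_module = complex_module A M
  for A :: "(complex, 'a) module" (structure) and M :: "('a, 'u) module" +
  fixes I :: "'l set" and W :: "'l \<Rightarrow> 'u set"
  assumes direct: "is_direct_sum M W" and sub: "subspace_set (W l)" and fd: "finite_dim A M (W l)"
    and out: "l \<notin> I \<Longrightarrow> W l = {\<zero>\<^bsub>M\<^esub>}"
begin

lemma W_closed: "x \<in> W l \<Longrightarrow> x \<in> carrier M" "\<zero>\<^bsub>M\<^esub> \<in> W l" "x \<in> W l \<Longrightarrow> x' \<in> W l \<Longrightarrow> x \<oplus>\<^bsub>M\<^esub> x' \<in> W l"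
  "x \<in> W l \<Longrightarrow> cs c x \<in> W l"
  using sub[of l] unfolding subspace_set_def by auto

definition "is_dec m f \<longleftrightarrow> (\<forall>l. f l \<in> W l) \<and> finite {l. f l \<noteq> \<zero>\<^bsub>M\<^esub>} \<and> m = (\<Oplus>\<^bsub>M\<^esub>l\<in>{l. f l \<noteq> \<zero>\<^bsub>M\<^esub>}. f l)"
definition "dec m = (THE f. is_dec m f)"

lemma dec: assumes "m \<in> carrier M" shows "is_dec m (dec m)"
proof -
  have "\<exists>!f. is_dec m f" using direct assms unfolding is_direct_sum_def is_dec_def by blast
  then show ?thesis unfolding dec_def by (rule theI')
qed

lemma dec_eqI: "m \<in> carrier M \<Longrightarrow> is_dec m f \<Longrightarrow> dec m = f"
  using dec[of m] direct unfolding is_direct_sum_def is_dec_def[symmetric] by blast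

lemma finsum_dec:
  assumes "\<And>l. f l \<in> W l" "finite U" "\<And>l. l \<notin> U \<Longrightarrow> f l = \<zero>\<^bsub>M\<^esub>"
  shows "(\<Oplus>\<^bsub>M\<^esub>l\<in>{l. f l \<noteq> \<zero>\<^bsub>M\<^esub>}. f l) = (\<Oplus>\<^bsub>M\<^esub>l\<in>U. f l)"
  by (rule M.add.finprod_mono_neutral_cong_left) (use assms W_closed in auto)

lemma dec_eqI':
  assumes "\<And>l. f l \<in> W l" "finite U" "\<And>l. l \<notin> U \<Longrightarrow> f l = \<zero>\<^bsub>M\<^esub>" "m = (\<Oplus>\<^bsub>M\<^esub>l\<in>U. f l)"
  shows "dec m = f"
proof (rule dec_eqI)
  show "m \<in> carrier M" unfolding assms(4) by (rule M.finsum_closed) (use assms W_closed in auto)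
  have "finite {l. f l \<noteq> \<zero>\<^bsub>M\<^esub>}" by (rule finite_subset[OF _ assms(2)]) (use assms(3) in auto)
  then show "is_dec m f" unfolding is_dec_def using finsum_dec[OF assms(1-3)] assms(1,4) by auto
qed

lemma dec_in: "m \<in> carrier M \<Longrightarrow> dec m l \<in> W l" "m \<in> carrier M \<Longrightarrow> finite {l. dec m l \<noteq> \<zero>\<^bsub>M\<^esub>}"
  "m \<in> carrier M \<Longrightarrow> dec m l \<in> carrier M"
  using dec W_closed(1) unfolding is_dec_def by blast+

lemma dec_sum: "m \<in> carrier M \<Longrightarrow> finite U \<Longrightarrow> (\<And>l. l \<notin> U \<Longrightarrow> dec m l = \<zero>\<^bsub>M\<^esub>) \<Longrightarrow> m = (\<Oplus>\<^bsub>M\<^esub>l\<in>U. dec m l)"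
  using finsum_dec[of "dec m" U] dec[of m] unfolding is_dec_def by auto

lemma dec_add:
  assumes "m \<in> carrier M" "n \<in> carrier M"
  shows "dec (m \<oplus>\<^bsub>M\<^esub> n) = (\<lambda>l. dec m l \<oplus>\<^bsub>M\<^esub> dec n l)"
proof (rule dec_eqI')
  let ?U = "{l. dec m l \<noteq> \<zero>\<^bsub>M\<^esub>} \<union> {l. dec n l \<noteq> \<zero>\<^bsub>M\<^esub>}"
  show "finite ?U" using dec_in assms by auto
  have "m = (\<Oplus>\<^bsub>M\<^esub>l\<in>?U. dec m l)" "n = (\<Oplus>\<^bsub>M\<^esub>l\<in>?U. dec n l)"
    by (rule dec_sum; use dec_in assms in auto)+
  moreover have "(\<Oplus>\<^bsub>M\<^esub>l\<in>?U. dec m l \<oplus>\<^bsub>M\<^esub> dec n l) = (\<Oplus>\<^bsub>M\<^esub>l\<in>?U. dec m l) \<oplus>\<^bsub>M\<^esub> (\<Oplus>\<^bsub>M\<^esub>l\<in>?U. dec n l)"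
    by (rule M.finsum_addf) (use dec_in W_closed assms in auto)
  ultimately show "m \<oplus>\<^bsub>M\<^esub> n = (\<Oplus>\<^bsub>M\<^esub>l\<in>?U. dec m l \<oplus>\<^bsub>M\<^esub> dec n l)" by simp
qed (use dec_in W_closed assms in auto)

lemma dec_cs:
  assumes "m \<in> carrier M" shows "dec (cs c m) = (\<lambda>l. cs c (dec m l))"
proof (rule dec_eqI')
  let ?U = "{l. dec m l \<noteq> \<zero>\<^bsub>M\<^esub>}"
  show fin: "finite ?U" using dec_in assms by auto
  have "m = (\<Oplus>\<^bsub>M\<^esub>l\<in>?U. dec m l)" by (rule dec_sum) (use fin assms in auto)
  moreover have "cs c (\<Oplus>\<^bsub>M\<^esub>l\<in>?U. dec m l) = (\<Oplus>\<^bsub>M\<^esub>l\<in>?U. cs c (dec m l))"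
    unfolding cscale_def by (rule smult_finsum) (use fin dec_in W_closed assms smult_one_closed in auto)
  ultimately show "cs c m = (\<Oplus>\<^bsub>M\<^esub>l\<in>?U. cs c (dec m l))" by simp
qed (use dec_in W_closed assms in auto)

lemma dec_W: "x \<in> W p \<Longrightarrow> dec x = (\<lambda>l. if l = p then x else \<zero>\<^bsub>M\<^esub>)"
  by (rule dec_eqI'[where U = "{p}"]) (use W_closed in auto)

text \<open>\<open>V p\<close> parametrizes the component \<open>p\<close>, and \<open>L p\<close> takes the coordinates of the projection to it.\<close>

lemma coordinates_exist:
  "\<exists>(V :: 'l \<Rightarrow> complex poly \<Rightarrow> 'u) L. (\<forall>p. range (V p) = W p) \<and> (\<forall>p v w. V p (v + w) = V p v \<oplus>\<^bsub>M\<^esub> V p w) \<and>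
    (\<forall>p c w. V p (smult c w) = cs c (V p w)) \<and>
    (\<forall>p. \<forall>m\<in>carrier M. \<forall>n\<in>carrier M. L p (m \<oplus>\<^bsub>M\<^esub> n) = L p m + L p n) \<and>
    (\<forall>p c. \<forall>m\<in>carrier M. L p (cs c m) = smult c (L p m)) \<and>
    (\<forall>m\<in>carrier M. finite {p. L p m \<noteq> 0}) \<and>
    (\<forall>m\<in>carrier M. \<forall>U. finite U \<longrightarrow> {p. L p m \<noteq> 0} \<subseteq> U \<longrightarrow> m = (\<Oplus>\<^bsub>M\<^esub>p\<in>U. V p (L p m))) \<and>
    (\<forall>p q w. q \<noteq> p \<longrightarrow> L q (V p w) = 0) \<and> (\<forall>p. \<exists>d. \<forall>m k. d \<le> k \<longrightarrow> coeff (L p m) k = 0) \<and>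
    (\<forall>p m. p \<notin> I \<longrightarrow> m \<in> carrier M \<longrightarrow> L p m = 0)"
proof -
  define R where "R p V \<phi> d \<longleftrightarrow> (\<forall>w. V w \<in> W p) \<and> (\<forall>v w. V (v + w) = V v \<oplus>\<^bsub>M\<^esub> V w) \<and>
    (\<forall>c w. V (smult c w) = cs c (V w)) \<and>
    (\<forall>m\<in>W p. \<forall>n\<in>W p. \<phi> (m \<oplus>\<^bsub>M\<^esub> n) = \<phi> m + (\<phi> n :: complex poly)) \<and> (\<forall>c. \<forall>m\<in>W p. \<phi> (cs c m) = smult c (\<phi> m)) \<and>
    (\<forall>m\<in>W p. V (\<phi> m) = m) \<and> (\<forall>m k. (d::nat) \<le> k \<longrightarrow> coeff (\<phi> m) k = 0)" for p and V :: "complex poly \<Rightarrow> 'u" and \<phi> d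
  have "\<forall>p. \<exists>V \<phi> d. R p V \<phi> d"
    unfolding R_def using linear_coordinates[OF sub fd] by (rule allI)
  then obtain V \<phi> d where R: "\<And>p. R p (V p) (\<phi> p) (d p)" by metis
  have V: "V p w \<in> W p" "V p (v + w) = V p v \<oplus>\<^bsub>M\<^esub> V p w" "V p (smult c w) = cs c (V p w)"
    "\<exists>d. \<forall>m k. d \<le> k \<longrightarrow> coeff (\<phi> p m) k = 0" for p v w c
    using R[of p] unfolding R_def by auto
  have \<phi>: "m \<in> W p \<Longrightarrow> n \<in> W p \<Longrightarrow> \<phi> p (m \<oplus>\<^bsub>M\<^esub> n) = \<phi> p m + \<phi> p n"
     "m \<in> W p \<Longrightarrow> \<phi> p (cs c m) = smult c (\<phi> p m)" "m \<in> W p \<Longrightarrow> V p (\<phi> p m) = m" for p m n c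
    using R[of p] unfolding R_def by auto
  have V0: "V p 0 = \<zero>\<^bsub>M\<^esub>" for p
    using V(3)[of p 0 0] W_closed(1)[OF V(1)[of p 0]] by simp
  have \<phi>0: "\<phi> p \<zero>\<^bsub>M\<^esub> = 0" for p
    using \<phi>(2)[OF W_closed(2), of p 0] by simp
  define L where "L p m = \<phi> p (dec m p)" for p m
  have L0: "L p m = 0 \<longleftrightarrow> dec m p = \<zero>\<^bsub>M\<^esub>" if "m \<in> carrier M" for p m
    using \<phi>(3)[OF dec_in(1)[OF that], of p] V0 \<phi>0 unfolding L_def by metis
  have c1: "range (V p) = W p" for p using V(1) \<phi>(3)[of _ p] by (auto simp: image_iff) metis
  have c2: "L p (m \<oplus>\<^bsub>M\<^esub> n) = L p m + L p n" if "m \<in> carrier M" "n \<in> carrier M" for p m n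
    unfolding L_def dec_add[OF that] by (rule \<phi>(1)) (use dec_in that in auto)
  have c3: "L p (cs c m) = smult c (L p m)" if "m \<in> carrier M" for p c m
    unfolding L_def dec_cs[OF that] by (rule \<phi>(2)) (use dec_in that in auto)
  have c4: "finite {p. L p m \<noteq> 0}" if "m \<in> carrier M" for m
    using L0[OF that] dec_in(2)[OF that] by simp
  have c5: "m = (\<Oplus>\<^bsub>M\<^esub>p\<in>U. V p (L p m))" if "m \<in> carrier M" "finite U" "{p. L p m \<noteq> 0} \<subseteq> U" for m U
  proof -
    have "V p (L p m) = dec m p" for p unfolding L_def using \<phi>(3) dec_in that by simp
    moreover have "dec m p = \<zero>\<^bsub>M\<^esub>" if "p \<notin> U" for p
      using that \<open>{p. L p m \<noteq> 0} \<subseteq> U\<close> L0[OF \<open>m \<in> carrier M\<close>] by blast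
    ultimately show ?thesis using dec_sum[OF that(1,2)] by simp
  qed
  have c7: "L q (V p w) = 0" if "q \<noteq> p" for p q w
    unfolding L_def using dec_W[OF V(1)[of p w]] that \<phi>0 by simp
  have c8: "\<exists>d. \<forall>m k. d \<le> k \<longrightarrow> coeff (L p m) k = 0" for p
    using V(4)[of p] unfolding L_def by blast
  have c9: "L p m = 0" if "p \<notin> I" "m \<in> carrier M" for p m
    unfolding L_def using dec_in(1)[OF that(2), of p] out[OF that(1)] \<phi>0 by auto
  show ?thesis
    by (rule exI[of _ V], rule exI[of _ L], intro conjI allI impI ballI)
      ((rule c1 c2 c3 c4 c5 c7 c8 c9 V(2,3); assumption)+)
qed

text \<open>The last two clauses tie the matrix picture to the given decomposition: the component
  \<open>W p\<close> has to become the functions supported at \<open>p\<close>, and the bound on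
  coefficients records its finite dimension.\<close>

definition "coordinates s \<Psi> \<longleftrightarrow> matrix_rep A I s \<and> bij_betw \<Psi> (carrier M) (matrix_rep.mcar A s) \<and>
  (\<forall>m\<in>carrier M. \<forall>n\<in>carrier M. \<Psi> (m \<oplus>\<^bsub>M\<^esub> n) = \<Psi> m + \<Psi> n) \<and>
  (\<forall>a\<in>carrier A. \<forall>m\<in>carrier M. \<Psi> (a \<odot>\<^bsub>M\<^esub> m) = matrix_rep.mact s a (\<Psi> m)) \<and>
  (\<forall>p. \<Psi> ` W p = {single p w | w. s \<one> p p w = w}) \<and>
  (\<forall>p. \<exists>d. \<forall>w k. d \<le> k \<longrightarrow> coeff (s \<one> p p w) k = 0)"

lemma coordinates: "\<exists>s \<Psi>. coordinates s \<Psi>"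
proof -
  obtain V :: "'l \<Rightarrow> complex poly \<Rightarrow> 'u" and L where *: "(\<forall>p. range (V p) = W p)" "(\<forall>p v w. V p (v + w) = V p v \<oplus>\<^bsub>M\<^esub> V p w)"
    "(\<forall>p c w. V p (smult c w) = cs c (V p w))"
    "(\<forall>p. \<forall>m\<in>carrier M. \<forall>n\<in>carrier M. L p (m \<oplus>\<^bsub>M\<^esub> n) = L p m + L p n)"
    "(\<forall>p c. \<forall>m\<in>carrier M. L p (cs c m) = smult c (L p m))"
    "(\<forall>m\<in>carrier M. finite {p. L p m \<noteq> 0})"
    "(\<forall>m\<in>carrier M. \<forall>U. finite U \<longrightarrow> {p. L p m \<noteq> 0} \<subseteq> U \<longrightarrow> m = (\<Oplus>\<^bsub>M\<^esub>p\<in>U. V p (L p m)))"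
    "(\<forall>p q w. q \<noteq> p \<longrightarrow> L q (V p w) = 0)" "(\<forall>p. \<exists>d. \<forall>m k. d \<le> k \<longrightarrow> coeff (L p m) k = 0)"
    "(\<forall>p m. p \<notin> I \<longrightarrow> m \<in> carrier M \<longrightarrow> L p m = 0)"
    using coordinates_exist by (elim exE conjE) blast
  have V: "V p w \<in> W p" "V p w \<in> carrier M" for p w using *(1) W_closed(1)[of "V p w" p] by auto
  note V_add = *(2)[rule_format] and V_smult = *(3)[rule_format]
  note L_add = *(4)[rule_format] and L_cs = *(5)[rule_format] and L_fin = *(6)[rule_format]
  note VL = *(7)[rule_format] and LV = *(8)[rule_format] and L_out = *(10)[rule_format]
  have L0: "L p \<zero>\<^bsub>M\<^esub> = 0" for p using L_cs[of "\<zero>\<^bsub>M\<^esub>" p 0] by simp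
  have L_sum: "L p (\<Oplus>\<^bsub>M\<^esub>x\<in>X. F x) = (\<Sum>x\<in>X. L p (F x))" if "finite X" "\<And>x. x \<in> X \<Longrightarrow> F x \<in> carrier M"
    for p X and F :: "'l \<Rightarrow> 'u"
    using that
  proof (induction X rule: finite_induct)
    case (insert x X)
    have "(\<Oplus>\<^bsub>M\<^esub>x\<in>insert x X. F x) = F x \<oplus>\<^bsub>M\<^esub> (\<Oplus>\<^bsub>M\<^esub>x\<in>X. F x)"
      by (rule M.finsum_insert) (use insert in auto)
    moreover have "(\<Oplus>\<^bsub>M\<^esub>x\<in>X. F x) \<in> carrier M" by (rule M.finsum_closed) (use insert in auto)
    ultimately show ?case using insert L_add by simp
  qed (simp add: L0)
  have VLV: "V p (L p (V p w)) = V p w" for p w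
  proof -
    have "{q. L q (V p w) \<noteq> 0} \<subseteq> {p}" using LV by blast
    from VL[OF V(2) _ this] show ?thesis using V(2) by (simp add: M.finsum_insert)
  qed
  define s where "s a q p w = L q (a \<odot>\<^bsub>M\<^esub> V p w)" for a q p w
  have L_act: "L r (a \<odot>\<^bsub>M\<^esub> m) = (\<Sum>q\<in>U. s a r q (L q m))"
    if a: "a \<in> carrier A" and m: "m \<in> carrier M" and U: "finite U" "{q. L q m \<noteq> 0} \<subseteq> U" for a r m U
  proof -
    have "a \<odot>\<^bsub>M\<^esub> m = (\<Oplus>\<^bsub>M\<^esub>q\<in>U. a \<odot>\<^bsub>M\<^esub> V q (L q m))"
      by (subst VL[OF m U]) (rule smult_finsum, use a U V in auto)
    then show ?thesis unfolding s_def by (simp add: L_sum U a V)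
  qed
  have s_one: "s \<one> q p w = L q (V p w)" for q p w by (simp add: s_def V)
  have m: "matrix_rep A I s"
  proof
    show "s a q p (v + w) = s a q p v + s a q p w" if "a \<in> carrier A" for a q p v w
      using that V by (simp add: s_def V_add smult_r_distr L_add)
    show "s a q p (smult c w) = smult c (s a q p w)" if "a \<in> carrier A" for a q p c w
      using that V by (simp add: s_def V_smult smult_cs L_cs)
    show "s a q p w = 0" if a: "a \<in> carrier A" and "p \<notin> I \<or> q \<notin> I" for a q p w
    proof (cases "q \<in> I")
      case True
      then have "V p w = \<zero>\<^bsub>M\<^esub>" using that out V(1)[of p w] by auto
      then show ?thesis using a by (simp add: s_def L0)
    qed (use a V L_out in \<open>auto simp: s_def\<close>)
    show "\<exists>U. finite U \<and> (\<forall>q. q \<notin> U \<longrightarrow> s a q p w = 0)" if "a \<in> carrier A" for a p w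
      using L_fin[of "a \<odot>\<^bsub>M\<^esub> V p w"] that V unfolding s_def
      by (intro exI[of _ "{q. L q (a \<odot>\<^bsub>M\<^esub> V p w) \<noteq> 0}"]) auto
    show "s (a \<oplus> b) q p w = s a q p w + s b q p w" if "a \<in> carrier A" "b \<in> carrier A" for a b q p w
      using that V by (simp add: s_def smult_l_distr L_add)
    show "s (a \<otimes> b) r p w = (\<Sum>q\<in>U. s a r q (s b q p w))"
      if "a \<in> carrier A" "b \<in> carrier A" "finite U" "\<And>q. q \<notin> U \<Longrightarrow> s b q p w = 0" for a b U r p w
    proof -
      have "L r (a \<odot>\<^bsub>M\<^esub> (b \<odot>\<^bsub>M\<^esub> V p w)) = (\<Sum>q\<in>U. s a r q (L q (b \<odot>\<^bsub>M\<^esub> V p w)))"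
        by (rule L_act) (use that V in \<open>auto simp: s_def\<close>)
      then show ?thesis using that V by (simp add: s_def smult_assoc)
    qed
    show "s \<one> q p w = 0" if "q \<noteq> p" for q p w
      using that LV by (simp add: s_one)
    show "s (c \<odot> \<one>) q p w = smult c (s \<one> q p w)" for c q p w
      using V by (simp add: s_one L_cs[symmetric]) (simp add: s_def cscale_def)
  qed
  then interpret m: matrix_rep A I s .
  define \<Psi> where "\<Psi> m = Abs_poly_mapping (\<lambda>q. L q m)" for m
  have lk: "lookup (\<Psi> m) q = L q m" if "m \<in> carrier M" for m q
    unfolding \<Psi>_def by (subst lookup_Abs_poly_mapping) (use L_fin[OF that] in auto)
  have ks: "keys (\<Psi> m) = {q. L q m \<noteq> 0}" if "m \<in> carrier M" for m
    by (auto simp: in_keys_iff lk[OF that])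
  have act: "\<Psi> (a \<odot>\<^bsub>M\<^esub> m) = m.mact a (\<Psi> m)" if "a \<in> carrier A" "m \<in> carrier M" for a m
  proof (rule poly_mapping_eqI)
    fix q show "lookup (\<Psi> (a \<odot>\<^bsub>M\<^esub> m)) q = lookup (m.mact a (\<Psi> m)) q"
      using L_act[OF that, where U = "keys (\<Psi> m)" and r = q] ks[OF that(2)] L_fin[OF that(2)] that
      by (simp add: lk m.lookup_mact)
  qed
  have mem: "\<Psi> m \<in> m.mcar" if m: "m \<in> carrier M" for m
  proof -
    have "L p m = s \<one> p p (L p m)" for p
    proof -
      have "L p m = (\<Sum>q\<in>insert p {q. L q m \<noteq> 0}. s \<one> p q (L q m))"
        using L_act[OF one_closed m _ subset_insertI, of p p] L_fin m by simp
      also have "\<dots> = (\<Sum>q\<in>{p}. s \<one> p q (L q m))"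
        by (rule sum.mono_neutral_right) (use L_fin[OF m] LV[OF not_sym] in \<open>auto simp: s_one\<close>)
      finally show ?thesis by simp
    qed
    then show ?thesis unfolding m.mcar_def by (simp add: lk[OF m])
  qed
  have inj: "m = n" if mn: "m \<in> carrier M" "n \<in> carrier M" "\<Psi> m = \<Psi> n" for m n
  proof -
    have "L q m = L q n" for q using lk mn by metis
    then show ?thesis using VL[OF mn(1) L_fin[OF mn(1)]] VL[OF mn(2) L_fin[OF mn(2)]] by simp
  qed
  have \<Psi>V: "\<Psi> (V p w) = single p (s \<one> p p w)" for p w
    by (rule poly_mapping_eqI) (use LV in \<open>auto simp: lk V lookup_single when_def s_one\<close>)
  have surj: "\<exists>m\<in>carrier M. \<Psi> m = f" if f: "f \<in> m.mcar" for f
  proof -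
    define m where "m = (\<Oplus>\<^bsub>M\<^esub>p\<in>keys f. V p (lookup f p))"
    have mc: "m \<in> carrier M" unfolding m_def by (rule M.finsum_closed) (use V in auto)
    have "L q m = lookup f q" for q
    proof -
      have "L q m = (\<Sum>p\<in>keys f. L q (V p (lookup f p)))" unfolding m_def by (rule L_sum) (use V in auto)
      also have "\<dots> = (\<Sum>p\<in>keys f. if p = q then lookup f p else 0)"
        using f LV unfolding m.mcar_def s_one by (intro sum.cong) auto
      also have "\<dots> = lookup f q" by (auto simp: in_keys_iff)
      finally show ?thesis .
    qed
    then have "\<Psi> m = f" by (intro poly_mapping_eqI) (simp add: lk[OF mc])
    then show ?thesis using mc by blast
  qed
  have "coordinates s \<Psi>" unfolding coordinates_def
  proof (intro conjI ballI allI)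
    show "matrix_rep A I s" by (rule m)
    show "bij_betw \<Psi> (carrier M) m.mcar" unfolding bij_betw_def inj_on_def using inj mem surj by (auto; metis image_eqI)
    show "\<Psi> (m \<oplus>\<^bsub>M\<^esub> n) = \<Psi> m + \<Psi> n" if "m \<in> carrier M" "n \<in> carrier M" for m n
      by (rule poly_mapping_eqI) (use that in \<open>simp add: lk lookup_add L_add\<close>)
    show "\<Psi> (a \<odot>\<^bsub>M\<^esub> m) = m.mact a (\<Psi> m)" if "a \<in> carrier A" "m \<in> carrier M" for a m by (rule act[OF that])
    show "\<Psi> ` W p = {single p w | w. s \<one> p p w = w}" for p
    proof -
      have "\<Psi> ` W p = {single p (s \<one> p p w) | w. True}"
        unfolding *(1)[rule_format, symmetric] image_image \<Psi>V by auto
      then show ?thesis using m.s_one_idem by (auto; metis)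
    qed
    show "\<exists>d. \<forall>w k. d \<le> k \<longrightarrow> coeff (s \<one> p p w) k = 0" for p using *(9) unfolding s_one by blast
  qed
  then show ?thesis by blast
qed

end

section \<open>Essential surjectivity\<close>

text \<open>The power series \<open>f\<close> evaluated at \<open>Z\<close>, applied to
  \<open>v\<close> and truncated after \<open>N\<close> terms. By \<open>fps_act_bound\<close> the
  truncation is harmless as soon as \<open>Z ^^ N\<close> kills \<open>v\<close>.\<close>

definition fps_act :: "complex fps \<Rightarrow> nat \<Rightarrow> (complex poly \<Rightarrow> complex poly) \<Rightarrow> complex poly \<Rightarrow> complex poly" where
  "fps_act f N Z v = (\<Sum>k<N. smult (fps_nth f k) ((Z ^^ k) v))"

locale linear_poly_map =
  fixes Z :: "complex poly \<Rightarrow> complex poly"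
  assumes Z_plus: "Z (v + w) = Z v + Z w" and Z_smult: "Z (smult c w) = smult c (Z w)"
begin

lemma Z_zero [simp]: "Z 0 = 0" using Z_plus[of 0 0] by simp

lemma Z_pow_zero [simp]: "(Z ^^ k) 0 = 0" by (induction k) auto

lemma Z_pow_plus: "(Z ^^ k) (v + w) = (Z ^^ k) v + (Z ^^ k) w" by (induction k) (auto simp: Z_plus)

lemma Z_pow_smult: "(Z ^^ k) (smult c w) = smult c ((Z ^^ k) w)" by (induction k) (auto simp: Z_smult)

lemma Z_pow_sum: "(Z ^^ k) (\<Sum>x\<in>X. F x) = (\<Sum>x\<in>X. (Z ^^ k) (F x))"
  by (induction X rule: infinite_finite_induct) (auto simp: Z_pow_plus)

lemma Z_pow_mono: "(Z ^^ N) v = 0 \<Longrightarrow> N \<le> k \<Longrightarrow> (Z ^^ k) v = 0"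
proof -
  assume *: "(Z ^^ N) v = 0" "N \<le> k"
  have "(Z ^^ ((k - N) + N)) v = (Z ^^ (k - N)) ((Z ^^ N) v)" by (simp only: funpow_add o_apply)
  then show ?thesis using * by simp
qed

lemma fps_act_bound:
  assumes "(Z ^^ N) v = 0" "N \<le> M" shows "fps_act f M Z v = fps_act f N Z v"
  unfolding fps_act_def
  by (rule sum.mono_neutral_right) (use assms Z_pow_mono in auto)

lemma fps_act_plus: "fps_act f N Z (v + w) = fps_act f N Z v + fps_act f N Z w"
  by (simp add: fps_act_def Z_pow_plus smult_add_right sum.distrib)

lemma fps_act_smult: "fps_act f N Z (smult c w) = smult c (fps_act f N Z w)"
  by (intro poly_eqI) (simp add: fps_act_def Z_pow_smult coeff_sum sum_distrib_left algebra_simps)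

lemma fps_act_add: "fps_act (f + g) N Z v = fps_act f N Z v + fps_act g N Z v"
  by (simp add: fps_act_def smult_add_left sum.distrib)

lemma fps_act_const: "fps_act (fps_const c * f) N Z v = smult c (fps_act f N Z v)"
  by (intro poly_eqI) (simp add: fps_act_def coeff_sum sum_distrib_left algebra_simps)

lemma fps_act_one: "0 < N \<Longrightarrow> fps_act 1 N Z v = v"
  unfolding fps_act_def by (subst sum.mono_neutral_right[where S = "{0}"]) auto

lemma fps_act_X: "Suc 0 < N \<Longrightarrow> fps_act fps_X N Z v = Z v"
  unfolding fps_act_def by (subst sum.mono_neutral_right[where S = "{1}"]) auto

lemma fps_act_X_power: "fps_act (fps_X ^ N * f) N Z v = 0"
  unfolding fps_act_def by (rule sum.neutral) (simp add: fps_X_power_mult_nth)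

text \<open>Terms with \<open>i + j \<ge> N\<close> vanish on \<open>v\<close>, so the square of
  index pairs may be cut down to a triangle, whose diagonals give the Cauchy product.\<close>

lemma fps_act_mult:
  assumes v: "(Z ^^ N) v = 0"
  shows "fps_act (f * g) N Z v = fps_act f N Z (fps_act g N Z v)"
proof -
  define t where "t i j = smult (fps_nth f i * fps_nth g j) ((Z ^^ (i + j)) v)" for i j
  have "fps_act f N Z (fps_act g N Z v) = (\<Sum>i<N. \<Sum>j<N. t i j)"
    unfolding fps_act_def t_def Z_pow_sum Z_pow_smult
    by (intro poly_eqI) (simp add: coeff_sum sum_distrib_left funpow_add algebra_simps)
  also have "\<dots> = (\<Sum>(i, j)\<in>{..<N} \<times> {..<N}. t i j)" by (simp add: sum.cartesian_product)
  also have "\<dots> = (\<Sum>(i, j)\<in>{(i, j). i + j < N}. t i j)"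
  proof (rule sum.mono_neutral_right)
    have "\<not> k < N \<Longrightarrow> (Z ^^ k) v = 0" for k using Z_pow_mono[OF v] by simp
    then show "\<forall>x\<in>{..<N} \<times> {..<N} - {(i, j). i + j < N}. (case x of (i, j) \<Rightarrow> t i j) = 0"
      unfolding t_def by (auto; metis)
  qed auto
  also have "\<dots> = (\<Sum>k<N. \<Sum>i\<le>k. t i (k - i))" by (rule sum.triangle_reindex)
  also have "\<dots> = fps_act (f * g) N Z v"
    unfolding fps_act_def
    by (intro sum.cong refl poly_eqI)
      (simp add: t_def fps_mult_nth atLeast0AtMost coeff_sum sum_distrib_right)
  finally show ?thesis by simp
qed

end

locale nilp_rep = symbol_algebra A I lab P \<rho> av uv bv + matrix_rep A I s
  for A :: "(complex, 'a) module" (structure) and I :: "'l set" and lab :: "'l \<Rightarrow> 'i::finite set"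
    and P \<rho> av uv bv s +
  assumes nilp: "p \<in> I \<Longrightarrow> \<exists>N. (s (bv p) p p ^^ N) (s \<one> p p w) = 0"
    and dim: "p \<in> I \<Longrightarrow> \<exists>d. \<forall>w k. d \<le> k \<longrightarrow> coeff (s \<one> p p w) k = 0"
begin

definition "Z p = (if p \<in> I then s (bv p) p p else (\<lambda>w. 0))"

sublocale Z: linear_poly_map "Z p" for p
  by unfold_locales (auto simp: Z_def s_plus s_smult bv)

text \<open>The exponent in \<open>nilp\<close> may depend on the vector. By \<open>dim\<close> the
  projections of finitely many monomials span the component, and a common exponent for these works
  for all vectors.\<close>

lemma uniform_nilp: "p \<in> I \<Longrightarrow> \<exists>N. 2 \<le> N \<and> (\<forall>w. (Z p ^^ N) (s \<one> p p w) = 0)"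
proof -
  assume p: "p \<in> I"
  obtain d where d: "\<And>w k. d \<le> k \<Longrightarrow> coeff (s \<one> p p w) k = 0" using dim[OF p] by blast
  have "\<forall>k. \<exists>N. (Z p ^^ N) (s \<one> p p (monom 1 k)) = 0" using nilp[OF p] p unfolding Z_def by simp
  then obtain n where n: "\<And>k. (Z p ^^ n k) (s \<one> p p (monom 1 k)) = 0" by metis
  \<comment> \<open>The summand 2 keeps the linear term within the truncation, as
    \<open>fps_act_X\<close> requires.\<close>
  define N where "N = 2 + (\<Sum>k<d. n k)"
  have "(Z p ^^ N) (s \<one> p p w) = 0" for w
  proof -
    let ?v = "s \<one> p p w"
    have "?v = (\<Sum>k<d. smult (coeff ?v k) (monom 1 k))"
      by (rule poly_eqI) (use d[of _ w] in \<open>auto simp: coeff_sum smult_monom not_less\<close>)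
    then have e: "s \<one> p p ?v = (\<Sum>k<d. smult (coeff ?v k) (s \<one> p p (monom 1 k)))"
      by (metis (no_types, lifting) one_closed s_smult s_sum sum.cong)
    have "(Z p ^^ N) ?v = (\<Sum>k<d. smult (coeff ?v k) ((Z p ^^ N) (s \<one> p p (monom 1 k))))"
      using arg_cong[OF e, of "Z p ^^ N"] by (simp only: s_one_idem Z.Z_pow_sum Z.Z_pow_smult)
    also have "\<dots> = 0"
    proof (rule sum.neutral, rule ballI)
      fix k assume "k \<in> {..<d}"
      then have "n k \<le> (\<Sum>k<d. n k)" by (intro member_le_sum) auto
      then have "n k \<le> N" unfolding N_def by simp
      then show "smult (coeff ?v k) ((Z p ^^ N) (s \<one> p p (monom 1 k))) = 0"
        using Z.Z_pow_mono[OF n] by simp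
    qed
    finally show ?thesis .
  qed
  then show ?thesis by (intro exI[of _ N]) (simp add: N_def)
qed

definition "N p = (SOME N. 2 \<le> N \<and> (\<forall>w. (Z p ^^ N) (s \<one> p p w) = 0))"

lemma N: "p \<in> I \<Longrightarrow> 2 \<le> N p" "p \<in> I \<Longrightarrow> (Z p ^^ N p) (s \<one> p p w) = 0"
  using someI_ex[OF uniform_nilp, of p] unfolding N_def by auto

definition "Y p f w = fps_act f (N p) (Z p) (s \<one> p p w)"

lemma s_one_pow: "p \<in> I \<Longrightarrow> s \<one> p p ((Z p ^^ k) (s \<one> p p w)) = (Z p ^^ k) (s \<one> p p w)"
  by (cases k) (auto simp: s_one_idem Z_def s_one_left bv)

lemma Y_one: "p \<in> I \<Longrightarrow> s \<one> p p (Y p f w) = Y p f w"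
  by (simp add: Y_def fps_act_def s_sum s_smult s_one_pow)

lemma Y_bound: "p \<in> I \<Longrightarrow> N p \<le> M \<Longrightarrow> Y p f w = fps_act f M (Z p) (s \<one> p p w)"
  unfolding Y_def by (rule Z.fps_act_bound[OF N(2), symmetric])

lemma Y_mult: "p \<in> I \<Longrightarrow> Y p (f * g) w = Y p f (Y p g w)"
  unfolding Y_def using Z.fps_act_mult[OF N(2), of p f g w] Y_one[of p g w] by (simp add: Y_def)

lemma Y_unit: "p \<in> I \<Longrightarrow> Y p 1 w = s \<one> p p w"
  unfolding Y_def by (rule Z.fps_act_one) (use N(1) in fastforce)

lemma Y_X: "p \<in> I \<Longrightarrow> Y p fps_X w = Z p w"
proof -
  assume p: "p \<in> I"
  have "Y p fps_X w = Z p (s \<one> p p w)" unfolding Y_def by (rule Z.fps_act_X) (use N(1)[OF p] in simp)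
  then show ?thesis using p by (simp add: Z_def s_one_right bv)
qed

lemma Y_add: "Y p (f + g) w = Y p f w + Y p g w" by (simp add: Y_def Z.fps_act_add)
lemma Y_plus: "Y p f (v + w) = Y p f v + Y p f w" by (simp add: Y_def s_plus Z.fps_act_plus)
lemma Y_smult: "Y p f (smult c w) = smult c (Y p f w)" by (simp add: Y_def s_smult Z.fps_act_smult)
lemma Y_scale: "Y p (fps_const c * f) w = smult c (Y p f w)" by (simp add: Y_def Z.fps_act_const)
lemma Y_zero [simp]: "Y p 0 w = 0" by (simp add: Y_def fps_act_def)

text \<open>The entry of \<open>a\<close> at \<open>(q, p)\<close> is prescribed by its symbol: it is the entry of \<open>av q p\<close> composed
  with the quotient of the two symbols, the variable being evaluated at the nilpotent map \<open>Z p\<close>.\<close>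

definition "keyed a \<longleftrightarrow> (\<forall>p\<in>I. \<forall>q\<in>I. \<forall>w. s a q p w = s (av q p) q p (Y p (inverse (uv q p) * ksym a q p) w))"

lemma keyed_add: "a \<in> carrier A \<Longrightarrow> b \<in> carrier A \<Longrightarrow> keyed a \<Longrightarrow> keyed b \<Longrightarrow> keyed (a \<oplus> b)"
  unfolding keyed_def by (simp add: ksym_add s_add distrib_left Y_add s_plus av)

text \<open>If \<open>h\<close> is diagonal and acts on each component by its own symbol, then
  multiplication by \<open>h\<close> on the right multiplies the symbol and the power series in
  \<open>keyed\<close> by the same factor. This is the step by which \<open>keyed\<close> spreads
  from a few elements to the whole algebra.\<close>

lemma keyed_mult:
  assumes a: "a \<in> carrier A" "keyed a" and h: "h \<in> carrier A"
    and sh: "\<And>p q w. p \<in> I \<Longrightarrow> q \<noteq> p \<Longrightarrow> s h q p w = 0" "\<And>p w. p \<in> I \<Longrightarrow> s h p p w = Y p (\<rho> h p p) w"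
    and \<rho>h: "\<And>p q. p \<in> I \<Longrightarrow> q \<noteq> p \<Longrightarrow> \<rho> h q p = 0"
  shows "keyed (a \<otimes> h)"
  unfolding keyed_def
proof (intro ballI allI)
  fix p q w assume pq: "p \<in> I" "q \<in> I"
  have "ksym h p p = \<rho> h p p" by (simp add: ksym_def)
  then have k: "ksym (a \<otimes> h) q p = ksym a q p * \<rho> h p p"
    using ksym_mult_single[OF a(1) h pq(1) pq(1) pq(2)] \<rho>h pq by simp
  have "s (a \<otimes> h) q p w = s a q p (s h p p w)"
    by (rule s_mult_single) (use a h sh pq in auto)
  also have "\<dots> = s (av q p) q p (Y p (inverse (uv q p) * ksym a q p) (Y p (\<rho> h p p) w))"
    using a(2) pq sh(2) unfolding keyed_def by simp
  also have "\<dots> = s (av q p) q p (Y p (inverse (uv q p) * ksym (a \<otimes> h) q p) w)"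
    using pq by (simp add: k Y_mult mult.assoc)
  finally show "s (a \<otimes> h) q p w = s (av q p) q p (Y p (inverse (uv q p) * ksym (a \<otimes> h) q p) w)" .
qed

lemma keyed_scal: "keyed a \<Longrightarrow> a \<in> carrier A \<Longrightarrow> keyed (a \<otimes> (c \<odot> \<one>))"
proof (rule keyed_mult)
  show "s (c \<odot> \<one>) p p w = Y p (\<rho> (c \<odot> \<one>) p p) w" if "p \<in> I" for p w
    using Y_scale[of p c 1 w] that by (simp add: \<rho>_scal s_scal Y_unit)
  show "\<rho> (c \<odot> \<one>) q p = 0" if "p \<in> I" "q \<noteq> p" for p q
    using that \<rho>_scal[of p q c] \<rho>_in[OF smult_one_closed] by (cases "q \<in> I") auto
qed (simp_all add: smult_one_closed s_scal s_one)

text \<open>The base case: the quotient of the two symbols is 0 where the symbol of \<open>a\<close>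
  vanishes, and 1 where it is that of \<open>av q p\<close>.\<close>

lemma keyed_if:
  assumes "a \<in> carrier A"
    "\<And>p q w. p \<in> I \<Longrightarrow> q \<in> I \<Longrightarrow> (\<rho> a q p = 0 \<and> s a q p w = 0) \<or>
      (\<rho> a q p = fps_X ^ upc (lab p) (lab q) * uv q p \<and> s a q p w = s (av q p) q p w)"
  shows "keyed a"
  unfolding keyed_def
proof (intro ballI allI)
  fix p q w assume pq: "p \<in> I" "q \<in> I"
  from assms(2)[OF pq, of w] show "s a q p w = s (av q p) q p (Y p (inverse (uv q p) * ksym a q p) w)"
  proof
    assume "\<rho> a q p = 0 \<and> s a q p w = 0"
    then show ?thesis by (simp add: ksym_zero s_zero av pq)
  next
    assume *: "\<rho> a q p = fps_X ^ upc (lab p) (lab q) * uv q p \<and> s a q p w = s (av q p) q p w"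
    then have "ksym a q p = uv q p" by (intro ksym_eqI) simp
    then have "Y p (inverse (uv q p) * ksym a q p) w = s \<one> p p w"
      using uv[OF pq] pq by (simp add: inverse_mult_eq_1 Y_unit)
    then show ?thesis using * by (simp add: s_one_right av pq)
  qed
qed

end

locale key_rep = nilp_rep +
  assumes key: "a \<in> carrier A \<Longrightarrow> keyed a"
begin

text \<open>The action of \<open>f\<close> times the generator from \<open>p\<close> to
  \<open>q\<close>; division by \<open>uv q p\<close> turns \<open>av q p\<close> into that
  generator.\<close>

definition "yM f q p w = (if p \<in> I \<and> q \<in> I then s (av q p) q p (Y p (inverse (uv q p) * f) w) else 0)"

lemma s_yM: "a \<in> carrier A \<Longrightarrow> p \<in> I \<Longrightarrow> q \<in> I \<Longrightarrow> s a q p w = yM (ksym a q p) q p w"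
  using key unfolding keyed_def yM_def by simp

lemma s_vanish: "a \<in> carrier A \<Longrightarrow> p \<in> I \<Longrightarrow> \<rho> a q p = 0 \<Longrightarrow> s a q p w = 0"
  using s_yM[of a p q w] s_out[of a p q w] by (cases "q \<in> I") (simp_all add: ksym_zero yM_def s_zero av)

text \<open>The product \<open>bv q \<otimes> av q p\<close> has the symbol of \<open>av q p\<close>
  times the variable. By \<open>keyed\<close> it therefore acts as \<open>av q p\<close> after
  \<open>Z p\<close>, although it is formed as \<open>Z q\<close> after
  \<open>av q p\<close>.\<close>

lemma comm_Z: "p \<in> I \<Longrightarrow> q \<in> I \<Longrightarrow> Z q (s (av q p) q p w) = s (av q p) q p (Z p w)"
proof -
  assume pq: "p \<in> I" "q \<in> I"
  have "Z q (s (av q p) q p w) = s (bv q \<otimes> av q p) q p w"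
    unfolding Z_def using pq
    by (subst s_mult_single[where q = q]) (auto simp: av bv s_vanish \<rho>_av)
  also have "\<dots> = s (av q p) q p (Y p (inverse (uv q p) * ksym (bv q \<otimes> av q p) q p) w)"
    using s_yM[of "bv q \<otimes> av q p" p q w] pq by (simp add: av bv yM_def)
  also have "ksym (bv q \<otimes> av q p) q p = fps_X * uv q p"
    using ksym_mult_single[of "bv q" "av q p" p q q] pq by (simp add: av bv \<rho>_av ksym_bv ksym_av)
  also have "inverse (uv q p) * (fps_X * uv q p) = fps_X"
    using uv[OF pq] by (metis fps_mult_fps_X_commute inverse_mult_eq_1 mult.left_commute mult.right_neutral)
  finally show ?thesis using pq by (simp add: Y_X)
qed

lemma comm_Y:
  assumes pq: "p \<in> I" "q \<in> I"
  shows "Y q f (s (av q p) q p w) = s (av q p) q p (Y p f w)"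
proof -
  let ?M = "max (N p) (N q)"
  have pow: "(Z q ^^ k) (s (av q p) q p v) = s (av q p) q p ((Z p ^^ k) v)" for k v
    by (induction k) (auto simp: comm_Z pq)
  have "Y q f (s (av q p) q p w) = fps_act f ?M (Z q) (s (av q p) q p w)"
    using Y_bound[of q ?M f] pq by (simp add: s_one_left av)
  also have "\<dots> = fps_act f ?M (Z q) (s (av q p) q p (s \<one> p p w))"
    using pq by (simp add: s_one_right av)
  also have "\<dots> = s (av q p) q p (fps_act f ?M (Z p) (s \<one> p p w))"
    by (simp add: fps_act_def pow s_sum s_smult av pq)
  also have "\<dots> = s (av q p) q p (Y p f w)"
    using Y_bound[of p ?M f] pq by simp
  finally show ?thesis .
qed

text \<open>Once \<open>comm_Y\<close> has moved all power series to the source, only the product of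
  \<open>av r q\<close> and \<open>av q p\<close> is left. Its symbol contributes their two units,
  which cancel, and the excess power.\<close>

lemma yM_comp:
  assumes "p \<in> I" "q \<in> I" "r \<in> I"
  shows "yM f r q (yM g q p w) = yM (f * g * fps_X ^ ex p q r) r p w"
proof -
  note I = assms and av' = av[OF assms(1,2)] av[OF assms(2,3)] av[OF assms(1,3)]
  have "yM f r q (yM g q p w) =
      s (av r q) r q (s (av q p) q p (Y p (inverse (uv r q) * f) (Y p (inverse (uv q p) * g) w)))"
    using I by (simp add: yM_def comm_Y)
  also have "\<dots> = s (av r q \<otimes> av q p) r p (Y p (inverse (uv r q) * f) (Y p (inverse (uv q p) * g) w))"
    using I by (subst s_mult_single[where q = q]) (auto simp: av' s_vanish \<rho>_av)
  also have "\<dots> = s (av r p) r p (Y p (inverse (uv r p) * ksym (av r q \<otimes> av q p) r p)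
      (Y p (inverse (uv r q) * f) (Y p (inverse (uv q p) * g) w)))"
    using s_yM[of "av r q \<otimes> av q p" p r] I by (simp add: av' yM_def)
  also have "\<dots> = s (av r p) r p (Y p (inverse (uv r p) * ksym (av r q \<otimes> av q p) r p *
      ((inverse (uv r q) * f) * (inverse (uv q p) * g))) w)"
    using I by (simp add: Y_mult)
  also have "ksym (av r q \<otimes> av q p) r p = uv r q * uv q p * fps_X ^ ex p q r"
    using ksym_mult_single[of "av r q" "av q p" p q r] I by (simp add: av' \<rho>_av ksym_av)
  also have "inverse (uv r p) * (uv r q * uv q p * fps_X ^ ex p q r) * ((inverse (uv r q) * f) * (inverse (uv q p) * g))
     = inverse (uv r p) * (f * g * fps_X ^ ex p q r) * ((inverse (uv r q) * uv r q) * (inverse (uv q p) * uv q p))"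
    by (simp only: ac_simps)
  also have "\<dots> = inverse (uv r p) * (f * g * fps_X ^ ex p q r)"
    using uv[OF I(1,2)] uv[OF I(2,3)] by (simp add: inverse_mult_eq_1)
  finally show ?thesis using I by (simp add: yM_def)
qed

lemma yM_one: "p \<in> I \<Longrightarrow> yM 1 p p w = s \<one> p p w"
  using s_yM[of \<one> p p w] by (simp add: ksym_one)

lemma yM_linear: "yM (f + g) q p w = yM f q p w + yM g q p w" "yM f q p (v + w) = yM f q p v + yM f q p w"
   "yM (fps_const c * f) q p w = smult c (yM f q p w)" "yM f q p (smult c w) = smult c (yM f q p w)"
   "yM f q p 0 = 0"
proof -
  have *: "inverse u * (fps_const c * f) = fps_const c * (inverse u * f)" for u :: "complex fps" by (simp add: ac_simps)
  show "yM (f + g) q p w = yM f q p w + yM g q p w" "yM f q p (v + w) = yM f q p v + yM f q p w"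
   "yM (fps_const c * f) q p w = smult c (yM f q p w)" "yM f q p (smult c w) = smult c (yM f q p w)"
    by (auto simp: yM_def distrib_left Y_add Y_plus Y_smult Y_scale s_plus s_smult av *)
  have "Y p g 0 = 0" for g using Y_smult[of p g 0 0] by simp
  then show "yM f q p 0 = 0" by (simp add: yM_def s_zero av)
qed

definition "\<tau> J = (SOME p. p \<in> I \<and> lab p = J)"

lemma \<tau>: "J \<in> P \<Longrightarrow> \<tau> J \<in> I" "J \<in> P \<Longrightarrow> lab (\<tau> J) = J"
  using someI_ex[of "\<lambda>p. p \<in> I \<and> lab p = J"] lab unfolding \<tau>_def by auto

definition "yP f K J = yM f (\<tau> K) (\<tau> J)"

lemma sys_yP: "sys P excess yP"
proof
  show "yP f L K (yP g K J w) = yP (f * g * fps_X ^ excess J K L) L J w"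
    if "J \<in> P" "K \<in> P" "L \<in> P" for f g J K L w
    using that yM_comp[of "\<tau> J" "\<tau> K" "\<tau> L"] \<tau> by (simp add: yP_def)
  show "\<exists>d. \<forall>w k. d \<le> k \<longrightarrow> coeff (yP 1 J J w) k = 0" if "J \<in> P" for J
    using dim[OF \<tau>(1)[OF that]] \<tau>[OF that] by (simp add: yP_def yM_one)
  show "\<exists>N. \<forall>f K w. yP (fps_X ^ N * f) K J w = 0" if J: "J \<in> P" for J
  proof (intro exI allI)
    fix f :: "complex fps" and K w
    have *: "inverse u * (fps_X ^ M * f) = fps_X ^ M * (inverse u * f)" for u and M by (simp add: ac_simps)
    show "yP (fps_X ^ N (\<tau> J) * f) K J w = 0"
      unfolding yP_def yM_def * Y_def Z.fps_act_X_power using av \<tau>(1)[OF J] by (simp add: s_zero)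
  qed
qed (simp_all add: yP_def yM_linear)

lemma matrix_rep_A: "matrix_rep A I s" ..

text \<open>Components with the same label are identified by the generators between them: the excess
  is zero, so both composites are the projections. Hence one representative \<open>\<tau> J\<close>
  for each label suffices to build \<open>y\<close>.\<close>

theorem ess_surj:
  "\<exists>y h. sys P excess y \<and> bij_betw (Poly_Mapping.mapp h) mcar (matrix_rep.mcar A (smat y)) \<and>
    (\<forall>f g. Poly_Mapping.mapp h (f + g) = Poly_Mapping.mapp h f + Poly_Mapping.mapp h g) \<and>
    (\<forall>f\<in>mcar. \<forall>a\<in>carrier A. Poly_Mapping.mapp h (mact a f) = matrix_rep.mact (smat y) a (Poly_Mapping.mapp h f))"
proof -
  define h where "h p = yM 1 (\<tau> (lab p)) p" for p
  define h' where "h' p = yM 1 p (\<tau> (lab p))" for p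
  note l = lab_in
  have t: "matrix_rep A I (smat yP)" by (rule matrix_rep_smat[OF sys_yP])
  note iso = matrix_rep_iso[of A I s "smat yP" h h', OF matrix_rep_A t]
  have 1: "h p (v + w) = h p v + h p w" "h' p (v + w) = h' p v + h' p w" for p v w
    by (simp_all add: h_def h'_def yM_linear)
  have 2: "h' p (h p w) = s \<one> p p w" if "p \<in> I" for p w
    using that yM_comp[of p "\<tau> (lab p)" p 1 1] l[OF that] \<tau> by (simp add: h_def h'_def yM_one)
  have 3: "h p (h' p w) = smat yP \<one> p p w" if "p \<in> I" for p w
    using that yM_comp[of "\<tau> (lab p)" p "\<tau> (lab p)" 1 1] l[OF that] \<tau>
    by (simp add: h_def h'_def smat_one[OF sys_yP] yP_def)
  have 4: "h q (s a q p w) = smat yP a q p (h p w)" if "p \<in> I" "q \<in> I" "a \<in> carrier A" for a p q w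
  proof -
    have "h q (s a q p w) = yM (ksym a q p) (\<tau> (lab q)) p w"
      using that yM_comp[of p q "\<tau> (lab q)" 1 "ksym a q p"] l[OF that(2)] \<tau> by (simp add: h_def s_yM)
    moreover have "smat yP a q p (h p w) = yM (ksym a q p) (\<tau> (lab q)) p w"
      using that yM_comp[of p "\<tau> (lab p)" "\<tau> (lab q)" "ksym a q p" 1] l[OF that(2)] l[OF that(1)] \<tau>
      by (simp add: h_def smat_def yP_def)
    ultimately show ?thesis by simp
  qed
  note iso = iso[OF 1 2 3 4]
  show ?thesis
    by (rule exI[of _ yP], rule exI[of _ h]) (use sys_yP iso in auto)
qed

end

context symbol_functor
begin

lemma iso_Fo:
  assumes M: "left_module A M" and dm: "decomposed_module A M I W"
    and co: "decomposed_module.coordinates A M I W s \<Psi>"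
    and k: "key_rep A I lab P \<rho> av uv bv s"
  shows "\<exists>y f. sys P excess y \<and> f \<in> module_hom A M (Fo y) \<and> bij_betw f (carrier M) (carrier (Fo y))"
proof -
  interpret M: left_module A M by fact
  interpret dm: decomposed_module A M I W by fact
  interpret k: key_rep A I lab P \<rho> av uv bv s by fact
  obtain y h where yh: "sys P excess y" "bij_betw (Poly_Mapping.mapp h) k.mcar (mc y)"
    "\<And>f g. Poly_Mapping.mapp h (f + g) = Poly_Mapping.mapp h f + Poly_Mapping.mapp h g"
    "\<And>f a. f \<in> k.mcar \<Longrightarrow> a \<in> carrier A \<Longrightarrow> Poly_Mapping.mapp h (k.mact a f) = matrix_rep.mact (smat y) a (Poly_Mapping.mapp h f)"
    using k.ess_surj by blast
  interpret t: transport A \<iota> "mc y" "matrix_rep.mact (smat y)" by (rule transport_Fo[OF yh(1)])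
  note c = co[unfolded dm.coordinates_def]
  define f where "f = (\<lambda>m\<in>carrier M. \<iota> (Poly_Mapping.mapp h (\<Psi> m)))"
  have \<Psi>: "bij_betw \<Psi> (carrier M) k.mcar" "\<And>m n. m \<in> carrier M \<Longrightarrow> n \<in> carrier M \<Longrightarrow> \<Psi> (m \<oplus>\<^bsub>M\<^esub> n) = \<Psi> m + \<Psi> n"
    "\<And>a m. a \<in> carrier A \<Longrightarrow> m \<in> carrier M \<Longrightarrow> \<Psi> (a \<odot>\<^bsub>M\<^esub> m) = k.mact a (\<Psi> m)"
    using c by auto
  have b: "bij_betw (\<lambda>m. \<iota> (Poly_Mapping.mapp h (\<Psi> m))) (carrier M) (\<iota> ` mc y)"
    using bij_betw_trans[OF bij_betw_trans[OF \<Psi>(1) yh(2)] inj_on_imp_bij_betw[OF inj_mcar[OF yh(1)]]]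
    by (simp add: o_def)
  then have "bij_betw f (carrier M) (carrier (Fo y))"
    unfolding f_def Fo_def t.N_simps by (rule bij_betw_cong[THEN iffD1, rotated]) simp
  moreover have mem: "Poly_Mapping.mapp h (\<Psi> m) \<in> mc y" "\<Psi> m \<in> k.mcar" if "m \<in> carrier M" for m
    using bij_betwE[OF \<Psi>(1)] bij_betwE[OF yh(2)] that by auto
  have "f \<in> module_hom A M (Fo y)"
    unfolding module_hom_def f_def Fo_def using mem yh(3,4) \<Psi>(2,3) by auto
  ultimately show ?thesis using yh(1) by blast
qed

end

section \<open>The path algebra\<close>

definition join :: "'i path \<Rightarrow> 'i path \<Rightarrow> complex \<Rightarrow> 'i path \<Rightarrow>\<^sub>0 complex" where
  "join p q c = (if last q = hd p then single (q @ tl p) c else 0)"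

definition pmul :: "('i path \<Rightarrow>\<^sub>0 complex) \<Rightarrow> ('i path \<Rightarrow>\<^sub>0 complex) \<Rightarrow> 'i path \<Rightarrow>\<^sub>0 complex" where
  "pmul f g = (\<Sum>p\<in>keys f. \<Sum>q\<in>keys g. join p q (lookup f p * lookup g q))"

definition pscale :: "complex \<Rightarrow> ('i path \<Rightarrow>\<^sub>0 complex) \<Rightarrow> 'i path \<Rightarrow>\<^sub>0 complex" where
  "pscale c f = Poly_Mapping.map ((*) c) f"

definition pidem :: "'i::finite set set \<Rightarrow> 'i path \<Rightarrow>\<^sub>0 complex" where
  "pidem V = (\<Sum>J\<in>V. single [J] 1)"

abbreviation "PA \<equiv> (path_algebra :: (complex, ('i::finite) path \<Rightarrow>\<^sub>0 complex) module)"

lemma PA_simps [simp]: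
  "carrier path_algebra = {f. keys f \<subseteq> paths}" "f \<otimes>\<^bsub>path_algebra\<^esub> g = pmul f g"
  "\<one>\<^bsub>path_algebra\<^esub> = pidem UNIV" "\<zero>\<^bsub>path_algebra\<^esub> = 0" "f \<oplus>\<^bsub>path_algebra\<^esub> g = f + g"
  "c \<odot>\<^bsub>path_algebra\<^esub> f = pscale c f"
  by (simp_all add: path_algebra_def pmul_def join_def pidem_def pscale_def)

lemma lookup_pscale [simp]: "lookup (pscale c f) p = c * lookup f p"
  by (simp add: pscale_def map.rep_eq when_def)

lemma join_add: "join p q (c + d) = join p q c + join p q d" by (simp add: join_def single_add)
lemma join_zero [simp]: "join p q 0 = 0" by (simp add: join_def)

lemma pmul_superset:
  assumes "finite X" "keys f \<subseteq> X" "finite Y" "keys g \<subseteq> Y"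
  shows "pmul f g = (\<Sum>p\<in>X. \<Sum>q\<in>Y. join p q (lookup f p * lookup g q))"
proof -
  have "pmul f g = (\<Sum>p\<in>keys f. \<Sum>q\<in>Y. join p q (lookup f p * lookup g q))"
    unfolding pmul_def by (intro sum.cong refl sum.mono_neutral_left) (use assms in \<open>auto simp: in_keys_iff\<close>)
  also have "\<dots> = (\<Sum>p\<in>X. \<Sum>q\<in>Y. join p q (lookup f p * lookup g q))"
    by (rule sum.mono_neutral_left) (use assms in \<open>auto simp: in_keys_iff\<close>)
  finally show ?thesis .
qed

lemma keys_plus_subset: "keys (f + g) \<subseteq> keys f \<union> keys (g :: 'a \<Rightarrow>\<^sub>0 'b::ab_group_add)"
  by (auto simp: in_keys_iff lookup_add)

lemma pmul_add_left: "pmul (f + f') g = pmul f g + pmul f' g"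
proof -
  let ?X = "keys f \<union> keys f'" and ?Y = "keys g"
  have "pmul (f + f') g = (\<Sum>p\<in>?X. \<Sum>q\<in>?Y. join p q (lookup (f + f') p * lookup g q))"
    by (rule pmul_superset) (simp_all add: keys_plus_subset)
  moreover have "pmul f g = (\<Sum>p\<in>?X. \<Sum>q\<in>?Y. join p q (lookup f p * lookup g q))"
    "pmul f' g = (\<Sum>p\<in>?X. \<Sum>q\<in>?Y. join p q (lookup f' p * lookup g q))"
    by (rule pmul_superset; auto)+
  ultimately show ?thesis by (simp add: lookup_add distrib_right join_add sum.distrib)
qed

lemma pmul_add_right: "pmul f (g + g') = pmul f g + pmul f g'"
proof -
  let ?X = "keys f" and ?Y = "keys g \<union> keys g'"
  have "pmul f (g + g') = (\<Sum>p\<in>?X. \<Sum>q\<in>?Y. join p q (lookup f p * lookup (g + g') q))"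
    by (rule pmul_superset) (simp_all add: keys_plus_subset)
  moreover have "pmul f g = (\<Sum>p\<in>?X. \<Sum>q\<in>?Y. join p q (lookup f p * lookup g q))"
    "pmul f g' = (\<Sum>p\<in>?X. \<Sum>q\<in>?Y. join p q (lookup f p * lookup g' q))"
    by (rule pmul_superset; auto)+
  ultimately show ?thesis by (simp add: lookup_add distrib_left join_add sum.distrib)
qed

lemma pmul_zero [simp]: "pmul 0 g = 0" "pmul f 0 = 0" by (simp_all add: pmul_def)

lemma pmul_sum_left: "pmul (\<Sum>x\<in>X. F x) g = (\<Sum>x\<in>X. pmul (F x) g)"
  by (induction X rule: infinite_finite_induct) (auto simp: pmul_add_left)

lemma pmul_sum_right: "pmul f (\<Sum>x\<in>X. F x) = (\<Sum>x\<in>X. pmul f (F x))"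
  by (induction X rule: infinite_finite_induct) (auto simp: pmul_add_right)

lemma pmul_single: "pmul (single p a) (single q b) = join p q (a * b)"
  by (subst pmul_superset[where X = "{p}" and Y = "{q}"]) auto

lemma sum_single_keys: "f = (\<Sum>p\<in>keys f. single p (lookup f p))"
  by (rule poly_mapping_eqI) (auto simp: lookup_sum lookup_single when_def in_keys_iff)

lemma paths_nonempty: "p \<in> paths \<Longrightarrow> p \<noteq> []" by (auto simp: paths_def)

lemma join_path:
  assumes "p \<in> paths" "q \<in> paths" "last q = hd p"
  shows "q @ tl p \<in> paths" "hd (q @ tl p) = hd q" "last (q @ tl p) = last p"
proof -
  obtain J r where p: "p = J # r" using paths_nonempty[OF assms(1)] by (cases p) auto
  show "q @ tl p \<in> paths" "hd (q @ tl p) = hd q" "last (q @ tl p) = last p"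
    using assms by (auto simp: paths_def p successively_append_iff successively_Cons)
qed

lemma pmul_assoc:
  assumes "keys f \<subseteq> paths" "keys g \<subseteq> paths" "keys h \<subseteq> paths"
  shows "pmul (pmul f g) h = pmul f (pmul g h)"
proof -
  have s: "pmul (pmul (single p a) (single q b)) (single r c) = pmul (single p a) (pmul (single q b) (single r c))"
    if "p \<in> paths" "q \<in> paths" "r \<in> paths" for p q r a b c
    using join_path[of p q] join_path[of q r] that paths_nonempty[of q] by (auto simp: pmul_single join_def mult.assoc)
  let ?s = "\<lambda>f. \<Sum>p\<in>keys f. single p (lookup f p)"
  have "pmul (pmul (?s f) (?s g)) (?s h) = pmul (?s f) (pmul (?s g) (?s h))"
    unfolding pmul_sum_left pmul_sum_right
    by (intro sum.cong refl s) (use assms in auto)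
  then show ?thesis unfolding sum_single_keys[symmetric] .
qed

lemma pidem_mul:
  assumes "keys f \<subseteq> paths"
  shows "pmul (pidem V) f = (\<Sum>p\<in>keys f. if last p \<in> V then single p (lookup f p) else 0)"
    and "pmul f (pidem V) = (\<Sum>p\<in>keys f. if hd p \<in> V then single p (lookup f p) else 0)"
proof -
  have 1: "pmul (pidem V) (single p c) = (if last p \<in> V then single p c else 0)" for p c
    unfolding pidem_def pmul_sum_left pmul_single join_def by simp
  have 2: "pmul (single p c) (pidem V) = (if hd p \<in> V then single p c else 0)" if "p \<in> paths" for p c
    unfolding pidem_def pmul_sum_right pmul_single join_def using paths_nonempty[OF that] by simp
  show "pmul (pidem V) f = (\<Sum>p\<in>keys f. if last p \<in> V then single p (lookup f p) else 0)"
    by (subst sum_single_keys[of f], unfold pmul_sum_right) (simp add: 1)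
  show "pmul f (pidem V) = (\<Sum>p\<in>keys f. if hd p \<in> V then single p (lookup f p) else 0)"
    by (subst sum_single_keys[of f], unfold pmul_sum_left) (intro sum.cong refl 2, use assms in auto)
qed

lemma keys_sum_subset: "(\<And>x. x \<in> X \<Longrightarrow> keys (F x) \<subseteq> U) \<Longrightarrow> keys (\<Sum>x\<in>X. F x :: 'a \<Rightarrow>\<^sub>0 'b::ab_group_add) \<subseteq> U"
  by (induction X rule: infinite_finite_induct) (auto dest!: subsetD[OF keys_plus_subset])

lemma pmul_closed: "keys f \<subseteq> paths \<Longrightarrow> keys g \<subseteq> paths \<Longrightarrow> keys (pmul f g) \<subseteq> paths"
  unfolding pmul_def by (intro keys_sum_subset) (use join_path in \<open>auto simp: join_def split: if_splits\<close>)

lemma pidem_closed: "keys (pidem V) \<subseteq> paths"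
  unfolding pidem_def by (intro keys_sum_subset) (auto simp: paths_def)

lemma pscale_pidem_mul:
  assumes "keys f \<subseteq> paths"
  shows "pmul (pscale c (pidem UNIV)) f = pscale c f" "pmul f (pscale c (pidem UNIV)) = pscale c f"
proof -
  have e: "pscale c (pidem UNIV) = (\<Sum>J\<in>UNIV. single [J] c)"
    by (rule poly_mapping_eqI) (simp add: pidem_def lookup_sum lookup_single when_def sum_distrib_left if_distrib cong: if_cong)
  have ps: "(\<Sum>p\<in>keys f. single p (c * lookup f p)) = pscale c f"
    by (rule poly_mapping_eqI) (auto simp: lookup_sum lookup_single when_def in_keys_iff)
  show "pmul (pscale c (pidem UNIV)) f = pscale c f"
    unfolding e pmul_sum_left
    by (subst sum_single_keys[of f], unfold pmul_sum_right, subst sum.swap)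
      (simp add: pmul_single join_def ps)
  have "pmul (single p d) (\<Sum>J\<in>UNIV. single [J] c) = single p (c * d)" if "p \<in> paths" for p d
    unfolding pmul_sum_right pmul_single join_def using paths_nonempty[OF that] by (simp add: mult.commute)
  then have "pmul (\<Sum>p\<in>keys f. single p (lookup f p)) (\<Sum>J\<in>UNIV. single [J] c) = (\<Sum>p\<in>keys f. single p (c * lookup f p))"
    unfolding pmul_sum_left by (intro sum.cong refl) (use assms in auto)
  then show "pmul f (pscale c (pidem UNIV)) = pscale c f"
    unfolding e ps sum_single_keys[symmetric] .
qed

lemma pscale_one [simp]: "pscale 1 f = f" by (rule poly_mapping_eqI) simp

lemma keys_closed [simp]: "keys f \<subseteq> paths \<Longrightarrow> keys g \<subseteq> paths \<Longrightarrow> keys (f + g) \<subseteq> paths"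
  "keys f \<subseteq> paths \<Longrightarrow> keys (- f) \<subseteq> paths" "keys f \<subseteq> paths \<Longrightarrow> keys g \<subseteq> paths \<Longrightarrow> keys (f - g) \<subseteq> paths"
  "keys f \<subseteq> paths \<Longrightarrow> keys (pscale c f) \<subseteq> paths" "p \<in> paths \<Longrightarrow> keys (single p c) \<subseteq> paths"
  for f g :: "('i::finite) path \<Rightarrow>\<^sub>0 complex"
proof -
  show 1: "keys f \<subseteq> paths \<Longrightarrow> keys g \<subseteq> paths \<Longrightarrow> keys (f + g) \<subseteq> paths" for f g :: "'i path \<Rightarrow>\<^sub>0 complex"
    using keys_plus_subset[of f g] by blast
  show 2: "keys f \<subseteq> paths \<Longrightarrow> keys (- f) \<subseteq> paths" for f :: "'i path \<Rightarrow>\<^sub>0 complex"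
    by (auto simp: in_keys_iff subset_iff)
  show "keys f \<subseteq> paths \<Longrightarrow> keys g \<subseteq> paths \<Longrightarrow> keys (f - g) \<subseteq> paths" using 1[of f "- g"] 2[of g] by simp
qed (auto simp: in_keys_iff subset_iff lookup_single when_def)

lemma ring_PA: "ring (PA :: (complex, ('i::finite) path \<Rightarrow>\<^sub>0 complex) module)"
proof (rule ringI)
  show "abelian_group (PA :: (complex, 'i path \<Rightarrow>\<^sub>0 complex) module)"
  proof (rule abelian_groupI)
    fix f :: "'i path \<Rightarrow>\<^sub>0 complex" assume f: "f \<in> carrier PA"
    show "\<exists>g\<in>carrier PA. g \<oplus>\<^bsub>PA\<^esub> f = \<zero>\<^bsub>PA\<^esub>"
      by (rule bexI[of _ "- f"]) (use f in \<open>auto simp: in_keys_iff subset_iff\<close>)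
  qed (auto simp: add_ac dest!: subsetD[OF keys_plus_subset])
  show "Group.monoid (PA :: (complex, 'i path \<Rightarrow>\<^sub>0 complex) module)"
    by (rule monoidI) (simp_all add: pmul_closed pmul_assoc pidem_closed pscale_pidem_mul[where c = 1, simplified])
qed (simp_all add: pmul_add_left pmul_add_right)

section \<open>Symbols of paths\<close>

text \<open>Along a path \<open>upc J K\<close> is 1 for a step that adds an element and 0 for a
  step that removes one, so this counts the upward steps.\<close>

fun up :: "'i path \<Rightarrow> nat" where
  "up [] = 0" | "up [J] = 0" | "up (J # K # r) = upc J K + up (K # r)"

lemma up_join: "p \<noteq> [] \<Longrightarrow> q \<noteq> [] \<Longrightarrow> last q = hd p \<Longrightarrow> up (q @ tl p) = up p + up q"
proof (induction q rule: up.induct)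
  case (2 J) then show ?case by (cases p) auto
qed auto

lemma card_adjacent: "card J + card (K - J) = card K + card (J - (K :: 'i::finite set))"
proof -
  have "card (J \<union> K) = card J + card (K - J)" "card (K \<union> J) = card K + card (J - K)"
    by (subst card_Un_disjoint[symmetric]; auto intro: arg_cong[where f = card])+
  then show ?thesis by (simp add: Un_commute)
qed

lemma card_sym_diff: "card (sym_diff J K) = card (J - K) + card (K - (J :: 'i::finite set))"
  by (rule card_Un_disjoint) auto

text \<open>Upward and downward steps add up to the length, and their difference is the change of
  cardinality. Hence the relations, which compare paths with equal ends and equal length, preserve
  \<open>up\<close>.\<close>

lemma up_length: "p \<in> paths \<Longrightarrow> 2 * up p + card (hd p) = path_length p + card (last (p :: 'i::finite path))"
proof (induction p rule: up.induct)
  case (3 J K r)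
  have a: "card (J - K) + card (K - J) = 1" "K # r \<in> paths"
    using 3(2) by (auto simp: paths_def adjacent_def card_sym_diff)
  have "2 * up (K # r) + card K = path_length (K # r) + card (last (K # r))" using 3(1)[OF a(2)] by simp
  then show ?case using a(1) card_adjacent[of J K] by (simp add: path_length_def upc_def)
qed (auto simp: path_length_def paths_def)

lemma upc_le_up: "p \<noteq> [] \<Longrightarrow> upc (hd p) (last p) \<le> up (p :: 'i::finite path)"
proof (induction p rule: up.induct)
  case (3 J K r)
  have "upc (hd (J # K # r)) (last (J # K # r)) \<le> upc J K + upc K (last (K # r))"
    using upc_triangle[of J "last (K # r)" K] by simp
  also have "\<dots> \<le> upc J K + up (K # r)" using 3 by simp
  finally show ?case by simp
qed auto

lemma up_excess:
  assumes "p \<in> paths" "path_length p = card (sym_diff (hd p) (last p)) + 2 * k"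
  shows "up p = upc (hd p) (last (p :: 'i::finite path)) + k"
  using up_length[OF assms(1)] assms(2) card_adjacent[of "hd p" "last p"]
  by (simp add: card_sym_diff upc_def)

text \<open>By \<open>up_length\<close> the length exceeds the distance of the ends by twice the
  number of surplus upward steps, a natural number by \<open>upc_le_up\<close>.\<close>

lemma length_excess:
  assumes "p \<in> paths"
  shows "\<exists>k. path_length p = card (sym_diff (hd p) (last (p :: 'i::finite path))) + 2 * k"
  using up_length[OF assms(1)] upc_le_up[OF paths_nonempty[OF assms]] card_adjacent[of "hd p" "last p"]
  by (intro exI[of _ "up p - upc (hd p) (last p)"]) (simp add: card_sym_diff upc_def)

definition psym :: "('i path \<Rightarrow>\<^sub>0 complex) \<Rightarrow> 'i set \<Rightarrow> 'i set \<Rightarrow> complex fps" where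
  "psym f K J = (\<Sum>p\<in>keys f. if hd p = J \<and> last p = K then fps_const (lookup f p) * fps_X ^ up p else 0)"

lemma psym_superset: "finite X \<Longrightarrow> keys f \<subseteq> X \<Longrightarrow>
    psym f K J = (\<Sum>p\<in>X. if hd p = J \<and> last p = K then fps_const (lookup f p) * fps_X ^ up p else 0)"
  unfolding psym_def by (rule sum.mono_neutral_left) (auto simp: in_keys_iff)

lemma psym_zero [simp]: "psym 0 K J = 0" by (simp add: psym_def)

lemma psym_add: "psym (f + g) K J = psym f K J + psym g K J"
proof -
  have X: "finite (keys f \<union> keys g)" by simp
  show ?thesis
    unfolding psym_superset[OF X keys_plus_subset] psym_superset[OF X Un_upper1] psym_superset[OF X Un_upper2]
    by (simp only: sum.distrib[symmetric], intro sum.cong refl)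
      (simp add: lookup_add fps_const_add[symmetric] distrib_right del: fps_const_add)
qed

lemma psym_uminus: "psym (- f) K J = - psym f K J"
  using psym_add[of f "- f" K J] by (simp add: eq_neg_iff_add_eq_0 add.commute)

lemma psym_sum: "psym (\<Sum>x\<in>X. F x) K J = (\<Sum>x\<in>X. psym (F x) K J)"
  by (induction X rule: infinite_finite_induct) (auto simp: psym_add)

lemma psym_single: "psym (single p c) K J = (if hd p = J \<and> last p = K then fps_const c * fps_X ^ up p else 0)"
  by (subst psym_superset[where X = "{p}"]) auto

lemma psym_mult:
  fixes f g :: "('i::finite) path \<Rightarrow>\<^sub>0 complex"
  assumes "keys f \<subseteq> paths" "keys g \<subseteq> paths"
  shows "psym (pmul f g) L J = (\<Sum>K\<in>UNIV. psym f L K * psym g K J)"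
proof -
  have s: "psym (pmul (single p a) (single q b)) L J = (\<Sum>K\<in>UNIV. psym (single p a) L K * psym (single q b) K J)"
    if "p \<in> paths" "q \<in> paths" for p q :: "'i path" and a b
  proof -
    note ne = paths_nonempty[OF that(1)] paths_nonempty[OF that(2)]
    have "(\<Sum>K\<in>UNIV. psym (single p a) L K * psym (single q b) K J) =
        (\<Sum>K\<in>{hd p}. psym (single p a) L K * psym (single q b) K J)"
      by (rule sum.mono_neutral_right) (auto simp: psym_single)
    then show ?thesis
      using join_path[OF that] up_join[OF ne]
      by (auto simp: pmul_single join_def psym_single power_add fps_const_mult[symmetric] algebra_simps simp del: fps_const_mult)
  qed
  let ?s = "\<lambda>f. \<Sum>p\<in>keys f. single p (lookup f p)"
  have "psym (pmul (?s f) (?s g)) L J = (\<Sum>p\<in>keys f. \<Sum>q\<in>keys g. \<Sum>K\<in>UNIV.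
      psym (single p (lookup f p)) L K * psym (single q (lookup g q)) K J)"
    unfolding pmul_sum_left pmul_sum_right psym_sum
    by (subst sum.swap, intro sum.cong refl s) (use assms in auto)
  also have "\<dots> = (\<Sum>p\<in>keys f. \<Sum>K\<in>UNIV. \<Sum>q\<in>keys g.
      psym (single p (lookup f p)) L K * psym (single q (lookup g q)) K J)"
    by (intro sum.cong refl sum.swap)
  also have "\<dots> = (\<Sum>K\<in>UNIV. \<Sum>p\<in>keys f. \<Sum>q\<in>keys g.
      psym (single p (lookup f p)) L K * psym (single q (lookup g q)) K J)"
    by (rule sum.swap)
  also have "\<dots> = (\<Sum>K\<in>UNIV. (\<Sum>p\<in>keys f. psym (single p (lookup f p)) L K) * (\<Sum>q\<in>keys g. psym (single q (lookup g q)) K J))"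
    unfolding sum_product ..
  finally show ?thesis unfolding psym_sum[symmetric] sum_single_keys[symmetric] .
qed

lemma psym_dvd:
  assumes "keys f \<subseteq> paths"
  shows "fps_X ^ upc J (K :: 'i::finite set) dvd psym f K J"
  unfolding psym_def
proof (rule dvd_sum)
  fix p assume p: "p \<in> keys f"
  then have "p \<noteq> []" using assms paths_nonempty by blast
  then have "upc J K \<le> up p" if "hd p = J" "last p = K" using upc_le_up[of p] that by simp
  then show "fps_X ^ upc J K dvd (if hd p = J \<and> last p = K then fps_const (lookup f p) * fps_X ^ up p else 0)"
    by (auto intro: dvd_mult le_imp_power_dvd)
qed

section \<open>The quotient algebra\<close>

interpretation PA: ring PA by (rule ring_PA)

lemma path_relations_closed:
  "{single p 1 - single q 1 |p q :: ('i::finite) path. p \<in> paths \<and> q \<in> paths \<and> hd p = hd q \<and> last p = last q \<and>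
      path_length p = path_length q} \<subseteq> carrier PA"
  by (rule subsetI, elim CollectE exE conjE) simp

lemma path_ideal: "ideal path_ideal PA"
  unfolding path_ideal_def by (rule PA.genideal_ideal[OF path_relations_closed])

lemma abelian_subgroup_path_ideal: "abelian_subgroup path_ideal PA"
  by (rule abelian_subgroupI3[OF ideal.axioms(1)[OF path_ideal] PA.is_abelian_group])

text \<open>Multiplicativity (\<open>psym_mult\<close>) makes the common kernel of all entries an
  ideal, and the defining relations lie in it by \<open>up_length\<close>.\<close>

lemma psym_ideal:
  fixes h :: "('i::finite) path \<Rightarrow>\<^sub>0 complex"
  assumes "h \<in> path_ideal"
  shows "psym h K J = 0"
proof -
  let ?K = "{f :: 'i path \<Rightarrow>\<^sub>0 complex. f \<in> carrier PA \<and> (\<forall>K J. psym f K J = 0)}"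
  have inv: "inv\<^bsub>add_monoid PA\<^esub> f = - f" if "f \<in> carrier PA" for f
  proof -
    have "\<ominus>\<^bsub>PA\<^esub> f = - f" by (rule PA.minus_equality) (use that in \<open>auto simp: in_keys_iff subset_iff\<close>)
    then show ?thesis by (simp add: a_inv_def)
  qed
  have "ideal ?K (PA :: (complex, 'i path \<Rightarrow>\<^sub>0 complex) module)"
  proof (rule idealI[OF ring_PA])
    show "subgroup ?K (add_monoid (PA :: (complex, 'i path \<Rightarrow>\<^sub>0 complex) module))"
    proof
      show "f \<in> ?K \<Longrightarrow> inv\<^bsub>add_monoid PA\<^esub> f \<in> ?K" for f
        using inv[of f] by (auto simp: psym_uminus in_keys_iff subset_iff)
    qed (auto simp: psym_add dest!: subsetD[OF keys_plus_subset])
    show "x \<otimes>\<^bsub>PA\<^esub> a \<in> ?K" "a \<otimes>\<^bsub>PA\<^esub> x \<in> ?K" if "a \<in> ?K" "x \<in> carrier PA" for a x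
      using that pmul_closed[of x a] pmul_closed[of a x] by (auto simp: psym_mult)
  qed
  moreover have "psym (single p 1 - single q 1) K J = 0"
    if "p \<in> paths" "q \<in> paths" "hd p = hd q" "last p = last q" "path_length p = path_length q" for p q :: "'i path" and K J
  proof -
    have "up p = up q" using up_length[OF that(1)] up_length[OF that(2)] that by simp
    then show ?thesis using psym_add[of "single p 1" "- single q 1" K J] that by (simp add: psym_uminus psym_single)
  qed
  ultimately have "path_ideal \<subseteq> ?K"
    unfolding path_ideal_def
    by (intro PA.genideal_minimal subsetI, simp, elim CollectE exE conjE) simp
  then show ?thesis using assms by auto
qed

lemma path_class_iff: "g \<in> path_class f \<longleftrightarrow> g - f \<in> path_ideal"
  unfolding path_class_def a_r_coset_def' by (auto simp: algebra_simps) (metis add.commute diff_add_cancel)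

lemma path_class_eqI: "keys f \<subseteq> paths \<Longrightarrow> keys g \<subseteq> paths \<Longrightarrow> g - f \<in> path_ideal \<Longrightarrow> path_class f = path_class g"
  unfolding path_class_def by (rule abelian_subgroup.a_repr_independence'[OF abelian_subgroup_path_ideal]) (auto simp: path_class_iff path_class_def[symmetric])

lemma pscale_ideal: "h \<in> path_ideal \<Longrightarrow> pscale c h \<in> path_ideal"
proof -
  assume h: "h \<in> path_ideal"
  then have "keys h \<subseteq> paths" using additive_subgroup.a_Hcarr[OF ideal.axioms(1)[OF path_ideal] h] by simp
  then show ?thesis using ideal.I_l_closed[OF path_ideal h, of "pscale c (pidem UNIV)"]
    by (simp add: pscale_pidem_mul pidem_closed)
qed

lemma BB_zero: "\<zero>\<^bsub>B\<^esub> = path_class (0 :: ('i::finite) path \<Rightarrow>\<^sub>0 complex)"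
proof -
  have "path_class (0 :: 'i path \<Rightarrow>\<^sub>0 complex) = path_ideal" by (auto simp: path_class_iff)
  then show ?thesis by (simp add: B_def quotient_algebra_def ring.defs module.defs FactRing_def)
qed

lemma BB_simps:
  "carrier B = {path_class f | f. keys f \<subseteq> paths}"
  "keys f \<subseteq> paths \<Longrightarrow> keys g \<subseteq> paths \<Longrightarrow> path_class f \<oplus>\<^bsub>B\<^esub> path_class g = path_class (f + g)"
  "keys f \<subseteq> paths \<Longrightarrow> keys g \<subseteq> paths \<Longrightarrow> path_class f \<otimes>\<^bsub>B\<^esub> path_class g = path_class (pmul f g)"
  "\<one>\<^bsub>B\<^esub> = path_class (pidem UNIV)"
  "keys f \<subseteq> paths \<Longrightarrow> c \<odot>\<^bsub>B\<^esub> path_class f = path_class (pscale c f)"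
proof -
  show "carrier B = {path_class f | f. keys f \<subseteq> paths}"
    by (auto simp: B_def quotient_algebra_def ring.defs module.defs FactRing_def A_RCOSETS_def' path_class_def a_r_coset_def')
  show "\<one>\<^bsub>B\<^esub> = path_class (pidem UNIV)"
    by (simp add: B_def quotient_algebra_def ring.defs module.defs FactRing_def path_class_def)
  show "path_class f \<oplus>\<^bsub>B\<^esub> path_class g = path_class (f + g)" if "keys f \<subseteq> paths" "keys g \<subseteq> paths" for f g
    using abelian_subgroup.a_rcos_sum[OF abelian_subgroup_path_ideal, of f g] that
    by (simp add: B_def quotient_algebra_def ring.defs module.defs FactRing_def path_class_def)
  show "path_class f \<otimes>\<^bsub>B\<^esub> path_class g = path_class (pmul f g)" if "keys f \<subseteq> paths" "keys g \<subseteq> paths" for f g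
    using ideal.rcoset_mult_add[OF path_ideal, of f g] that
    by (simp add: B_def quotient_algebra_def ring.defs module.defs FactRing_def path_class_def)
  show "c \<odot>\<^bsub>B\<^esub> path_class f = path_class (pscale c f)" if f: "keys f \<subseteq> paths" for f c
  proof -
    \<comment> \<open>The scalar multiplication of \<open>quotient_algebra\<close> is a union over
      all representatives; it is a single class because they all yield the same one.\<close>
    have 1: "path_class (pscale c x) = path_class (pscale c f)" if x: "x \<in> path_class f" for x
    proof (rule path_class_eqI)
      have "x - f \<in> path_ideal" using x by (simp add: path_class_iff)
      from additive_subgroup.a_Hcarr[OF ideal.axioms(1)[OF path_ideal] this] f keys_closed(1)[of "x - f" f] show "keys (pscale c x) \<subseteq> paths" by simp
      have "pscale c (x - f) = pscale c x - pscale c f"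
        by (rule poly_mapping_eqI) (simp add: lookup_minus algebra_simps)
      then have 2: "pscale c x - pscale c f \<in> path_ideal" using pscale_ideal \<open>x - f \<in> path_ideal\<close> by metis
      have "pscale c (f - x) = pscale c f - pscale c x"
        by (rule poly_mapping_eqI) (simp add: lookup_minus algebra_simps)
      moreover have "pscale (-1) (x - f) = f - x"
        by (rule poly_mapping_eqI) (simp add: lookup_minus)
      ultimately show "pscale c f - pscale c x \<in> path_ideal"
        using pscale_ideal \<open>x - f \<in> path_ideal\<close> by metis
    qed (use f in simp)
    have "f \<in> path_class f" using additive_subgroup.zero_closed[OF ideal.axioms(1)[OF path_ideal]] by (simp add: path_class_iff)
    then have "(\<Union>x\<in>path_class f. path_class (pscale c x)) = path_class (pscale c f)"
      by (rule UN_constant_eq) (use 1 in blast)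
    then show ?thesis
      by (simp add: B_def quotient_algebra_def ring.defs module.defs path_class_def)
  qed
qed

subsection \<open>Components of transported and of decomposed modules\<close>

context complex_module
begin

lemma lin_insert: "finite S \<Longrightarrow> s \<notin> S \<Longrightarrow> insert s S \<subseteq> carrier M \<Longrightarrow> lin (insert s S) k = cs (k s) s \<oplus>\<^bsub>M\<^esub> lin S k"
  unfolding lin_def by (rule M.finsum_insert) auto

text \<open>The family \<open>F\<close> need not be injective, in contrast to the definition of \<open>finite_dim\<close>.\<close>

lemma finite_dimI:
  assumes X: "finite X" and F: "\<And>x. x \<in> X \<Longrightarrow> F x \<in> W" and W: "W \<subseteq> carrier M"
    and span: "\<And>m. m \<in> W \<Longrightarrow> \<exists>c. m = (\<Oplus>\<^bsub>M\<^esub>x\<in>X. cs (c x) (F x))"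
  shows "finite_dim A M W"
proof -
  have "\<exists>c'. (\<Oplus>\<^bsub>M\<^esub>x\<in>X. cs (c x) (F x)) = lin (F ` X) c'" for c
    using X F
  proof (induction X rule: finite_induct)
    case empty then show ?case by (simp add: lin_def)
  next
    case (insert x X)
    then obtain c' where c': "(\<Oplus>\<^bsub>M\<^esub>x\<in>X. cs (c x) (F x)) = lin (F ` X) c'" by auto
    have Fx: "F x \<in> carrier M" "F ` X \<subseteq> carrier M" using insert(4) W by blast+
    have "(\<Oplus>\<^bsub>M\<^esub>x\<in>insert x X. cs (c x) (F x)) = cs (c x) (F x) \<oplus>\<^bsub>M\<^esub> (\<Oplus>\<^bsub>M\<^esub>x\<in>X. cs (c x) (F x))"
      by (rule M.finsum_insert) (use insert(1,2) Fx in auto)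
    then have e: "(\<Oplus>\<^bsub>M\<^esub>x\<in>insert x X. cs (c x) (F x)) = cs (c x) (F x) \<oplus>\<^bsub>M\<^esub> lin (F ` X) c'" using c' by simp
    show ?case
    proof (cases "F x \<in> F ` X")
      \<comment> \<open>A vector that is already among the earlier ones contributes by adding its
        coefficient to theirs.\<close>
      case True
      have S: "finite (F ` X - {F x})" "F x \<notin> F ` X - {F x}" "insert (F x) (F ` X - {F x}) = F ` X"
        "F ` insert x X = F ` X" using True insert(1) by auto
      have i: "lin (F ` X) k = cs (k (F x)) (F x) \<oplus>\<^bsub>M\<^esub> lin (F ` X - {F x}) k" for k
        using lin_insert[OF S(1,2), of k] S(3) Fx by simp
      have "lin (F ` X - {F x}) c' = lin (F ` X - {F x}) (c'(F x := c' (F x) + c x))"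
        by (rule lin_cong) (use Fx in auto)
      then have "lin (F ` X) (c'(F x := c' (F x) + c x)) =
          cs (c x + c' (F x)) (F x) \<oplus>\<^bsub>M\<^esub> lin (F ` X - {F x}) c'"
        using i[of "c'(F x := c' (F x) + c x)"] by (simp add: add.commute)
      also have "\<dots> = cs (c x) (F x) \<oplus>\<^bsub>M\<^esub> (cs (c' (F x)) (F x) \<oplus>\<^bsub>M\<^esub> lin (F ` X - {F x}) c')"
        using Fx lin_closed[of "F ` X - {F x}" c'] by (simp add: cs_add M.add.m_assoc Diff_subset[THEN subset_trans])
      finally have "lin (F ` X) (c'(F x := c' (F x) + c x)) = cs (c x) (F x) \<oplus>\<^bsub>M\<^esub> lin (F ` X) c'"
        using i[of c'] by simp
      then show ?thesis using e S(4) by metis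
    next
      case False
      have "lin (F ` X) (c'(F x := c x)) = lin (F ` X) c'"
        by (rule lin_cong) (use Fx False in \<open>auto, metis image_eqI\<close>)
      then have "lin (insert (F x) (F ` X)) (c'(F x := c x)) = cs (c x) (F x) \<oplus>\<^bsub>M\<^esub> lin (F ` X) c'"
        using lin_insert[of "F ` X" "F x" "c'(F x := c x)"] False insert(1) Fx by simp
      then show ?thesis using e by (metis image_insert)
    qed
  qed
  then have "\<forall>m\<in>W. \<exists>c. m = lin (F ` X) c" using span by metis
  then show ?thesis unfolding finite_dim_def lin_def using X F by (intro exI[of _ "F ` X"]) auto
qed

end

lemma (in matrix_rep) lookup_mact_diag:
  assumes "a \<in> carrier A" "\<And>p w. p \<noteq> q \<Longrightarrow> s a q p w = 0"
  shows "lookup (mact a f) q = s a q q (lookup f q)"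
proof -
  have "lookup (mact a f) q = (\<Sum>p\<in>insert q (keys f). s a q p (lookup f p))"
    by (rule lookup_mact') (use assms in auto)
  also have "\<dots> = (\<Sum>p\<in>{q}. s a q p (lookup f p))"
    by (rule sum.mono_neutral_right) (use assms(2) in auto)
  finally show ?thesis by simp
qed

context symbol_functor
begin

lemma complex_module_Fo: "sys P excess y \<Longrightarrow> complex_module A (Fo y)"
  using left_module_Fo complex_algebra_axioms by (auto simp: complex_module_def)

lemma cscale_Fo:
  assumes y: "sys P excess y" and f: "f \<in> mc y"
  shows "cscale A (Fo y) c (\<iota> f) = \<iota> (Poly_Mapping.map (smult c) f)" "Poly_Mapping.map (smult c) f \<in> mc y"
proof -
  interpret t: transport A \<iota> "mc y" "matrix_rep.mact (smat y)" by (rule transport_Fo[OF y])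
  interpret m: matrix_rep A I "smat y" by (rule matrix_rep_smat[OF y])
  have "m.mact (c \<odot> \<one>) f = Poly_Mapping.map (smult c) f"
  proof (rule poly_mapping_eqI)
    fix q
    have "lookup (m.mact (c \<odot> \<one>) f) q = smult c (smat y \<one> q q (lookup f q))"
      by (subst m.lookup_mact_diag) (auto simp: smult_one_closed m.s_scal m.s_one[OF not_sym])
    then show "lookup (m.mact (c \<odot> \<one>) f) q = lookup (Poly_Mapping.map (smult c) f) q"
      using f by (simp add: m.mcar_def map.rep_eq when_def)
  qed
  then show "cscale A (Fo y) c (\<iota> f) = \<iota> (Poly_Mapping.map (smult c) f)" "Poly_Mapping.map (smult c) f \<in> mc y"
    using f t.act[OF smult_one_closed f, of c] by (auto simp: cscale_def Fo_def)
qed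

lemma single_mc: "sys P excess y \<Longrightarrow> p \<in> I \<Longrightarrow> y 1 (lab p) (lab p) w = w \<Longrightarrow> single p w \<in> mc y"
  by (auto simp: mc_iff lookup_single when_def sys.y_zero)

text \<open>Each component is the image of a projection whose values have degree below
  \<open>d\<close>, hence is spanned by the projections of the monomials of degree below
  \<open>d\<close>.\<close>

lemma finite_dim_Fo:
  assumes y: "sys P excess y" and X: "finite X" "X \<subseteq> I"
  shows "finite_dim A (Fo y) (\<iota> ` {f \<in> mc y. keys f \<subseteq> X})"
proof -
  interpret y: sys P excess y by (rule y)
  interpret c: complex_module A "Fo y" by (rule complex_module_Fo[OF y])
  interpret t: transport A \<iota> "mc y" "matrix_rep.mact (smat y)" by (rule transport_Fo[OF y])
  note N = t.finsum_N[folded Fo_def]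
  have "\<forall>p\<in>X. \<exists>d. \<forall>w k. d \<le> k \<longrightarrow> coeff (y 1 (lab p) (lab p) w) k = 0"
    using y.y_dim lab_in X by blast
  then obtain d0 where d0: "\<And>p w k. p \<in> X \<Longrightarrow> d0 p \<le> k \<Longrightarrow> coeff (y 1 (lab p) (lab p) w) k = 0" by metis
  define d where "d = (\<Sum>p\<in>X. d0 p)"
  have d: "coeff (y 1 (lab p) (lab p) w) k = 0" if "p \<in> X" "d \<le> k" for p w k
  proof (rule d0[OF that(1)])
    have "d0 p \<le> d" unfolding d_def by (rule member_le_sum) (use that X in auto)
    then show "d0 p \<le> k" using that by simp
  qed
  define G where "G = (\<lambda>(p, k). single p (y 1 (lab p) (lab p) (monom 1 k)))"
  have G: "G (p, k) \<in> mc y" "keys (G (p, k)) \<subseteq> X" if "p \<in> X" for p k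
    using that X y.y_one_left lab_in by (auto simp: G_def intro!: single_mc[OF y])
  show ?thesis
  proof (rule c.finite_dimI[where X = "X \<times> {..<d}" and F = "\<lambda>x. \<iota> (G x)"])
    show "\<iota> ` {f \<in> mc y. keys f \<subseteq> X} \<subseteq> carrier (Fo y)" by (auto simp: Fo_def)
    show "\<exists>c. m = (\<Oplus>\<^bsub>Fo y\<^esub>x\<in>X \<times> {..<d}. cscale A (Fo y) (c x) (\<iota> (G x)))"
      if m: "m \<in> \<iota> ` {f \<in> mc y. keys f \<subseteq> X}" for m
    proof -
      obtain f where f: "m = \<iota> f" "f \<in> mc y" "keys f \<subseteq> X" using m by auto
      define c where "c = (\<lambda>(p, k). coeff (lookup f p) k)"
      have 1: "(\<Oplus>\<^bsub>Fo y\<^esub>x\<in>X \<times> {..<d}. cscale A (Fo y) (c x) (\<iota> (G x))) =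
          (\<Oplus>\<^bsub>Fo y\<^esub>x\<in>X \<times> {..<d}. \<iota> (Poly_Mapping.map (smult (c x)) (G x)))"
        by (rule c.M.finsum_cong') (use cscale_Fo[OF y] G in \<open>auto simp: Fo_def\<close>)
      also have "\<dots> = \<iota> (\<Sum>x\<in>X \<times> {..<d}. Poly_Mapping.map (smult (c x)) (G x))"
        by (rule N(1)) (use cscale_Fo[OF y] G X in auto)
      also have "(\<Sum>x\<in>X \<times> {..<d}. Poly_Mapping.map (smult (c x)) (G x)) = f"
      proof (rule poly_mapping_eqI)
        fix q
        have "lookup (\<Sum>x\<in>X \<times> {..<d}. Poly_Mapping.map (smult (c x)) (G x)) q =
           (\<Sum>p\<in>X. \<Sum>k<d. if p = q then smult (coeff (lookup f q) k) (y 1 (lab q) (lab q) (monom 1 k)) else 0)"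
          unfolding lookup_sum sum.cartesian_product
          by (intro sum.cong) (auto simp: map.rep_eq when_def G_def c_def lookup_single)
        also have "\<dots> = (\<Sum>p\<in>X. if p = q then (\<Sum>k<d. smult (coeff (lookup f q) k) (y 1 (lab q) (lab q) (monom 1 k))) else 0)"
          by (intro sum.cong) auto
        also have "\<dots> = lookup f q"
        proof (cases "q \<in> X")
          case True
          have yf: "y 1 (lab q) (lab q) (lookup f q) = lookup f q"
            using f True X by (auto simp: mc_iff[OF y])
          have "lookup f q = (\<Sum>k<d. smult (coeff (lookup f q) k) (monom 1 k))"
            by (rule poly_eqI) (use d[OF True, of _ "lookup f q"] yf in \<open>auto simp: coeff_sum smult_monom not_less\<close>)
          then have "y 1 (lab q) (lab q) (lookup f q) = (\<Sum>k<d. smult (coeff (lookup f q) k) (y 1 (lab q) (lab q) (monom 1 k)))"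
            by (metis (no_types, lifting) sum.cong y.y_smult y.y_sum)
          then show ?thesis using True X yf by simp
        next
          case False
          then show ?thesis using f X by (auto simp: in_keys_iff intro!: sum.neutral)
        qed
        finally show "lookup (\<Sum>x\<in>X \<times> {..<d}. Poly_Mapping.map (smult (c x)) (G x)) q = lookup f q" .
      qed
      finally show ?thesis using f by metis
    qed
  qed (use X G in auto)
qed

end

context decomposed_module
begin

text \<open>The column of \<open>s\<close> at \<open>p\<close> and \<open>w\<close> is read off from
  a single element of \<open>W p\<close>, the same for all algebra elements and all rows. Facts
  about the action on \<open>W p\<close> thereby become facts about matrix entries
  (\<open>coordinatesD\<close>).\<close>

lemma coordinates_ex:
  assumes co: "coordinates s \<Psi>"
  shows "\<exists>m\<in>W p. \<forall>a\<in>carrier A. \<forall>q. s a q p w = lookup (\<Psi> (a \<odot>\<^bsub>M\<^esub> m)) q"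
proof -
  interpret m: matrix_rep A I s using co by (simp add: coordinates_def)
  have "single p (s \<one> p p w) \<in> \<Psi> ` W p" using co m.s_one_idem by (auto simp: coordinates_def)
  then obtain m where m: "m \<in> W p" "\<Psi> m = single p (s \<one> p p w)" by auto
  have "s a q p w = lookup (\<Psi> (a \<odot>\<^bsub>M\<^esub> m)) q" if "a \<in> carrier A" for a q
    using co m W_closed(1)[OF m(1)] that by (simp add: coordinates_def m.mact_single m.s_one_right)
  then show ?thesis using m(1) by blast
qed

lemma coordinatesD:
  assumes co: "coordinates s \<Psi>"
  shows "matrix_rep A I s" "\<exists>d. \<forall>w k. d \<le> k \<longrightarrow> coeff (s \<one> p p w) k = 0"
    and "a \<in> carrier A \<Longrightarrow> b \<in> carrier A \<Longrightarrow> (\<And>m. m \<in> W p \<Longrightarrow> a \<odot>\<^bsub>M\<^esub> m = b \<odot>\<^bsub>M\<^esub> m) \<Longrightarrow> s a q p w = s b q p w"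
    and "a \<in> carrier A \<Longrightarrow> (\<And>m. m \<in> W p \<Longrightarrow> a \<odot>\<^bsub>M\<^esub> m = \<zero>\<^bsub>M\<^esub>) \<Longrightarrow> s a q p w = 0"
    and "a \<in> carrier A \<Longrightarrow> (\<And>m. m \<in> W p \<Longrightarrow> a \<odot>\<^bsub>M\<^esub> m \<in> W r) \<Longrightarrow> q \<noteq> r \<Longrightarrow> s a q p w = 0"
proof -
  show mr: "matrix_rep A I s" using co by (simp add: coordinates_def)
  interpret m: matrix_rep A I s by (rule mr)
  show "\<exists>d. \<forall>w k. d \<le> k \<longrightarrow> coeff (s \<one> p p w) k = 0" using co by (simp add: coordinates_def)
  note ex = coordinates_ex[OF co]
  show "s a q p w = s b q p w" if "a \<in> carrier A" "b \<in> carrier A" "\<And>m. m \<in> W p \<Longrightarrow> a \<odot>\<^bsub>M\<^esub> m = b \<odot>\<^bsub>M\<^esub> m"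
    using ex[of p w] that by metis
  have z: "\<Psi> \<zero>\<^bsub>M\<^esub> = 0" using co M.additive_zero[of \<Psi>] by (simp add: coordinates_def)
  show "s a q p w = 0" if "a \<in> carrier A" "\<And>m. m \<in> W p \<Longrightarrow> a \<odot>\<^bsub>M\<^esub> m = \<zero>\<^bsub>M\<^esub>"
    using ex[of p w] that z by auto
  show "s a q p w = 0" if a: "a \<in> carrier A" "\<And>m. m \<in> W p \<Longrightarrow> a \<odot>\<^bsub>M\<^esub> m \<in> W r" "q \<noteq> r"
  proof -
    obtain m where m: "m \<in> W p" "\<And>q. s a q p w = lookup (\<Psi> (a \<odot>\<^bsub>M\<^esub> m)) q" using ex[of p w] a by blast
    have "\<Psi> (a \<odot>\<^bsub>M\<^esub> m) \<in> \<Psi> ` W r" using a(2)[OF m(1)] by blast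
    then obtain v where "\<Psi> (a \<odot>\<^bsub>M\<^esub> m) = single r v" using co by (auto simp: coordinates_def)
    then show ?thesis using m(2)[of q] a(3) by (simp add: lookup_single)
  qed
qed

end

section \<open>The nilpotent category\<close>

text \<open>Only the ends are constrained: a path in the corner algebra may pass through vertices
  outside \<open>V\<close>.\<close>

definition vpaths :: "'i::finite set set \<Rightarrow> 'i path set" where
  "vpaths V = {p \<in> paths. hd p \<in> V \<and> last p \<in> V}"

lemma pscale_sum: "pscale c (\<Sum>x\<in>X. F x) = (\<Sum>x\<in>X. pscale c (F x))"
  by (rule poly_mapping_eqI) (simp add: lookup_sum sum_distrib_left)

lemma pscale_join: "pscale c (join p q d) = join p q (c * d)"
  by (rule poly_mapping_eqI) (simp add: join_def lookup_single when_def)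

lemma pscale_pscale: "pscale c (pscale d f) = pscale (c * d) f"
  by (rule poly_mapping_eqI) (simp add: algebra_simps)

lemma keys_pscale: "keys (pscale c f) \<subseteq> keys f" by (auto simp: in_keys_iff)

lemma pmul_pscale: "pmul (pscale c f) g = pscale c (pmul f g)" "pmul f (pscale c g) = pscale c (pmul f g)"
proof -
  have "pmul (pscale c f) g = (\<Sum>p\<in>keys f. \<Sum>q\<in>keys g. join p q (lookup (pscale c f) p * lookup g q))"
    by (rule pmul_superset) (use keys_pscale in auto)
  then show "pmul (pscale c f) g = pscale c (pmul f g)"
    by (simp add: pmul_def pscale_sum pscale_join mult.assoc)
  have "pmul f (pscale c g) = (\<Sum>p\<in>keys f. \<Sum>q\<in>keys g. join p q (lookup f p * lookup (pscale c g) q))"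
    by (rule pmul_superset) (use keys_pscale in auto)
  then show "pmul f (pscale c g) = pscale c (pmul f g)"
    by (simp add: pmul_def pscale_sum pscale_join mult.left_commute)
qed

text \<open>The quotient algebra and its corner are both of the following form.\<close>

lemma class_algebra:
  fixes R :: "(complex, ('i::finite path \<Rightarrow>\<^sub>0 complex) set) module"
  assumes U: "U \<subseteq> paths" and car: "carrier R = {path_class f | f. keys f \<subseteq> U}"
    and add: "\<And>f g. keys f \<subseteq> U \<Longrightarrow> keys g \<subseteq> U \<Longrightarrow> path_class f \<oplus>\<^bsub>R\<^esub> path_class g = path_class (f + g)"
    and mul: "\<And>f g. keys f \<subseteq> U \<Longrightarrow> keys g \<subseteq> U \<Longrightarrow> path_class f \<otimes>\<^bsub>R\<^esub> path_class g = path_class (pmul f g)"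
    and one: "\<one>\<^bsub>R\<^esub> = path_class e" and zero: "\<zero>\<^bsub>R\<^esub> = path_class 0"
    and sc: "\<And>c f. keys f \<subseteq> U \<Longrightarrow> c \<odot>\<^bsub>R\<^esub> path_class f = path_class (pscale c f)"
    and cl: "\<And>f g. keys f \<subseteq> U \<Longrightarrow> keys g \<subseteq> U \<Longrightarrow> keys (pmul f g) \<subseteq> U"
    and e: "keys e \<subseteq> U" "\<And>f. keys f \<subseteq> U \<Longrightarrow> pmul e f = f" "\<And>f. keys f \<subseteq> U \<Longrightarrow> pmul f e = f"
  shows "complex_algebra R"
proof -
  have plus: "keys (f + g) \<subseteq> U" if "keys f \<subseteq> U" "keys g \<subseteq> U" for f g :: "'i path \<Rightarrow>\<^sub>0 complex"
    using that keys_plus_subset[of f g] by blast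
  have scl: "keys (pscale c f) \<subseteq> U" if "keys f \<subseteq> U" for c and f :: "'i path \<Rightarrow>\<^sub>0 complex"
    using that keys_pscale[of c f] by blast
  have assoc: "pmul (pmul f g) h = pmul f (pmul g h)" if "keys f \<subseteq> U" "keys g \<subseteq> U" "keys h \<subseteq> U" for f g h
    by (rule pmul_assoc) (use that U in auto)
  have el: "\<exists>f. keys f \<subseteq> U \<and> x = path_class f" if "x \<in> carrier R" for x using that car by auto
  have mem: "path_class f \<in> carrier R" if "keys f \<subseteq> U" for f using that car by auto
  have "ring R"
  proof (rule ringI)
    show "abelian_group R"
    proof (rule abelian_groupI)
      fix x assume "x \<in> carrier R"
      then obtain f where f: "keys f \<subseteq> U" "x = path_class f" using el by blast
      have "keys (- f) \<subseteq> U" using f by (auto simp: in_keys_iff)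
      then show "\<exists>y\<in>carrier R. y \<oplus>\<^bsub>R\<^esub> x = \<zero>\<^bsub>R\<^esub>"
        by (intro bexI[of _ "path_class (- f)"]) (use f in \<open>auto simp: add zero mem\<close>)
      show "\<zero>\<^bsub>R\<^esub> \<oplus>\<^bsub>R\<^esub> x = x" using f by (simp add: add zero)
    next
      fix x y assume "x \<in> carrier R" "y \<in> carrier R"
      then obtain f g where f: "keys f \<subseteq> U" "x = path_class f" "keys g \<subseteq> U" "y = path_class g" using el by metis
      show "x \<oplus>\<^bsub>R\<^esub> y \<in> carrier R" "x \<oplus>\<^bsub>R\<^esub> y = y \<oplus>\<^bsub>R\<^esub> x"
        using f plus by (simp_all add: add mem add.commute)
    next
      fix x y z assume "x \<in> carrier R" "y \<in> carrier R" "z \<in> carrier R"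
      then obtain f g h where f: "keys f \<subseteq> U" "x = path_class f" "keys g \<subseteq> U" "y = path_class g"
        "keys h \<subseteq> U" "z = path_class h" using el by metis
      show "x \<oplus>\<^bsub>R\<^esub> y \<oplus>\<^bsub>R\<^esub> z = x \<oplus>\<^bsub>R\<^esub> (y \<oplus>\<^bsub>R\<^esub> z)"
        using f plus by (simp add: add add.assoc)
    qed (simp add: zero mem)
    show "Group.monoid R"
    proof (rule monoidI)
      fix x y z assume "x \<in> carrier R" "y \<in> carrier R" "z \<in> carrier R"
      then obtain f g h where f: "keys f \<subseteq> U" "x = path_class f" "keys g \<subseteq> U" "y = path_class g"
        "keys h \<subseteq> U" "z = path_class h" using el by metis
      show "x \<otimes>\<^bsub>R\<^esub> y \<otimes>\<^bsub>R\<^esub> z = x \<otimes>\<^bsub>R\<^esub> (y \<otimes>\<^bsub>R\<^esub> z)"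
        using f cl by (simp add: mul assoc)
    next
      fix x y assume "x \<in> carrier R" "y \<in> carrier R"
      then obtain f g where f: "keys f \<subseteq> U" "x = path_class f" "keys g \<subseteq> U" "y = path_class g" using el by metis
      show "x \<otimes>\<^bsub>R\<^esub> y \<in> carrier R" using f cl by (simp add: mul mem)
    next
      fix x assume "x \<in> carrier R"
      then obtain f where f: "keys f \<subseteq> U" "x = path_class f" using el by blast
      show "\<one>\<^bsub>R\<^esub> \<otimes>\<^bsub>R\<^esub> x = x" "x \<otimes>\<^bsub>R\<^esub> \<one>\<^bsub>R\<^esub> = x" using f e by (simp_all add: mul one)
    qed (simp add: one mem e)
  next
    fix x y z assume "x \<in> carrier R" "y \<in> carrier R" "z \<in> carrier R"
    then obtain f g h where f: "keys f \<subseteq> U" "x = path_class f" "keys g \<subseteq> U" "y = path_class g"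
      "keys h \<subseteq> U" "z = path_class h" using el by metis
    show "(x \<oplus>\<^bsub>R\<^esub> y) \<otimes>\<^bsub>R\<^esub> z = x \<otimes>\<^bsub>R\<^esub> z \<oplus>\<^bsub>R\<^esub> y \<otimes>\<^bsub>R\<^esub> z" "z \<otimes>\<^bsub>R\<^esub> (x \<oplus>\<^bsub>R\<^esub> y) = z \<otimes>\<^bsub>R\<^esub> x \<oplus>\<^bsub>R\<^esub> z \<otimes>\<^bsub>R\<^esub> y"
      using f cl plus by (simp_all add: mul add pmul_add_left pmul_add_right)
  qed
  then interpret ring R .
  show ?thesis
  proof
    fix c d :: complex
    have "pscale (c + d) e = pscale c e + pscale d e"
      by (rule poly_mapping_eqI) (simp add: lookup_add algebra_simps)
    then show "(c + d) \<odot>\<^bsub>R\<^esub> \<one>\<^bsub>R\<^esub> = c \<odot>\<^bsub>R\<^esub> \<one>\<^bsub>R\<^esub> \<oplus>\<^bsub>R\<^esub> d \<odot>\<^bsub>R\<^esub> \<one>\<^bsub>R\<^esub>"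
      using e scl by (simp add: one sc add)
    show "(c * d) \<odot>\<^bsub>R\<^esub> \<one>\<^bsub>R\<^esub> = (c \<odot>\<^bsub>R\<^esub> \<one>\<^bsub>R\<^esub>) \<otimes>\<^bsub>R\<^esub> (d \<odot>\<^bsub>R\<^esub> \<one>\<^bsub>R\<^esub>)"
      using e scl by (simp add: one sc mul pmul_pscale pscale_pscale mult.commute)
    show "c \<odot>\<^bsub>R\<^esub> \<one>\<^bsub>R\<^esub> \<in> carrier R" using e scl by (simp add: one sc mem)
    show "1 \<odot>\<^bsub>R\<^esub> \<one>\<^bsub>R\<^esub> = \<one>\<^bsub>R\<^esub>" using e by (simp add: one sc)
    fix a assume "a \<in> carrier R"
    then obtain f where f: "keys f \<subseteq> U" "a = path_class f" using el by blast
    show "(c \<odot>\<^bsub>R\<^esub> \<one>\<^bsub>R\<^esub>) \<otimes>\<^bsub>R\<^esub> a = a \<otimes>\<^bsub>R\<^esub> (c \<odot>\<^bsub>R\<^esub> \<one>\<^bsub>R\<^esub>)"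
      using f e scl by (simp add: one sc mul pmul_pscale)
  qed
qed

lemma complex_algebra_BB: "complex_algebra (B :: (complex, (('i::finite) path \<Rightarrow>\<^sub>0 complex) set) module)"
  by (rule class_algebra[where U = paths and e = "pidem UNIV"])
    (auto simp: BB_simps BB_zero pmul_closed pidem_closed pscale_pidem_mul[where c = 1, simplified])

lemma pi_idempotent_eq: "pi_idempotent a = path_class (pidem (vertices a) :: ('i::finite) path \<Rightarrow>\<^sub>0 complex)"
proof -
  interpret R: complex_algebra "B :: (complex, ('i path \<Rightarrow>\<^sub>0 complex) set) module" by (rule complex_algebra_BB)
  have mem: "path_class f \<in> carrier B" if "keys f \<subseteq> paths" for f :: "'i path \<Rightarrow>\<^sub>0 complex"
    using that by (auto simp: BB_simps)
  have "(\<Oplus>\<^bsub>B\<^esub>J\<in>V. vertex_idempotent J) = path_class (pidem V)" if "finite V" for V :: "'i set set"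
    using that
  proof (induction V rule: finite_induct)
    case empty then show ?case by (simp add: pidem_def BB_zero)
  next
    case (insert J V)
    have J: "keys (single [J] 1 :: 'i path \<Rightarrow>\<^sub>0 complex) \<subseteq> paths" for J by (simp add: paths_def)
    have "(\<Oplus>\<^bsub>B\<^esub>J\<in>insert J V. vertex_idempotent J) = vertex_idempotent J \<oplus>\<^bsub>B\<^esub> (\<Oplus>\<^bsub>B\<^esub>J\<in>V. vertex_idempotent J)"
      by (rule R.finsum_insert) (use insert J mem in \<open>auto simp: vertex_idempotent_def\<close>)
    also have "\<dots> = path_class (single [J] 1 + pidem V)"
      using insert J by (simp add: vertex_idempotent_def BB_simps(2) pidem_closed)
    finally show ?case using insert by (simp add: pidem_def)
  qed
  then show ?thesis unfolding pi_idempotent_def by simp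
qed

lemma vpaths_paths: "keys f \<subseteq> vpaths V \<Longrightarrow> keys f \<subseteq> paths" by (auto simp: vpaths_def)

lemma pidem_vpaths: "keys (pidem V) \<subseteq> vpaths (V :: ('i::finite) set set)"
  unfolding pidem_def by (intro keys_sum_subset) (auto simp: vpaths_def paths_def)

lemma sandwich:
  assumes "keys f \<subseteq> paths"
  shows "keys (pmul (pmul (pidem V) f) (pidem V)) \<subseteq> vpaths V"
    and "keys f \<subseteq> vpaths V \<Longrightarrow> pmul (pidem V) f = f" "keys f \<subseteq> vpaths V \<Longrightarrow> pmul f (pidem V) = f"
proof -
  let ?g = "pmul (pidem V) f"
  have g: "keys ?g \<subseteq> {p \<in> paths. last p \<in> V}"
    unfolding pidem_mul(1)[OF assms] by (intro keys_sum_subset) (use assms in auto)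
  then have "keys ?g \<subseteq> paths" by auto
  show "keys (pmul ?g (pidem V)) \<subseteq> vpaths V"
    unfolding pidem_mul(2)[OF \<open>keys ?g \<subseteq> paths\<close>] by (intro keys_sum_subset) (use g in \<open>auto simp: vpaths_def\<close>)
  assume v: "keys f \<subseteq> vpaths V"
  have "(\<Sum>p\<in>keys f. if last p \<in> V then single p (lookup f p) else 0) = (\<Sum>p\<in>keys f. single p (lookup f p))"
    "(\<Sum>p\<in>keys f. if hd p \<in> V then single p (lookup f p) else 0) = (\<Sum>p\<in>keys f. single p (lookup f p))"
    by (intro sum.cong; use v in \<open>auto simp: vpaths_def\<close>)+
  then show "pmul (pidem V) f = f" "pmul f (pidem V) = f"
    unfolding pidem_mul[OF assms] sum_single_keys[symmetric] by auto
qed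

lemma pmul_vpaths: "keys f \<subseteq> vpaths V \<Longrightarrow> keys g \<subseteq> vpaths V \<Longrightarrow> keys (pmul f g) \<subseteq> vpaths V"
  using sandwich[of f V] sandwich[of g V] sandwich(1)[of "pmul f g" V] pmul_closed[of f g]
    pmul_assoc[of "pidem V" f g] pmul_assoc[of f g "pidem V"] pidem_closed[of V] vpaths_paths
  by (metis)

lemma C_simps:
  fixes f g :: "('i::finite) path \<Rightarrow>\<^sub>0 complex"
  shows "carrier (pi_B_pi a) = {path_class f | f :: 'i path \<Rightarrow>\<^sub>0 complex. keys f \<subseteq> vpaths (vertices a)}"
  "keys f \<subseteq> paths \<Longrightarrow> keys g \<subseteq> paths \<Longrightarrow> path_class f \<oplus>\<^bsub>pi_B_pi a\<^esub> path_class g = path_class (f + g)"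
  "keys f \<subseteq> paths \<Longrightarrow> keys g \<subseteq> paths \<Longrightarrow> path_class f \<otimes>\<^bsub>pi_B_pi a\<^esub> path_class g = path_class (pmul f g)"
  "\<one>\<^bsub>pi_B_pi a\<^esub> = path_class (pidem (vertices a) :: 'i path \<Rightarrow>\<^sub>0 complex)"
  "\<zero>\<^bsub>pi_B_pi a\<^esub> = path_class (0 :: 'i path \<Rightarrow>\<^sub>0 complex)"
  "keys f \<subseteq> paths \<Longrightarrow> c \<odot>\<^bsub>pi_B_pi a\<^esub> path_class f = path_class (pscale c f)"
proof -
  let ?e = "pidem (vertices a) :: 'i path \<Rightarrow>\<^sub>0 complex"
  have "carrier (pi_B_pi a) = {path_class ?e \<otimes>\<^bsub>B\<^esub> x \<otimes>\<^bsub>B\<^esub> path_class ?e |x. x \<in> carrier B}"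
    by (simp add: pi_B_pi_def corner_algebra_def pi_idempotent_eq)
  also have "\<dots> = {path_class (pmul (pmul ?e f) ?e) | f. keys f \<subseteq> paths}"
    unfolding BB_simps(1)
    by (auto simp: BB_simps(3) pidem_closed pmul_closed) (metis BB_simps(3) pidem_closed pmul_closed)
  also have "\<dots> = {path_class f | f :: 'i path \<Rightarrow>\<^sub>0 complex. keys f \<subseteq> vpaths (vertices a)}"
  proof (intro subset_antisym subsetI)
    fix x assume "x \<in> {path_class (pmul (pmul ?e f) ?e) | f. keys f \<subseteq> paths}"
    then show "x \<in> {path_class f | f :: 'i path \<Rightarrow>\<^sub>0 complex. keys f \<subseteq> vpaths (vertices a)}"
      using sandwich(1) by blast
  next
    fix x assume "x \<in> {path_class f | f :: 'i path \<Rightarrow>\<^sub>0 complex. keys f \<subseteq> vpaths (vertices a)}"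
    then obtain f :: "'i path \<Rightarrow>\<^sub>0 complex" where *: "x = path_class f" "keys f \<subseteq> vpaths (vertices a)" by blast
    have k: "keys f \<subseteq> paths" by (rule vpaths_paths[OF *(2)])
    have "pmul (pmul ?e f) ?e = f" using sandwich(2,3)[OF k *(2)] by simp
    then show "x \<in> {path_class (pmul (pmul ?e f) ?e) | f. keys f \<subseteq> paths}"
      unfolding mem_Collect_eq by (intro exI[of _ f]) (use * k in simp)
  qed
  finally show "carrier (pi_B_pi a) = {path_class f | f :: 'i path \<Rightarrow>\<^sub>0 complex. keys f \<subseteq> vpaths (vertices a)}" .
qed (simp_all add: pi_B_pi_def corner_algebra_def pi_idempotent_eq BB_simps(2,3,5) BB_zero)

lemma complex_algebra_pi_B_pi: "complex_algebra (pi_B_pi a :: (complex, (('i::finite) path \<Rightarrow>\<^sub>0 complex) set) module)"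
  by (rule class_algebra[where U = "vpaths (vertices a)" and e = "pidem (vertices a)"])
    (simp_all add: C_simps vpaths_paths pmul_vpaths pidem_vpaths sandwich, auto simp: vpaths_def)

section \<open>Symbols and distinguished elements of the corner algebra\<close>

definition prho :: "(('i::finite) path \<Rightarrow>\<^sub>0 complex) set \<Rightarrow> 'i set \<Rightarrow> 'i set \<Rightarrow> complex fps" where
  "prho b K J = psym (SOME f. keys f \<subseteq> paths \<and> b = path_class f) K J"

lemma prho: assumes f: "keys f \<subseteq> paths" shows "prho (path_class f) K J = psym f K J"
proof -
  define g where "g = (SOME g. keys g \<subseteq> paths \<and> path_class f = path_class g)"
  have g: "keys g \<subseteq> paths \<and> path_class f = path_class g"
    unfolding g_def by (rule someI[of _ f]) (use f in simp)
  have "f \<in> path_class f"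
    using additive_subgroup.zero_closed[OF ideal.axioms(1)[OF path_ideal]] by (simp add: path_class_iff)
  then have "f - g \<in> path_ideal" using g path_class_iff by metis
  then have "psym (f - g) K J = 0" by (rule psym_ideal)
  then show ?thesis using psym_add[of "f - g" g K J] by (simp add: prho_def g_def)
qed

definition elem :: "('i::finite) path \<Rightarrow> complex \<Rightarrow> ('i path \<Rightarrow>\<^sub>0 complex) set" where
  "elem p c = path_class (single p c)"

lemma elem_mult: "p \<in> paths \<Longrightarrow> q \<in> paths \<Longrightarrow>
    elem p c \<otimes>\<^bsub>pi_B_pi a\<^esub> elem q d = (if last q = hd p then elem (q @ tl p) (c * d) else \<zero>\<^bsub>pi_B_pi a\<^esub>)"
  by (simp add: elem_def C_simps pmul_single join_def)

lemma keys_single_vpaths: "p \<in> vpaths V \<Longrightarrow> keys (single p c) \<subseteq> vpaths V"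
  by (auto split: if_splits)

lemma elem_closed: "p \<in> vpaths (vertices a) \<Longrightarrow> elem p c \<in> carrier (pi_B_pi a)"
  unfolding elem_def C_simps using keys_single_vpaths by blast

lemma prho_elem: "p \<in> paths \<Longrightarrow> prho (elem p c) K J = (if hd p = J \<and> last p = K then fps_const c * fps_X ^ up p else 0)"
  by (simp add: elem_def prho psym_single)

lemma elem_eq:
  assumes "p \<in> paths" "q \<in> paths" "hd p = hd q" "last p = last q" "path_length p = path_length (q :: ('i::finite) path)"
  shows "elem p c = elem q c"
  unfolding elem_def
proof (rule path_class_eqI)
  have "single q 1 - single p 1 \<in> (path_ideal :: ('i path \<Rightarrow>\<^sub>0 complex) set)"
    unfolding path_ideal_def
    by (rule subsetD[OF PA.genideal_self[OF path_relations_closed]], rule CollectI, rule exI[of _ q], rule exI[of _ p])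
      (use assms in simp)
  from pscale_ideal[OF this, of c] show "single q c - single p c \<in> path_ideal"
    by (rule back_subst[of "\<lambda>x. x \<in> path_ideal"])
      (auto intro!: poly_mapping_eqI simp: lookup_minus lookup_single when_def)
qed (use assms in auto)

text \<open>The elements of the symmetric difference are toggled one at a time.\<close>

lemma path_between_exists: "\<exists>p\<in>paths. hd p = J \<and> last p = K \<and> path_length p = card (sym_diff J (K :: 'i::finite set))"
proof (induction "card (sym_diff J K)" arbitrary: J)
  case 0
  then have "sym_diff J K = {}" by simp
  then have "J = K" by auto
  then show ?case by (intro bexI[of _ "[K]"]) (auto simp: path_length_def paths_def)
next
  case (Suc m)
  then obtain i where i: "i \<in> sym_diff J K" by (metis card.empty ex_in_conv nat.distinct(1))
  define J' where "J' = sym_diff J {i}"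
  have e: "sym_diff J' K = sym_diff J K - {i}" "sym_diff J J' = {i}" using i by (auto simp: J'_def)
  have "m = card (sym_diff J' K)" unfolding e(1) using Suc(2) i by simp
  from Suc(1)[OF this] obtain p where p: "p \<in> paths" "hd p = J'" "last p = K" "path_length p = m"
    using \<open>m = card (sym_diff J' K)\<close> by metis
  have ne: "p \<noteq> []" by (rule paths_nonempty[OF p(1)])
  have "adjacent J (hd p)" unfolding adjacent_def p(2) e(2) by simp
  then have "J # p \<in> paths" using p(1) by (simp add: paths_def successively_Cons)
  moreover have "path_length (J # p) = card (sym_diff J K)"
    using p(4) ne Suc(2) by (cases p) (simp_all add: path_length_def)
  ultimately show ?case using p(3) ne by (intro bexI[of _ "J # p"]) simp_all
qed

definition "spath J K = (SOME p. p \<in> paths \<and> hd p = J \<and> last p = K \<and> path_length p = card (sym_diff J (K :: 'i::finite set)))"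

lemma spath: "spath J K \<in> paths" "hd (spath J K) = J" "last (spath J K) = K"
  "path_length (spath J K) = card (sym_diff J (K :: 'i::finite set))"
proof -
  have "\<exists>p. p \<in> paths \<and> hd p = J \<and> last p = K \<and> path_length p = card (sym_diff J K)"
    using path_between_exists[of J K] by blast
  from someI_ex[OF this] show "spath J K \<in> paths" "hd (spath J K) = J" "last (spath J K) = K"
    "path_length (spath J K) = card (sym_diff J K)" unfolding spath_def by auto
qed

lemma up_spath: "up (spath J K) = upc J (K :: 'i::finite set)"
  using up_excess[of "spath J K" 0] by (simp add: spath)

text \<open>A loop of length 2, whose symbol is the variable. The toggled index
  \<open>undefined\<close> stands for an arbitrary one, and the vertex in the middle may lie outside
  \<open>vertices a\<close>.\<close>

definition "bloop J = [J, sym_diff J {undefined}, J :: 'i::finite set]"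

lemma bloop: "bloop J \<in> paths" "hd (bloop J) = J" "last (bloop J) = J" "path_length (bloop J) = 2" "up (bloop J) = 1"
proof -
  have "sym_diff J (sym_diff J {undefined}) = {undefined}" "sym_diff (sym_diff J {undefined}) J = {undefined}" by auto
  then show p: "bloop J \<in> paths" by (simp add: bloop_def paths_def adjacent_def)
  show "hd (bloop J) = J" "last (bloop J) = J" "path_length (bloop J) = 2" by (simp_all add: bloop_def path_length_def)
  then show "up (bloop J) = 1" using up_length[OF p] by simp
qed

lemma length_join: "p \<in> paths \<Longrightarrow> q \<in> paths \<Longrightarrow> path_length (q @ tl p) = path_length p + path_length q"
  using paths_nonempty[of p] paths_nonempty[of q] by (cases p; cases q) (auto simp: path_length_def)

text \<open>Components are indexed by the vertices themselves. A shortest path makes exactly the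
  upward steps forced by its ends, so its symbol is the minimal power of the variable and the unit
  is 1.\<close>

lemma symbol_algebra_pi_B_pi:
  "symbol_algebra (pi_B_pi a) (vertices a) (\<lambda>J. J) (vertices a) prho
     (\<lambda>K J. elem (spath J K) 1) (\<lambda>_ _. 1) (\<lambda>J :: 'i::finite set. elem (bloop J) 1)"
proof -
  let ?V = "vertices a :: 'i set set"
  interpret complex_algebra "pi_B_pi a :: (complex, ('i path \<Rightarrow>\<^sub>0 complex) set) module"
    by (rule complex_algebra_pi_B_pi)
  have el: "\<exists>f. keys f \<subseteq> vpaths ?V \<and> keys f \<subseteq> paths \<and> b = path_class f" if "b \<in> carrier (pi_B_pi a)" for b
    using that vpaths_paths unfolding C_simps(1) by blast
  show ?thesis
  proof
    show "\<exists>U. finite U \<and> (\<forall>q. q \<notin> U \<longrightarrow> prho b q p = 0)" for b and p :: "'i set"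
      by (rule exI[of _ UNIV]) simp
    show "prho b q p = 0" if "b \<in> carrier (pi_B_pi a)" "p \<in> ?V" "q \<notin> ?V" for b p q
    proof -
      note h = that
      obtain f where f: "keys f \<subseteq> vpaths ?V" "keys f \<subseteq> paths" "b = path_class f" using el[OF h(1)] by (elim exE conjE)
      have "last x \<in> ?V" if "x \<in> keys f" for x using f(1) that by (auto simp: vpaths_def)
      then have "psym f q p = 0" unfolding psym_def using that(3) by (intro sum.neutral) auto
      then show ?thesis using f by (simp add: prho)
    qed
    show "prho (b \<oplus>\<^bsub>pi_B_pi a\<^esub> c) q p = prho b q p + prho c q p"
      if "b \<in> carrier (pi_B_pi a)" "c \<in> carrier (pi_B_pi a)" for b c :: "('i path \<Rightarrow>\<^sub>0 complex) set" and p q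
    proof -
      note h = that
      obtain f g where f: "keys f \<subseteq> paths" "b = path_class f" "keys g \<subseteq> paths" "c = path_class g"
        using el[OF h(1)] el[OF h(2)] by (elim exE conjE)
      then show ?thesis by (simp add: C_simps prho psym_add)
    qed
    show "prho (b \<otimes>\<^bsub>pi_B_pi a\<^esub> c) r p = (\<Sum>q\<in>U. prho b r q * prho c q p)"
      if "b \<in> carrier (pi_B_pi a)" "c \<in> carrier (pi_B_pi a)" "finite U" "\<And>q. q \<notin> U \<Longrightarrow> prho c q p = 0" for b c :: "('i path \<Rightarrow>\<^sub>0 complex) set" and p r U
    proof -
      note h = that
      obtain f g where f: "keys f \<subseteq> paths" "b = path_class f" "keys g \<subseteq> paths" "c = path_class g"
        using el[OF h(1)] el[OF h(2)] by (elim exE conjE)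
      have "prho (b \<otimes>\<^bsub>pi_B_pi a\<^esub> c) r p = (\<Sum>q\<in>UNIV. prho b r q * prho c q p)"
        using f by (simp add: C_simps prho pmul_closed psym_mult)
      also have "\<dots> = (\<Sum>q\<in>U. prho b r q * prho c q p)"
        by (rule sum.mono_neutral_right) (use that(4) in auto)
      finally show ?thesis .
    qed
    show "prho (c \<odot>\<^bsub>pi_B_pi a\<^esub> \<one>\<^bsub>pi_B_pi a\<^esub>) q p = (if q = p then fps_const c else 0)" if "p \<in> ?V" "q \<in> ?V" for c p q
    proof -
      have e: "pscale c (pidem ?V) = (\<Sum>J\<in>?V. single [J] c)"
        unfolding pidem_def pscale_sum by (intro sum.cong refl poly_mapping_eqI) (simp add: lookup_single when_def)
      have cl: "keys (\<Sum>J\<in>?V. single [J] c) \<subseteq> paths" by (intro keys_sum_subset) (auto simp: paths_def)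
      have "prho (c \<odot>\<^bsub>pi_B_pi a\<^esub> \<one>\<^bsub>pi_B_pi a\<^esub>) q p = psym (\<Sum>J\<in>?V. single [J] c) q p"
        unfolding C_simps(4) C_simps(6)[OF pidem_closed] e by (rule prho[OF cl])
      also have "\<dots> = (\<Sum>J\<in>?V. if J = p then (if q = p then fps_const c else 0) else 0)"
        unfolding psym_sum psym_single by (intro sum.cong) auto
      also have "\<dots> = (if q = p then fps_const c else 0)" using that by simp
      finally show ?thesis .
    qed
    show "fps_X ^ upc p q dvd prho b q p" if "b \<in> carrier (pi_B_pi a)" for b :: "('i path \<Rightarrow>\<^sub>0 complex) set" and p q
    proof -
      note h = that
      obtain f where f: "keys f \<subseteq> paths" "b = path_class f" using el[OF h] by (elim exE conjE)
      then show ?thesis using psym_dvd by (simp add: prho)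
    qed
    show "elem (spath p q) 1 \<in> carrier (pi_B_pi a)" if "p \<in> ?V" "q \<in> ?V" for p q
      by (rule elem_closed) (use that in \<open>simp add: vpaths_def spath\<close>)
    show "elem (bloop p) 1 \<in> carrier (pi_B_pi a)" if "p \<in> ?V" for p
      by (rule elem_closed) (use that in \<open>simp add: vpaths_def bloop\<close>)
  qed (auto simp: prho_elem spath bloop up_spath)
qed

lemma loops_exist: "\<exists>p\<in>paths. hd p = J \<and> last p = K \<and> path_length p = card (sym_diff J (K :: 'i::finite set)) + 2 * k"
proof (induction k)
  case 0 then show ?case using path_between_exists by auto
next
  case (Suc k)
  then obtain p where p: "p \<in> paths" "hd p = J" "last p = K" "path_length p = card (sym_diff J K) + 2 * k" by blast
  have e: "last (bloop J) = hd p" using p by (simp add: bloop)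
  have "path_length (bloop J @ tl p) = card (sym_diff J K) + 2 * Suc k"
    using length_join[OF p(1) bloop(1), of J] by (simp add: p bloop)
  then show ?case
    using join_path[OF p(1) bloop(1) e] by (intro bexI[of _ "bloop J @ tl p"] conjI) (simp_all only: p bloop)
qed

section \<open>Nilpotent modules in coordinates\<close>

locale nilpotent_object =
  fixes a :: int and M :: "((('i::finite) path \<Rightarrow>\<^sub>0 complex) set, 'v) module"
  assumes M: "left_module (pi_B_pi a) M" and nil: "nilpotent_module a M"
begin

abbreviation "A \<equiv> pi_B_pi a :: (complex, ('i path \<Rightarrow>\<^sub>0 complex) set) module"
abbreviation "V \<equiv> vertices a :: 'i set set"

sublocale complex_module A M
  using M complex_algebra_pi_B_pi by (auto simp: complex_module_def)

abbreviation "e J \<equiv> elem [J] 1"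

lemma e_closed [simp]: "J \<in> V \<Longrightarrow> e J \<in> carrier A"
  by (rule elem_closed) (simp add: vpaths_def paths_def)

lemma e_path: "[J] \<in> paths" by (simp add: paths_def)

definition "W J = (if J \<in> V then {e J \<odot>\<^bsub>M\<^esub> m | m. m \<in> carrier M} else {\<zero>\<^bsub>M\<^esub>})"

lemma elem_in_W: "p \<in> vpaths V \<Longrightarrow> m \<in> carrier M \<Longrightarrow> elem p c \<odot>\<^bsub>M\<^esub> m \<in> W (last p)"
proof -
  assume p: "p \<in> vpaths V" and m: "m \<in> carrier M"
  then have pp: "p \<in> paths" "last p \<in> V" by (auto simp: vpaths_def)
  have "elem p c = e (last p) \<otimes>\<^bsub>A\<^esub> elem p c" using elem_mult[OF e_path pp(1)] by simp
  then have "elem p c \<odot>\<^bsub>M\<^esub> m = e (last p) \<odot>\<^bsub>M\<^esub> (elem p c \<odot>\<^bsub>M\<^esub> m)"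
    using pp elem_closed[OF p] m by (metis e_closed smult_assoc)
  then show ?thesis using pp elem_closed[OF p] m unfolding W_def by auto
qed

lemma elem_vanish: "p \<in> vpaths V \<Longrightarrow> m \<in> W J \<Longrightarrow> J \<noteq> hd p \<Longrightarrow> elem p c \<odot>\<^bsub>M\<^esub> m = \<zero>\<^bsub>M\<^esub>"
proof -
  assume p: "p \<in> vpaths V" and m: "m \<in> W J" and J: "J \<noteq> hd p"
  have pp: "p \<in> paths" using p by (auto simp: vpaths_def)
  show ?thesis
  proof (cases "J \<in> V")
    case True
    then obtain n where n: "n \<in> carrier M" "m = e J \<odot>\<^bsub>M\<^esub> n" using m by (auto simp: W_def)
    have "elem p c \<odot>\<^bsub>M\<^esub> m = (elem p c \<otimes>\<^bsub>A\<^esub> e J) \<odot>\<^bsub>M\<^esub> n"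
      using n True elem_closed[OF p] by (simp add: smult_assoc)
    also have "elem p c \<otimes>\<^bsub>A\<^esub> e J = \<zero>\<^bsub>A\<^esub>" using J by (simp add: elem_mult pp e_path)
    finally show ?thesis using n by simp
  qed (use m elem_closed[OF p] in \<open>simp add: W_def\<close>)
qed

lemma e_W: "m \<in> W J \<Longrightarrow> J \<in> V \<Longrightarrow> e J \<odot>\<^bsub>M\<^esub> m = m"
proof -
  assume m: "m \<in> W J" and J: "J \<in> V"
  then obtain n where n: "n \<in> carrier M" "m = e J \<odot>\<^bsub>M\<^esub> n" by (auto simp: W_def)
  have "e J \<odot>\<^bsub>M\<^esub> m = (e J \<otimes>\<^bsub>A\<^esub> e J) \<odot>\<^bsub>M\<^esub> n" using n J by (simp add: smult_assoc)
  then show ?thesis using n by (simp add: elem_mult e_path)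
qed

lemma W_carrier: "W J \<subseteq> carrier M" by (auto simp: W_def)

lemma sum_e: "m \<in> carrier M \<Longrightarrow> m = (\<Oplus>\<^bsub>M\<^esub>J\<in>V. e J \<odot>\<^bsub>M\<^esub> m)"
proof -
  assume m: "m \<in> carrier M"
  have "path_class (pidem X) \<odot>\<^bsub>M\<^esub> m = (\<Oplus>\<^bsub>M\<^esub>J\<in>X. e J \<odot>\<^bsub>M\<^esub> m)" if "finite X" "X \<subseteq> V" for X
    using that
  proof (induction X rule: finite_induct)
    case empty
    then show ?case using m C_simps(5)[where 'i = 'i, of a, symmetric] by (simp add: pidem_def)
  next
    case (insert J X)
    have cl: "path_class (pidem X) \<in> carrier A"
    proof -
      have "keys (pidem X) \<subseteq> vpaths V"
        using pidem_vpaths[of X] insert(4) by (auto simp: vpaths_def)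
      then show ?thesis unfolding C_simps(1) by blast
    qed
    have "path_class (pidem (insert J X)) = e J \<oplus>\<^bsub>A\<^esub> path_class (pidem X)"
      using insert(1,2) by (simp add: elem_def C_simps(2) pidem_closed e_path) (simp add: pidem_def)
    then have "path_class (pidem (insert J X)) \<odot>\<^bsub>M\<^esub> m = e J \<odot>\<^bsub>M\<^esub> m \<oplus>\<^bsub>M\<^esub> path_class (pidem X) \<odot>\<^bsub>M\<^esub> m"
      using m cl insert by (simp add: smult_l_distr)
    moreover have "(\<Oplus>\<^bsub>M\<^esub>J\<in>insert J X. e J \<odot>\<^bsub>M\<^esub> m) = e J \<odot>\<^bsub>M\<^esub> m \<oplus>\<^bsub>M\<^esub> (\<Oplus>\<^bsub>M\<^esub>J\<in>X. e J \<odot>\<^bsub>M\<^esub> m)"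
      by (rule M.finsum_insert) (use insert m in auto)
    ultimately show ?case using insert by simp
  qed
  from this[of V] show ?thesis using m by (simp add: C_simps(4)[symmetric])
qed

text \<open>Existence is the decomposition of the identity into the \<open>e J\<close>. For
  uniqueness, \<open>e J\<close> applied to any decomposition isolates its term at
  \<open>J\<close>.\<close>

lemma direct: "is_direct_sum M W"
  unfolding is_direct_sum_def
proof
  fix m assume m: "m \<in> carrier M"
  define f where "f J = (if J \<in> V then e J \<odot>\<^bsub>M\<^esub> m else \<zero>\<^bsub>M\<^esub>)" for J
  have fM: "f J \<in> carrier M" for J using m by (simp add: f_def)
  have "m = (\<Oplus>\<^bsub>M\<^esub>J\<in>V. f J)"
    by (subst sum_e[OF m]) (rule M.finsum_cong', use m in \<open>auto simp: f_def\<close>)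
  also have "\<dots> = (\<Oplus>\<^bsub>M\<^esub>J\<in>{l. f l \<noteq> \<zero>\<^bsub>M\<^esub>}. f J)"
    by (rule M.add.finprod_mono_neutral_cong_right) (use fM in \<open>auto simp: f_def\<close>)
  finally have mf: "m = (\<Oplus>\<^bsub>M\<^esub>J\<in>{l. f l \<noteq> \<zero>\<^bsub>M\<^esub>}. f J)" .
  show "\<exists>!f. (\<forall>l. f l \<in> W l) \<and> finite {l. f l \<noteq> \<zero>\<^bsub>M\<^esub>} \<and> m = (\<Oplus>\<^bsub>M\<^esub>l\<in>{l. f l \<noteq> \<zero>\<^bsub>M\<^esub>}. f l)"
  proof (rule ex1I[of _ f])
    show "(\<forall>l. f l \<in> W l) \<and> finite {l. f l \<noteq> \<zero>\<^bsub>M\<^esub>} \<and> m = (\<Oplus>\<^bsub>M\<^esub>l\<in>{l. f l \<noteq> \<zero>\<^bsub>M\<^esub>}. f l)"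
      using mf m by (auto simp: f_def W_def)
    fix g assume g: "(\<forall>l. g l \<in> W l) \<and> finite {l. g l \<noteq> \<zero>\<^bsub>M\<^esub>} \<and> m = (\<Oplus>\<^bsub>M\<^esub>l\<in>{l. g l \<noteq> \<zero>\<^bsub>M\<^esub>}. g l)"
    then have gW: "g l \<in> W l" "g l \<in> carrier M" for l using W_carrier by blast+
    show "g = f"
    proof
      fix J
      show "g J = f J"
      proof (cases "J \<in> V")
        case True
        have "m = (\<Oplus>\<^bsub>M\<^esub>l\<in>UNIV. g l)"
          unfolding conjunct2[OF conjunct2[OF g]]
          by (rule M.add.finprod_mono_neutral_cong_left) (use gW in auto)
        then have "e J \<odot>\<^bsub>M\<^esub> m = (\<Oplus>\<^bsub>M\<^esub>l\<in>UNIV. e J \<odot>\<^bsub>M\<^esub> g l)"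
          using smult_finsum[of "e J" UNIV g] True gW by auto
        also have "\<dots> = (\<Oplus>\<^bsub>M\<^esub>l\<in>UNIV. if J = l then g l else \<zero>\<^bsub>M\<^esub>)"
        proof (rule M.finsum_cong')
          show "e J \<odot>\<^bsub>M\<^esub> g l = (if J = l then g l else \<zero>\<^bsub>M\<^esub>)" for l
            using e_W[of "g J" J] elem_vanish[of "[J]" "g l" l 1] gW True by (auto simp: vpaths_def e_path)
        qed (use gW in auto)
        also have "\<dots> = g J" by (rule M.add.finprod_singleton) (use gW in auto)
        finally show ?thesis using True by (simp add: f_def)
      qed (use gW[of J] in \<open>simp add: f_def W_def\<close>)
    qed
  qed
qed

lemma subspace_W: "subspace_set (W J)"
proof (cases "J \<in> V")
  case True
  have WI: "e J \<odot>\<^bsub>M\<^esub> m \<in> W J" if "m \<in> carrier M" for m using that True by (auto simp: W_def)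
  have WE: "\<exists>n\<in>carrier M. m = e J \<odot>\<^bsub>M\<^esub> n" if "m \<in> W J" for m using that True by (auto simp: W_def)
  show ?thesis unfolding subspace_set_def
  proof (intro conjI ballI allI W_carrier)
    show "\<zero>\<^bsub>M\<^esub> \<in> W J" using WI[of "\<zero>\<^bsub>M\<^esub>"] True by simp
    fix m assume m: "m \<in> W J"
    obtain m' where m': "m' \<in> carrier M" "m = e J \<odot>\<^bsub>M\<^esub> m'" using WE[OF m] by blast
    show "cs c m \<in> W J" for c using WI[of "cs c m'"] m' True by (simp add: smult_cs)
    fix n assume n: "n \<in> W J"
    obtain n' where n': "n' \<in> carrier M" "n = e J \<odot>\<^bsub>M\<^esub> n'" using WE[OF n] by blast
    show "m \<oplus>\<^bsub>M\<^esub> n \<in> W J" using WI[of "m' \<oplus>\<^bsub>M\<^esub> n'"] m' n' True by (simp add: smult_r_distr)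
  qed
next
  case False
  then show ?thesis by (simp add: subspace_set_def W_def)
qed

lemma finite_dim_W: "finite_dim A M (W J)"
proof (cases "J \<in> V")
  case True
  obtain S where S: "finite S" "S \<subseteq> carrier M" "\<And>m. m \<in> carrier M \<Longrightarrow> \<exists>c. m = (\<Oplus>\<^bsub>M\<^esub>s\<in>S. cs (c s) s)"
  proof -
    have "finite_dim A M (carrier M)" using nil by (simp add: nilpotent_module_def)
    then show ?thesis using that unfolding finite_dim_def by (elim exE conjE) (rule that, auto)
  qed
  show ?thesis
  proof (rule finite_dimI[where X = S and F = "\<lambda>s. e J \<odot>\<^bsub>M\<^esub> s"])
    fix m assume "m \<in> W J"
    then obtain n where n: "n \<in> carrier M" "m = e J \<odot>\<^bsub>M\<^esub> n" using True by (auto simp: W_def)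
    obtain c where c: "n = (\<Oplus>\<^bsub>M\<^esub>s\<in>S. cs (c s) s)" using S(3) n by blast
    have "m = (\<Oplus>\<^bsub>M\<^esub>s\<in>S. e J \<odot>\<^bsub>M\<^esub> cs (c s) s)"
      unfolding n(2) c by (rule smult_finsum) (use S True in auto)
    also have "\<dots> = (\<Oplus>\<^bsub>M\<^esub>s\<in>S. cs (c s) (e J \<odot>\<^bsub>M\<^esub> s))"
      by (rule M.finsum_cong') (use S True in \<open>auto simp: smult_cs\<close>)
    finally show "\<exists>c. m = (\<Oplus>\<^bsub>M\<^esub>x\<in>S. cs (c x) (e J \<odot>\<^bsub>M\<^esub> x))" by blast
  qed (use S True W_carrier in \<open>auto simp: W_def\<close>)
next
  case False
  then show ?thesis unfolding finite_dim_def W_def by (intro exI[of _ "{}"]) auto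
qed

sublocale decomposed_module A M V W
  by unfold_locales ((rule direct subspace_W finite_dim_W)+, simp add: W_def)

text \<open>Up to the relations a path is a shortest path preceded by loops of length 2, so
  \<open>keyed\<close> follows by induction on the number of loops and extends to linear
  combinations. The loops act nilpotently because their powers are paths of growing length.\<close>

lemma key_rep:
  assumes co: "coordinates s \<Psi>"
  shows "key_rep A V (\<lambda>J. J) V prho (\<lambda>K J. elem (spath J K) 1) (\<lambda>_ _. 1) (\<lambda>J. elem (bloop J) 1) s"
proof -
  interpret sa: symbol_algebra A V "\<lambda>J. J" V prho "\<lambda>K J. elem (spath J K) 1" "\<lambda>_ _. 1" "\<lambda>J. elem (bloop J) 1"
    by (rule symbol_algebra_pi_B_pi)
  note cD = coordinatesD[OF co]
  interpret m: matrix_rep A V s by (rule cD(1))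
  have s_elem: "s (elem p c) q r w = 0" if "p \<in> vpaths V" "r \<noteq> hd p \<or> q \<noteq> last p" for p c q r w
    using that(2)
  proof
    assume "r \<noteq> hd p"
    then show ?thesis using elem_vanish[OF that(1)] by (intro cD(4) elem_closed that(1)) auto
  next
    assume "q \<noteq> last p"
    show ?thesis
      by (rule cD(5)[of _ _ "last p"]) (use elem_in_W[OF that(1)] W_carrier elem_closed[OF that(1)] \<open>q \<noteq> last p\<close> in auto)
  qed
  have bl: "bloop J \<in> vpaths V" if "J \<in> V" for J using that by (simp add: vpaths_def bloop)
  \<comment> \<open>The iterates of \<open>bloop J\<close> act as single paths of length
    \<open>2 * N\<close>, to which the nilpotency of the module applies.\<close>
  have "\<exists>l\<in>paths. hd l = J \<and> last l = J \<and> path_length l = 2 * N \<and> (\<forall>w. (s (elem (bloop J) 1) J J ^^ N) (s \<one>\<^bsub>A\<^esub> J J w) = s (elem l 1) J J w)"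
    if J: "J \<in> V" for J N
  proof (induction N)
    case 0
    have "s \<one>\<^bsub>A\<^esub> J J w = s (e J) J J w" for w
      by (rule cD(3)) (use J e_W W_closed(1) in auto)
    then show ?case by (intro bexI[of _ "[J]"]) (auto simp: e_path path_length_def)
  next
    case (Suc N)
    then obtain l where l: "l \<in> paths" "hd l = J" "last l = J" "path_length l = 2 * N"
      "\<And>w. (s (elem (bloop J) 1) J J ^^ N) (s \<one>\<^bsub>A\<^esub> J J w) = s (elem l 1) J J w" by blast
    have lv: "l \<in> vpaths V" using l J by (simp add: vpaths_def)
    have "s (elem (bloop J) 1 \<otimes>\<^bsub>A\<^esub> elem l 1) J J w = s (elem (bloop J) 1) J J (s (elem l 1) J J w)" for w
      by (rule m.s_mult_single) (use elem_closed lv bl[OF J] s_elem l in auto)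
    moreover have "elem (bloop J) 1 \<otimes>\<^bsub>A\<^esub> elem l 1 = elem (l @ tl (bloop J)) 1"
      using elem_mult[OF bloop(1)[of J] l(1)] l(3) by (simp add: bloop)
    ultimately show ?case
      using join_path[OF bloop(1)[of J] l(1)] length_join[OF bloop(1)[of J] l(1)] l
      by (intro bexI[of _ "l @ tl (bloop J)"]) (auto simp: bloop)
  qed note loop = this
  obtain N0 where N0: "\<And>l x m. N0 \<le> l \<Longrightarrow> x \<in> carrier A \<Longrightarrow> x \<in> length_component l \<Longrightarrow> m \<in> carrier M \<Longrightarrow> x \<odot>\<^bsub>M\<^esub> m = \<zero>\<^bsub>M\<^esub>"
    using nil unfolding nilpotent_module_def by blast
  interpret nilp_rep A V "\<lambda>J. J" V prho "\<lambda>K J. elem (spath J K) 1" "\<lambda>_ _. 1" "\<lambda>J. elem (bloop J) 1" s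
  proof
    show "\<exists>N. (s (elem (bloop J) 1) J J ^^ N) (s \<one>\<^bsub>A\<^esub> J J w) = 0" if J: "J \<in> V" for J w
    proof -
      obtain l where l: "l \<in> paths" "hd l = J" "last l = J" "path_length l = 2 * N0"
        "\<And>w. (s (elem (bloop J) 1) J J ^^ N0) (s \<one>\<^bsub>A\<^esub> J J w) = s (elem l 1) J J w" using loop[OF J] by blast
      have lv: "l \<in> vpaths V" using l J by (simp add: vpaths_def)
      have "elem l 1 \<in> length_component (2 * N0)"
        unfolding length_component_def elem_def
        by (rule CollectI, rule exI[of _ "single l 1"]) (use l in auto)
      then have "s (elem l 1) J J w = 0"
        by (intro cD(4) elem_closed lv N0[of "2 * N0"]) (use W_closed(1) lv elem_closed in auto)
      then show ?thesis using l(5) by metis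
    qed
    show "\<exists>d. \<forall>w k. d \<le> k \<longrightarrow> coeff (s \<one>\<^bsub>A\<^esub> J J w) k = 0" for J by (rule cD(2))
  qed
  have k0: "keyed (elem (spath J K) 1)" if JK: "J \<in> V" "K \<in> V" for J K
  proof (rule keyed_if)
    have v: "spath J K \<in> vpaths V" using JK by (simp add: vpaths_def spath)
    show "elem (spath J K) 1 \<in> carrier A" by (rule elem_closed[OF v])
    show "(prho (elem (spath J K) 1) q p = 0 \<and> s (elem (spath J K) 1) q p w = 0) \<or>
      (prho (elem (spath J K) 1) q p = fps_X ^ upc p q * 1 \<and> s (elem (spath J K) 1) q p w = s (elem (spath p q) 1) q p w)"
      for p q w
    proof (cases "p = J \<and> q = K")
      case True then show ?thesis by (simp add: prho_elem spath up_spath)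
    next
      case False
      then show ?thesis using s_elem[OF v, of p q 1 w] by (auto simp: prho_elem spath)
    qed
  qed
  have k1: "keyed (elem p c)" if "p \<in> vpaths V" "path_length p = card (sym_diff (hd p) (last p)) + 2 * k" for p c k
    using that
  proof (induction k arbitrary: p c)
    case 0
    let ?J = "hd p" and ?K = "last p"
    have p: "p \<in> paths" "?J \<in> V" "?K \<in> V" using 0 by (auto simp: vpaths_def)
    have v: "spath ?J ?K \<in> vpaths V" using p by (simp add: vpaths_def spath)
    have "elem (spath ?J ?K) 1 \<otimes>\<^bsub>A\<^esub> (c \<odot>\<^bsub>A\<^esub> \<one>\<^bsub>A\<^esub>) = path_class (pscale c (pmul (single (spath ?J ?K) 1) (pidem V)))"
      by (simp add: elem_def C_simps pidem_closed spath pmul_pscale)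
    also have "pmul (single (spath ?J ?K) 1) (pidem V) = single (spath ?J ?K) 1"
      by (rule sandwich(3)) (use v in \<open>auto simp: spath\<close>)
    also have "pscale c (single (spath ?J ?K) 1) = single (spath ?J ?K) c"
      by (rule poly_mapping_eqI) (simp add: lookup_single when_def)
    also have "path_class (single (spath ?J ?K) c) = elem p c"
      unfolding elem_def[symmetric] by (rule elem_eq) (use p 0 in \<open>auto simp: spath\<close>)
    finally show ?case using keyed_scal[OF k0[OF p(2,3)] elem_closed[OF v], of c] by simp
  next
    case (Suc k)
    let ?J = "hd p" and ?K = "last p"
    have p: "p \<in> paths" "?J \<in> V" "?K \<in> V" using Suc by (auto simp: vpaths_def)
    \<comment> \<open>\<open>q\<close> is shorter than \<open>p\<close> by 2. With the loop in front
      it has the ends and the length of \<open>p\<close>, hence the same class.\<close>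
    obtain q where q: "q \<in> paths" "hd q = ?J" "last q = ?K" "path_length q = card (sym_diff ?J ?K) + 2 * k"
      using loops_exist by blast
    have qv: "q \<in> vpaths V" using q p by (simp add: vpaths_def)
    have jn: "last (bloop ?J) = hd q" using q by (simp add: bloop)
    have "elem q c \<otimes>\<^bsub>A\<^esub> elem (bloop ?J) 1 = elem (bloop ?J @ tl q) c"
      using elem_mult[OF q(1) bloop(1)] jn by simp
    also have "\<dots> = elem p c"
      by (rule elem_eq) (use join_path[OF q(1) bloop(1) jn] length_join[OF q(1) bloop(1)[of ?J]] q p Suc.prems in \<open>simp_all add: bloop\<close>)
    finally have e: "elem p c = elem q c \<otimes>\<^bsub>A\<^esub> elem (bloop ?J) 1" by simp
    show ?case unfolding e
    proof (rule keyed_mult)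
      show "keyed (elem q c)" by (rule Suc.IH) (use qv q in auto)
      show "s (elem (bloop ?J) 1) q' p' w = 0" if "q' \<noteq> p'" for p' q' w
        by (rule s_elem[OF bl[OF p(2)]]) (use that in \<open>auto simp: bloop\<close>)
      show "prho (elem (bloop ?J) 1) q' p' = 0" if "q' \<noteq> p'" for p' q'
        using that by (auto simp: prho_elem bloop)
      show "s (elem (bloop ?J) 1) p' p' w = Y p' (prho (elem (bloop ?J) 1) p' p') w" if "p' \<in> V" for p' w
      proof (cases "p' = ?J")
        case True
        then show ?thesis using that by (simp add: prho_elem bloop Y_X Z_def)
      next
        case False
        then show ?thesis using s_elem[OF bl[OF p(2)], of p' p' 1 w] by (auto simp: prho_elem bloop)
      qed
    qed (use elem_closed[OF qv] elem_closed[OF bl[OF p(2)]] in auto)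
  qed
  have k2: "keyed (elem p c)" if "p \<in> vpaths V" for p c
    using length_excess[of p] k1[OF that] that by (auto simp: vpaths_def)
  have k3: "keyed (path_class (\<Sum>p\<in>X. single p (c p))) \<and> keys (\<Sum>p\<in>X. single p (c p)) \<subseteq> vpaths V"
    if "finite X" "X \<subseteq> vpaths V" for X and c :: "'i path \<Rightarrow> complex"
    using that
  proof (induction X rule: finite_induct)
    case empty
    have "s \<zero>\<^bsub>A\<^esub> q p w = 0" for p q w by (rule cD(4)) (use W_closed(1) in auto)
    moreover have "prho \<zero>\<^bsub>A\<^esub> q p = 0" for p q unfolding C_simps(5) by (subst prho) auto
    ultimately have "keyed \<zero>\<^bsub>A\<^esub>" by (intro keyed_if) auto
    then show ?case unfolding C_simps(5) by simp
  next
    case (insert p X)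
    let ?f = "\<Sum>p\<in>X. single p (c p)"
    have f: "keyed (path_class ?f)" "keys ?f \<subseteq> vpaths V" "p \<in> vpaths V" using insert by auto
    have e: "elem p (c p) \<oplus>\<^bsub>A\<^esub> path_class ?f = path_class (single p (c p) + ?f)"
      unfolding elem_def by (rule C_simps(2)) (use f vpaths_paths[OF f(2)] in \<open>auto simp: vpaths_def\<close>)
    have mem: "path_class ?f \<in> carrier A" using f(2) unfolding C_simps(1) by blast
    have "keyed (path_class (single p (c p) + ?f))"
      unfolding e[symmetric] by (rule keyed_add[OF elem_closed[OF f(3)] mem k2[OF f(3)] f(1)])
    moreover have "keys (single p (c p) + ?f) \<subseteq> vpaths V"
      using keys_plus_subset[of "single p (c p)" ?f] keys_single_vpaths[OF f(3), of "c p"] f(2) by blast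
    ultimately show ?case using insert(1,2) by simp
  qed
  show ?thesis
  proof
    fix b assume "b \<in> carrier A"
    then obtain f where f: "keys f \<subseteq> vpaths V" "b = path_class f" unfolding C_simps(1) by blast
    then show "keyed b" using k3[OF finite_keys f(1), of "lookup f"] sum_single_keys[of f] by simp
  qed
qed

end

section \<open>The functor to nilpotent modules\<close>

locale nilpotent_functor =
  fixes a :: int and \<iota> :: "('i::finite) set coords \<Rightarrow> 'v"
  assumes inj: "inj_on \<iota> {f. keys f \<subseteq> vertices a}"
begin

abbreviation "A \<equiv> pi_B_pi a :: (complex, ('i path \<Rightarrow>\<^sub>0 complex) set) module"
abbreviation "V \<equiv> vertices a :: 'i set set"

sublocale symbol_functor A V "\<lambda>J. J" V prho "\<lambda>K J. elem (spath J K) 1" "\<lambda>_ _. 1" "\<lambda>J. elem (bloop J) 1" \<iota>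
  by (intro symbol_functor.intro symbol_functor_axioms.intro symbol_algebra_pi_B_pi inj)

text \<open>By \<open>up_length\<close> a long path has many upward steps, so its coefficient is
  divisible by a high power of the variable, which acts as zero by \<open>y_nil\<close>.\<close>

lemma nilpotent_Fo:
  assumes y: "sys V excess y" shows "nilpotent_module a (Fo y)"
proof -
  interpret y: sys V excess y by (rule y)
  interpret t: transport A \<iota> "mc y" "matrix_rep.mact (smat y)" by (rule transport_Fo[OF y])
  interpret m: matrix_rep A V "smat y" by (rule matrix_rep_smat[OF y])
  have "finite_dim A (Fo y) (carrier (Fo y))"
  proof -
    have "carrier (Fo y) = \<iota> ` {f \<in> mc y. keys f \<subseteq> V}" using m.mcar_in by (auto simp: Fo_def)
    then show ?thesis using finite_dim_Fo[OF y, of V] by simp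
  qed
  moreover have "\<exists>N. \<forall>l\<ge>N. \<forall>x \<in> carrier A \<inter> length_component l. \<forall>m\<in>carrier (Fo y). x \<odot>\<^bsub>Fo y\<^esub> m = \<zero>\<^bsub>Fo y\<^esub>"
  proof -
    have "\<forall>J\<in>V. \<exists>N. \<forall>f K w. y (fps_X ^ N * f) K J w = 0" using y.y_nil by blast
    then obtain n where n: "\<And>J f K w. J \<in> V \<Longrightarrow> y (fps_X ^ n J * f) K J w = 0" by metis
    define c where "c = CARD('i)"
    \<comment> \<open>Since \<open>2 * up p \<ge> l - c\<close>, the bound
      \<open>up p \<ge> upc J K + n J\<close> holds for \<open>l \<ge> 2 * n J + 3 * c\<close>. The
      sum dominates every \<open>n J\<close>, and \<open>c\<close> bounds both
      \<open>card (hd p)\<close> and \<open>upc J K\<close>.\<close>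
    define N where "N = 2 * (\<Sum>J\<in>V. n J) + 3 * c"
    have "x \<odot>\<^bsub>Fo y\<^esub> m = \<zero>\<^bsub>Fo y\<^esub>" if l: "N \<le> l" and x: "x \<in> carrier A" "x \<in> length_component l" and m: "m \<in> carrier (Fo y)" for l x m
    proof -
      obtain g where g: "m = \<iota> g" "g \<in> mc y" using m by (auto simp: Fo_def)
      obtain f :: "'i path \<Rightarrow>\<^sub>0 complex" where f: "x = path_class f" "keys f \<subseteq> paths" "\<And>p. p \<in> keys f \<Longrightarrow> path_length p = l"
        using x(2) unfolding length_component_def by auto
      have "y (ksym x K J) K J w = 0" if JK: "J \<in> V" "K \<in> V" for J K w
      proof -
        have cc: "card (X :: 'i set) \<le> c" for X unfolding c_def by (rule card_mono) auto
        have nJ: "n J \<le> (\<Sum>J\<in>V. n J)" by (rule member_le_sum) (use JK in auto)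
        have "fps_X ^ (upc J K + n J) dvd psym f K J" unfolding psym_def
        proof (rule dvd_sum)
          fix p assume p: "p \<in> keys f"
          have "2 * up p + card (hd p) = l + card (last p)" using up_length[of p] f p by auto
          then have "upc J K + n J \<le> up p" if "hd p = J" "last p = K"
            using l nJ cc[of "hd p"] cc[of "K - J"] unfolding N_def upc_def by simp
          then show "fps_X ^ (upc J K + n J) dvd (if hd p = J \<and> last p = K then fps_const (lookup f p) * fps_X ^ up p else 0)"
            by (auto intro!: dvd_mult le_imp_power_dvd)
        qed
        then obtain h where h: "psym f K J = fps_X ^ (upc J K + n J) * h" by (auto simp: dvd_def)
        have "ksym x K J = fps_X ^ n J * h"
          by (rule ksym_eqI) (use h f in \<open>simp add: prho power_add mult.assoc\<close>)
        then show ?thesis using n[OF JK(1)] by simp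
      qed
      then have "smat y x K J w = 0" for K J w by (simp add: smat_def)
      then have "m.mact x g = 0" using x(1) by (intro poly_mapping_eqI) (simp add: m.lookup_mact)
      then show ?thesis using g by (simp add: Fo_def)
    qed
    then show ?thesis by blast
  qed
  ultimately show ?thesis unfolding nilpotent_module_def by blast
qed

lemma e_Fo:
  assumes y: "sys V excess y" and J: "J \<in> V" and f: "f \<in> mc y"
  shows "elem [J] 1 \<odot>\<^bsub>Fo y\<^esub> \<iota> f = \<iota> (single J (lookup f J))"
proof -
  interpret t: transport A \<iota> "mc y" "matrix_rep.mact (smat y)" by (rule transport_Fo[OF y])
  interpret m: matrix_rep A V "smat y" by (rule matrix_rep_smat[OF y])
  interpret y: sys V excess y by (rule y)
  have eA: "elem [J] 1 \<in> carrier A" by (rule elem_closed) (use J in \<open>simp add: vpaths_def paths_def\<close>)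
  have pJ: "[J] \<in> paths" by (simp add: paths_def)
  have k: "ksym (elem [J] 1) q p = (if p = J \<and> q = J then 1 else 0)" for p q
    by (rule ksym_eqI) (simp add: prho_elem pJ)
  have "m.mact (elem [J] 1) f = single J (lookup f J)"
  proof (rule poly_mapping_eqI)
    fix q
    have "lookup (m.mact (elem [J] 1) f) q = smat y (elem [J] 1) q q (lookup f q)"
      by (rule m.lookup_mact_diag[OF eA]) (auto simp: smat_def k)
    then show "lookup (m.mact (elem [J] 1) f) q = lookup (single J (lookup f J)) q"
      using f J mc_iff[OF y] by (auto simp: smat_def k lookup_single)
  qed
  then show ?thesis using f by (simp add: Fo_def)
qed

theorem nilpotent_leg:
  "is_functor (sys_category V excess) (nilpotent_category a) Fo Fm"
  "r \<in> Obj (sys_category V excess) \<Longrightarrow> s \<in> Obj (sys_category V excess) \<Longrightarrow>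
     bij_betw (Fm r s) (Hom (sys_category V excess) r s) (Hom (nilpotent_category a) (Fo r) (Fo s))"
  "X \<in> Obj (nilpotent_category a) \<Longrightarrow> \<exists>r\<in>Obj (sys_category V excess). \<exists>f. is_iso (nilpotent_category a) X (Fo r) f"
proof -
  show "is_functor (sys_category V excess) (nilpotent_category a) Fo Fm"
    unfolding nilpotent_category_def by (rule functor_F[where Q = "nilpotent_module a", OF nilpotent_Fo])
  show "bij_betw (Fm r s) (Hom (sys_category V excess) r s) (Hom (nilpotent_category a) (Fo r) (Fo s))"
    if "r \<in> Obj (sys_category V excess)" "s \<in> Obj (sys_category V excess)"
  proof -
    have rs: "sys V excess r" "sys V excess s" using that by (auto simp: sys_category_def)
    have "\<exists>w'. s 1 p p w' = w' \<and> F (\<iota> (single p w)) = \<iota> (single p w')"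
      if F: "F \<in> module_hom A (Fo r) (Fo s)" and p: "p \<in> V" and w: "r 1 p p w = w" for F p w
    proof -
      have sg: "single p w \<in> mc r" by (rule single_mc[OF rs(1) p w])
      then have "F (\<iota> (single p w)) \<in> carrier (Fo s)" using F by (auto simp: module_hom_def Fo_def transported_module_def)
      then obtain g where g: "g \<in> mc s" "F (\<iota> (single p w)) = \<iota> g" by (auto simp: Fo_def transported_module_def)
      have eA: "elem [p] 1 \<in> carrier A" by (rule elem_closed) (use p in \<open>simp add: vpaths_def paths_def\<close>)
      \<comment> \<open>Homomorphisms commute with the vertex idempotents and hence respect
        components.\<close>
      have "F (\<iota> (single p w)) = F (elem [p] 1 \<odot>\<^bsub>Fo r\<^esub> \<iota> (single p w))"
        using e_Fo[OF rs(1) p sg] by simp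
      also have "\<dots> = elem [p] 1 \<odot>\<^bsub>Fo s\<^esub> F (\<iota> (single p w))"
        using F sg eA by (auto simp: module_hom_def Fo_def transported_module_def)
      also have "\<dots> = \<iota> (single p (lookup g p))" using e_Fo[OF rs(2) p g(1)] g(2) by simp
      finally show ?thesis using g(1) p mc_iff[OF rs(2)] by blast
    qed
    note pres = this
    have "bij_betw (Fm r s) (sys_hom V r s) (module_hom A (Fo r) (Fo s))"
      by (rule fully_faithful[OF rs]) (rule pres)
    then show ?thesis
      by (simp add: sys_category_def nilpotent_category_def module_category_def)
  qed
  show "\<exists>r\<in>Obj (sys_category V excess). \<exists>f. is_iso (nilpotent_category a) X (Fo r) f"
    if X: "X \<in> Obj (nilpotent_category a)"
  proof -
    have X': "left_module A X" "nilpotent_module a X" using X by (auto simp: nilpotent_category_def module_category_def)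
    interpret n: nilpotent_object a X by (rule nilpotent_object.intro[OF X'])
    obtain s \<Psi> where co: "n.coordinates s \<Psi>" using n.coordinates by blast
    obtain y f where "sys V excess y" "f \<in> module_hom A X (Fo y)" "bij_betw f (carrier X) (carrier (Fo y))"
      using iso_Fo[OF X'(1) n.decomposed_module_axioms co n.key_rep[OF co]] by blast
    then show ?thesis
      unfolding nilpotent_category_def using is_iso_module_category[OF X'(1)]
      by (intro bexI[of _ y]) (auto simp: sys_category_def)
  qed
qed

end

section \<open>Linear operators on polynomials\<close>

lemma lookup_scal [simp]: "lookup (scal c p) m = c * lookup p m"
  by (simp add: scal_def map.rep_eq when_def)

lemma scal_simps [simp]: "scal c 0 = 0" "scal 0 p = 0" "scal 1 p = p" "scal c (scal d p) = scal (c * d) p"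
  by (auto intro!: poly_mapping_eqI simp: mult.assoc)

lemma scal_add: "scal c (p + q) = scal c p + scal c q" "scal (c + d) p = scal c p + scal d p"
  by (auto intro!: poly_mapping_eqI simp: lookup_add algebra_simps)

lemma scal_sum: "scal c (\<Sum>x\<in>X. F x) = (\<Sum>x\<in>X. scal c (F x))"
  by (rule poly_mapping_eqI) (simp add: lookup_sum sum_distrib_left)

lemma scal_single: "scal c (single m d) = single m (c * d)"
  by (rule poly_mapping_eqI) (simp add: lookup_single when_def)

lemma scal_mult: "scal c (p * q) = p * scal c q"
  unfolding scal_def mult_map_scale_conv_mult by (simp add: algebra_simps)

definition linear_op :: "'i operator \<Rightarrow> bool" where
  "linear_op X \<longleftrightarrow> (\<forall>p q. X (p + q) = X p + X q) \<and> (\<forall>c p. X (scal c p) = scal c (X p))"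

lemma linear_opD: "linear_op X \<Longrightarrow> X (p + q) = X p + X q" "linear_op X \<Longrightarrow> X (scal c p) = scal c (X p)"
  "linear_op X \<Longrightarrow> X 0 = 0"
proof -
  show 1: "linear_op X \<Longrightarrow> X (p + q) = X p + X q" "linear_op X \<Longrightarrow> X (scal c p) = scal c (X p)" for p q c
    by (auto simp: linear_op_def)
  show "linear_op X \<Longrightarrow> X 0 = 0" using 1(2)[of 0 0] by simp
qed

lemma linear_op_sum: "linear_op X \<Longrightarrow> X (\<Sum>x\<in>U. F x) = (\<Sum>x\<in>U. X (F x))"
  by (induction U rule: infinite_finite_induct) (auto simp: linear_opD)

lemma linear_op_intros:
  "linear_op (scal c)" "linear_op (\<lambda>p. v * p)"
  "linear_op X \<Longrightarrow> linear_op Y \<Longrightarrow> linear_op (\<lambda>p. X p + Y p)"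
  "linear_op X \<Longrightarrow> linear_op Y \<Longrightarrow> linear_op (X \<circ> Y)"
proof -
  show "linear_op (\<lambda>p. v * p)" unfolding linear_op_def by (simp only: distrib_left scal_mult) simp
qed (auto simp: linear_op_def scal_add add_ac mult.commute)

abbreviation "xmon m \<equiv> single m (1 :: complex)"

lemma mpoly_expand: "p = (\<Sum>m\<in>keys p. scal (lookup p m) (xmon m))"
  unfolding scal_single by (simp add: sum_single_keys[symmetric])

lemma linear_op_expand: "linear_op X \<Longrightarrow> X p = (\<Sum>m\<in>keys p. scal (lookup p m) (X (xmon m)))"
  by (subst mpoly_expand[of p]) (simp only: linear_op_sum linear_opD)

lemma linear_op_eqI: "linear_op X \<Longrightarrow> linear_op Y \<Longrightarrow> (\<And>m. X (xmon m) = Y (xmon m)) \<Longrightarrow> X = Y"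
proof
  fix p
  assume l: "linear_op X" "linear_op Y" and e: "\<And>m. X (xmon m) = Y (xmon m)"
  have "X p = (\<Sum>m\<in>keys p. scal (lookup p m) (X (xmon m)))" by (rule linear_op_expand[OF l(1)])
  also have "\<dots> = Y p" unfolding e by (rule linear_op_expand[OF l(2), symmetric])
  finally show "X p = Y p" .
qed

definition lin_ext :: "(('i \<Rightarrow>\<^sub>0 nat) \<Rightarrow> 'i mpoly) \<Rightarrow> 'i operator" where
  "lin_ext F p = (\<Sum>m\<in>keys p. scal (lookup p m) (F m))"

lemma lin_ext: "linear_op (lin_ext F)" "lin_ext F (xmon m) = F m"
proof -
  have sup: "lin_ext F p = (\<Sum>m\<in>U. scal (lookup p m) (F m))" if "finite U" "keys p \<subseteq> U" for p U
    unfolding lin_ext_def by (rule sum.mono_neutral_left) (use that in \<open>auto simp: in_keys_iff\<close>)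
  show "lin_ext F (xmon m) = F m" by (simp add: lin_ext_def)
  have "lin_ext F (p + q) = lin_ext F p + lin_ext F q" for p q
  proof -
    have U: "finite (keys p \<union> keys q)" by simp
    show ?thesis
      unfolding sup[OF U keys_plus_subset] sup[OF U Un_upper1] sup[OF U Un_upper2]
      by (simp add: lookup_add scal_add sum.distrib)
  qed
  moreover have "lin_ext F (scal c p) = scal c (lin_ext F p)" for c p
  proof -
    have "keys (scal c p) \<subseteq> keys p" by (auto simp: in_keys_iff)
    from sup[OF _ this] show ?thesis by (simp add: lin_ext_def scal_sum)
  qed
  ultimately show "linear_op (lin_ext F)" by (simp add: linear_op_def)
qed

definition ei :: "('i \<Rightarrow>\<^sub>0 nat) \<Rightarrow> 'i \<Rightarrow> int" where "ei m i = int (lookup m i)"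
text \<open>Negative entries are truncated to 0. In \<open>shift_op\<close> this does no harm, as
  the coefficient is then zero (\<open>falling_zero\<close>).\<close>

definition en :: "('i::finite \<Rightarrow> int) \<Rightarrow> 'i \<Rightarrow>\<^sub>0 nat" where "en l = Abs_poly_mapping (\<lambda>i. nat (l i))"

lemma lookup_en [simp]: "lookup (en l) i = nat (l i)"
  unfolding en_def by (subst lookup_Abs_poly_mapping) auto

lemma ei_en: "(\<And>i. 0 \<le> l i) \<Longrightarrow> ei (en l) = l" by (auto simp: ei_def)
lemma en_ei [simp]: "en (ei m) = m" by (rule poly_mapping_eqI) (simp add: ei_def)
lemma ei_nonneg [simp]: "0 \<le> ei m i" by (simp add: ei_def)

lemma var_mon: "var i * xmon m = xmon (single i 1 + m)" by (simp add: var_def mult_single)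

lemma partial_lin_ext: "partial i = lin_ext (\<lambda>m. single (m - single i 1) (of_nat (lookup m i)))"
  by (rule ext) (simp add: partial_def lin_ext_def scal_single mult.commute)

lemma linear_partial: "linear_op (partial i)" unfolding partial_lin_ext by (rule lin_ext)

lemma partial_mon: "partial i (xmon m) = single (m - single i 1) (of_nat (lookup m i))"
  unfolding partial_lin_ext by (rule lin_ext)

lemma linear_t_partial: "linear_op (t_partial i)"
  using linear_op_intros(4)[OF linear_op_intros(2)[of "var i"] linear_partial[of i]]
  by (simp add: t_partial_def[abs_def] comp_def)

lemma t_partial_mon: "t_partial i (xmon m) = scal (of_nat (lookup m i)) (xmon m)"
proof (cases "lookup m i = 0")
  case True
  then show ?thesis by (simp add: t_partial_def partial_mon)
next
  case False
  then have "single i 1 + (m - single i 1) = m"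
    by (intro poly_mapping_eqI) (auto simp: lookup_add lookup_minus lookup_single when_def)
  then show ?thesis by (simp add: t_partial_def partial_mon var_def mult_single scal_single)
qed

lemma lookup_t_partial: "lookup (t_partial i p) m = of_nat (lookup m i) * lookup p m"
proof -
  have "t_partial i p = (\<Sum>m\<in>keys p. scal (lookup p m) (scal (of_nat (lookup m i)) (xmon m)))"
    by (subst linear_op_expand[OF linear_t_partial]) (simp only: t_partial_mon)
  then show ?thesis
    by (auto simp: lookup_sum lookup_single when_def in_keys_iff if_distrib cong: if_cong)
qed

definition hop :: "'i \<Rightarrow> complex \<Rightarrow> 'i operator" where "hop i c p = t_partial i p - scal c p"

lemma lookup_hop: "lookup (hop i c p) m = (of_nat (lookup m i) - c) * lookup p m"
  by (simp add: hop_def lookup_minus lookup_t_partial algebra_simps)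

lemma linear_hop: "linear_op (hop i c)"
  unfolding linear_op_def by (auto intro!: poly_mapping_eqI simp: lookup_hop lookup_add algebra_simps)

lemma hop_mon: "hop i c (xmon m) = scal (of_nat (lookup m i) - c) (xmon m)"
  by (rule poly_mapping_eqI) (simp add: lookup_hop lookup_single when_def)

lemma hop_alt: "hop i c = (\<lambda>p. t_partial i p + scal (- c) p)"
  by (rule ext, rule poly_mapping_eqI) (simp add: hop_def lookup_minus lookup_add)

section \<open>Normal forms in the Weyl algebra\<close>

text \<open>\<open>shift_op d\<close> is the product of the \<open>t\<^sub>i\<close> with \<open>d i > 0\<close> and the \<open>\<partial>\<^sub>i\<close> with \<open>d i < 0\<close>, each with
  multiplicity \<open>\<bar>d i\<bar>\<close>.\<close>

definition falling :: "('i::finite \<Rightarrow> int) \<Rightarrow> ('i \<Rightarrow>\<^sub>0 nat) \<Rightarrow> complex" where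
  "falling d m = (\<Prod>i\<in>UNIV. \<Prod>k<nat (- d i). of_nat (lookup m i) - of_nat k)"

definition shift_op :: "('i::finite \<Rightarrow> int) \<Rightarrow> 'i operator" where
  "shift_op d = lin_ext (\<lambda>m. scal (falling d m) (xmon (en (\<lambda>i. ei m i + d i))))"

lemma linear_shift_op: "linear_op (shift_op d)"
  unfolding shift_op_def by (rule lin_ext)

lemma shift_op_mon: "shift_op d (xmon m) = scal (falling d m) (xmon (en (\<lambda>i. ei m i + d i)))"
  unfolding shift_op_def by (rule lin_ext)

text \<open>If there are more derivatives in a variable than its exponent allows, one factor of the
  falling factorial is zero.\<close>

lemma falling_zero: "ei m i + d i < 0 \<Longrightarrow> falling d m = 0"
proof -
  assume "ei m i + d i < 0"
  then have "lookup m i < nat (- d i)" by (simp add: ei_def)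
  then have "(\<Prod>k<nat (- d i). of_nat (lookup m i) - (of_nat k :: complex)) = 0"
    by (intro prod_zero) auto
  then show ?thesis unfolding falling_def by (intro prod_zero) auto
qed

text \<open>The equation is cross-multiplied because the factors may vanish.\<close>

lemma falling_upd: "falling (d(i := e)) m * (\<Prod>k<nat (- d i). of_nat (lookup m i) - of_nat k)
   = falling d m * (\<Prod>k<nat (- e). of_nat (lookup m i) - of_nat k)"
proof -
  have 1: "falling d m = (\<Prod>k<nat (- d i). of_nat (lookup m i) - of_nat k) *
      (\<Prod>j\<in>UNIV - {i}. \<Prod>k<nat (- d j). of_nat (lookup m j) - of_nat k)" for d
    unfolding falling_def by (rule prod.remove) auto
  have "(\<Prod>j\<in>UNIV - {i}. \<Prod>k<nat (- (d(i := e)) j). of_nat (lookup m j) - (of_nat k :: complex)) =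
      (\<Prod>j\<in>UNIV - {i}. \<Prod>k<nat (- d j). of_nat (lookup m j) - of_nat k)"
    by (rule prod.cong) auto
  then show ?thesis unfolding 1[of d] 1[of "d(i := e)"] by simp
qed

lemma falling_upd_nonneg: "0 \<le> d i \<Longrightarrow> 0 \<le> e \<Longrightarrow> falling (d(i := e)) m = falling d m"
  using falling_upd[of d i e m] by simp

lemma falling_upd_pred: "d i \<le> 0 \<Longrightarrow> falling (d(i := d i - 1)) m = falling d m * (of_nat (lookup m i) + of_int (d i))"
proof -
  assume d: "d i \<le> 0"
  have 1: "falling d m = (\<Prod>k<nat (- d i). of_nat (lookup m i) - of_nat k) *
      (\<Prod>j\<in>UNIV - {i}. \<Prod>k<nat (- d j). of_nat (lookup m j) - of_nat k)" for d
    unfolding falling_def by (rule prod.remove) auto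
  have "(\<Prod>j\<in>UNIV - {i}. \<Prod>k<nat (- (d(i := d i - 1)) j). of_nat (lookup m j) - (of_nat k :: complex)) =
      (\<Prod>j\<in>UNIV - {i}. \<Prod>k<nat (- d j). of_nat (lookup m j) - of_nat k)"
    by (rule prod.cong) auto
  moreover have "nat (- (d(i := d i - 1)) i) = Suc (nat (- d i))" using d by simp
  moreover have "of_nat (nat (- d i)) = - (of_int (d i) :: complex)" using d by simp
  ultimately show ?thesis unfolding 1[of d] 1[of "d(i := d i - 1)"] by (simp add: mult_ac)
qed

lemma var_shift_op_nonneg:
  assumes "0 \<le> d i" shows "(\<lambda>p. var i * p) \<circ> shift_op d = shift_op (d(i := d i + 1))"
proof (rule linear_op_eqI)
  fix m
  have "xmon (single i 1 + en (\<lambda>j. ei m j + d j)) = xmon (en (\<lambda>j. ei m j + (d(i := d i + 1)) j))" if "falling d m \<noteq> 0"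
  proof -
    have "0 \<le> ei m j + d j" for j using falling_zero[of m j d] that by linarith
    then have "single i 1 + en (\<lambda>j. ei m j + d j) = en (\<lambda>j. ei m j + (d(i := d i + 1)) j)"
      by (intro poly_mapping_eqI) (auto simp: lookup_add lookup_single when_def nat_add_distrib algebra_simps)
    then show ?thesis by simp
  qed
  then show "((\<lambda>p. var i * p) \<circ> shift_op d) (xmon m) = shift_op (d(i := d i + 1)) (xmon m)"
    using assms falling_upd_nonneg[of d i "d i + 1" m]
    by (cases "falling d m = 0") (simp_all add: shift_op_mon scal_mult[symmetric] var_mon)
qed (simp_all add: linear_op_intros linear_shift_op)

text \<open>In one variable with derivative \<open>D\<close> and \<open>k = - d i\<close>, this is
  \<open>t D^k = D^(k-1) (t D - (k-1))\<close>.\<close>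

lemma var_shift_op_neg:
  assumes "d i < 0"
  shows "(\<lambda>p. var i * p) \<circ> shift_op d = shift_op (d(i := d i + 1)) \<circ> hop i (- of_int (d i) - 1)"
proof (rule linear_op_eqI)
  fix m
  let ?d = "d(i := d i + 1)"
  have f: "falling d m = falling ?d m * (of_nat (lookup m i) + of_int (d i + 1))"
    using falling_upd_pred[of ?d i m] assms by simp
  have "xmon (single i 1 + en (\<lambda>j. ei m j + d j)) = xmon (en (\<lambda>j. ei m j + ?d j))" if "falling d m \<noteq> 0"
  proof -
    have "0 \<le> ei m j + d j" for j using falling_zero[of m j d] that by linarith
    then have "single i 1 + en (\<lambda>j. ei m j + d j) = en (\<lambda>j. ei m j + ?d j)"
      by (intro poly_mapping_eqI) (auto simp: lookup_add lookup_single when_def nat_add_distrib algebra_simps)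
    then show ?thesis by simp
  qed
  then have "((\<lambda>p. var i * p) \<circ> shift_op d) (xmon m) = scal (falling d m) (xmon (en (\<lambda>j. ei m j + ?d j)))"
    by (cases "falling d m = 0") (simp_all add: shift_op_mon scal_mult[symmetric] var_mon)
  also have "\<dots> = (shift_op ?d \<circ> hop i (- of_int (d i) - 1)) (xmon m)"
    unfolding f by (simp add: hop_mon linear_opD(2)[OF linear_shift_op] shift_op_mon algebra_simps)
  finally show "((\<lambda>p. var i * p) \<circ> shift_op d) (xmon m) = (shift_op ?d \<circ> hop i (- of_int (d i) - 1)) (xmon m)" .
qed (simp_all add: linear_op_intros linear_shift_op linear_hop)

lemma partial_shift_op_mon:
  "partial i (shift_op d (xmon m)) =
     scal (falling d m * (of_nat (lookup m i) + of_int (d i))) (xmon (en (\<lambda>j. ei m j + (d(i := d i - 1)) j)))"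
proof (cases "falling d m = 0")
  case False
  then have nn: "0 \<le> ei m j + d j" for j using falling_zero[of m j d] by linarith
  have c: "of_nat (nat (ei m i + d i)) = (of_nat (lookup m i) + of_int (d i) :: complex)"
    using nn[of i] by (simp add: ei_def)
  have e: "en (\<lambda>j. ei m j + d j) - single i 1 = en (\<lambda>j. ei m j + (d(i := d i - 1)) j)"
    using nn by (intro poly_mapping_eqI) (auto simp: lookup_minus lookup_single when_def nat_diff_distrib algebra_simps)
  have "partial i (shift_op d (xmon m)) = scal (falling d m) (partial i (xmon (en (\<lambda>j. ei m j + d j))))"
    by (simp only: shift_op_mon linear_opD(2)[OF linear_partial])
  then show ?thesis by (simp only: partial_mon c e scal_single lookup_en mult_1_right)
qed (simp add: shift_op_mon linear_opD(3)[OF linear_partial])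

lemma partial_shift_op_nonpos:
  assumes "d i \<le> 0"
  shows "partial i \<circ> shift_op d = shift_op (d(i := d i - 1))"
proof (rule linear_op_eqI)
  fix m show "(partial i \<circ> shift_op d) (xmon m) = shift_op (d(i := d i - 1)) (xmon m)"
    unfolding comp_apply partial_shift_op_mon by (simp only: shift_op_mon falling_upd_pred[of d i, OF assms])
qed (rule linear_op_intros linear_shift_op linear_partial)+

text \<open>In one variable with derivative \<open>D\<close> and \<open>k = d i\<close>, this is
  \<open>D t^k = t^(k-1) (t D + k)\<close>.\<close>

lemma partial_shift_op_pos:
  assumes "0 < d i"
  shows "partial i \<circ> shift_op d = shift_op (d(i := d i - 1)) \<circ> hop i (- of_int (d i))"
proof (rule linear_op_eqI)
  fix m
  have "falling (d(i := d i - 1)) m = falling d m" by (rule falling_upd_nonneg) (use assms in auto)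
  then show "(partial i \<circ> shift_op d) (xmon m) = (shift_op (d(i := d i - 1)) \<circ> hop i (- of_int (d i))) (xmon m)"
    unfolding comp_apply partial_shift_op_mon
    by (simp only: hop_mon linear_opD(2)[OF linear_shift_op] shift_op_mon scal_simps(4)) (simp add: mult.commute)
qed (rule linear_op_intros linear_shift_op linear_partial linear_hop)+

lemma shift_op_zero: "shift_op (\<lambda>_. 0) = id"
  by (rule linear_op_eqI) (simp_all add: linear_shift_op, simp_all add: linear_op_def shift_op_mon falling_def)

text \<open>The span of the products of some \<open>shift_op d\<close>, \<open>d\<close> in
  \<open>\<Delta>\<close>, with polynomials in the \<open>t_partial i\<close>. The diagonal factors
  stand on the right, so multiplication from the left has to be checked on \<open>shift_op d\<close>
  only.\<close>

inductive_set normal_ops :: "('i::finite \<Rightarrow> int) set \<Rightarrow> 'i operator set" for \<Delta> where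
  shift: "d \<in> \<Delta> \<Longrightarrow> shift_op d \<in> normal_ops \<Delta>"
| add: "X \<in> normal_ops \<Delta> \<Longrightarrow> Y \<in> normal_ops \<Delta> \<Longrightarrow> (\<lambda>p. X p + Y p) \<in> normal_ops \<Delta>"
| hop: "X \<in> normal_ops \<Delta> \<Longrightarrow> X \<circ> hop i c \<in> normal_ops \<Delta>"
| scal: "X \<in> normal_ops \<Delta> \<Longrightarrow> X \<circ> scal c \<in> normal_ops \<Delta>"

lemma linear_normal_ops: "X \<in> normal_ops \<Delta> \<Longrightarrow> linear_op X"
  by (induction rule: normal_ops.induct) ((rule linear_op_intros linear_shift_op linear_hop | assumption)+)

lemma linear_generated: "X \<in> generated_operators S \<Longrightarrow> (\<And>Y. Y \<in> S \<Longrightarrow> linear_op Y) \<Longrightarrow> linear_op X"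
  by (induction rule: generated_operators.induct) (blast intro: linear_op_intros)+

lemma linear_weyl: "X \<in> weyl_algebra \<Longrightarrow> linear_op X"
  unfolding weyl_algebra_def by (erule linear_generated) (auto intro: linear_op_intros linear_partial)

lemma generator_normal_ops:
  assumes G: "linear_op G" and s: "\<And>d. G \<circ> shift_op d \<in> normal_ops UNIV" and X: "X \<in> normal_ops UNIV"
  shows "G \<circ> X \<in> normal_ops UNIV"
  using X
proof (induction rule: normal_ops.induct)
  case (add X Y)
  have "G \<circ> (\<lambda>p. X p + Y p) = (\<lambda>p. (G \<circ> X) p + (G \<circ> Y) p)" by (auto simp: linear_opD[OF G])
  then show ?case by (simp only: normal_ops.add[OF add.IH])
next
  case (hop X i c)
  show ?case unfolding comp_assoc[symmetric] by (rule normal_ops.hop[OF hop.IH])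
next
  case (scal X c)
  show ?case unfolding comp_assoc[symmetric] by (rule normal_ops.scal[OF scal.IH])
qed (rule s)

lemma weyl_normal_ops: "X \<in> weyl_algebra \<Longrightarrow> X \<in> normal_ops UNIV"
proof -
  \<comment> \<open>Stability of normal forms under multiplication from the left is a property that
    passes to composites of operators; applied to \<open>id\<close> it gives the claim.\<close>
  have "\<forall>Y\<in>normal_ops UNIV. X \<circ> Y \<in> normal_ops UNIV" if "X \<in> weyl_algebra" for X :: "'a operator"
    using that unfolding weyl_algebra_def
  proof (induction rule: generated_operators.induct)
    case (generator X)
    then consider i where "X = (\<lambda>p. var i * p)" | i where "X = partial i" by auto
    then show ?case
    proof cases
      case (1 i)
      have s: "X \<circ> shift_op d \<in> normal_ops UNIV" for d
      proof (cases "0 \<le> d i")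
        case True
        then show ?thesis unfolding 1 by (simp only: var_shift_op_nonneg) (rule normal_ops.shift, simp)
      next
        case False
        then show ?thesis unfolding 1 by (simp only: var_shift_op_neg not_le) (intro normal_ops.hop normal_ops.shift, simp)
      qed
      have l: "linear_op X" unfolding 1 by (rule linear_op_intros)
      show ?thesis by (rule ballI) (rule generator_normal_ops[OF l s])
    next
      case (2 i)
      have s: "X \<circ> shift_op d \<in> normal_ops UNIV" for d
      proof (cases "0 < d i")
        case True
        then show ?thesis unfolding 2 by (simp only: partial_shift_op_pos) (intro normal_ops.hop normal_ops.shift, simp)
      next
        case False
        then show ?thesis unfolding 2 by (simp only: partial_shift_op_nonpos not_less) (rule normal_ops.shift, simp)
      qed
      have l: "linear_op X" unfolding 2 by (rule linear_partial)
      show ?thesis by (rule ballI) (rule generator_normal_ops[OF l s])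
    qed
  next
    case (scalar c)
    have "scal c \<circ> Y = Y \<circ> scal c" if "Y \<in> normal_ops UNIV" for Y :: "'a operator"
      using linear_opD(2)[OF linear_normal_ops[OF that]] by auto
    then show ?case by (metis normal_ops.scal)
  next
    case (add X Y)
    show ?case
    proof
      fix Z :: "'a operator" assume Z: "Z \<in> normal_ops UNIV"
      have "X \<circ> Z \<in> normal_ops UNIV" "Y \<circ> Z \<in> normal_ops UNIV" using add.IH Z by blast+
      from normal_ops.add[OF this] show "(\<lambda>p. X p + Y p) \<circ> Z \<in> normal_ops UNIV" by (simp add: comp_def)
    qed
  next
    case (comp X Y)
    show ?case unfolding comp_assoc using comp.IH by blast
  qed
  moreover assume "X \<in> weyl_algebra"
  moreover have "id \<in> normal_ops UNIV" using normal_ops.shift[of "\<lambda>_. 0" UNIV] by (simp add: shift_op_zero)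
  ultimately have "X \<circ> id \<in> normal_ops UNIV" by blast
  then show ?thesis unfolding comp_id .
qed

lemma shift_op_weyl: "shift_op d \<in> weyl_algebra"
proof (induction "\<Sum>i\<in>UNIV. nat \<bar>d i\<bar>" arbitrary: d)
  case 0
  then have "d = (\<lambda>_. 0)" by (auto simp: fun_eq_iff)
  moreover have "id = scal 1" by (auto simp: fun_eq_iff)
  ultimately have "shift_op d = scal 1" by (simp only: shift_op_zero)
  then show ?case unfolding weyl_algebra_def by (simp only: generated_operators.scalar)
next
  case (Suc n)
  then obtain i where i: "d i \<noteq> 0" by (metis (mono_tags) abs_zero nat_0 nat.distinct(1) sum.neutral)
  have rem: "(\<Sum>j\<in>UNIV. nat \<bar>f j\<bar>) = nat \<bar>f i\<bar> + (\<Sum>j\<in>UNIV - {i}. nat \<bar>f j\<bar>)" for f :: "'a \<Rightarrow> int"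
    by (rule sum.remove) auto
  have upd: "(\<Sum>j\<in>UNIV - {i}. nat \<bar>(d(i := e)) j\<bar>) = (\<Sum>j\<in>UNIV - {i}. nat \<bar>d j\<bar>)" for e
    by (rule sum.cong) auto
  have gens: "(\<lambda>p. var i * p) \<in> weyl_algebra" "partial i \<in> weyl_algebra"
    unfolding weyl_algebra_def by (auto intro: generated_operators.generator)
  have cp: "X \<in> weyl_algebra \<Longrightarrow> Y \<in> weyl_algebra \<Longrightarrow> X \<circ> Y \<in> weyl_algebra" for X Y :: "'a operator"
    unfolding weyl_algebra_def by (rule generated_operators.comp)
  show ?case
  proof (cases "0 < d i")
    case True
    let ?d = "d(i := d i - 1)"
    have "n = (\<Sum>j\<in>UNIV. nat \<bar>?d j\<bar>)" using Suc(2) True unfolding rem[of d] rem[of ?d] upd by simp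
    then have "shift_op ?d \<in> weyl_algebra" using Suc(1) by blast
    then show ?thesis using cp[OF gens(1), of "shift_op ?d"] var_shift_op_nonneg[of ?d i] True by simp
  next
    case False
    let ?d = "d(i := d i + 1)"
    have "n = (\<Sum>j\<in>UNIV. nat \<bar>?d j\<bar>)" using Suc(2) False i unfolding rem[of d] rem[of ?d] upd by simp
    then have "shift_op ?d \<in> weyl_algebra" using Suc(1) by blast
    then show ?thesis using cp[OF gens(2), of "shift_op ?d"] partial_shift_op_nonpos[of ?d i] False i by simp
  qed
qed

section \<open>The centralizer of the Euler operator\<close>

definition deg :: "('i::finite \<Rightarrow>\<^sub>0 nat) \<Rightarrow> nat" where "deg m = (\<Sum>i\<in>UNIV. lookup m i)"

lemma lookup_euler: "lookup (euler p) m = of_nat (deg m) * lookup p m"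
  by (simp add: euler_def lookup_sum lookup_t_partial sum_distrib_right deg_def)

lemma linear_euler: "linear_op euler"
  unfolding linear_op_def by (auto intro!: poly_mapping_eqI simp: lookup_euler lookup_add algebra_simps)

lemma euler_mon: "euler (xmon m) = scal (of_nat (deg m)) (xmon m)"
  by (rule poly_mapping_eqI) (simp add: lookup_euler lookup_single when_def)

abbreviation "shifts0 \<equiv> {d :: 'i::finite \<Rightarrow> int. (\<Sum>i\<in>UNIV. d i) = 0}"

definition homog :: "nat \<Rightarrow> ('i::finite) mpoly \<Rightarrow> 'i mpoly" where
  "homog k p = (\<Sum>m\<in>keys p. if deg m = k then single m (lookup p m) else 0)"

lemma lookup_homog: "lookup (homog k p) m = (if deg m = k then lookup p m else 0)"
proof -
  have "lookup (homog k p) m = (\<Sum>m'\<in>keys p. if m' = m then (if deg m = k then lookup p m else 0) else 0)"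
    unfolding homog_def lookup_sum by (intro sum.cong) (auto simp: lookup_single)
  then show ?thesis by (auto simp: in_keys_iff)
qed

text \<open>The component of degree 0 for the grading of operators in which \<open>var i\<close> has
  degree 1 and \<open>partial i\<close> has degree -1.\<close>

definition degree_zero_part :: "('i::finite) operator \<Rightarrow> 'i operator" where
  "degree_zero_part X = lin_ext (\<lambda>m. homog (deg m) (X (xmon m)))"

lemma degree_zero_part_mon: "degree_zero_part X (xmon m) = homog (deg m) (X (xmon m))"
  unfolding degree_zero_part_def by (rule lin_ext)

lemma linear_degree_zero_part: "linear_op (degree_zero_part X)"
  unfolding degree_zero_part_def by (rule lin_ext)

lemma homog_simps: "homog k (p + q) = homog k p + homog k q" "homog k (scal c p) = scal c (homog k p)" "homog k 0 = 0"
  by (auto intro!: poly_mapping_eqI simp: lookup_homog lookup_add)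

lemma deg_en: "(\<And>i. 0 \<le> l i) \<Longrightarrow> int (deg (en l)) = (\<Sum>i\<in>UNIV. l i)"
  by (simp add: deg_def)

lemma degree_zero_part_normal: "X \<in> normal_ops UNIV \<Longrightarrow> degree_zero_part X \<in> normal_ops (shifts0 :: ('i::finite \<Rightarrow> int) set)"
proof (induction rule: normal_ops.induct)
  case (shift d)
  have z: "(\<lambda>p. 0) \<in> normal_ops (shifts0 :: ('i \<Rightarrow> int) set)"
  proof -
    have "shift_op (\<lambda>_. 0) \<circ> scal 0 \<in> normal_ops (shifts0 :: ('i \<Rightarrow> int) set)"
      by (intro normal_ops.scal normal_ops.shift) simp
    then show ?thesis by (simp add: shift_op_zero comp_def)
  qed
  have e: "homog (deg m) (shift_op d (xmon m)) = (if d \<in> shifts0 then shift_op d (xmon m) else 0)" for m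
  proof (cases "falling d m = 0")
    case False
    then have nn: "0 \<le> ei m j + d j" for j using falling_zero[of m j d] by linarith
    have "int (deg (en (\<lambda>i. ei m i + d i))) = int (deg m) + (\<Sum>i\<in>UNIV. d i)"
      by (subst deg_en[OF nn]) (simp add: sum.distrib deg_def ei_def)
    then have "deg (en (\<lambda>i. ei m i + d i)) = deg m \<longleftrightarrow> d \<in> shifts0" by auto
    then show ?thesis by (intro poly_mapping_eqI) (auto simp: shift_op_mon lookup_homog lookup_single when_def)
  qed (simp add: shift_op_mon homog_simps)
  show ?case
  proof (cases "d \<in> shifts0")
    case True
    have "degree_zero_part (shift_op d) = shift_op d"
      by (rule linear_op_eqI) (use True in \<open>simp_all add: linear_degree_zero_part linear_shift_op degree_zero_part_mon e\<close>)
    then show ?thesis using normal_ops.shift[OF True] by simp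
  next
    case False
    have "degree_zero_part (shift_op d) = (\<lambda>p. 0)"
      by (rule linear_op_eqI) (use False in \<open>simp_all add: linear_degree_zero_part degree_zero_part_mon e\<close>, simp add: linear_op_def)
    then show ?thesis using z by simp
  qed
next
  case (add X Y)
  have "degree_zero_part (\<lambda>p. X p + Y p) = (\<lambda>p. degree_zero_part X p + degree_zero_part Y p)"
    by (rule linear_op_eqI) (simp_all add: linear_degree_zero_part linear_op_intros degree_zero_part_mon homog_simps)
  then show ?case by (simp only: normal_ops.add[OF add.IH])
next
  case (hop X i c)
  have "degree_zero_part (X \<circ> hop i c) = degree_zero_part X \<circ> hop i c"
    by (rule linear_op_eqI)
      (simp_all add: linear_degree_zero_part linear_op_intros linear_hop degree_zero_part_mon hop_mon
        linear_opD(2)[OF linear_degree_zero_part] linear_opD(2)[OF linear_normal_ops[OF hop.hyps]] homog_simps)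
  then show ?case by (simp only: normal_ops.hop[OF hop.IH])
next
  case (scal X c)
  have "degree_zero_part (X \<circ> scal c) = degree_zero_part X \<circ> scal c"
    by (rule linear_op_eqI)
      (simp_all add: linear_degree_zero_part linear_op_intros degree_zero_part_mon
        linear_opD(2)[OF linear_degree_zero_part] linear_opD(2)[OF linear_normal_ops[OF scal.hyps]] homog_simps)
  then show ?case by (simp only: normal_ops.scal[OF scal.IH])
qed

lemma carrier_D_E: "carrier D_E = {X \<in> weyl_algebra. X \<circ> euler = euler \<circ> X}"
  by (simp add: D_E_def operator_algebra_def)

text \<open>Commuting with \<open>euler\<close> means preserving the degree of monomials, so
  \<open>X\<close> equals its part of degree 0. Taking this part of a normal form discards all
  shifts whose sum is not zero.\<close>

lemma D_E_normal: "X \<in> carrier D_E \<Longrightarrow> X \<in> normal_ops shifts0"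
proof -
  assume X: "X \<in> carrier D_E"
  then have w: "X \<in> weyl_algebra" and c: "X (euler p) = euler (X p)" for p
    by (auto simp: carrier_D_E fun_eq_iff)
  have lin: "linear_op X" by (rule linear_weyl[OF w])
  have "homog (deg m) (X (xmon m)) = X (xmon m)" for m
  proof (rule poly_mapping_eqI)
    fix m'
    have "lookup (X (euler (xmon m))) m' = of_nat (deg m) * lookup (X (xmon m)) m'"
      by (simp add: euler_mon linear_opD(2)[OF lin])
    then have "of_nat (deg m) * lookup (X (xmon m)) m' = of_nat (deg m') * lookup (X (xmon m)) m'"
      unfolding c lookup_euler by (rule sym)
    then show "lookup (homog (deg m) (X (xmon m))) m' = lookup (X (xmon m)) m'"
      unfolding lookup_homog by (metis mult_cancel_right of_nat_eq_iff)
  qed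
  then have "degree_zero_part X = X"
    by (intro linear_op_eqI linear_degree_zero_part lin) (simp add: degree_zero_part_mon)
  then show ?thesis using degree_zero_part_normal[OF weyl_normal_ops[OF w]] by simp
qed

lemma shift_op_D_E: "d \<in> shifts0 \<Longrightarrow> shift_op d \<in> carrier D_E"
proof -
  assume d: "d \<in> shifts0"
  have "shift_op d \<circ> euler = euler \<circ> shift_op d"
  proof (rule linear_op_eqI)
    fix m
    show "(shift_op d \<circ> euler) (xmon m) = (euler \<circ> shift_op d) (xmon m)"
    proof (cases "falling d m = 0")
      case False
      then have nn: "0 \<le> ei m j + d j" for j using falling_zero[of m j d] by linarith
      have "int (deg (en (\<lambda>i. ei m i + d i))) = int (deg m)"
        by (subst deg_en[OF nn]) (use d in \<open>simp add: sum.distrib deg_def ei_def\<close>)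
      then show ?thesis
        by (simp add: euler_mon shift_op_mon linear_opD(2)[OF linear_euler] linear_opD(2)[OF linear_shift_op] mult.commute)
    qed (simp add: shift_op_mon euler_mon linear_opD(2)[OF linear_shift_op] linear_opD(3)[OF linear_euler])
  qed (simp_all add: linear_op_intros linear_shift_op linear_euler)
  then show ?thesis using shift_op_weyl by (auto simp: carrier_D_E)
qed

lemma operator_algebra_simps [simp]:
  "carrier (operator_algebra S) = S" "X \<otimes>\<^bsub>operator_algebra S\<^esub> Y = X \<circ> Y" "\<one>\<^bsub>operator_algebra S\<^esub> = id"
  "\<zero>\<^bsub>operator_algebra S\<^esub> = (\<lambda>p. 0)" "X \<oplus>\<^bsub>operator_algebra S\<^esub> Y = (\<lambda>p. X p + Y p)"
  "c \<odot>\<^bsub>operator_algebra S\<^esub> X = (\<lambda>p. scal c (X p))"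
  by (simp_all add: operator_algebra_def)

lemma complex_algebra_operators:
  assumes lin: "\<And>X. X \<in> S \<Longrightarrow> linear_op X" and sc: "\<And>c. scal c \<in> S"
    and add: "\<And>X Y. X \<in> S \<Longrightarrow> Y \<in> S \<Longrightarrow> (\<lambda>p. X p + Y p) \<in> S"
    and cmp: "\<And>X Y. X \<in> S \<Longrightarrow> Y \<in> S \<Longrightarrow> X \<circ> Y \<in> S"
  shows "complex_algebra (operator_algebra S)"
proof -
  have id: "id = scal 1" by (auto simp: fun_eq_iff)
  have "ring (operator_algebra S)"
  proof (rule ringI)
    show "abelian_group (operator_algebra S)"
    proof (rule abelian_groupI)
      fix X assume X: "X \<in> carrier (operator_algebra S)"
      have "(\<lambda>p. (scal (-1) \<circ> X) p + X p) = (\<lambda>p. 0)"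
        by (rule ext, rule poly_mapping_eqI) (simp add: lookup_add)
      then show "\<exists>Y\<in>carrier (operator_algebra S). Y \<oplus>\<^bsub>operator_algebra S\<^esub> X = \<zero>\<^bsub>operator_algebra S\<^esub>"
        using cmp[OF sc] X by (intro bexI[of _ "scal (-1) \<circ> X"]) simp_all
    next
      have z: "(\<lambda>p. 0) = scal 0" by (auto simp: fun_eq_iff)
      show "\<zero>\<^bsub>operator_algebra S\<^esub> \<in> carrier (operator_algebra S)"
        unfolding operator_algebra_simps z by (rule sc)
    qed (auto simp: add add_ac)
    show "Group.monoid (operator_algebra S)"
      by (rule monoidI) (use cmp sc[of 1] in \<open>auto simp: id[symmetric]\<close>)
  qed (auto simp: linear_opD[OF lin])
  then interpret ring "operator_algebra S" .
  have so: "c \<odot>\<^bsub>operator_algebra S\<^esub> \<one>\<^bsub>operator_algebra S\<^esub> = scal c" for c by auto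
  show ?thesis
  proof
    show "(c \<odot>\<^bsub>operator_algebra S\<^esub> \<one>\<^bsub>operator_algebra S\<^esub>) \<otimes>\<^bsub>operator_algebra S\<^esub> X =
        X \<otimes>\<^bsub>operator_algebra S\<^esub> (c \<odot>\<^bsub>operator_algebra S\<^esub> \<one>\<^bsub>operator_algebra S\<^esub>)" if "X \<in> carrier (operator_algebra S)" for c X
      using that linear_opD(2)[OF lin] unfolding so by (auto simp: fun_eq_iff)
  qed (auto simp: sc scal_add fun_eq_iff so)
qed

lemma D_E_closed:
  "scal c \<in> carrier D_E" "X \<in> carrier D_E \<Longrightarrow> Y \<in> carrier D_E \<Longrightarrow> (\<lambda>p. X p + Y p) \<in> carrier D_E"
  "X \<in> carrier D_E \<Longrightarrow> Y \<in> carrier D_E \<Longrightarrow> X \<circ> Y \<in> carrier D_E" "X \<in> carrier D_E \<Longrightarrow> linear_op X"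
proof -
  show "scal c \<in> carrier D_E"
    by (auto simp: carrier_D_E weyl_algebra_def generated_operators.scalar fun_eq_iff linear_opD(2)[OF linear_euler])
  show "(\<lambda>p. X p + Y p) \<in> carrier D_E" if "X \<in> carrier D_E" "Y \<in> carrier D_E"
    using that by (auto simp: carrier_D_E weyl_algebra_def generated_operators.add fun_eq_iff linear_opD[OF linear_euler])
  show "X \<circ> Y \<in> carrier D_E" if "X \<in> carrier D_E" "Y \<in> carrier D_E"
    using that by (auto simp: carrier_D_E weyl_algebra_def generated_operators.comp fun_eq_iff)
  show "X \<in> carrier D_E \<Longrightarrow> linear_op X" by (auto simp: carrier_D_E linear_weyl)
qed

lemma D_E_simps [simp]:
  "X \<otimes>\<^bsub>D_E\<^esub> Y = X \<circ> Y" "\<one>\<^bsub>D_E\<^esub> = id" "\<zero>\<^bsub>D_E\<^esub> = (\<lambda>p. 0)" "X \<oplus>\<^bsub>D_E\<^esub> Y = (\<lambda>p. X p + Y p)"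
  "c \<odot>\<^bsub>D_E\<^esub> X = (\<lambda>p. scal c (X p))"
  by (simp_all add: D_E_def)

lemma complex_algebra_D_E: "complex_algebra (D_E :: (complex, ('i::finite) operator) module)"
  unfolding D_E_def by (rule complex_algebra_operators) ((rule D_E_closed[unfolded carrier_D_E]; assumption)+)

lemma hop_D_E: "hop i c \<in> carrier (D_E :: (complex, ('i::finite) operator) module)"
proof -
  have "(\<lambda>p. var i * p) \<circ> partial i \<in> weyl_algebra"
    unfolding weyl_algebra_def by (intro generated_operators.comp generated_operators.generator) auto
  moreover have "(\<lambda>p. var i * p) \<circ> partial i = t_partial i" by (auto simp: t_partial_def)
  moreover have "t_partial i \<circ> euler = euler \<circ> t_partial i"
    by (rule ext, rule poly_mapping_eqI) (simp add: lookup_t_partial lookup_euler)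
  ultimately have "t_partial i \<in> carrier D_E" by (simp add: carrier_D_E)
  then show ?thesis unfolding hop_alt by (rule D_E_closed(2)) (rule D_E_closed(1))
qed

section \<open>Symbols of differential operators\<close>

text \<open>The matrix entry of an operator from \<open>t\<^bsup>p+k\<^esup>\<close> to \<open>t\<^bsup>q+k\<^esup>\<close>, with \<open>k\<close> added to all exponents, is
  for large \<open>k\<close> a polynomial in \<open>k\<close>; replacing \<open>k\<close> by a formal variable gives the action on
  \<open>t\<^bsup>p+z\<^esup>\<close> for arbitrary integral exponents \<open>p\<close>.\<close>

definition pt :: "('i::finite \<Rightarrow> int) \<Rightarrow> nat \<Rightarrow> 'i \<Rightarrow>\<^sub>0 nat" where "pt p k = en (\<lambda>i. p i + int k)"

definition is_sym :: "('i::finite) operator \<Rightarrow> complex poly \<Rightarrow> ('i \<Rightarrow> int) \<Rightarrow> ('i \<Rightarrow> int) \<Rightarrow> bool" where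
  "is_sym X f q p \<longleftrightarrow> (\<forall>\<^sub>F k in sequentially. lookup (X (xmon (pt p k))) (pt q k) = poly f (of_nat k))"

definition wsym :: "('i::finite) operator \<Rightarrow> ('i \<Rightarrow> int) \<Rightarrow> ('i \<Rightarrow> int) \<Rightarrow> complex poly" where
  "wsym X q p = (THE f. is_sym X f q p)"

lemma eventually_nonneg: "\<forall>\<^sub>F k in sequentially. \<forall>i :: 'i::finite. 0 \<le> p i + int k"
proof (rule eventually_all_finite)
  fix i show "\<forall>\<^sub>F k in sequentially. 0 \<le> p i + int k"
    using eventually_ge_at_top[of "nat (- p i)"] by eventually_elim linarith
qed

lemma ei_pt: "(\<And>i. 0 \<le> p i + int k) \<Longrightarrow> ei (pt p k) = (\<lambda>i. p i + int k)"
  unfolding pt_def by (rule ei_en)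

text \<open>A nonzero polynomial has only finitely many zeros, so the values at all large
  \<open>k\<close> determine it.\<close>

lemma is_sym_unique: assumes "is_sym X f q p" "is_sym X g q p" shows "f = g"
proof (rule ccontr)
  assume ne: "f \<noteq> g"
  have "\<forall>\<^sub>F k in sequentially. poly (f - g) (of_nat k) = 0"
    using assms unfolding is_sym_def by eventually_elim simp
  then obtain K where K: "\<And>k. k \<ge> K \<Longrightarrow> poly (f - g) (of_nat k) = 0" by (auto simp: eventually_sequentially)
  have "finite {x. poly (f - g) x = 0}" by (rule poly_roots_finite) (use ne in simp)
  moreover have "of_nat ` {K..} \<subseteq> {x. poly (f - g) x = 0}" using K by auto
  ultimately have "finite ((of_nat :: nat \<Rightarrow> complex) ` {K..})" by (rule finite_subset[rotated])
  then have "finite {K..}" by (rule finite_imageD) (simp add: inj_on_def)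
  then show False using infinite_Ici by blast
qed

lemma wsym_eqI: "is_sym X f q p \<Longrightarrow> wsym X q p = f"
  unfolding wsym_def using is_sym_unique by blast

text \<open>The value of \<open>falling d\<close> at the exponent \<open>p\<close> with the variable
  added to all entries.\<close>

definition shift_poly :: "('i::finite \<Rightarrow> int) \<Rightarrow> ('i \<Rightarrow> int) \<Rightarrow> complex poly" where
  "shift_poly d p = (\<Prod>i\<in>UNIV. \<Prod>j<nat (- d i). [:of_int (p i) - of_nat j, 1:])"

lemma is_sym_shift: "is_sym (shift_op d) (if q = (\<lambda>i. p i + d i) then shift_poly d p else 0) q p"
  unfolding is_sym_def
  using eventually_nonneg[of p] eventually_nonneg[of q] eventually_nonneg[of "\<lambda>i. p i + d i"]
proof eventually_elim
  case (elim k)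
  have e: "ei (pt p k) = (\<lambda>i. p i + int k)" using elim by (intro ei_pt) auto
  have l: "of_nat (lookup (pt p k) i) = (of_int (p i) + of_nat k :: complex)" for i
  proof -
    have "int (lookup (pt p k) i) = p i + int k" using fun_cong[OF e, of i] by (simp add: ei_def)
    then have "of_int (int (lookup (pt p k) i)) = (of_int (p i + int k) :: complex)" by simp
    then show ?thesis by simp
  qed
  have f: "falling d (pt p k) = poly (shift_poly d p) (of_nat k)"
    by (simp add: falling_def shift_poly_def poly_prod l algebra_simps)
  have "en (\<lambda>i. p i + int k + d i) = pt q k \<longleftrightarrow> q = (\<lambda>i. p i + d i)"
  proof
    assume "en (\<lambda>i. p i + int k + d i) = pt q k"
    then have "ei (en (\<lambda>i. p i + int k + d i)) = ei (pt q k)" by simp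
    moreover have "ei (pt q k) = (\<lambda>i. q i + int k)" using elim by (intro ei_pt) auto
    moreover have "ei (en (\<lambda>i. p i + int k + d i)) = (\<lambda>i. p i + int k + d i)"
      by (rule ei_en) (use elim(3) in \<open>auto simp: algebra_simps\<close>)
    ultimately show "q = (\<lambda>i. p i + d i)" by (auto simp: fun_eq_iff)
  qed (simp add: pt_def algebra_simps)
  then show ?case by (auto simp: shift_op_mon e f lookup_single when_def)
qed

lemma is_sym_add: "is_sym X f q p \<Longrightarrow> is_sym Y g q p \<Longrightarrow> is_sym (\<lambda>v. X v + Y v) (f + g) q p"
  unfolding is_sym_def by (rule eventually_elim2[where P = "\<lambda>k. lookup (X (xmon (pt p k))) (pt q k) = poly f (of_nat k)"]) (simp_all add: lookup_add)

lemma is_sym_scal: "linear_op X \<Longrightarrow> is_sym X f q p \<Longrightarrow> is_sym (X \<circ> scal c) (smult c f) q p"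
  unfolding is_sym_def by (erule eventually_mono) (simp only: comp_apply linear_opD lookup_scal poly_smult)

lemma is_sym_hop: "linear_op X \<Longrightarrow> is_sym X f q p \<Longrightarrow> is_sym (X \<circ> hop i c) (f * [:of_int (p i) - c, 1:]) q p"
  unfolding is_sym_def using eventually_nonneg[of p]
proof (rule eventually_elim2)
  fix k assume l: "linear_op X" and k: "\<forall>i. 0 \<le> p i + int k"
    and e: "lookup (X (xmon (pt p k))) (pt q k) = poly f (of_nat k)"
  have "int (lookup (pt p k) i) = p i + int k" using ei_pt[of p k] k by (metis ei_def)
  then have "of_int (int (lookup (pt p k) i)) = (of_int (p i + int k) :: complex)" by simp
  then have "of_nat (lookup (pt p k) i) = (of_int (p i) + of_nat k :: complex)" by simp
  then show "lookup ((X \<circ> hop i c) (xmon (pt p k))) (pt q k) = poly (f * [:of_int (p i) - c, 1:]) (of_nat k)"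
    by (simp add: hop_mon linear_opD(2)[OF l] e algebra_simps)
qed

lemma is_sym_exists: "X \<in> normal_ops \<Delta> \<Longrightarrow> \<exists>f. is_sym X f q p"
  by (induction rule: normal_ops.induct)
    (blast intro: is_sym_shift is_sym_add is_sym_scal is_sym_hop linear_normal_ops)+

lemma is_sym_wsym: "X \<in> normal_ops \<Delta> \<Longrightarrow> is_sym X (wsym X q p) q p"
  using is_sym_exists wsym_eqI by metis

lemma wsym_shift: "wsym (shift_op d) q p = (if q = (\<lambda>i. p i + d i) then shift_poly d p else 0)"
  by (rule wsym_eqI[OF is_sym_shift])

lemma wsym_add: "X \<in> normal_ops \<Delta> \<Longrightarrow> Y \<in> normal_ops \<Delta>' \<Longrightarrow> wsym (\<lambda>v. X v + Y v) q p = wsym X q p + wsym Y q p"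
  by (intro wsym_eqI is_sym_add is_sym_wsym)

lemma wsym_scal: "X \<in> normal_ops \<Delta> \<Longrightarrow> wsym (X \<circ> scal c) q p = smult c (wsym X q p)"
  by (rule wsym_eqI[OF is_sym_scal[OF linear_normal_ops is_sym_wsym]])

lemma wsym_hop: "X \<in> normal_ops \<Delta> \<Longrightarrow> wsym (X \<circ> hop i c) q p = wsym X q p * [:of_int (p i) - c, 1:]"
  by (rule wsym_eqI[OF is_sym_hop[OF linear_normal_ops is_sym_wsym]])

text \<open>A bound on the exponent shifts of \<open>X\<close>, uniform in the monomial. For normal
  forms a finite one exists, which makes each column of the symbol finite.\<close>

definition shifts_in :: "('i::finite) operator \<Rightarrow> ('i \<Rightarrow> int) set \<Rightarrow> bool" where
  "shifts_in X D \<longleftrightarrow> (\<forall>m m'. lookup (X (xmon m)) m' \<noteq> 0 \<longrightarrow> (\<lambda>i. ei m' i - ei m i) \<in> D)"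

lemma shifts_exist: "X \<in> normal_ops \<Delta> \<Longrightarrow> \<exists>D. finite D \<and> D \<subseteq> \<Delta> \<and> shifts_in X D"
proof (induction rule: normal_ops.induct)
  case (shift d)
  have "shifts_in (shift_op d) {d}" unfolding shifts_in_def
  proof (intro allI impI)
    fix m m' assume ne: "lookup (shift_op d (xmon m)) m' \<noteq> 0"
    then have f: "falling d m \<noteq> 0" "m' = en (\<lambda>i. ei m i + d i)"
      by (auto simp: shift_op_mon lookup_single when_def split: if_splits)
    then have "0 \<le> ei m j + d j" for j using falling_zero[of m j d] by linarith
    then have "ei m' = (\<lambda>i. ei m i + d i)" unfolding f(2) by (rule ei_en)
    then show "(\<lambda>i. ei m' i - ei m i) \<in> {d}" by auto
  qed
  then show ?case using shift by (intro exI[of _ "{d}"]) auto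
next
  case (add X Y)
  then obtain D D' where D: "finite D" "D \<subseteq> \<Delta>" "shifts_in X D" "finite D'" "D' \<subseteq> \<Delta>" "shifts_in Y D'" by blast
  have "shifts_in (\<lambda>p. X p + Y p) (D \<union> D')" unfolding shifts_in_def
  proof (intro allI impI)
    fix m m' assume "lookup (X (xmon m) + Y (xmon m)) m' \<noteq> 0"
    then have "lookup (X (xmon m)) m' \<noteq> 0 \<or> lookup (Y (xmon m)) m' \<noteq> 0" by (auto simp: lookup_add)
    then show "(\<lambda>i. ei m' i - ei m i) \<in> D \<union> D'" using D(3,6) unfolding shifts_in_def by blast
  qed
  then show ?case using D by (intro exI[of _ "D \<union> D'"]) auto
next
  case (hop X i c)
  then obtain D where D: "finite D" "D \<subseteq> \<Delta>" "shifts_in X D" by blast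
  have "shifts_in (X \<circ> hop i c) D"
    using D(3) unfolding shifts_in_def by (simp add: hop_mon linear_opD(2)[OF linear_normal_ops[OF hop.hyps]])
  then show ?case using D by blast
next
  case (scal X c)
  then obtain D where D: "finite D" "D \<subseteq> \<Delta>" "shifts_in X D" by blast
  have "shifts_in (X \<circ> scal c) D"
    using D(3) unfolding shifts_in_def by (simp add: linear_opD(2)[OF linear_normal_ops[OF scal.hyps]])
  then show ?case using D by blast
qed

lemma wsym_outside:
  assumes "shifts_in X D" "(\<lambda>i. q i - p i) \<notin> D" shows "wsym X q p = 0"
proof (rule wsym_eqI)
  show "is_sym X 0 q p" unfolding is_sym_def using eventually_nonneg[of p] eventually_nonneg[of q]
  proof eventually_elim
    case (elim k)
    then have "ei (pt p k) = (\<lambda>i. p i + int k)" "ei (pt q k) = (\<lambda>i. q i + int k)" by (auto intro!: ei_pt)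
    then have "(\<lambda>i. ei (pt q k) i - ei (pt p k) i) \<notin> D" using assms(2) by simp
    then show ?case using assms(1) unfolding shifts_in_def by (metis poly_0)
  qed
qed

text \<open>For large \<open>k\<close> all exponents involved are nonnegative. Then the monomials of
  \<open>Y\<close> at \<open>pt p k\<close> are of the form \<open>pt q k\<close> with
  \<open>q\<close> in a fixed finite set, and the claim is the multiplication of matrices.\<close>

lemma wsym_mult:
  assumes X: "X \<in> normal_ops \<Delta>" and Y: "Y \<in> normal_ops \<Delta>" and U: "finite U" "\<And>q. q \<notin> U \<Longrightarrow> wsym Y q p = 0"
  shows "wsym (X \<circ> Y) r p = (\<Sum>q\<in>U. wsym X r q * wsym Y q p)"
proof -
  obtain D where D: "finite D" "shifts_in Y D" using shifts_exist[OF Y] by blast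
  define V where "V = (\<lambda>d i. p i + d i) ` D"
  have V: "finite V" using D by (simp add: V_def)
  have out: "wsym Y q p = 0" if "q \<notin> V" for q
  proof (rule wsym_outside[OF D(2)])
    show "(\<lambda>i. q i - p i) \<notin> D"
    proof
      assume "(\<lambda>i. q i - p i) \<in> D"
      then have "(\<lambda>i. p i + (q i - p i)) \<in> V" unfolding V_def by (rule image_eqI[rotated]) simp
      then show False using that by simp
    qed
  qed
  have "is_sym (X \<circ> Y) (\<Sum>q\<in>V. wsym X r q * wsym Y q p) r p"
  proof -
    have "\<forall>\<^sub>F k in sequentially. \<forall>q\<in>V. lookup (Y (xmon (pt p k))) (pt q k) = poly (wsym Y q p) (of_nat k)"
      using is_sym_wsym[OF Y] V by (intro eventually_ball_finite) (auto simp: is_sym_def)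
    moreover have "\<forall>\<^sub>F k in sequentially. \<forall>q\<in>V. lookup (X (xmon (pt q k))) (pt r k) = poly (wsym X r q) (of_nat k)"
      using is_sym_wsym[OF X] V by (intro eventually_ball_finite) (auto simp: is_sym_def)
    moreover have "\<forall>\<^sub>F k in sequentially. \<forall>q\<in>V. \<forall>i. 0 \<le> q i + int k"
      using eventually_nonneg V by (intro eventually_ball_finite) auto
    ultimately show ?thesis unfolding is_sym_def using eventually_nonneg[of p]
    proof eventually_elim
      case (elim k)
      have ep: "ei (pt p k) = (\<lambda>i. p i + int k)" using elim(4) by (intro ei_pt) auto
      have eq: "ei (pt q k) = (\<lambda>i. q i + int k)" if "q \<in> V" for q using elim(3) that by (intro ei_pt) auto
      have inj: "pt q k = pt q' k \<longleftrightarrow> q = q'" if "q \<in> V" "q' \<in> V" for q q'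
      proof
        assume "pt q k = pt q' k"
        then have "(\<lambda>i. q i + int k) = (\<lambda>i. q' i + int k)" using eq that by metis
        then show "q = q'" by (auto simp: fun_eq_iff)
      qed simp
      let ?v = "Y (xmon (pt p k))"
      have "?v = (\<Sum>q\<in>V. scal (lookup ?v (pt q k)) (xmon (pt q k)))"
      proof (rule poly_mapping_eqI)
        fix m
        show "lookup ?v m = lookup (\<Sum>q\<in>V. scal (lookup ?v (pt q k)) (xmon (pt q k))) m"
        proof (cases "lookup ?v m = 0")
          case True
          then have "lookup (scal (lookup ?v (pt q k)) (xmon (pt q k))) m = 0" for q
            by (cases "pt q k = m") (auto simp: lookup_single)
          then show ?thesis unfolding lookup_sum True by (intro sum.neutral[symmetric]) blast
        next
          case False
          then have d: "(\<lambda>i. ei m i - ei (pt p k) i) \<in> D" using D(2) unfolding shifts_in_def by blast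
          \<comment> \<open>Subtracting \<open>k\<close> from all exponents of a monomial
            \<open>m\<close> that occurs gives the intermediate weight it belongs to.\<close>
          define q where "q = (\<lambda>i. p i + (ei m i - ei (pt p k) i))"
          have q: "q \<in> V" unfolding V_def q_def by (rule image_eqI[OF _ d]) simp
          have "q = (\<lambda>i. ei m i - int k)" unfolding q_def ep by auto
          then have "m = pt q k" by (simp add: pt_def)
          then have "lookup (\<Sum>q\<in>V. scal (lookup ?v (pt q k)) (xmon (pt q k))) m =
              (\<Sum>q'\<in>V. if q' = q then lookup ?v m else 0)"
            unfolding lookup_sum using inj q by (intro sum.cong) (auto simp: lookup_single when_def)
          then show ?thesis using q V by simp
        qed
      qed
      then have "X ?v = (\<Sum>q\<in>V. scal (lookup ?v (pt q k)) (X (xmon (pt q k))))"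
        using linear_op_sum[OF linear_normal_ops[OF X], of "\<lambda>q. scal (lookup ?v (pt q k)) (xmon (pt q k))" V]
          linear_opD(2)[OF linear_normal_ops[OF X]] by simp
      then show ?case using elim(1,2) by (simp add: lookup_sum poly_sum mult.commute)
    qed
  qed
  then have "wsym (X \<circ> Y) r p = (\<Sum>q\<in>V. wsym X r q * wsym Y q p)" by (rule wsym_eqI)
  also have "\<dots> = (\<Sum>q\<in>V \<union> U. wsym X r q * wsym Y q p)"
    by (rule sum.mono_neutral_left) (use U V out in auto)
  also have "\<dots> = (\<Sum>q\<in>U. wsym X r q * wsym Y q p)"
    by (rule sum.mono_neutral_right) (use U V in auto)
  finally show ?thesis .
qed

section \<open>Divisibility of symbols by powers of the variable\<close>

definition neg_set :: "('i \<Rightarrow> int) \<Rightarrow> 'i set" where "neg_set p = {i. p i < 0}"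

definition unit_poly :: "('i::finite \<Rightarrow> int) \<Rightarrow> ('i \<Rightarrow> int) \<Rightarrow> complex poly" where
  "unit_poly d p = (\<Prod>i\<in>UNIV. \<Prod>j\<in>{j. j < nat (- d i) \<and> int j \<noteq> p i}. [:of_int (p i) - of_nat j, 1:])"

lemma unit_poly_nonzero: "poly (unit_poly d p) 0 \<noteq> 0"
proof -
  have "of_int (p i) - of_nat j \<noteq> (0 :: complex)" if "int j \<noteq> p i" for i and j :: nat
    using that by (metis eq_iff_diff_eq_0 of_int_eq_iff of_int_of_nat_eq)
  then show ?thesis by (simp add: unit_poly_def poly_prod)
qed

text \<open>The factor \<open>p i - j + z\<close> with \<open>j < - d i\<close> equals
  \<open>z\<close> exactly for \<open>j = p i\<close>. Such a \<open>j\<close> exists iff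
  \<open>0 \<le> p i < - d i\<close>, that is, iff the exponent at \<open>i\<close> turns from
  nonnegative to negative. All other factors go into \<open>unit_poly\<close>.\<close>

lemma shift_poly_eq:
  "shift_poly d p = [:0, 1:] ^ upc (neg_set p) (neg_set (\<lambda>i. p i + d i)) * unit_poly d p"
proof -
  let ?S = "neg_set (\<lambda>i. p i + d i) - neg_set p"
  have 1: "(\<Prod>j<nat (- d i). [:of_int (p i) - of_nat j, 1:]) =
      (if i \<in> ?S then [:0, 1:] else 1) * (\<Prod>j\<in>{j. j < nat (- d i) \<and> int j \<noteq> p i}. [:of_int (p i) - of_nat j, 1 :: complex:])" for i
  proof (cases "i \<in> ?S")
    case True
    then have j: "nat (p i) < nat (- d i)" "int (nat (p i)) = p i" by (auto simp: neg_set_def)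
    have s: "{j. j < nat (- d i) \<and> int j \<noteq> p i} = {..<nat (- d i)} - {nat (p i)}" using j(2) by auto
    have "(\<Prod>j<nat (- d i). [:of_int (p i) - of_nat j, 1:]) = [:of_int (p i) - of_nat (nat (p i)), 1 :: complex:] *
       (\<Prod>j\<in>{..<nat (- d i)} - {nat (p i)}. [:of_int (p i) - of_nat j, 1:])"
      by (rule prod.remove) (use j in auto)
    moreover have "of_int (p i) - of_nat (nat (p i)) = (0 :: complex)" using j(2) by (metis diff_self of_int_of_nat_eq)
    ultimately show ?thesis using True unfolding s by simp
  next
    case False
    then have "{j. j < nat (- d i) \<and> int j \<noteq> p i} = {..<nat (- d i)}" by (auto simp: neg_set_def)
    then show ?thesis by (simp only: if_not_P[OF False] mult_1_left)
  qed
  have "(\<Prod>i\<in>UNIV. if i \<in> ?S then [:0, 1:] else (1 :: complex poly)) = [:0, 1:] ^ card ?S"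
    by (simp add: prod.If_cases set_diff_eq)
  then show ?thesis unfolding shift_poly_def 1 prod.distrib unit_poly_def upc_def by simp
qed

lemma wsym_dvd: "X \<in> normal_ops \<Delta> \<Longrightarrow> [:0, 1:] ^ upc (neg_set p) (neg_set q) dvd wsym X q p"
proof (induction rule: normal_ops.induct)
  case (shift d) show ?case unfolding wsym_shift by (auto simp: shift_poly_eq)
next
  case (add X Y) then show ?case using wsym_add[OF add.hyps] by simp
next
  case (hop X i c) then show ?case using wsym_hop[OF hop.hyps] by (metis dvd_mult2)
next
  case (scal X c) then show ?case using wsym_scal[OF scal.hyps] by (metis dvd_smult)
qed

definition wrho :: "('i::finite) operator \<Rightarrow> ('i \<Rightarrow> int) \<Rightarrow> ('i \<Rightarrow> int) \<Rightarrow> complex fps" where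
  "wrho X q p = fps_of_poly (wsym X q p)"

definition slice :: "int \<Rightarrow> ('i::finite \<Rightarrow> int) set" where "slice a = {p. (\<Sum>i\<in>UNIV. p i) = a}"

text \<open>If all entries are negative, their sum is at most \<open>- n - 1\<close>; if none is,
  the sum is nonnegative. These are the only obstructions, and \<open>vertices a\<close> excludes
  exactly the sets that they rule out.\<close>

lemma neg_set_slice:
  assumes c: "CARD('i::finite) = n + 1" and a: "a \<ge> 0 \<or> (- int n - 1 < a \<and> a < 0)"
  shows "neg_set ` slice a = (vertices a :: 'i set set)"
proof (intro subset_antisym subsetI)
  fix J assume "J \<in> neg_set ` (slice a :: ('i \<Rightarrow> int) set)"
  then obtain p where p: "(\<Sum>i\<in>UNIV. p i) = a" "J = neg_set (p :: 'i \<Rightarrow> int)" by (auto simp: slice_def)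
  have "J \<noteq> UNIV"
  proof
    assume "J = UNIV"
    have "p i \<le> -1" for i
    proof -
      have "i \<in> neg_set p" using p(2) \<open>J = UNIV\<close> by auto
      then show ?thesis unfolding neg_set_def by simp
    qed
    then have "(\<Sum>i\<in>UNIV. p i) \<le> (\<Sum>i\<in>(UNIV :: 'i set). -1)" by (intro sum_mono)
    then show False using p c a by simp
  qed
  moreover have "J \<noteq> {}" if "a < 0"
  proof
    assume "J = {}"
    then have "0 \<le> (\<Sum>i\<in>UNIV. p i)" using p by (intro sum_nonneg) (auto simp: neg_set_def not_less)
    then show False using p that by simp
  qed
  ultimately show "J \<in> vertices a" by (auto simp: vertices_def)
next
  fix J assume J: "J \<in> (vertices a :: 'i set set)"
  \<comment> \<open>Starting from -1 on \<open>J\<close> and 0 elsewhere, \<open>b\<close> is what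
    is missing to the sum \<open>a\<close>. It is added at one index, inside \<open>J\<close> if it
    is negative and outside otherwise, so that \<open>J\<close> remains the set of negative
    entries.\<close>
  define b where "b = a + int (card J)"
  have "\<exists>j. (j \<in> J) = (b < 0)"
  proof (cases "b < 0")
    case True
    then have "J \<noteq> {}" using J unfolding b_def vertices_def by (auto split: if_splits)
    then show ?thesis using True by auto
  next
    case False
    have "J \<noteq> UNIV" using J by (auto simp: vertices_def split: if_splits)
    then show ?thesis using False by auto
  qed
  then obtain j where j: "(j \<in> J) = (b < 0)" by blast
  define p where "p i = (if i \<in> J then -1 else 0) + (if i = j then b else 0)" for i
  have "(\<Sum>i\<in>UNIV. p i) = a"
    unfolding p_def sum.distrib by (simp add: sum.If_cases b_def)
  moreover have "neg_set p = J" using j by (auto simp: neg_set_def p_def split: if_splits)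
  ultimately show "J \<in> neg_set ` slice a" unfolding slice_def by blast
qed

lemma hop_normal: "hop i c \<in> normal_ops shifts0"
proof -
  have "shift_op (\<lambda>_. 0) \<circ> hop i c \<in> normal_ops shifts0" by (intro normal_ops.hop normal_ops.shift) simp
  then show ?thesis unfolding shift_op_zero id_comp .
qed

lemma wsym_id: "wsym id q p = (if q = p then 1 else 0)"
  using wsym_shift[of "\<lambda>_. 0" q p] by (simp add: shift_op_zero shift_poly_def)

lemma wsym_hop_diag: "wsym (hop i c) q p = (if q = p then [:of_int (p i) - c, 1:] else 0)"
proof -
  have "id \<in> normal_ops shifts0" using normal_ops.shift[of "\<lambda>_. 0" shifts0] by (simp add: shift_op_zero)
  from wsym_hop[OF this, of i c q p] show ?thesis by (simp add: wsym_id)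
qed

text \<open>Every \<open>hop i (of_int (p i))\<close> has the variable as its diagonal symbol at
  \<open>p\<close>, so the index \<open>undefined\<close> is an arbitrary choice.\<close>

lemma symbol_algebra_D_E:
  assumes c: "CARD('i::finite) = n + 1" and a: "a \<ge> 0 \<or> (- int n - 1 < a \<and> a < 0)"
  shows "symbol_algebra (D_E :: (complex, 'i operator) module) (slice a) neg_set (vertices a) wrho
    (\<lambda>q p. shift_op (\<lambda>i. q i - p i)) (\<lambda>q p. fps_of_poly (unit_poly (\<lambda>i. q i - p i) p))
    (\<lambda>p. hop undefined (of_int (p undefined)))"
proof -
  interpret complex_algebra "D_E :: (complex, 'i operator) module" by (rule complex_algebra_D_E)
  note N = D_E_normal
  have X_power: "fps_of_poly ([:0, 1:] ^ m) = (fps_X ^ m :: complex fps)" for m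
    by (simp add: fps_of_poly_power fps_of_poly_fps_X)
  have in_slice: "(\<lambda>i. q i - p i) \<in> shifts0 \<longleftrightarrow> q \<in> slice a" if "p \<in> slice a" for p q :: "'i \<Rightarrow> int"
    using that by (simp add: slice_def sum_subtractf)
  show ?thesis
  proof
    show "neg_set ` slice a = (vertices a :: 'i set set)" by (rule neg_set_slice[OF c a])
    show "\<exists>U. finite U \<and> (\<forall>q. q \<notin> U \<longrightarrow> wrho X q p = 0)" if "X \<in> carrier D_E" for X :: "'i operator" and p :: "'i \<Rightarrow> int"
    proof -
      note X = that
      obtain D where D: "finite D" "shifts_in X D" using shifts_exist[OF N[OF X]] by blast
      have "wrho X q p = 0" if "q \<notin> (\<lambda>d i. p i + d i) ` D" for q
      proof -
        have "(\<lambda>i. q i - p i) \<notin> D"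
        proof
          assume "(\<lambda>i. q i - p i) \<in> D"
          then have "(\<lambda>i. p i + (q i - p i)) \<in> (\<lambda>d i. p i + d i) ` D" by (rule image_eqI[rotated]) simp
          then show False using that by simp
        qed
        then show ?thesis unfolding wrho_def using wsym_outside[OF D(2)] by simp
      qed
      then show ?thesis using D(1) by (intro exI[of _ "(\<lambda>d i. p i + d i) ` D"]) simp
    qed
    show "wrho X q p = 0" if "X \<in> carrier D_E" "p \<in> slice a" "q \<notin> slice a" for X :: "'i operator" and p q :: "'i \<Rightarrow> int"
    proof -
      note X = that(1)
      obtain D where D: "D \<subseteq> shifts0" "shifts_in X D" using shifts_exist[OF N[OF X]] by blast
      have "(\<lambda>i. q i - p i) \<notin> D" using D(1) in_slice[OF that(2), of q] that(3) by blast
      then show ?thesis unfolding wrho_def using wsym_outside[OF D(2)] by simp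
    qed
    show "wrho (X \<oplus>\<^bsub>D_E\<^esub> Y) q p = wrho X q p + wrho Y q p" if "X \<in> carrier D_E" "Y \<in> carrier D_E" for X Y :: "'i operator" and p q :: "'i \<Rightarrow> int"
      using wsym_add[OF N[OF that(1)] N[OF that(2)]] by (simp add: wrho_def fps_of_poly_add)
    show "wrho (X \<otimes>\<^bsub>D_E\<^esub> Y) r p = (\<Sum>q\<in>U. wrho X r q * wrho Y q p)"
      if "X \<in> carrier D_E" "Y \<in> carrier D_E" "finite U" "\<And>q. q \<notin> U \<Longrightarrow> wrho Y q p = 0" for X Y :: "'i operator" and p r :: "'i \<Rightarrow> int" and U
    proof -
      have out: "wsym Y q p = 0" if "q \<notin> U" for q
        using \<open>\<And>q. q \<notin> U \<Longrightarrow> wrho Y q p = 0\<close>[OF that] by (simp add: wrho_def)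
      have "wsym (X \<circ> Y) r p = (\<Sum>q\<in>U. wsym X r q * wsym Y q p)"
        by (rule wsym_mult[OF N[OF that(1)] N[OF that(2)] that(3)]) (rule out)
      then show ?thesis by (simp only: D_E_simps wrho_def fps_of_poly_sum fps_of_poly_mult)
    qed
    show "wrho (c \<odot>\<^bsub>D_E\<^esub> \<one>\<^bsub>D_E\<^esub>) q p = (if q = p then fps_const c else 0)" for c and p q :: "'i \<Rightarrow> int"
    proof -
      have id: "id \<in> normal_ops (shifts0 :: ('i \<Rightarrow> int) set)"
        using normal_ops.shift[of "\<lambda>_. 0" "shifts0 :: ('i \<Rightarrow> int) set"] by (simp add: shift_op_zero)
      have "c \<odot>\<^bsub>D_E\<^esub> \<one>\<^bsub>D_E\<^esub> = id \<circ> scal c" by (simp add: fun_eq_iff)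
      then have "wsym (c \<odot>\<^bsub>D_E\<^esub> \<one>\<^bsub>D_E\<^esub>) q p = smult c (wsym id q p)" using wsym_scal[OF id, of c q p] by simp
      then show ?thesis by (simp add: wrho_def wsym_id fps_of_poly_const)
    qed
    show "fps_X ^ upc (neg_set p) (neg_set q) dvd wrho X q p" if "X \<in> carrier D_E" for X :: "'i operator" and p q :: "'i \<Rightarrow> int"
    proof -
      note X = that
      obtain h where "wsym X q p = [:0, 1:] ^ upc (neg_set p) (neg_set q) * h"
        using wsym_dvd[OF N[OF X]] by (auto simp: dvd_def)
      then show ?thesis by (simp add: wrho_def fps_of_poly_mult X_power)
    qed
    show "shift_op (\<lambda>i. q i - p i) \<in> carrier D_E" if "p \<in> slice a" "q \<in> slice a" for p q :: "'i \<Rightarrow> int"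
      by (rule shift_op_D_E) (use in_slice that in blast)
    show "wrho (shift_op (\<lambda>i. q i - p i)) r p = (if r = q then fps_X ^ upc (neg_set p) (neg_set q) *
        fps_of_poly (unit_poly (\<lambda>i. q i - p i) p) else 0)" for p q r :: "'i \<Rightarrow> int"
      by (simp add: wrho_def wsym_shift shift_poly_eq fps_of_poly_mult X_power)
    show "fps_nth (fps_of_poly (unit_poly (\<lambda>i. q i - p i) p)) 0 \<noteq> 0" for p q :: "'i \<Rightarrow> int"
      using unit_poly_nonzero by (simp add: poly_0_coeff_0)
    show "hop undefined (of_int (p undefined)) \<in> carrier D_E" for p :: "'i \<Rightarrow> int" by (rule hop_D_E)
    show "wrho (hop undefined (of_int (p undefined))) p p = fps_X" for p :: "'i \<Rightarrow> int"
      by (simp add: wrho_def wsym_hop_diag fps_of_poly_fps_X)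
    show "wrho (hop undefined (of_int (p undefined))) r q = 0" if "r \<noteq> q" for p q r :: "'i \<Rightarrow> int"
      using that by (simp add: wrho_def wsym_hop_diag)
  qed
qed

section \<open>Weight modules\<close>

context left_module
begin

lemma pow_Suc_smult: "x \<in> carrier A \<Longrightarrow> m \<in> carrier M \<Longrightarrow> (x [^]\<^bsub>A\<^esub> Suc N) \<odot>\<^bsub>M\<^esub> m = (x [^]\<^bsub>A\<^esub> N) \<odot>\<^bsub>M\<^esub> (x \<odot>\<^bsub>M\<^esub> m)"
  by (simp add: smult_assoc)

lemma pow_add_smult:
  "x \<in> carrier A \<Longrightarrow> m \<in> carrier M \<Longrightarrow> (x [^]\<^bsub>A\<^esub> (K + N :: nat)) \<odot>\<^bsub>M\<^esub> m = (x [^]\<^bsub>A\<^esub> K) \<odot>\<^bsub>M\<^esub> ((x [^]\<^bsub>A\<^esub> N) \<odot>\<^bsub>M\<^esub> m)"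
  by (simp add: smult_assoc[symmetric] A.nat_pow_mult)

definition "nil x m \<longleftrightarrow> (\<exists>N::nat. (x [^]\<^bsub>A\<^esub> N) \<odot>\<^bsub>M\<^esub> m = \<zero>\<^bsub>M\<^esub>)"

lemma pow_mono: "x \<in> carrier A \<Longrightarrow> m \<in> carrier M \<Longrightarrow> (x [^]\<^bsub>A\<^esub> (N::nat)) \<odot>\<^bsub>M\<^esub> m = \<zero>\<^bsub>M\<^esub> \<Longrightarrow> N \<le> K \<Longrightarrow> (x [^]\<^bsub>A\<^esub> K) \<odot>\<^bsub>M\<^esub> m = \<zero>\<^bsub>M\<^esub>"
  using pow_add_smult[of x m "K - N" N] by simp

lemma nil_zero: "x \<in> carrier A \<Longrightarrow> nil x \<zero>\<^bsub>M\<^esub>"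
  unfolding nil_def by (intro exI[of _ 0]) simp

lemma nil_plus: 
  assumes x: "x \<in> carrier A" "m \<in> carrier M" "n \<in> carrier M" and "nil x m" "nil x n"
  shows "nil x (m \<oplus>\<^bsub>M\<^esub> n)"
proof -
  obtain N K :: nat where "(x [^]\<^bsub>A\<^esub> N) \<odot>\<^bsub>M\<^esub> m = \<zero>\<^bsub>M\<^esub>" "(x [^]\<^bsub>A\<^esub> K) \<odot>\<^bsub>M\<^esub> n = \<zero>\<^bsub>M\<^esub>" using assms unfolding nil_def by auto
  then have "(x [^]\<^bsub>A\<^esub> max N K) \<odot>\<^bsub>M\<^esub> m = \<zero>\<^bsub>M\<^esub>" "(x [^]\<^bsub>A\<^esub> max N K) \<odot>\<^bsub>M\<^esub> n = \<zero>\<^bsub>M\<^esub>"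
    using pow_mono x by (metis max.cobounded1 max.cobounded2)+
  then have "(x [^]\<^bsub>A\<^esub> max N K) \<odot>\<^bsub>M\<^esub> (m \<oplus>\<^bsub>M\<^esub> n) = \<zero>\<^bsub>M\<^esub>" using x by (simp add: smult_r_distr)
  then show ?thesis unfolding nil_def by blast
qed

lemma nil_finsum:
  assumes x: "x \<in> carrier A" and "finite U" "\<And>u. u \<in> U \<Longrightarrow> F u \<in> carrier M \<and> nil x (F u)"
  shows "nil x (\<Oplus>\<^bsub>M\<^esub>u\<in>U. F u)"
  using assms(2,3)
proof (induction U rule: finite_induct)
  case empty then show ?case by (simp add: nil_zero x)
next
  case (insert u U)
  have "(\<Oplus>\<^bsub>M\<^esub>u\<in>insert u U. F u) = F u \<oplus>\<^bsub>M\<^esub> (\<Oplus>\<^bsub>M\<^esub>u\<in>U. F u)" by (rule M.finsum_insert) (use insert in auto)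
  then show ?case using insert by (auto intro!: nil_plus M.finsum_closed simp: x)
qed

lemma pow_intertwine:
  assumes x: "x \<in> carrier A" "x' \<in> carrier A" "b \<in> carrier A" "x' \<otimes>\<^bsub>A\<^esub> b = b \<otimes>\<^bsub>A\<^esub> x" and m: "m \<in> carrier M"
  shows "(x' [^]\<^bsub>A\<^esub> (N::nat)) \<odot>\<^bsub>M\<^esub> (b \<odot>\<^bsub>M\<^esub> m) = b \<odot>\<^bsub>M\<^esub> ((x [^]\<^bsub>A\<^esub> N) \<odot>\<^bsub>M\<^esub> m)"
  using m
proof (induction N arbitrary: m)
  case 0 then show ?case using x by simp
next
  case (Suc N)
  have "x' \<odot>\<^bsub>M\<^esub> (b \<odot>\<^bsub>M\<^esub> m) = b \<odot>\<^bsub>M\<^esub> (x \<odot>\<^bsub>M\<^esub> m)" using x Suc.prems by (simp add: smult_assoc[symmetric])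
  then show ?case using Suc x by (simp only: pow_Suc_smult smult_closed)
qed

lemma nil_intertwine:
  assumes x: "x \<in> carrier A" "x' \<in> carrier A" "b \<in> carrier A" "x' \<otimes>\<^bsub>A\<^esub> b = b \<otimes>\<^bsub>A\<^esub> x" and m: "m \<in> carrier M" "nil x m"
  shows "nil x' (b \<odot>\<^bsub>M\<^esub> m)"
proof -
  obtain N :: nat where "(x [^]\<^bsub>A\<^esub> N) \<odot>\<^bsub>M\<^esub> m = \<zero>\<^bsub>M\<^esub>" using m by (auto simp: nil_def)
  then have "(x' [^]\<^bsub>A\<^esub> N) \<odot>\<^bsub>M\<^esub> (b \<odot>\<^bsub>M\<^esub> m) = \<zero>\<^bsub>M\<^esub>" using pow_intertwine[OF x m(1)] x by simp
  then show ?thesis unfolding nil_def by blast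
qed

text \<open>Induction on the sum of the two exponents replaces the binomial formula: applying
  \<open>x\<close> or \<open>z\<close> to \<open>m\<close> lowers one exponent and, since the two
  commute, keeps the other.\<close>

lemma nil_add:
  assumes x: "x \<in> carrier A" "z \<in> carrier A" "x \<otimes>\<^bsub>A\<^esub> z = z \<otimes>\<^bsub>A\<^esub> x" and m: "m \<in> carrier M" "nil x m" "nil z m"
  shows "nil (x \<oplus>\<^bsub>A\<^esub> z) m"
proof -
  have "(x [^]\<^bsub>A\<^esub> N) \<odot>\<^bsub>M\<^esub> m = \<zero>\<^bsub>M\<^esub> \<Longrightarrow> (z [^]\<^bsub>A\<^esub> K) \<odot>\<^bsub>M\<^esub> m = \<zero>\<^bsub>M\<^esub> \<Longrightarrow> m \<in> carrier M \<Longrightarrow> nil (x \<oplus>\<^bsub>A\<^esub> z) m" for N K :: nat and m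
  proof (induction "N + K" arbitrary: N K m)
    case 0 then show ?case using nil_zero[of "x \<oplus>\<^bsub>A\<^esub> z"] x by simp
  next
    case (Suc l)
    consider "N = 0 \<or> K = 0" | N' K' where "N = Suc N'" "K = Suc K'" by (metis not0_implies_Suc)
    then show ?case
    proof cases
      case 1 then have "m = \<zero>\<^bsub>M\<^esub>" using Suc.prems by auto
      then show ?thesis using nil_zero x by simp
    next
      case 2
      have "nil (x \<oplus>\<^bsub>A\<^esub> z) (x \<odot>\<^bsub>M\<^esub> m)"
      proof (rule Suc.hyps(1))
        show "l = N' + K" using Suc.hyps(2) 2 by simp
        show "(x [^]\<^bsub>A\<^esub> N') \<odot>\<^bsub>M\<^esub> (x \<odot>\<^bsub>M\<^esub> m) = \<zero>\<^bsub>M\<^esub>" using Suc.prems(1) unfolding 2 pow_Suc_smult[OF x(1) Suc.prems(3)] .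
        show "(z [^]\<^bsub>A\<^esub> K) \<odot>\<^bsub>M\<^esub> (x \<odot>\<^bsub>M\<^esub> m) = \<zero>\<^bsub>M\<^esub>"
          using pow_intertwine[OF x(2,2,1) x(3)[symmetric] Suc.prems(3)] Suc.prems(2) x by simp
      qed (use x Suc in simp)
      moreover have "nil (x \<oplus>\<^bsub>A\<^esub> z) (z \<odot>\<^bsub>M\<^esub> m)"
      proof (rule Suc.hyps(1))
        show "l = N + K'" using Suc.hyps(2) 2 by simp
        show "(z [^]\<^bsub>A\<^esub> K') \<odot>\<^bsub>M\<^esub> (z \<odot>\<^bsub>M\<^esub> m) = \<zero>\<^bsub>M\<^esub>" using Suc.prems(2) unfolding 2 pow_Suc_smult[OF x(2) Suc.prems(3)] .
        show "(x [^]\<^bsub>A\<^esub> N) \<odot>\<^bsub>M\<^esub> (z \<odot>\<^bsub>M\<^esub> m) = \<zero>\<^bsub>M\<^esub>"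
          using pow_intertwine[OF x(1,1,2) x(3) Suc.prems(3)] Suc.prems(1) x by simp
      qed (use x Suc in simp)
      ultimately have "nil (x \<oplus>\<^bsub>A\<^esub> z) (x \<odot>\<^bsub>M\<^esub> m \<oplus>\<^bsub>M\<^esub> z \<odot>\<^bsub>M\<^esub> m)" using x Suc.prems by (intro nil_plus) auto
      then have "nil (x \<oplus>\<^bsub>A\<^esub> z) ((x \<oplus>\<^bsub>A\<^esub> z) \<odot>\<^bsub>M\<^esub> m)" using x Suc.prems by (simp add: smult_l_distr)
      then obtain L :: nat where "((x \<oplus>\<^bsub>A\<^esub> z) [^]\<^bsub>A\<^esub> L) \<odot>\<^bsub>M\<^esub> ((x \<oplus>\<^bsub>A\<^esub> z) \<odot>\<^bsub>M\<^esub> m) = \<zero>\<^bsub>M\<^esub>" unfolding nil_def by blast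
      then have "((x \<oplus>\<^bsub>A\<^esub> z) [^]\<^bsub>A\<^esub> Suc L) \<odot>\<^bsub>M\<^esub> m = \<zero>\<^bsub>M\<^esub>" using pow_Suc_smult[of "x \<oplus>\<^bsub>A\<^esub> z" m L] x Suc.prems(3) by simp
      then show ?thesis unfolding nil_def by blast
    qed
  qed
  then show ?thesis using m unfolding nil_def by blast
qed

lemma smult_l_minus: "x \<in> carrier A \<Longrightarrow> m \<in> carrier M \<Longrightarrow> (\<ominus>\<^bsub>A\<^esub> x) \<odot>\<^bsub>M\<^esub> m = \<ominus>\<^bsub>M\<^esub> (x \<odot>\<^bsub>M\<^esub> m)"
  using smult_l_distr[of "\<ominus>\<^bsub>A\<^esub> x" x m] by (intro M.minus_equality[symmetric]) (auto simp: A.l_neg)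

text \<open>In a commutative algebra every element \<open>D\<close> acts on a simple module by zero or bijectively, so
  on a semisimple module \<open>D m\<close> is a multiple of \<open>D (D m)\<close>.\<close>

lemma semisimple_nil:
  assumes comm: "\<And>x z. x \<in> carrier A \<Longrightarrow> z \<in> carrier A \<Longrightarrow> x \<otimes>\<^bsub>A\<^esub> z = z \<otimes>\<^bsub>A\<^esub> x"
    and ss: "\<forall>m\<in>carrier M. \<exists>T. finite T \<and> T \<subseteq> \<Union>{S. submodule S A M \<and> S \<noteq> {\<zero>\<^bsub>M\<^esub>} \<and>
        (\<forall>T. submodule T A M \<longrightarrow> T \<subseteq> S \<longrightarrow> T = {\<zero>\<^bsub>M\<^esub>} \<or> T = S)} \<and> m = (\<Oplus>\<^bsub>M\<^esub>x\<in>T. x)"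
    and D: "D \<in> carrier A" and m: "m \<in> carrier M" "nil D m"
  shows "D \<odot>\<^bsub>M\<^esub> m = \<zero>\<^bsub>M\<^esub>"
proof -
  let ?P = "\<lambda>m. m \<in> carrier M \<and> (\<exists>c\<in>carrier A. D \<odot>\<^bsub>M\<^esub> m = c \<odot>\<^bsub>M\<^esub> (D \<odot>\<^bsub>M\<^esub> (D \<odot>\<^bsub>M\<^esub> m)))"
  have sw: "x \<odot>\<^bsub>M\<^esub> (z \<odot>\<^bsub>M\<^esub> v) = z \<odot>\<^bsub>M\<^esub> (x \<odot>\<^bsub>M\<^esub> v)" if "x \<in> carrier A" "z \<in> carrier A" "v \<in> carrier M" for x z v
    using that comm by (simp add: smult_assoc[symmetric])
  have simple: "?P x" if S: "submodule S A M" "\<And>T. submodule T A M \<Longrightarrow> T \<subseteq> S \<Longrightarrow> T = {\<zero>\<^bsub>M\<^esub>} \<or> T = S"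
    and x: "x \<in> S" for S x
  proof -
    have xM: "x \<in> carrier M" using subgroup.subset[OF submodule.axioms(1)[OF S(1)]] x by auto
    show ?thesis
    proof (cases "D \<odot>\<^bsub>M\<^esub> x = \<zero>\<^bsub>M\<^esub>")
      case True then show ?thesis using xM D by (auto intro!: bexI[of _ D])
    next
      case False
      \<comment> \<open>A nonzero submodule of the simple module \<open>S\<close>, hence all of it,
        so that \<open>x\<close> itself is a multiple of \<open>D x\<close>.\<close>
      define T where "T = (\<lambda>a. a \<odot>\<^bsub>M\<^esub> (D \<odot>\<^bsub>M\<^esub> x)) ` carrier A"
      have DxM: "D \<odot>\<^bsub>M\<^esub> x \<in> carrier M" using D xM by simp
      have "submodule T A M"
      proof
        show "T \<subseteq> carrier (add_monoid M)" using DxM by (auto simp: T_def)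
        show "u \<otimes>\<^bsub>add_monoid M\<^esub> v \<in> T" if "u \<in> T" "v \<in> T" for u v
        proof -
          note h = that
          obtain a b where "a \<in> carrier A" "b \<in> carrier A" "u = a \<odot>\<^bsub>M\<^esub> (D \<odot>\<^bsub>M\<^esub> x)" "v = b \<odot>\<^bsub>M\<^esub> (D \<odot>\<^bsub>M\<^esub> x)"
            using h by (auto simp: T_def)
          then show ?thesis unfolding T_def using DxM by (intro image_eqI[of _ _ "a \<oplus>\<^bsub>A\<^esub> b"]) (auto simp: smult_l_distr)
        qed
        show "\<one>\<^bsub>add_monoid M\<^esub> \<in> T" unfolding T_def using DxM by (intro image_eqI[of _ _ "\<zero>\<^bsub>A\<^esub>"]) auto
        show "inv\<^bsub>add_monoid M\<^esub> u \<in> T" if "u \<in> T" for u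
        proof -
          note h = that
          obtain a where a: "a \<in> carrier A" "u = a \<odot>\<^bsub>M\<^esub> (D \<odot>\<^bsub>M\<^esub> x)" using h by (auto simp: T_def)
          then have "\<ominus>\<^bsub>M\<^esub> u \<in> T" unfolding T_def using DxM by (intro image_eqI[of _ _ "\<ominus>\<^bsub>A\<^esub> a"]) (auto simp: smult_l_minus)
          then show ?thesis by (simp add: a_inv_def)
        qed
        show "a \<odot>\<^bsub>M\<^esub> u \<in> T" if "a \<in> carrier A" "u \<in> T" for a u
          using that DxM unfolding T_def by (auto simp: smult_assoc[symmetric])
      qed
      moreover have "T \<subseteq> S" unfolding T_def using S(1) x D by (auto simp: submodule_def submodule_axioms_def)
      moreover have "D \<odot>\<^bsub>M\<^esub> x \<in> T" unfolding T_def by (rule image_eqI[of _ _ "\<one>\<^bsub>A\<^esub>"]) (use DxM in auto)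
      ultimately have "T = S" using S(2)[of T] False by blast
      then have "x \<in> T" using x by simp
      then obtain b where b: "b \<in> carrier A" "x = b \<odot>\<^bsub>M\<^esub> (D \<odot>\<^bsub>M\<^esub> x)" unfolding T_def by auto
      have "D \<odot>\<^bsub>M\<^esub> x = D \<odot>\<^bsub>M\<^esub> (b \<odot>\<^bsub>M\<^esub> (D \<odot>\<^bsub>M\<^esub> x))" using b(2) by simp
      also have "\<dots> = b \<odot>\<^bsub>M\<^esub> (D \<odot>\<^bsub>M\<^esub> (D \<odot>\<^bsub>M\<^esub> x))" by (rule sw[OF D b(1) DxM])
      finally show ?thesis using b(1) xM by blast
    qed
  qed
  have plus: "?P (m \<oplus>\<^bsub>M\<^esub> n)" if mn: "?P m" "?P n" for m n
  proof -
    obtain c b where cb: "c \<in> carrier A" "D \<odot>\<^bsub>M\<^esub> m = c \<odot>\<^bsub>M\<^esub> (D \<odot>\<^bsub>M\<^esub> (D \<odot>\<^bsub>M\<^esub> m))" "b \<in> carrier A" "D \<odot>\<^bsub>M\<^esub> n = b \<odot>\<^bsub>M\<^esub> (D \<odot>\<^bsub>M\<^esub> (D \<odot>\<^bsub>M\<^esub> n))"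
      using mn by auto
    have M: "m \<in> carrier M" "n \<in> carrier M" using mn by auto
    \<comment> \<open>Chosen so that \<open>1 - d D = (1 - c D) (1 - b D)\<close>, an element that
      kills both \<open>D m\<close> and \<open>D n\<close>.\<close>
    define d where "d = c \<oplus>\<^bsub>A\<^esub> b \<oplus>\<^bsub>A\<^esub> \<ominus>\<^bsub>A\<^esub> (c \<otimes>\<^bsub>A\<^esub> (b \<otimes>\<^bsub>A\<^esub> D))"
    have d: "d \<odot>\<^bsub>M\<^esub> v = c \<odot>\<^bsub>M\<^esub> v \<oplus>\<^bsub>M\<^esub> b \<odot>\<^bsub>M\<^esub> v \<oplus>\<^bsub>M\<^esub> \<ominus>\<^bsub>M\<^esub> (c \<odot>\<^bsub>M\<^esub> (b \<odot>\<^bsub>M\<^esub> (D \<odot>\<^bsub>M\<^esub> v)))" if "v \<in> carrier M" for v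
      unfolding d_def using cb D that by (simp add: smult_l_distr smult_l_minus smult_assoc)
    have dA: "d \<in> carrier A" using cb D by (simp add: d_def)
    have "d \<odot>\<^bsub>M\<^esub> (D \<odot>\<^bsub>M\<^esub> (D \<odot>\<^bsub>M\<^esub> m)) = D \<odot>\<^bsub>M\<^esub> m"
    proof -
      let ?v = "D \<odot>\<^bsub>M\<^esub> (D \<odot>\<^bsub>M\<^esub> m)"
      have v: "?v \<in> carrier M" using D M by simp
      have "c \<odot>\<^bsub>M\<^esub> (b \<odot>\<^bsub>M\<^esub> (D \<odot>\<^bsub>M\<^esub> ?v)) = b \<odot>\<^bsub>M\<^esub> (D \<odot>\<^bsub>M\<^esub> (c \<odot>\<^bsub>M\<^esub> ?v))" using sw[of c b "D \<odot>\<^bsub>M\<^esub> ?v"] sw[of c D ?v] cb D v by simp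
      then have "c \<odot>\<^bsub>M\<^esub> (b \<odot>\<^bsub>M\<^esub> (D \<odot>\<^bsub>M\<^esub> ?v)) = b \<odot>\<^bsub>M\<^esub> ?v" using cb(2) by simp
      then show ?thesis unfolding d[OF v] using cb(1,3) cb(2)[symmetric] v D M by (simp add: M.a_assoc M.r_neg)
    qed
    moreover have "d \<odot>\<^bsub>M\<^esub> (D \<odot>\<^bsub>M\<^esub> (D \<odot>\<^bsub>M\<^esub> n)) = D \<odot>\<^bsub>M\<^esub> n"
    proof -
      let ?v = "D \<odot>\<^bsub>M\<^esub> (D \<odot>\<^bsub>M\<^esub> n)"
      have v: "?v \<in> carrier M" using D M by simp
      have "b \<odot>\<^bsub>M\<^esub> (D \<odot>\<^bsub>M\<^esub> ?v) = D \<odot>\<^bsub>M\<^esub> (b \<odot>\<^bsub>M\<^esub> ?v)" using sw[of b D ?v] cb D v by simp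
      then have "c \<odot>\<^bsub>M\<^esub> (b \<odot>\<^bsub>M\<^esub> (D \<odot>\<^bsub>M\<^esub> ?v)) = c \<odot>\<^bsub>M\<^esub> ?v" using cb(4) by simp
      then show ?thesis unfolding d[OF v] using cb(1,3) cb(4)[symmetric] v D M by (simp add: M.a_ac M.r_neg)
    qed
    ultimately have "D \<odot>\<^bsub>M\<^esub> (m \<oplus>\<^bsub>M\<^esub> n) = d \<odot>\<^bsub>M\<^esub> (D \<odot>\<^bsub>M\<^esub> (D \<odot>\<^bsub>M\<^esub> (m \<oplus>\<^bsub>M\<^esub> n)))"
      using D M dA by (simp add: smult_r_distr)
    then show ?thesis using dA M by blast
  qed
  have sums: "finite T \<Longrightarrow> (\<And>x. x \<in> T \<Longrightarrow> ?P x) \<Longrightarrow> ?P (\<Oplus>\<^bsub>M\<^esub>x\<in>T. x)" for T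
  proof (induction T rule: finite_induct)
    case empty then show ?case using D by (auto intro!: bexI[of _ D])
  next
    case (insert x T)
    have "(\<Oplus>\<^bsub>M\<^esub>x\<in>insert x T. x) = x \<oplus>\<^bsub>M\<^esub> (\<Oplus>\<^bsub>M\<^esub>x\<in>T. x)" by (rule M.finsum_insert) (use insert in auto)
    then show ?case using plus[of x "\<Oplus>\<^bsub>M\<^esub>x\<in>T. x"] insert by simp
  qed
  obtain T where T: "finite T" "T \<subseteq> \<Union>{S. submodule S A M \<and> S \<noteq> {\<zero>\<^bsub>M\<^esub>} \<and>
        (\<forall>T. submodule T A M \<longrightarrow> T \<subseteq> S \<longrightarrow> T = {\<zero>\<^bsub>M\<^esub>} \<or> T = S)}" "m = (\<Oplus>\<^bsub>M\<^esub>x\<in>T. x)"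
    using ss m(1) by blast
  have "?P x" if "x \<in> T" for x
  proof -
    obtain S where "submodule S A M" "x \<in> S" "\<And>T. submodule T A M \<Longrightarrow> T \<subseteq> S \<Longrightarrow> T = {\<zero>\<^bsub>M\<^esub>} \<or> T = S" using T(2) \<open>x \<in> T\<close> by blast
    then show ?thesis by (intro simple)
  qed
  then have "?P m" using sums[OF T(1)] unfolding T(3) by blast
  then obtain c where c: "c \<in> carrier A" "D \<odot>\<^bsub>M\<^esub> m = c \<odot>\<^bsub>M\<^esub> (D \<odot>\<^bsub>M\<^esub> (D \<odot>\<^bsub>M\<^esub> m))" by blast
  \<comment> \<open>Substituted into itself, the equation makes \<open>D v\<close> a multiple of all
    higher powers of \<open>D\<close> at \<open>v\<close>, so it vanishes with them.\<close>
  have step: "D \<odot>\<^bsub>M\<^esub> v = \<zero>\<^bsub>M\<^esub>" if v: "v \<in> carrier M" "(D [^]\<^bsub>A\<^esub> N) \<odot>\<^bsub>M\<^esub> v = \<zero>\<^bsub>M\<^esub>" "D \<odot>\<^bsub>M\<^esub> v = c \<odot>\<^bsub>M\<^esub> (D \<odot>\<^bsub>M\<^esub> (D \<odot>\<^bsub>M\<^esub> v))" for N :: nat and v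
    using v
  proof (induction N arbitrary: v)
    case 0 then show ?case using D by simp
  next
    case (Suc N)
    have "D \<odot>\<^bsub>M\<^esub> (D \<odot>\<^bsub>M\<^esub> v) = \<zero>\<^bsub>M\<^esub>"
    proof (rule Suc.IH)
      show "(D [^]\<^bsub>A\<^esub> N) \<odot>\<^bsub>M\<^esub> (D \<odot>\<^bsub>M\<^esub> v) = \<zero>\<^bsub>M\<^esub>" using Suc.prems(2) unfolding pow_Suc_smult[OF D Suc.prems(1)] .
      show "D \<odot>\<^bsub>M\<^esub> (D \<odot>\<^bsub>M\<^esub> v) = c \<odot>\<^bsub>M\<^esub> (D \<odot>\<^bsub>M\<^esub> (D \<odot>\<^bsub>M\<^esub> (D \<odot>\<^bsub>M\<^esub> v)))"
        using Suc.prems(3) sw[of D c "D \<odot>\<^bsub>M\<^esub> (D \<odot>\<^bsub>M\<^esub> v)"] c(1) D Suc.prems(1) by simp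
    qed (use D Suc in simp)
    then show ?case using Suc.prems(3) c(1) by simp
  qed
  show ?thesis using step[OF m(1) _ c(2)] m(2) unfolding nil_def by blast
qed

end

text \<open>Serves to pass from the decomposition over all complex weights to one indexed by
  integral weights, with \<open>g\<close> the embedding of the latter.\<close>

lemma is_direct_sum_reindex:
  assumes ds: "is_direct_sum M W" and g: "inj g" and W: "\<And>l. l \<notin> range g \<Longrightarrow> W l = {\<zero>\<^bsub>M\<^esub>}"
    and M: "abelian_group M" "\<And>l. W l \<subseteq> carrier M"
  shows "is_direct_sum M (\<lambda>k. W (g k))"
  unfolding is_direct_sum_def
proof
  interpret M: abelian_group M by (rule M)
  fix m assume m: "m \<in> carrier M"
  let ?D = "\<lambda>f. (\<forall>l. f l \<in> W l) \<and> finite {l. f l \<noteq> \<zero>\<^bsub>M\<^esub>} \<and> m = (\<Oplus>\<^bsub>M\<^esub>l\<in>{l. f l \<noteq> \<zero>\<^bsub>M\<^esub>}. f l)"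
  let ?E = "\<lambda>f. (\<forall>k. f k \<in> W (g k)) \<and> finite {k. f k \<noteq> \<zero>\<^bsub>M\<^esub>} \<and> m = (\<Oplus>\<^bsub>M\<^esub>k\<in>{k. f k \<noteq> \<zero>\<^bsub>M\<^esub>}. f k)"
  have equiv: "?D f \<longleftrightarrow> ?E (f \<circ> g)" if f: "\<And>l. f l \<in> W l" for f
  proof -
    have s: "{l. f l \<noteq> \<zero>\<^bsub>M\<^esub>} = g ` {k. (f \<circ> g) k \<noteq> \<zero>\<^bsub>M\<^esub>}"
    proof (intro subset_antisym subsetI)
      fix l assume l: "l \<in> {l. f l \<noteq> \<zero>\<^bsub>M\<^esub>}"
      then have "l \<in> range g" using W[of l] f[of l] by auto
      then show "l \<in> g ` {k. (f \<circ> g) k \<noteq> \<zero>\<^bsub>M\<^esub>}" using l by auto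
    qed auto
    have i: "inj_on g X" for X using g by (auto intro: inj_on_subset)
    have "(\<Oplus>\<^bsub>M\<^esub>l\<in>{l. f l \<noteq> \<zero>\<^bsub>M\<^esub>}. f l) = (\<Oplus>\<^bsub>M\<^esub>k\<in>{k. (f \<circ> g) k \<noteq> \<zero>\<^bsub>M\<^esub>}. (f \<circ> g) k)"
      unfolding s o_def by (rule M.finsum_reindex[OF _ i]) (use f M(2) in auto)
    moreover have "finite {l. f l \<noteq> \<zero>\<^bsub>M\<^esub>} \<longleftrightarrow> finite {k. (f \<circ> g) k \<noteq> \<zero>\<^bsub>M\<^esub>}" unfolding s by (rule finite_image_iff[OF i])
    ultimately show ?thesis using f by auto
  qed
  have u: "\<exists>!f. ?D f" using ds m unfolding is_direct_sum_def by blast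
  then obtain f where f: "?D f" "\<And>f'. ?D f' \<Longrightarrow> f' = f" by blast
  show "\<exists>!f. ?E f"
  proof (rule ex1I[of _ "f \<circ> g"])
    have "f l \<in> W l" for l using f(1) by blast
    then show "?E (f \<circ> g)" using equiv[of f] f(1) by blast
    fix h assume h: "?E h"
    define h' where "h' l = (if l \<in> range g then h (inv_into UNIV g l) else \<zero>\<^bsub>M\<^esub>)" for l
    have hg: "h' \<circ> g = h" using g by (auto simp: h'_def fun_eq_iff)
    have hW: "h' l \<in> W l" for l
    proof (cases "l \<in> range g")
      case True
      then obtain k where "l = g k" by blast
      then show ?thesis using h fun_cong[OF hg, of k] by simp
    next
      case False then show ?thesis using W by (simp add: h'_def)
    qed
    have "?D h'" unfolding equiv[OF hW] hg by (rule h)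
    then show "h = f \<circ> g" using f(2)[of h'] hg by simp
  qed
qed

lemma (in left_module) nil_mult:
  assumes x: "x \<in> carrier A" "z \<in> carrier A" "x \<otimes>\<^bsub>A\<^esub> z = z \<otimes>\<^bsub>A\<^esub> x" and m: "m \<in> carrier M" "nil z m"
  shows "nil (x \<otimes>\<^bsub>A\<^esub> z) m"
proof -
  obtain N :: nat where N: "(z [^]\<^bsub>A\<^esub> N) \<odot>\<^bsub>M\<^esub> m = \<zero>\<^bsub>M\<^esub>" using m unfolding nil_def by blast
  have "((x \<otimes>\<^bsub>A\<^esub> z) [^]\<^bsub>A\<^esub> N) \<odot>\<^bsub>M\<^esub> m = (x [^]\<^bsub>A\<^esub> N) \<odot>\<^bsub>M\<^esub> ((z [^]\<^bsub>A\<^esub> N) \<odot>\<^bsub>M\<^esub> m)"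
    unfolding A.pow_mult_distrib[OF x(3,1,2)] using x m by (intro smult_assoc) auto
  then show ?thesis unfolding nil_def N using x by (intro exI[of _ N]) simp
qed

lemma hop_abs: "(\<lambda>p. t_partial i p - scal c p) = hop i c" by (simp add: hop_def fun_eq_iff)

lemma hop_commute: "hop i c \<circ> hop j d = hop j d \<circ> hop i c"
  by (rule ext, rule poly_mapping_eqI) (simp add: lookup_hop)

text \<open>Hence \<open>shift_op d\<close> moves vectors of weight \<open>q\<close> to weight
  \<open>q + d\<close>, see \<open>shift_op_W\<close>.\<close>

lemma hop_shift_op: "hop i (c + of_int (d i)) \<circ> shift_op d = shift_op d \<circ> hop i c"
proof (rule linear_op_eqI)
  fix m
  show "(hop i (c + of_int (d i)) \<circ> shift_op d) (xmon m) = (shift_op d \<circ> hop i c) (xmon m)"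
  proof (cases "falling d m = 0")
    case False
    then have "0 \<le> ei m j + d j" for j using falling_zero[of m j d] by linarith
    then have "ei (en (\<lambda>i. ei m i + d i)) i = ei m i + d i" by (subst ei_en) auto
    then have "int (lookup (en (\<lambda>i. ei m i + d i)) i) = int (lookup m i) + d i" by (simp add: ei_def)
    then have "of_nat (lookup (en (\<lambda>i. ei m i + d i)) i) = (of_nat (lookup m i) + of_int (d i) :: complex)"
      by (metis of_int_add of_int_of_nat_eq)
    then show ?thesis
      by (simp add: hop_mon shift_op_mon linear_opD(2)[OF linear_hop] linear_opD(2)[OF linear_shift_op] mult.commute)
  qed (simp add: shift_op_mon hop_mon linear_opD(2)[OF linear_shift_op] linear_opD(3)[OF linear_hop])
qed (simp_all add: linear_op_intros linear_hop linear_shift_op)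

abbreviation (input) "H'_gens \<equiv> {\<lambda>p. t_partial i p - t_partial j p | i j. True}"

lemma carrier_H': "carrier H' = generated_operators H'_gens" by (simp add: H'_def)

lemma H'_gen_hop: "(\<lambda>p. t_partial i p - t_partial j p) = (\<lambda>p. hop i 0 p + (scal (-1) \<circ> hop j 0) p)"
  by (rule ext, rule poly_mapping_eqI) (simp add: lookup_add lookup_minus lookup_hop lookup_t_partial)

text \<open>Monomials are common eigenvectors of the generators. This gives the commutativity that
  \<open>semisimple_nil\<close> asks for.\<close>

lemma H'_diagonal: "X \<in> carrier H' \<Longrightarrow> \<exists>h. \<forall>p m. lookup (X p) m = h m * lookup p m"
  unfolding carrier_H'
proof (induction rule: generated_operators.induct)
  case (generator X)
  then obtain i j where "X = (\<lambda>p. t_partial i p - t_partial j p)" by auto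
  then show ?case
    by (intro exI[of _ "\<lambda>m. of_nat (lookup m i) - of_nat (lookup m j)"]) (simp add: lookup_minus lookup_t_partial algebra_simps)
next
  case (scalar c) then show ?case by (intro exI[of _ "\<lambda>_. c"]) simp
next
  case (add X Y)
  then obtain g h where "\<forall>p m. lookup (X p) m = g m * lookup p m" "\<forall>p m. lookup (Y p) m = h m * lookup p m" by blast
  then show ?case by (intro exI[of _ "\<lambda>m. g m + h m"]) (simp add: lookup_add algebra_simps)
next
  case (comp X Y)
  then obtain g h where "\<forall>p m. lookup (X p) m = g m * lookup p m" "\<forall>p m. lookup (Y p) m = h m * lookup p m" by blast
  then show ?case by (intro exI[of _ "\<lambda>m. g m * h m"]) simp
qed

lemma H'_commute: "X \<in> carrier H' \<Longrightarrow> Y \<in> carrier H' \<Longrightarrow> X \<circ> Y = Y \<circ> X"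
proof (rule ext, rule poly_mapping_eqI)
  fix p m assume "X \<in> carrier H'" "Y \<in> carrier H'"
  then obtain g h where "\<forall>p m. lookup (X p) m = g m * lookup p m" "\<forall>p m. lookup (Y p) m = h m * lookup p m"
    using H'_diagonal by metis
  then show "lookup ((X \<circ> Y) p) m = lookup ((Y \<circ> X) p) m" by simp
qed

lemma H'_D_E: "carrier H' \<subseteq> carrier (D_E :: (complex, ('i::finite) operator) module)"
proof
  fix X :: "'i operator" assume "X \<in> carrier H'"
  then show "X \<in> carrier D_E" unfolding carrier_H'
  proof (induction rule: generated_operators.induct)
    case (generator X)
    then obtain i j where "X = (\<lambda>p. t_partial i p - t_partial j p)" by auto
    then show ?case unfolding H'_gen_hop by (simp only: D_E_closed hop_D_E)
  qed (simp_all only: D_E_closed)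
qed

lemma complex_algebra_H': "complex_algebra (H' :: (complex, ('i::finite) operator) module)"
  unfolding H'_def
proof (rule complex_algebra_operators)
  fix X :: "'i operator" assume "X \<in> generated_operators H'_gens"
  then have "X \<in> carrier H'" by (simp add: carrier_H')
  then show "linear_op X" using H'_D_E D_E_closed(4) by blast
qed (fact generated_operators.scalar generated_operators.add generated_operators.comp)+

lemma H'_simps [simp]:
  "X \<otimes>\<^bsub>H'\<^esub> Y = X \<circ> Y" "\<one>\<^bsub>H'\<^esub> = id" "\<zero>\<^bsub>H'\<^esub> = (\<lambda>p. 0)" "X \<oplus>\<^bsub>H'\<^esub> Y = (\<lambda>p. X p + Y p)"
  "c \<odot>\<^bsub>H'\<^esub> X = (\<lambda>p. scal c (X p))"
  by (simp_all add: H'_def)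

lemma pow_H': "X [^]\<^bsub>H'\<^esub> (N::nat) = X [^]\<^bsub>D_E\<^esub> N"
  by (induction N) (simp_all add: nat_pow_def)

lemma left_module_H': "left_module D_E M \<Longrightarrow> left_module (H' :: (complex, ('i::finite) operator) module) M"
proof -
  assume "left_module D_E M"
  then interpret left_module D_E M .
  have r: "ring (H' :: (complex, 'i operator) module)" using complex_algebra_H' complex_algebra.axioms by blast
  have D: "X \<in> carrier D_E" if "X \<in> carrier H'" for X :: "'i operator" using that H'_D_E by blast
  show ?thesis
    by (intro left_module.intro r left_module_axioms.intro M.abelian_group_axioms)
      (use smult_closed smult_l_distr smult_r_distr smult_assoc smult_one in \<open>auto dest!: D simp del: o_apply\<close>)
qed

lemma hop_diff_H': "(\<lambda>p. hop i c p + (scal (-1) \<circ> hop j d) p) \<in> carrier H'"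
proof -
  have "(\<lambda>p. hop i c p + (scal (-1) \<circ> hop j d) p) = (\<lambda>p. (t_partial i p - t_partial j p) + scal (d - c) p)"
    by (rule ext, rule poly_mapping_eqI) (simp add: lookup_add lookup_minus lookup_hop lookup_t_partial algebra_simps)
  moreover have "(\<lambda>p. t_partial i p - t_partial j p) \<in> generated_operators H'_gens"
    by (rule generated_operators.generator) blast
  ultimately show ?thesis unfolding carrier_H' using generated_operators.add[OF _ generated_operators.scalar] by simp
qed

section \<open>Weight spaces of modules over the centralizer\<close>

locale D_E_module = left_module "D_E :: (complex, ('i::finite) operator) module" M for M :: "(('i::finite) operator, 'u) module"
begin

sublocale complex_module D_E M
  by (intro complex_module.intro complex_algebra_D_E left_module_axioms)

abbreviation "W \<mu> \<equiv> weight_space M \<mu>"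

text \<open>\<open>weight_space\<close> demands one positive exponent for all indices. As there are
  finitely many indices, the successor of the sum of separate exponents will do.\<close>

lemma W_iff: "m \<in> W q \<longleftrightarrow> m \<in> carrier M \<and> (\<forall>i. nil (hop i (q i)) m)"
proof
  assume "m \<in> W q"
  then show "m \<in> carrier M \<and> (\<forall>i. nil (hop i (q i)) m)" unfolding weight_space_def hop_abs nil_def by blast
next
  assume m: "m \<in> carrier M \<and> (\<forall>i. nil (hop i (q i)) m)"
  then obtain N :: "'i \<Rightarrow> nat" where N: "\<And>i. (hop i (q i) [^]\<^bsub>D_E\<^esub> N i) \<odot>\<^bsub>M\<^esub> m = \<zero>\<^bsub>M\<^esub>"
    unfolding nil_def by metis
  have "(hop i (q i) [^]\<^bsub>D_E\<^esub> Suc (\<Sum>i\<in>UNIV. N i)) \<odot>\<^bsub>M\<^esub> m = \<zero>\<^bsub>M\<^esub>" for i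
    by (rule pow_mono[OF hop_D_E _ N[of i]]) (use m in \<open>auto intro!: le_SucI member_le_sum\<close>)
  then show "m \<in> W q" unfolding weight_space_def hop_abs using m by blast
qed

lemma subspace_W: "subspace_set (W q)"
  unfolding subspace_set_def
proof (intro conjI ballI allI)
  show "W q \<subseteq> carrier M" by (auto simp: W_iff)
  show "\<zero>\<^bsub>M\<^esub> \<in> W q" by (simp add: W_iff nil_zero hop_D_E)
  show "m \<oplus>\<^bsub>M\<^esub> n \<in> W q" if "m \<in> W q" "n \<in> W q" for m n
    using that by (auto simp: W_iff nil_plus hop_D_E)
  show "cs c m \<in> W q" if "m \<in> W q" for c m
    unfolding cscale_def W_iff
  proof (intro conjI allI)
    have m: "m \<in> carrier M" using that by (simp add: W_iff)
    show "(c \<odot>\<^bsub>D_E\<^esub> \<one>\<^bsub>D_E\<^esub>) \<odot>\<^bsub>M\<^esub> m \<in> carrier M" by (rule smult_closed[OF smult_one_closed m])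
    show "nil (hop i (q i)) ((c \<odot>\<^bsub>D_E\<^esub> \<one>\<^bsub>D_E\<^esub>) \<odot>\<^bsub>M\<^esub> m)" for i
      by (rule nil_intertwine[OF hop_D_E hop_D_E smult_one_closed smult_one_central[symmetric, OF hop_D_E] m])
        (use that in \<open>simp add: W_iff\<close>)
  qed
qed

lemma hop_W: "m \<in> W q \<Longrightarrow> hop i c \<odot>\<^bsub>M\<^esub> m \<in> W q"
  unfolding W_iff
  using nil_intertwine[OF hop_D_E hop_D_E hop_D_E, of _ _ i c, unfolded D_E_simps, OF hop_commute] hop_D_E by blast

lemma shift_op_W: "d \<in> shifts0 \<Longrightarrow> m \<in> W q \<Longrightarrow> shift_op d \<odot>\<^bsub>M\<^esub> m \<in> W (\<lambda>i. q i + of_int (d i))"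
  unfolding W_iff
  using nil_intertwine[OF hop_D_E hop_D_E shift_op_D_E, of d, unfolded D_E_simps, OF _ hop_shift_op] shift_op_D_E by blast

text \<open>The operator is the sum of the commuting \<open>hop i (q i)\<close>, each of which is
  nilpotent on \<open>m\<close>.\<close>

lemma euler_nil:
  assumes "m \<in> W q" shows "(\<lambda>p :: 'i mpoly. euler p - scal (\<Sum>i\<in>UNIV. q i) p) \<in> carrier D_E" "nil (\<lambda>p :: 'i mpoly. euler p - scal (\<Sum>i\<in>UNIV. q i) p) m"
proof -
  define E where "E U = (\<lambda>p. \<Sum>i\<in>U. hop i (q i) p)" for U
  have m: "m \<in> carrier M" "\<And>i. nil (hop i (q i)) m" using assms by (auto simp: W_iff)
  have EU: "E U \<in> carrier D_E \<and> nil (E U) m" if "finite U" for U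
    using that
  proof (induction U rule: finite_induct)
    case empty
    have "E {} = \<zero>\<^bsub>D_E\<^esub>" by (simp add: E_def)
    then have "E {} \<in> carrier D_E" "(E {} [^]\<^bsub>D_E\<^esub> Suc 0) \<odot>\<^bsub>M\<^esub> m = \<zero>\<^bsub>M\<^esub>"
      using A.zero_closed m(1) by (simp_all only: pow_Suc_smult) (simp_all only: smult_l_null smult_r_null A.nat_pow_closed)
    then show ?case unfolding nil_def by blast
  next
    case (insert i U)
    have E: "E (insert i U) = hop i (q i) \<oplus>\<^bsub>D_E\<^esub> E U" using insert(1,2) by (simp add: E_def)
    have "hop i (q i) \<otimes>\<^bsub>D_E\<^esub> E U = E U \<otimes>\<^bsub>D_E\<^esub> hop i (q i)"
      unfolding D_E_simps
      by (rule ext, rule poly_mapping_eqI) (simp add: E_def lookup_hop lookup_sum sum_distrib_left algebra_simps)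
    then show ?case unfolding E using insert.IH hop_D_E m by (intro conjI nil_add A.a_closed) auto
  qed
  have e: "E UNIV = (\<lambda>p :: 'i mpoly. euler p - scal (\<Sum>i\<in>UNIV. q i) p)"
    by (rule ext, rule poly_mapping_eqI)
      (simp add: E_def lookup_sum lookup_hop lookup_minus euler_def lookup_t_partial sum_distrib_right sum_subtractf algebra_simps)
  show "(\<lambda>p :: 'i mpoly. euler p - scal (\<Sum>i\<in>UNIV. q i) p) \<in> carrier D_E" using EU[OF finite[of UNIV]] unfolding e by blast
  show "nil (\<lambda>p :: 'i mpoly. euler p - scal (\<Sum>i\<in>UNIV. q i) p) m" using EU[OF finite[of UNIV]] unfolding e by blast
qed

lemma nil_scal: "nil (scal c) m \<Longrightarrow> c \<noteq> 0 \<Longrightarrow> m \<in> carrier M \<Longrightarrow> m = \<zero>\<^bsub>M\<^esub>"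
proof -
  assume m: "nil (scal c) m" "c \<noteq> 0" "m \<in> carrier M"
  obtain N :: nat where N: "(scal c [^]\<^bsub>D_E\<^esub> N) \<odot>\<^bsub>M\<^esub> m = \<zero>\<^bsub>M\<^esub>" using m unfolding nil_def by blast
  have i: "scal (1 / c) \<otimes>\<^bsub>D_E\<^esub> scal c = \<one>\<^bsub>D_E\<^esub>" using m by (auto simp: fun_eq_iff)
  have "(scal c [^]\<^bsub>D_E\<^esub> N) \<odot>\<^bsub>M\<^esub> v = \<zero>\<^bsub>M\<^esub> \<Longrightarrow> v \<in> carrier M \<Longrightarrow> v = \<zero>\<^bsub>M\<^esub>" for v
  proof (induction N arbitrary: v)
    case 0 then show ?case by (simp only: A.nat_pow_0 smult_one)
  next
    case (Suc N)
    have "(scal c [^]\<^bsub>D_E\<^esub> N) \<odot>\<^bsub>M\<^esub> (scal c \<odot>\<^bsub>M\<^esub> v) = \<zero>\<^bsub>M\<^esub>"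
      using Suc.prems(1) unfolding pow_Suc_smult[OF D_E_closed(1) Suc.prems(2)] .
    then have "scal c \<odot>\<^bsub>M\<^esub> v = \<zero>\<^bsub>M\<^esub>" by (rule Suc.IH[OF _ smult_closed[OF D_E_closed(1) Suc.prems(2)]])
    then have "(scal (1 / c) \<otimes>\<^bsub>D_E\<^esub> scal c) \<odot>\<^bsub>M\<^esub> v = \<zero>\<^bsub>M\<^esub>"
      by (simp only: smult_assoc[OF D_E_closed(1) D_E_closed(1) Suc.prems(2)] smult_r_null D_E_closed(1))
    then show ?case unfolding i using Suc.prems(2) by (simp only: smult_one)
  qed
  then show ?thesis using N m(3) by blast
qed

text \<open>On a vector of weight \<open>q\<close>, both \<open>euler\<close> minus the sum of
  \<open>q\<close> and \<open>euler\<close> minus \<open>c\<close> are nilpotent. Their difference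
  is a scalar, and a nonzero scalar is nilpotent only on the zero vector.\<close>

lemma W_support:
  assumes E: "E_locally_nilpotent c M" and q: "(\<Sum>i\<in>UNIV. q i) \<noteq> c"
  shows "W q = {\<zero>\<^bsub>M\<^esub>}"
proof -
  have "m = \<zero>\<^bsub>M\<^esub>" if m: "m \<in> W q" for m
  proof -
    let ?s = "\<Sum>i\<in>UNIV. q i"
    let ?X = "\<lambda>d (p :: 'i mpoly). euler p - scal d p"
    have mM: "m \<in> carrier M" using m by (simp add: W_iff)
    have X: "?X ?s \<in> carrier D_E" "nil (?X ?s) m" by (rule euler_nil[OF m])+
    have d: "?X d = ?X ?s \<oplus>\<^bsub>D_E\<^esub> scal (?s - d)" for d
      unfolding D_E_simps by (rule ext, rule poly_mapping_eqI) (simp add: lookup_add lookup_minus algebra_simps)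
    have Xd: "?X d \<in> carrier D_E" for d by (subst d[of d]) (simp only: A.a_closed X(1) D_E_closed(1))
    have "nil (?X c) m" using E mM unfolding E_locally_nilpotent_def nil_def by blast
    moreover have "nil (scal (-1) \<otimes>\<^bsub>D_E\<^esub> ?X ?s) m"
    proof -
      have c: "scal (-1) \<otimes>\<^bsub>D_E\<^esub> ?X ?s = ?X ?s \<otimes>\<^bsub>D_E\<^esub> scal (-1)"
        unfolding D_E_simps by (rule ext, rule poly_mapping_eqI) (simp add: lookup_minus lookup_euler)
      show ?thesis by (rule nil_mult[OF D_E_closed(1) X(1) c mM X(2)])
    qed
    ultimately have "nil (?X c \<oplus>\<^bsub>D_E\<^esub> (scal (-1) \<otimes>\<^bsub>D_E\<^esub> ?X ?s)) m"
    proof (rule nil_add[rotated 4, OF _ _])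
      show "?X c \<otimes>\<^bsub>D_E\<^esub> (scal (-1) \<otimes>\<^bsub>D_E\<^esub> ?X ?s) = (scal (-1) \<otimes>\<^bsub>D_E\<^esub> ?X ?s) \<otimes>\<^bsub>D_E\<^esub> ?X c"
        unfolding D_E_simps by (rule ext, rule poly_mapping_eqI) (simp add: lookup_minus lookup_euler algebra_simps)
    qed (use mM Xd D_E_closed(1) in \<open>auto intro!: A.m_closed simp del: D_E_simps\<close>)
    moreover have "?X c \<oplus>\<^bsub>D_E\<^esub> (scal (-1) \<otimes>\<^bsub>D_E\<^esub> ?X ?s) = scal (?s - c)"
      unfolding D_E_simps by (rule ext, rule poly_mapping_eqI) (simp add: lookup_add lookup_minus algebra_simps)
    ultimately show ?thesis using nil_scal[of "?s - c" m] q mM by simp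
  qed
  moreover have "\<zero>\<^bsub>M\<^esub> \<in> W q" using subspace_W by (simp add: subspace_set_def)
  ultimately show ?thesis by blast
qed

text \<open>The difference of the two operators lies in \<open>H'\<close> and is nilpotent on
  \<open>m\<close>, being a sum of commuting nilpotents; by \<open>semisimple_nil\<close> it kills
  \<open>m\<close>.\<close>

lemma hop_eq:
  assumes ss: "acts_semisimply H' M" and m: "m \<in> W q"
  shows "hop i (q i) \<odot>\<^bsub>M\<^esub> m = hop j (q j) \<odot>\<^bsub>M\<^esub> m"
proof -
  interpret h: left_module "H' :: (complex, 'i operator) module" M by (rule left_module_H'[OF left_module_axioms])
  let ?D = "\<lambda>p. hop i (q i) p + (scal (-1) \<circ> hop j (q j)) p"
  have mM: "m \<in> carrier M" "\<And>i. nil (hop i (q i)) m" using m by (auto simp: W_iff)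
  have D: "?D = hop i (q i) \<oplus>\<^bsub>D_E\<^esub> (scal (-1) \<otimes>\<^bsub>D_E\<^esub> hop j (q j))" by (simp only: D_E_simps)
  have c: "scal (-1) \<otimes>\<^bsub>D_E\<^esub> hop j (q j) = hop j (q j) \<otimes>\<^bsub>D_E\<^esub> scal (-1)"
    unfolding D_E_simps by (rule ext, rule poly_mapping_eqI) (simp add: lookup_hop)
  have "nil (scal (-1) \<otimes>\<^bsub>D_E\<^esub> hop j (q j)) m"
    by (rule nil_mult[OF D_E_closed(1) hop_D_E c mM])
  then have "nil ?D m" unfolding D
  proof (rule nil_add[rotated 5])
    show "hop i (q i) \<otimes>\<^bsub>D_E\<^esub> (scal (-1) \<otimes>\<^bsub>D_E\<^esub> hop j (q j)) = (scal (-1) \<otimes>\<^bsub>D_E\<^esub> hop j (q j)) \<otimes>\<^bsub>D_E\<^esub> hop i (q i)"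
      unfolding D_E_simps by (rule ext, rule poly_mapping_eqI) (simp add: lookup_hop)
  qed (use mM hop_D_E D_E_closed(1) in \<open>auto intro!: A.m_closed simp del: D_E_simps\<close>)
  then have "h.nil ?D m" unfolding nil_def h.nil_def pow_H' .
  then have "?D \<odot>\<^bsub>M\<^esub> m = \<zero>\<^bsub>M\<^esub>"
  proof (rule h.semisimple_nil[rotated 4])
    show "X \<otimes>\<^bsub>H'\<^esub> Y = Y \<otimes>\<^bsub>H'\<^esub> X" if "X \<in> carrier H'" "Y \<in> carrier H'" for X Y :: "'i operator"
      unfolding H'_simps by (rule H'_commute[OF that])
    show "?D \<in> carrier H'" by (rule hop_diff_H')
  qed (use ss[unfolded acts_semisimply_def simple_submodule_def] mM in auto)
  then have "hop i (q i) \<odot>\<^bsub>M\<^esub> m \<oplus>\<^bsub>M\<^esub> scal (-1) \<odot>\<^bsub>M\<^esub> (hop j (q j) \<odot>\<^bsub>M\<^esub> m) = \<zero>\<^bsub>M\<^esub>"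
    unfolding D by (simp only: smult_l_distr smult_assoc A.m_closed hop_D_E D_E_closed(1) mM(1))
  moreover have "scal (-1) \<odot>\<^bsub>M\<^esub> v = \<ominus>\<^bsub>M\<^esub> v" if v: "v \<in> carrier M" for v
  proof -
    have "scal (-1) = ((-1) \<odot>\<^bsub>D_E\<^esub> \<one>\<^bsub>D_E\<^esub> :: 'i operator)" by (simp add: fun_eq_iff)
    then have "scal (-1) \<odot>\<^bsub>M\<^esub> v \<oplus>\<^bsub>M\<^esub> v = cs (-1 + 1) v" unfolding cs_add[OF v] using v by (simp only: cs_one) (simp only: cscale_def)
    then have "scal (-1) \<odot>\<^bsub>M\<^esub> v \<oplus>\<^bsub>M\<^esub> v = \<zero>\<^bsub>M\<^esub>" using v by simp
    then show ?thesis using M.minus_equality[OF _ v smult_closed[OF D_E_closed(1) v]] by metis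
  qed
  ultimately show ?thesis using hop_D_E mM(1) by (metis M.minus_equality M.minus_minus smult_closed M.a_inv_closed)
qed

end

section \<open>Weight modules in coordinates\<close>

locale weight_object = D_E_module M for M :: "(('i::finite) operator, 'u) module" +
  fixes a :: int and n :: nat
  assumes card: "CARD('i) = n + 1" and a: "a \<ge> 0 \<or> (- int n - 1 < a \<and> a < 0)"
    and gw: "is_direct_sum M (weight_space M)" and fdW: "finite_dim D_E M (weight_space M q)"
    and supp: "weight_support M \<subseteq> {q. \<forall>i. q i \<in> \<int>}" and Enil: "E_locally_nilpotent (of_int a) M"
    and ss: "acts_semisimply H' M"
begin

abbreviation "Wi p \<equiv> W (\<lambda>i. of_int (p i))"

sublocale decomposed_module D_E M "slice a" Wi
proof
  show "is_direct_sum M Wi"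
  proof (rule is_direct_sum_reindex[OF gw])
    show "inj (\<lambda>p i. of_int (p i) :: complex)" by (auto simp: inj_def fun_eq_iff)
    show "W q = {\<zero>\<^bsub>M\<^esub>}" if "q \<notin> range (\<lambda>p i. of_int (p i))" for q
    proof (rule ccontr)
      assume "W q \<noteq> {\<zero>\<^bsub>M\<^esub>}"
      then have "\<forall>i. \<exists>k. q i = of_int k" using supp unfolding weight_support_def by (fastforce elim: Ints_cases)
      then obtain p where "\<And>i. q i = of_int (p i)" by metis
      then have "q = (\<lambda>i. of_int (p i))" by auto
      then show False using that by blast
    qed
    show "W q \<subseteq> carrier M" for q by (auto simp: W_iff)
  qed (rule M.abelian_group_axioms)
  show "subspace_set (Wi p)" for p by (rule subspace_W)
  show "finite_dim D_E M (Wi p)" for p by (rule fdW)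
  show "Wi p = {\<zero>\<^bsub>M\<^esub>}" if "p \<notin> slice a" for p
  proof (rule W_support[OF Enil])
    show "(\<Sum>i\<in>UNIV. of_int (p i)) \<noteq> (of_int a :: complex)"
      using that unfolding of_int_sum[symmetric] of_int_eq_iff by (simp add: slice_def)
  qed
qed

abbreviation "b0 p \<equiv> hop undefined (of_int (p undefined))"

text \<open>An entry of \<open>shift_op d\<close> at \<open>(q, p)\<close> vanishes unless
  \<open>q = p + d\<close>, where \<open>shift_op d\<close> is \<open>av q p\<close> itself, and a
  factor \<open>hop i c\<close> acts by its symbol evaluated at \<open>Z p\<close>. Normal forms
  extend \<open>keyed\<close> to the whole algebra.\<close>

lemma key_rep:
  assumes co: "coordinates s \<Psi>"
  shows "key_rep D_E (slice a) neg_set (vertices a) wrho (\<lambda>q p. shift_op (\<lambda>i. q i - p i))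
    (\<lambda>q p. fps_of_poly (unit_poly (\<lambda>i. q i - p i) p)) b0 s"
proof -
  interpret sa: symbol_algebra "D_E :: (complex, 'i operator) module" "slice a" neg_set "vertices a" wrho
    "\<lambda>q p. shift_op (\<lambda>i. q i - p i)" "\<lambda>q p. fps_of_poly (unit_poly (\<lambda>i. q i - p i) p)" b0
    by (rule symbol_algebra_D_E[OF card a])
  note cD = coordinatesD[OF co]
  interpret m: matrix_rep D_E "slice a" s by (rule cD(1))
  have s_hop: "s (hop i c) q p w = 0" if "q \<noteq> p" for i c q p w
    by (rule cD(5)[OF hop_D_E hop_W that])
  interpret nilp_rep D_E "slice a" neg_set "vertices a" wrho "\<lambda>q p. shift_op (\<lambda>i. q i - p i)"
    "\<lambda>q p. fps_of_poly (unit_poly (\<lambda>i. q i - p i) p)" b0 s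
  proof
    show "\<exists>N. (s (b0 p) p p ^^ N) (s \<one>\<^bsub>D_E\<^esub> p p w) = 0" if p: "p \<in> slice a" for p w
    proof -
      have pow: "(s (b0 p) p p ^^ N) (s \<one>\<^bsub>D_E\<^esub> p p w) = s (b0 p [^]\<^bsub>D_E\<^esub> N) p p w" for N :: nat and w
      proof (induction N arbitrary: w)
        case (Suc N)
        have "s (b0 p [^]\<^bsub>D_E\<^esub> Suc N) p p w = s (b0 p [^]\<^bsub>D_E\<^esub> N) p p (s (b0 p) p p w)"
          unfolding A.nat_pow_Suc by (rule m.s_mult_single[OF A.nat_pow_closed[OF hop_D_E] hop_D_E s_hop])
        also have "\<dots> = (s (b0 p) p p ^^ N) (s \<one>\<^bsub>D_E\<^esub> p p (s (b0 p) p p w))" by (rule Suc.IH[symmetric])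
        also have "\<dots> = (s (b0 p) p p ^^ N) (s (b0 p) p p (s \<one>\<^bsub>D_E\<^esub> p p w))"
          by (simp only: m.s_one_left m.s_one_right hop_D_E)
        finally show ?case by (simp only: funpow_Suc_right o_apply)
      qed (simp only: funpow_0 A.nat_pow_0)
      obtain m where m: "m \<in> Wi p" "\<And>X q. X \<in> carrier D_E \<Longrightarrow> s X q p w = lookup (\<Psi> (X \<odot>\<^bsub>M\<^esub> m)) q"
        using coordinates_ex[OF co, of p w] by blast
      have "nil (b0 p) m" using m(1) unfolding W_iff by blast
      then obtain N :: nat where "(b0 p [^]\<^bsub>D_E\<^esub> N) \<odot>\<^bsub>M\<^esub> m = \<zero>\<^bsub>M\<^esub>" unfolding nil_def by blast
      moreover have "\<Psi> \<zero>\<^bsub>M\<^esub> = 0" using co M.additive_zero[of \<Psi>] by (simp add: coordinates_def)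
      ultimately have "s (b0 p [^]\<^bsub>D_E\<^esub> N) p p w = 0" using m(2)[OF A.nat_pow_closed[OF hop_D_E]] by simp
      then show ?thesis using pow by metis
    qed
    show "\<exists>d. \<forall>w k. d \<le> k \<longrightarrow> coeff (s \<one>\<^bsub>D_E\<^esub> p p w) k = 0" for p by (rule cD(2))
  qed
  \<comment> \<open>Semisimplicity enters here: on the component \<open>p\<close> every
    \<open>hop i (of_int (p i))\<close> acts as \<open>Z p\<close>, whichever the index
    \<open>i\<close>. The remaining part of \<open>hop i c\<close> is a scalar.\<close>
  have Y_hop: "s (hop i c) p p w = Y p (wrho (hop i c) p p) w" if p: "p \<in> slice a" for i c p w
  proof -
    let ?c = "of_int (p i) - c"
    have d: "hop i c = hop i (of_int (p i)) \<oplus>\<^bsub>D_E\<^esub> (?c \<odot>\<^bsub>D_E\<^esub> \<one>\<^bsub>D_E\<^esub>)"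
      unfolding D_E_simps by (rule ext, rule poly_mapping_eqI) (simp add: lookup_hop lookup_add algebra_simps)
    have "s (hop i (of_int (p i))) p p w = s (b0 p) p p w"
      by (rule cD(3)[OF hop_D_E hop_D_E hop_eq[OF ss]])
    then have "s (hop i c) p p w = Z p w + smult ?c (s \<one>\<^bsub>D_E\<^esub> p p w)"
      unfolding d m.s_add[OF hop_D_E smult_one_closed] using p by (simp only: Z_def if_True m.s_scal)
    also have "\<dots> = Y p (fps_X + fps_const ?c) w"
      unfolding Y_add using Y_X[OF p, of w] Y_scale[of p ?c 1 w] Y_unit[OF p, of w] by simp
    also have "fps_X + fps_const ?c = wrho (hop i c) p p"
      by (simp add: wrho_def wsym_hop_diag fps_of_poly_pCons)
    finally show ?thesis .
  qed
  have sh: "keyed (shift_op d)" if d: "d \<in> shifts0" for d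
  proof (rule keyed_if[OF shift_op_D_E[OF d]])
    fix p q :: "'i \<Rightarrow> int" and w assume pq: "p \<in> slice a" "q \<in> slice a"
    show "(wrho (shift_op d) q p = 0 \<and> s (shift_op d) q p w = 0) \<or>
      (wrho (shift_op d) q p = fps_X ^ upc (neg_set p) (neg_set q) * fps_of_poly (unit_poly (\<lambda>i. q i - p i) p) \<and>
       s (shift_op d) q p w = s (shift_op (\<lambda>i. q i - p i)) q p w)"
    proof (cases "q = (\<lambda>i. p i + d i)")
      case True
      then have "d = (\<lambda>i. q i - p i)" by auto
      then show ?thesis using sa.\<rho>_av[OF pq, of q] by simp
    next
      case False
      have "s (shift_op d) q p w = 0"
      proof (rule cD(5)[OF shift_op_D_E[OF d] _ False])
        fix m assume "m \<in> Wi p"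
        from shift_op_W[OF d this] show "shift_op d \<odot>\<^bsub>M\<^esub> m \<in> Wi (\<lambda>i. p i + d i)" by simp
      qed
      then show ?thesis using False by (simp add: wrho_def wsym_shift)
    qed
  qed
  have "X \<in> carrier D_E \<and> keyed X" if "X \<in> normal_ops shifts0" for X
    using that
  proof (induction rule: normal_ops.induct)
    case (shift d) then show ?case using sh shift_op_D_E by blast
  next
    case (add X Y)
    then have "keyed (X \<oplus>\<^bsub>D_E\<^esub> Y)" by (intro keyed_add) auto
    then show ?case using add D_E_closed(2) unfolding D_E_simps by blast
  next
    case (hop X i c)
    then have X: "X \<in> carrier D_E" "keyed X" by auto
    have "keyed (X \<otimes>\<^bsub>D_E\<^esub> hop i c)"
    proof (rule keyed_mult[OF X hop_D_E s_hop Y_hop])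
      show "wrho (hop i c) q p = 0" if "q \<noteq> p" for p q using that by (simp add: wrho_def wsym_hop_diag)
    qed
    then show ?case using D_E_closed(3)[OF X(1) hop_D_E] unfolding D_E_simps by blast
  next
    case (scal X c)
    then have X: "X \<in> carrier D_E" "keyed X" by auto
    have "c \<odot>\<^bsub>D_E\<^esub> \<one>\<^bsub>D_E\<^esub> = scal c" by auto
    then have "keyed (X \<otimes>\<^bsub>D_E\<^esub> scal c)" using keyed_scal[OF X(2,1), of c] by simp
    then show ?case using D_E_closed(3)[OF X(1) D_E_closed(1)] unfolding D_E_simps by blast
  qed
  then have "keyed X" if "X \<in> carrier D_E" for X using D_E_normal[OF that] by blast
  then show ?thesis by unfold_locales
qed

end

abbreviation "ci q \<equiv> (\<lambda>i. of_int (q i) :: complex)"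

lemma ci_inj: "ci q = ci r \<longleftrightarrow> q = r" by (auto simp: fun_eq_iff)

text \<open>In a difference of two \<open>t_partial i\<close> the variable cancels, so symbols of
  \<open>H'\<close> are constant. Hence \<open>H'\<close> acts by scalars on every component of
  \<open>Fo y\<close>.\<close>

lemma H'_symbol:
  fixes X :: "('i::finite) operator"
  shows "X \<in> carrier H' \<Longrightarrow> \<exists>c. \<forall>q. wsym X q p = (if q = p then [:c:] else 0)"
proof -
  have gen: "(\<lambda>v. t_partial i v - t_partial j v) = (\<lambda>v. hop i 0 v + (hop j 0 \<circ> scal (-1)) v)" for i j :: 'i
    by (rule ext, rule poly_mapping_eqI) (simp add: lookup_add lookup_minus lookup_hop lookup_t_partial)
  have N: "X \<in> normal_ops shifts0" if "X \<in> generated_operators H'_gens" for X :: "'i operator"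
    using D_E_normal H'_D_E that unfolding carrier_H' by blast
  show "X \<in> carrier H' \<Longrightarrow> \<exists>c. \<forall>q. wsym X q p = (if q = p then [:c:] else 0)"
    unfolding carrier_H'
  proof (induction rule: generated_operators.induct)
    case (generator X)
    then obtain i j where X: "X = (\<lambda>v. t_partial i v - t_partial j v)" by auto
    have "wsym X q p = wsym (hop i 0) q p + smult (-1) (wsym (hop j 0) q p)" for q
      unfolding X gen wsym_add[OF hop_normal normal_ops.scal[OF hop_normal]] wsym_scal[OF hop_normal] by (rule refl)
    then show ?case by (intro exI[of _ "of_int (p i) - of_int (p j)"]) (simp add: wsym_hop_diag)
  next
    case (scalar c)
    have id: "id \<in> normal_ops (shifts0 :: ('i \<Rightarrow> int) set)"
      using normal_ops.shift[of "\<lambda>_. 0" "shifts0 :: ('i \<Rightarrow> int) set"] by (simp add: shift_op_zero)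
    show ?case using wsym_scal[OF id, of c _ p] by (intro exI[of _ c]) (simp add: wsym_id)
  next
    case (add X Y)
    then obtain c d where cd: "\<forall>q. wsym X q p = (if q = p then [:c:] else 0)" "\<forall>q. wsym Y q p = (if q = p then [:d:] else 0)" by blast
    have "wsym (\<lambda>v. X v + Y v) q p = (if q = p then [:c + d:] else 0)" for q
      unfolding wsym_add[OF N[OF add.hyps(1)] N[OF add.hyps(2)]] using cd by simp
    then show ?case by blast
  next
    case (comp X Y)
    then obtain c d where cd: "\<forall>q. wsym X q p = (if q = p then [:c:] else 0)" "\<forall>q. wsym Y q p = (if q = p then [:d:] else 0)" by blast
    have "wsym (X \<circ> Y) r p = (\<Sum>q\<in>{p}. wsym X r q * wsym Y q p)" for r
      by (rule wsym_mult[OF N[OF comp.hyps(1)] N[OF comp.hyps(2)]]) (use cd in auto)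
    then have "wsym (X \<circ> Y) q p = (if q = p then [:c * d:] else 0)" for q using cd by simp
    then show ?case by blast
  qed
qed

section \<open>The functor to weight modules\<close>

locale weight_functor =
  fixes a :: int and n :: nat and \<iota> :: "('i::finite \<Rightarrow> int) coords \<Rightarrow> 'u"
  assumes card: "CARD('i) = n + 1" and a: "a \<ge> 0 \<or> (- int n - 1 < a \<and> a < 0)"
    and inj: "inj_on \<iota> {f. keys f \<subseteq> slice a}"
begin

sublocale symbol_functor "D_E :: (complex, 'i operator) module" "slice a" neg_set "vertices a" wrho
  "\<lambda>q p. shift_op (\<lambda>i. q i - p i)" "\<lambda>q p. fps_of_poly (unit_poly (\<lambda>i. q i - p i) p)"
  "\<lambda>p. hop undefined (of_int (p undefined))" \<iota>
  by (intro symbol_functor.intro symbol_functor_axioms.intro symbol_algebra_D_E[OF card a] inj)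

end

locale weight_functor_object = weight_functor a n \<iota>
  for a n and \<iota> :: "('i::finite \<Rightarrow> int) coords \<Rightarrow> 'u" +
  fixes y assumes y: "sys (vertices a :: 'i set set) excess y"
begin

sublocale y: sys "vertices a :: 'i set set" excess y by (rule y)
sublocale t: transport D_E \<iota> "mc y" "matrix_rep.mact (smat y)" by (rule transport_Fo[OF y])
sublocale m: matrix_rep D_E "slice a" "smat y" by (rule matrix_rep_smat[OF y])
sublocale D: D_E_module "Fo y" by (rule D_E_module.intro[OF left_module_Fo[OF y]])

lemmas N = t.N_simps[folded Fo_def]

lemma mc: "f \<in> mc y \<longleftrightarrow> keys f \<subseteq> slice a \<and> (\<forall>p\<in>slice a. y 1 (neg_set p) (neg_set p) (lookup f p) = lookup f p)"
  by (rule mc_iff[OF y])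

lemma smat_hop: "smat y (hop i c) q p w = (if p = q \<and> q \<in> slice a then y (fps_of_poly [:of_int (q i) - c, 1:]) (neg_set q) (neg_set q) w else 0)"
proof -
  have "ksym (hop i c) q p = (if q = p then fps_of_poly [:of_int (q i) - c, 1:] else 0)"
    by (rule ksym_eqI) (simp add: wrho_def wsym_hop_diag upc_def)
  then show ?thesis by (auto simp: smat_def)
qed

lemma hop_pow:
  "f \<in> mc y \<Longrightarrow> \<exists>g\<in>mc y. (hop i c [^]\<^bsub>D_E\<^esub> (N::nat)) \<odot>\<^bsub>Fo y\<^esub> \<iota> f = \<iota> g \<and>
     (\<forall>q\<in>slice a. lookup g q = y (fps_of_poly [:of_int (q i) - c, 1:] ^ N) (neg_set q) (neg_set q) (lookup f q))"
proof (induction N arbitrary: f)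
  case 0
  have "\<iota> f \<in> carrier (Fo y)" using 0 N(1) by auto
  then have "(hop i c [^]\<^bsub>D_E\<^esub> (0::nat)) \<odot>\<^bsub>Fo y\<^esub> \<iota> f = \<iota> f" by (simp only: nat_pow_0 D.smult_one)
  moreover have "lookup f q = y (fps_of_poly [:of_int (q i) - c, 1:] ^ 0) (neg_set q) (neg_set q) (lookup f q)" if "q \<in> slice a" for q
    using 0 mc that by simp
  ultimately show ?case using 0 by blast
next
  case (Suc N)
  have f: "\<iota> f \<in> carrier (Fo y)" using Suc.prems N(1) by auto
  have h: "m.mact (hop i c) f \<in> mc y" by (rule t.act[OF hop_D_E Suc.prems])
  obtain g where g: "g \<in> mc y" "(hop i c [^]\<^bsub>D_E\<^esub> N) \<odot>\<^bsub>Fo y\<^esub> \<iota> (m.mact (hop i c) f) = \<iota> g"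
    "\<And>q. q \<in> slice a \<Longrightarrow> lookup g q = y (fps_of_poly [:of_int (q i) - c, 1:] ^ N) (neg_set q) (neg_set q) (lookup (m.mact (hop i c) f) q)"
    using Suc.IH[OF h] by blast
  have "(hop i c [^]\<^bsub>D_E\<^esub> Suc N) \<odot>\<^bsub>Fo y\<^esub> \<iota> f = \<iota> g"
    by (rule trans[OF D.pow_Suc_smult[OF hop_D_E f]]) (simp only: N(4)[OF Suc.prems, of "hop i c"] g(2))
  moreover have "lookup g q = y (fps_of_poly [:of_int (q i) - c, 1:] ^ Suc N) (neg_set q) (neg_set q) (lookup f q)"
    if q: "q \<in> slice a" for q
  proof -
    have J: "neg_set q \<in> vertices a" using q by (rule lab_in)
    have "lookup (m.mact (hop i c) f) q = smat y (hop i c) q q (lookup f q)"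
      by (rule m.lookup_mact_diag[OF hop_D_E]) (simp add: smat_hop)
    then show ?thesis unfolding g(3)[OF q] by (simp add: smat_hop q y.y_comp J y.e_refl mult.commute)
  qed
  ultimately show ?case using g(1) by blast
qed

text \<open>On the coordinate at \<open>q\<close>, \<open>hop i (r i)\<close> acts as the power
  series \<open>q i - r i + z\<close>. It is invertible if \<open>q i \<noteq> r i\<close> and
  nilpotent otherwise, so a vector of weight \<open>r\<close> has no coordinate other than the one
  with \<open>q = r\<close>.\<close>

lemma weight_space_Fo: "weight_space (Fo y) r = \<iota> ` {f \<in> mc y. \<forall>q\<in>keys f. ci q = r}"
proof (intro subset_antisym subsetI)
  fix x assume x: "x \<in> weight_space (Fo y) r"
  then obtain f where f: "x = \<iota> f" "f \<in> mc y" unfolding D.W_iff N(1) by auto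
  have "ci q i = r i" if q: "q \<in> keys f" for q i
  proof (rule ccontr)
    assume ne: "ci q i \<noteq> r i"
    have qs: "q \<in> slice a" using f(2) q mc by blast
    have J: "neg_set q \<in> vertices a" using qs by (rule lab_in)
    have "D.nil (hop i (r i)) (\<iota> f)" using x unfolding D.W_iff f(1) by blast
    then obtain N :: nat where N0: "(hop i (r i) [^]\<^bsub>D_E\<^esub> N) \<odot>\<^bsub>Fo y\<^esub> \<iota> f = \<zero>\<^bsub>Fo y\<^esub>" unfolding D.nil_def by blast
    obtain g where g: "g \<in> mc y" "(hop i (r i) [^]\<^bsub>D_E\<^esub> N) \<odot>\<^bsub>Fo y\<^esub> \<iota> f = \<iota> g"
      "lookup g q = y (fps_of_poly [:of_int (q i) - r i, 1:] ^ N) (neg_set q) (neg_set q) (lookup f q)"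
      using hop_pow[OF f(2), of i "r i" N] qs by blast
    have "\<iota> g = \<iota> 0" using g(2) N0 unfolding N(2) by simp
    then have "g = 0" using t.inj_eq[OF g(1) t.zero] by blast
    let ?h = "fps_of_poly [:of_int (q i) - r i, 1:] ^ N"
    have "y (inverse ?h * ?h) (neg_set q) (neg_set q) (lookup f q) = y (inverse ?h) (neg_set q) (neg_set q) (lookup g q)"
      unfolding g(3) by (simp add: y.y_comp J y.e_refl)
    also have "\<dots> = 0" using \<open>g = 0\<close> by simp
    also have "inverse ?h * ?h = 1" using ne by (intro inverse_mult_eq_1) (simp add: fps_power_zeroth)
    finally have "lookup f q = 0" using f(2) qs mc by simp
    then show False using q by (simp add: in_keys_iff)
  qed
  then show "x \<in> \<iota> ` {f \<in> mc y. \<forall>q\<in>keys f. ci q = r}" using f by (auto simp: fun_eq_iff)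
next
  fix x assume "x \<in> \<iota> ` {f \<in> mc y. \<forall>q\<in>keys f. ci q = r}"
  then obtain f where f: "x = \<iota> f" "f \<in> mc y" "\<And>q. q \<in> keys f \<Longrightarrow> ci q = r" by auto
  have "D.nil (hop i (r i)) (\<iota> f)" for i
  proof (cases "keys f = {}")
    case True
    then have "\<iota> f = \<zero>\<^bsub>Fo y\<^esub>" by (simp add: N(2))
    then show ?thesis using D.nil_zero[OF hop_D_E] by metis
  next
    case False
    then obtain p where p: "p \<in> keys f" by blast
    have ps: "p \<in> slice a" using f(2) p mc by blast
    have k: "q = p" if "q \<in> keys f" for q using f(3)[OF that] f(3)[OF p] ci_inj by metis
    obtain N where Nn: "\<And>f K w. y (fps_X ^ N * f) K (neg_set p) w = 0" using y.y_nil[OF lab_in[OF ps]] by blast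
    obtain g where g: "g \<in> mc y" "(hop i (r i) [^]\<^bsub>D_E\<^esub> N) \<odot>\<^bsub>Fo y\<^esub> \<iota> f = \<iota> g"
      "\<And>q. q \<in> slice a \<Longrightarrow> lookup g q = y (fps_of_poly [:of_int (q i) - r i, 1:] ^ N) (neg_set q) (neg_set q) (lookup f q)"
      using hop_pow[OF f(2), of i "r i" N] by blast
    have ri: "r i = of_int (p i)" using fun_cong[OF f(3)[OF p], of i] by simp
    have "lookup g q = 0" for q
    proof (cases "q \<in> slice a")
      case False then show ?thesis using g(1) mc by (auto simp: in_keys_iff)
    next
      case True
      show ?thesis
      proof (cases "q = p")
        case True then show ?thesis using g(3)[OF ps] Nn[of 1 "neg_set p" "lookup f p"] by (simp add: ri fps_of_poly_fps_X)
      next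
        case False
        then have "lookup f q = 0" using k[of q] by (auto simp: in_keys_iff)
        then show ?thesis using g(3)[OF True] by simp
      qed
    qed
    then have "g = 0" by (intro poly_mapping_eqI) simp
    then have "(hop i (r i) [^]\<^bsub>D_E\<^esub> N) \<odot>\<^bsub>Fo y\<^esub> \<iota> f = \<zero>\<^bsub>Fo y\<^esub>" using g(2) by (simp add: N(2))
    then show ?thesis unfolding D.nil_def by blast
  qed
  then show "x \<in> weight_space (Fo y) r" unfolding D.W_iff f(1) using f(2) N(1) by auto
qed

text \<open>At most one \<open>q\<close> satisfies \<open>ci q = r\<close>; written as a sum, the
  definition also covers the weights that are not integral, where it gives zero.\<close>

definition "pr f r = (\<Sum>q\<in>{q \<in> keys f. ci q = r}. single q (lookup f q :: complex poly))"

lemma lookup_pr: "lookup (pr f r) q = (if ci q = r then lookup f q else 0)"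
proof -
  have "lookup (pr f r) q = (\<Sum>p\<in>{p \<in> keys f. ci p = r}. if p = q then lookup f q else 0)"
    unfolding pr_def lookup_sum by (rule sum.cong) (auto simp: lookup_single when_def)
  then show ?thesis by (auto simp: in_keys_iff)
qed

lemma keys_pr: "q \<in> keys (pr f r) \<Longrightarrow> ci q = r"
  using lookup_pr[of f r q] unfolding in_keys_iff by (metis (mono_tags))

lemma pr_mc: "f \<in> mc y \<Longrightarrow> pr f r \<in> mc y"
  unfolding mc using lookup_pr[of f r] by (auto simp: in_keys_iff split: if_splits)

lemma sum_pr: "finite R \<Longrightarrow> ci ` keys f \<subseteq> R \<Longrightarrow> (\<Sum>r\<in>R. pr f r) = f"
proof (rule poly_mapping_eqI)
  fix q assume R: "finite R" "ci ` keys f \<subseteq> R"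
  have "lookup (\<Sum>r\<in>R. pr f r) q = (\<Sum>r\<in>R. if r = ci q then lookup f q else 0)"
    unfolding lookup_sum by (rule sum.cong) (auto simp: lookup_pr)
  also have "\<dots> = (if ci q \<in> R then lookup f q else 0)" by (rule sum.delta[OF R(1)])
  also have "\<dots> = lookup f q" using R(2) by (auto simp: in_keys_iff image_subset_iff)
  finally show "lookup (\<Sum>r\<in>R. pr f r) q = lookup f q" .
qed

lemma direct_sum_Fo: "is_direct_sum (Fo y) (weight_space (Fo y))"
  unfolding is_direct_sum_def
proof
  fix m assume "m \<in> carrier (Fo y)"
  then obtain f where f: "m = \<iota> f" "f \<in> mc y" unfolding N(1) by auto
  let ?P = "\<lambda>G. (\<forall>l. G l \<in> weight_space (Fo y) l) \<and> finite {l. G l \<noteq> \<zero>\<^bsub>Fo y\<^esub>} \<and>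
    m = (\<Oplus>\<^bsub>Fo y\<^esub>l\<in>{l. G l \<noteq> \<zero>\<^bsub>Fo y\<^esub>}. G l)"
  show "\<exists>!G. ?P G"
  proof (rule ex1I[of _ "\<lambda>r. \<iota> (pr f r)"])
    let ?S = "{r. \<iota> (pr f r) \<noteq> \<zero>\<^bsub>Fo y\<^esub>}"
    have S: "?S = ci ` keys f"
    proof (intro subset_antisym subsetI)
      fix r assume "r \<in> ?S"
      then have "pr f r \<noteq> 0" by (auto simp: N(2))
      then obtain q where "lookup (pr f r) q \<noteq> 0" by (metis poly_mapping_eqI lookup_zero)
      then have "ci q = r" "q \<in> keys f" unfolding lookup_pr in_keys_iff by (metis (mono_tags))+
      then show "r \<in> ci ` keys f" by blast
    next
      fix r assume "r \<in> ci ` keys f"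
      then obtain q where "r = ci q" "q \<in> keys f" by blast
      then have "lookup (pr f r) q \<noteq> 0" by (simp add: lookup_pr in_keys_iff)
      then have "pr f r \<noteq> 0" by auto
      then show "r \<in> ?S" unfolding N(2) using t.inj_eq[OF pr_mc[OF f(2)] t.zero] by simp
    qed
    have "(\<Oplus>\<^bsub>Fo y\<^esub>r\<in>ci ` keys f. \<iota> (pr f r)) = \<iota> (\<Sum>r\<in>ci ` keys f. pr f r)"
      by (rule t.finsum_N(1)[folded Fo_def]) (use f pr_mc in auto)
    then have e: "m = (\<Oplus>\<^bsub>Fo y\<^esub>r\<in>ci ` keys f. \<iota> (pr f r))" unfolding f(1) by (simp add: sum_pr)
    show "?P (\<lambda>r. \<iota> (pr f r))"
    proof (intro conjI allI)
      show "\<iota> (pr f r) \<in> weight_space (Fo y) r" for r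
        unfolding weight_space_Fo using pr_mc[OF f(2), of r] keys_pr[of _ f r] by blast
      show "finite ?S" unfolding S by simp
      show "m = (\<Oplus>\<^bsub>Fo y\<^esub>r\<in>?S. \<iota> (pr f r))" unfolding S by (rule e)
    qed
    fix G assume G: "?P G"
    have "\<forall>r. \<exists>g. g \<in> mc y \<and> (\<forall>q\<in>keys g. ci q = r) \<and> G r = \<iota> g" using G unfolding weight_space_Fo by blast
    then obtain g where g: "\<And>r. g r \<in> mc y" "\<And>r q. q \<in> keys (g r) \<Longrightarrow> ci q = r" "\<And>r. G r = \<iota> (g r)" by metis
    let ?T = "{r. G r \<noteq> \<zero>\<^bsub>Fo y\<^esub>}"
    have fT: "finite ?T" using G by blast
    have "m = (\<Oplus>\<^bsub>Fo y\<^esub>r\<in>?T. \<iota> (g r))" using G unfolding g(3) by blast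
    also have "\<dots> = \<iota> (\<Sum>r\<in>?T. g r)" by (rule t.finsum_N(1)[folded Fo_def]) (use fT g in auto)
    finally have "f = (\<Sum>r\<in>?T. g r)"
      unfolding f(1) using t.inj_eq[OF f(2) t.finsum_N(2)[where F = g, OF fT g(1)]] by blast
    then have fq: "lookup f q = lookup (g (ci q)) q" for q
    proof -
      assume *: "f = (\<Sum>r\<in>?T. g r)"
      have z: "lookup (g r) q = 0" if "r \<noteq> ci q" for r using g(2)[of q r] that by (auto simp: in_keys_iff)
      have z': "lookup (g r) q = 0" if "r \<notin> ?T" for r
      proof -
        have "\<iota> (g r) = \<iota> 0" using that by (simp add: g(3) N(2))
        then have "g r = 0" using t.inj_eq[OF g(1) t.zero] by blast
        then show ?thesis by simp
      qed
      have "lookup f q = (\<Sum>r\<in>?T. lookup (g r) q)" by (subst *) (simp add: lookup_sum)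
      also have "\<dots> = (\<Sum>r\<in>insert (ci q) ?T. lookup (g r) q)"
        by (rule sum.mono_neutral_left) (use fT z' in auto)
      also have "\<dots> = (\<Sum>r\<in>{ci q}. lookup (g r) q)"
        by (rule sum.mono_neutral_right) (use fT z in auto)
      finally show ?thesis by simp
    qed
    have "g r = pr f r" for r
    proof (rule poly_mapping_eqI)
      fix q show "lookup (g r) q = lookup (pr f r) q"
        unfolding lookup_pr fq using g(2)[of q r] by (auto simp: in_keys_iff)
    qed
    then show "G = (\<lambda>r. \<iota> (pr f r))" using g(3) by auto
  qed
qed

text \<open>By \<open>H'_symbol\<close> the algebra \<open>H'\<close> acts on this line by scalars,
  and it contains all scalars.\<close>

lemma H'_simple:
  assumes p: "p \<in> slice a" and w: "y 1 (neg_set p) (neg_set p) w = w" "w \<noteq> 0"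
  shows "simple_submodule H' (Fo y) ((\<lambda>c. \<iota> (single p (smult c w))) ` UNIV)"
proof -
  let ?S = "(\<lambda>c. \<iota> (single p (smult c w))) ` UNIV"
  have mc_c: "single p (smult c w) \<in> mc y" for c
    by (rule single_mc[OF y p]) (simp add: y.y_smult w)
  have X: "\<exists>c. \<forall>d. X \<odot>\<^bsub>Fo y\<^esub> \<iota> (single p (smult d w)) = \<iota> (single p (smult (c * d) w))" if X: "X \<in> carrier H'" for X
  proof -
    have XD: "X \<in> carrier D_E" using X H'_D_E by blast
    obtain c where c: "\<And>q. wsym X q p = (if q = p then [:c:] else 0)" using H'_symbol[OF X, of p] by blast
    have ks: "ksym X q p = (if q = p then fps_const c else 0)" for q
      by (rule ksym_eqI) (simp add: wrho_def c upc_def fps_of_poly_const)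
    have "m.mact X (single p (smult d w)) = single p (smult (c * d) w)" for d
    proof (rule poly_mapping_eqI)
      fix q show "lookup (m.mact X (single p (smult d w))) q = lookup (single p (smult (c * d) w)) q"
        by (cases "q = p") (simp_all add: m.mact_single[OF XD] smat_def ks p y.y_const y.y_smult w lookup_single mult.commute)
    qed
    then show ?thesis using N(4)[OF mc_c] by (intro exI[of _ c]) simp
  qed
  have sc: "scal e \<odot>\<^bsub>Fo y\<^esub> \<iota> (single p (smult d w)) = \<iota> (single p (smult (e * d) w))" for e d
  proof -
    have "scal e = (e \<odot>\<^bsub>D_E\<^esub> \<one>\<^bsub>D_E\<^esub> :: 'i operator)" by auto
    then have "scal e \<odot>\<^bsub>Fo y\<^esub> \<iota> (single p (smult d w)) = \<iota> (Poly_Mapping.map (smult e) (single p (smult d w)))"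
      using cscale_Fo(1)[OF y mc_c, of e] unfolding cscale_def by simp
    moreover have "Poly_Mapping.map (smult e) (single p (smult d w)) = single p (smult (e * d) w)"
      by (rule poly_mapping_eqI) (simp add: Poly_Mapping.map.rep_eq lookup_single when_def)
    ultimately show ?thesis by simp
  qed
  have zero: "\<iota> (single p (smult 0 w)) = \<zero>\<^bsub>Fo y\<^esub>" by (simp add: N(2))
  have nz: "\<iota> (single p (smult c w)) \<noteq> \<zero>\<^bsub>Fo y\<^esub>" if "c \<noteq> 0" for c
  proof
    assume "\<iota> (single p (smult c w)) = \<zero>\<^bsub>Fo y\<^esub>"
    then have "single p (smult c w) = 0" unfolding N(2) using t.inj_eq[OF mc_c t.zero] by blast
    then have "lookup (single p (smult c w)) p = 0" by (simp only: lookup_zero)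
    then show False using that w(2) by (simp add: lookup_single_eq)
  qed
  have "submodule ?S H' (Fo y)"
  proof
    show "?S \<subseteq> carrier (add_monoid (Fo y))" using mc_c N(1) by auto
    show "u \<otimes>\<^bsub>add_monoid (Fo y)\<^esub> v \<in> ?S" if "u \<in> ?S" "v \<in> ?S" for u v
      using that by (auto simp: N(3)[OF mc_c mc_c] single_add[symmetric] smult_add_left[symmetric])
    show "\<one>\<^bsub>add_monoid (Fo y)\<^esub> \<in> ?S" using zero by (metis monoid.simps(2) rangeI)
    show "inv\<^bsub>add_monoid (Fo y)\<^esub> u \<in> ?S" if "u \<in> ?S" for u
    proof -
      obtain c where c: "u = \<iota> (single p (smult c w))" using \<open>u \<in> ?S\<close> by auto
      have "inv\<^bsub>add_monoid (Fo y)\<^esub> u = \<iota> (- single p (smult c w))"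
        unfolding c a_inv_def[symmetric] by (rule t.minus_N[folded Fo_def, OF mc_c])
      also have "- single p (smult c w) = single p (smult (- c) w)" by (simp add: single_uminus)
      finally show ?thesis by blast
    qed
    show "X \<odot>\<^bsub>Fo y\<^esub> u \<in> ?S" if "X \<in> carrier H'" "u \<in> ?S" for X u using X[OF that(1)] that(2) by auto
  qed
  moreover have "?S \<noteq> {\<zero>\<^bsub>Fo y\<^esub>}" using nz[OF one_neq_zero] by (metis rangeI singletonD)
  moreover have "T = {\<zero>\<^bsub>Fo y\<^esub>} \<or> T = ?S" if T: "submodule T H' (Fo y)" "T \<subseteq> ?S" for T
  proof (rule disjCI)
    assume "T \<noteq> ?S"
    have z: "\<zero>\<^bsub>Fo y\<^esub> \<in> T" using subgroup.one_closed[OF submodule.axioms(1)[OF T(1)]] by simp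
    have "x = \<zero>\<^bsub>Fo y\<^esub>" if "x \<in> T" for x
    proof (rule ccontr)
      assume ne: "x \<noteq> \<zero>\<^bsub>Fo y\<^esub>"
      obtain c where c: "x = \<iota> (single p (smult c w))" using \<open>x \<in> T\<close> T(2) by blast
      have c0: "c \<noteq> 0" using ne zero c by auto
      have "\<iota> (single p (smult d w)) \<in> T" for d
      proof -
        have "scal (d / c) \<in> carrier H'" unfolding carrier_H' by (rule generated_operators.scalar)
        then have "scal (d / c) \<odot>\<^bsub>Fo y\<^esub> x \<in> T" using submodule.smult_closed[OF T(1)] \<open>x \<in> T\<close> by blast
        then show ?thesis unfolding c sc using c0 by simp
      qed
      then show False using \<open>T \<noteq> ?S\<close> T(2) by auto
    qed
    then show "T = {\<zero>\<^bsub>Fo y\<^esub>}" using z by blast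
  qed
  ultimately show ?thesis unfolding simple_submodule_def by blast
qed

lemma split_Fo:
  assumes f: "f \<in> mc y"
  shows "\<iota> f = (\<Oplus>\<^bsub>Fo y\<^esub>q\<in>keys f. \<iota> (single q (lookup f q)))" "q \<in> keys f \<Longrightarrow> single q (lookup f q) \<in> mc y"
proof -
  show m: "single q (lookup f q) \<in> mc y" if "q \<in> keys f" for q
    by (rule single_mc[OF y]) (use that f mc in auto)
  have "(\<Oplus>\<^bsub>Fo y\<^esub>q\<in>keys f. \<iota> (single q (lookup f q))) = \<iota> (\<Sum>q\<in>keys f. single q (lookup f q))"
    by (rule t.finsum_N(1)[folded Fo_def]) (use m in auto)
  then show "\<iota> f = (\<Oplus>\<^bsub>Fo y\<^esub>q\<in>keys f. \<iota> (single q (lookup f q)))" using sum_singles[of f] by simp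
qed

lemma semisimple_Fo: "acts_semisimply H' (Fo y)"
  unfolding acts_semisimply_def
proof
  fix x assume "x \<in> carrier (Fo y)"
  then obtain f where f: "x = \<iota> f" "f \<in> mc y" unfolding N(1) by auto
  let ?F = "\<lambda>q. \<iota> (single q (lookup f q))"
  \<comment> \<open>\<open>acts_semisimply\<close> sums over a set of vectors, so the summands have
    to be distinct.\<close>
  have inj: "inj_on ?F (keys f)"
  proof
    fix p q assume pq: "p \<in> keys f" "q \<in> keys f" "?F p = ?F q"
    then have "single p (lookup f p) = single q (lookup f q)" using t.inj_eq[OF split_Fo(2)[OF f(2) pq(1)] split_Fo(2)[OF f(2) pq(2)]] by blast
    then have "lookup (single p (lookup f p)) p = lookup (single q (lookup f q)) p" by simp
    then show "p = q" using pq(1) lookup_single_not_eq[of q p "lookup f q"] by (auto simp: in_keys_iff)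
  qed
  have "(\<Oplus>\<^bsub>Fo y\<^esub>v\<in>?F ` keys f. v) = (\<Oplus>\<^bsub>Fo y\<^esub>q\<in>keys f. ?F q)"
    by (rule D.M.finsum_reindex[OF _ inj]) (use split_Fo(2)[OF f(2)] N(1) in auto)
  then have "x = (\<Oplus>\<^bsub>Fo y\<^esub>v\<in>?F ` keys f. v)" unfolding f(1) split_Fo(1)[OF f(2)] by (rule sym)
  moreover have "\<exists>S. simple_submodule H' (Fo y) S \<and> ?F q \<in> S" if q: "q \<in> keys f" for q
  proof -
    have "simple_submodule H' (Fo y) ((\<lambda>c. \<iota> (single q (smult c (lookup f q)))) ` UNIV)"
      by (rule H'_simple) (use q f mc in \<open>auto simp: in_keys_iff\<close>)
    moreover have "?F q \<in> (\<lambda>c. \<iota> (single q (smult c (lookup f q)))) ` UNIV" by (rule image_eqI[of _ _ 1]) auto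
    ultimately show ?thesis by blast
  qed
  ultimately show "\<exists>T. finite T \<and> T \<subseteq> \<Union> {S. simple_submodule H' (Fo y) S} \<and> x = (\<Oplus>\<^bsub>Fo y\<^esub>v\<in>T. v)"
    by (intro exI[of _ "?F ` keys f"] conjI finite_imageI finite_keys subsetI) (blast, assumption)
qed

lemma E_nilpotent_Fo: "E_locally_nilpotent (of_int a) (Fo y)"
  unfolding E_locally_nilpotent_def D.nil_def[symmetric]
proof
  fix x assume "x \<in> carrier (Fo y)"
  then obtain f where f: "x = \<iota> f" "f \<in> mc y" unfolding N(1) by auto
  let ?E = "\<lambda>p :: 'i mpoly. euler p - scal (of_int a) p"
  have E: "?E \<in> carrier D_E \<and> D.nil ?E (\<iota> (single q (lookup f q)))" if q: "q \<in> keys f" for q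
  proof -
    have "\<iota> (single q (lookup f q)) \<in> weight_space (Fo y) (ci q)"
      unfolding weight_space_Fo using split_Fo(2)[OF f(2) q] by auto
    note x = this
    have "(\<Sum>i\<in>UNIV. q i) = a" using f(2) q mc by (auto simp: slice_def)
    then have e: "(\<Sum>i\<in>UNIV. ci q i) = of_int a" by (metis of_int_sum)
    show ?thesis using D.euler_nil[OF x] unfolding e by blast
  qed
  show "D.nil ?E x"
  proof (cases "keys f = {}")
    case True
    then have "x = \<zero>\<^bsub>Fo y\<^esub>" by (simp add: f N(2))
    then show ?thesis unfolding D.nil_def by (intro exI[of _ 0]) (simp only: nat_pow_0 D.smult_one D.M.zero_closed)
  next
    case False
    then have "?E \<in> carrier D_E" using E by blast
    then show ?thesis unfolding f(1) split_Fo(1)[OF f(2)]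
      by (rule D.nil_finsum) (use E split_Fo(2)[OF f(2)] N(1) in auto)
  qed
qed

lemma weight_Fo: "generalized_weight_module (Fo y) \<and> (\<forall>q. finite_dim D_E (Fo y) (weight_space (Fo y) q)) \<and>
     weight_support (Fo y) \<subseteq> {q. \<forall>i. q i \<in> \<int>} \<and> E_locally_nilpotent (of_int a) (Fo y) \<and> acts_semisimply H' (Fo y)"
proof (intro conjI allI)
  show "generalized_weight_module (Fo y)"
    unfolding generalized_weight_module_def using direct_sum_Fo left_module_Fo[OF y] by blast
  show "finite_dim D_E (Fo y) (weight_space (Fo y) r)" for r
  proof -
    let ?X = "{q \<in> slice a. ci q = r}"
    have "weight_space (Fo y) r = \<iota> ` {f \<in> mc y. keys f \<subseteq> ?X}" unfolding weight_space_Fo using mc by blast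
    moreover have "finite ?X"
    proof (cases "?X = {}")
      case False
      then obtain p where "ci p = r" by blast
      then have "?X \<subseteq> {p}" using ci_inj by auto
      then show ?thesis by (rule finite_subset) simp
    next
      case True show ?thesis unfolding True by simp
    qed
    ultimately show ?thesis using finite_dim_Fo[OF y, of ?X] by auto
  qed
  show "weight_support (Fo y) \<subseteq> {q. \<forall>i. q i \<in> \<int>}"
  proof
    fix r assume "r \<in> weight_support (Fo y)"
    then have ne: "weight_space (Fo y) r \<noteq> {\<zero>\<^bsub>Fo y\<^esub>}" by (simp add: weight_support_def)
    have "\<exists>q. ci q = r"
    proof (rule ccontr)
      assume "\<nexists>q. ci q = r"
      then have "{f \<in> mc y. \<forall>q\<in>keys f. ci q = r} = {0}" using t.zero by (auto simp: keys_eq_empty)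
      then show False using ne unfolding weight_space_Fo N(2) by simp
    qed
    then show "r \<in> {q. \<forall>i. q i \<in> \<int>}" by auto
  qed
qed (rule E_nilpotent_Fo semisimple_Fo)+

end

context weight_functor
begin

abbreviation "V \<equiv> vertices a :: 'i set set"

theorem weight_leg:
  "is_functor (sys_category V excess) (weight_category (of_int a)) Fo Fm"
  "r \<in> Obj (sys_category V excess) \<Longrightarrow> s \<in> Obj (sys_category V excess) \<Longrightarrow>
     bij_betw (Fm r s) (Hom (sys_category V excess) r s) (Hom (weight_category (of_int a)) (Fo r) (Fo s))"
  "X \<in> Obj (weight_category (of_int a)) \<Longrightarrow> \<exists>r\<in>Obj (sys_category V excess). \<exists>f. is_iso (weight_category (of_int a)) X (Fo r) f"
proof -
  have obj: "weight_functor_object a n \<iota> y" if "sys V excess y" for y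
    by (intro weight_functor_object.intro weight_functor_axioms weight_functor_object_axioms.intro that)
  note weight = weight_functor_object.weight_Fo[OF obj]
  show "is_functor (sys_category V excess) (weight_category (of_int a)) Fo Fm"
    unfolding weight_category_def by (rule functor_F) (rule weight)
  show "bij_betw (Fm r s) (Hom (sys_category V excess) r s) (Hom (weight_category (of_int a)) (Fo r) (Fo s))"
    if "r \<in> Obj (sys_category V excess)" "s \<in> Obj (sys_category V excess)"
  proof -
    have rs: "sys V excess r" "sys V excess s" using that by (auto simp: sys_category_def)
    interpret r: weight_functor_object a n \<iota> r by (rule obj[OF rs(1)])
    interpret s: weight_functor_object a n \<iota> s by (rule obj[OF rs(2)])
    \<comment> \<open>Homomorphisms commute with every \<open>hop i c\<close> and hence map vectors
      of a weight to vectors of the same weight.\<close>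
    have pres: "\<exists>w'. s 1 (neg_set p) (neg_set p) w' = w' \<and> F (\<iota> (single p w)) = \<iota> (single p w')"
      if F: "F \<in> module_hom D_E (Fo r) (Fo s)" and p: "p \<in> slice a" and w: "r 1 (neg_set p) (neg_set p) w = w" for F p w
    proof -
      let ?x = "\<iota> (single p w)"
      have sg: "single p w \<in> mc r" by (rule single_mc[OF rs(1) p w])
      have x: "?x \<in> carrier (Fo r)" using sg r.N(1) by auto
      have Fx: "F ?x \<in> carrier (Fo s)" using F x by (auto simp: module_hom_def)
      have smF: "F (X \<odot>\<^bsub>Fo r\<^esub> v) = X \<odot>\<^bsub>Fo s\<^esub> F v" if "X \<in> carrier D_E" "v \<in> carrier (Fo r)" for X v
        using F that by (simp add: module_hom_def)
      have "F \<zero>\<^bsub>Fo r\<^esub> = \<zero>\<^bsub>Fo s\<^esub>"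
      proof -
        have z: "\<zero>\<^bsub>Fo r\<^esub> \<in> carrier (Fo r)" by (rule r.D.M.zero_closed)
        have "F \<zero>\<^bsub>Fo r\<^esub> \<in> carrier (Fo s)" using F z by (auto simp: module_hom_def)
        then show ?thesis
          using smF[OF zero_closed z] unfolding r.D.smult_r_null[OF zero_closed] by (simp only: s.D.smult_l_null)
      qed
      moreover have "r.D.nil (hop i (ci p i)) ?x" for i
      proof -
        have "?x \<in> weight_space (Fo r) (ci p)" unfolding r.weight_space_Fo using sg by auto
        then show ?thesis unfolding r.D.W_iff by blast
      qed
      ultimately have "s.D.nil (hop i (ci p i)) (F ?x)" for i
        unfolding r.D.nil_def s.D.nil_def using smF[OF nat_pow_closed[OF hop_D_E] x] by metis
      then have "F ?x \<in> weight_space (Fo s) (ci p)" unfolding s.D.W_iff using Fx by blast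
      then obtain g where g: "F ?x = \<iota> g" "g \<in> mc s" "\<And>q. q \<in> keys g \<Longrightarrow> ci q = ci p"
        unfolding s.weight_space_Fo by blast
      have "g = single p (lookup g p)"
      proof (rule poly_mapping_eqI)
        fix q show "lookup g q = lookup (single p (lookup g p)) q"
          using g(3)[of q] ci_inj[of q p] by (cases "q = p") (auto simp: lookup_single in_keys_iff)
      qed
      then show ?thesis using g(1,2) p s.mc by metis
    qed
    have "bij_betw (Fm r s) (sys_hom V r s) (module_hom D_E (Fo r) (Fo s))"
      by (rule fully_faithful[OF rs]) (rule pres)
    then show ?thesis by (simp add: sys_category_def weight_category_def module_category_def)
  qed
  show "\<exists>r\<in>Obj (sys_category V excess). \<exists>f. is_iso (weight_category (of_int a)) X (Fo r) f"
    if X: "X \<in> Obj (weight_category (of_int a))"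
  proof -
    have X': "left_module D_E X" using X by (auto simp: weight_category_def module_category_def)
    interpret w: weight_object X a n
      by (intro weight_object.intro D_E_module.intro X' weight_object_axioms.intro card a)
        (use X in \<open>auto simp: weight_category_def module_category_def generalized_weight_module_def\<close>)
    obtain s \<Psi> where co: "w.coordinates s \<Psi>" using w.coordinates by blast
    obtain y f where "sys V excess y" "f \<in> module_hom D_E X (Fo y)" "bij_betw f (carrier X) (carrier (Fo y))"
      using iso_Fo[OF X' w.decomposed_module_axioms co w.key_rep[OF co]] by blast
    then show ?thesis
      unfolding weight_category_def using is_iso_module_category[OF X']
      by (intro bexI[of _ y]) (auto simp: sys_category_def)
  qed
qed

end

section \<open>Cardinalities\<close>

lemma real_eqI_rat: assumes "\<And>q. real_of_rat q < x \<longleftrightarrow> real_of_rat q < z" shows "x = z"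
proof (rule ccontr)
  assume "x \<noteq> z"
  then consider "x < z" | "z < x" by linarith
  then show False
  proof cases
    case 1 then obtain q where "x < of_rat q" "of_rat q < z" using of_rat_dense by blast
    then show False using assms[of q] by simp
  next
    case 2 then obtain q where "z < of_rat q" "of_rat q < x" using of_rat_dense by blast
    then show False using assms[of q] by simp
  qed
qed

text \<open>In base 3 with digits 0 and 1, all terms after the first difference together amount to
  at most half of it. In base 2 they could compensate it.\<close>

lemma nat_set_into_real: "inj (\<lambda>S. suminf (\<lambda>n. if n \<in> S then (1 / 3) ^ n else 0 :: real))"
proof (rule injI, rule ccontr)
  fix S T :: "nat set"
  let ?t = "\<lambda>S n. if n \<in> S then (1 / 3) ^ n else 0 :: real"
  assume eq: "suminf (?t S) = suminf (?t T)" and "S \<noteq> T"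
  then have ex: "\<exists>n. (n \<in> S) \<noteq> (n \<in> T)" by blast
  define n where "n = (LEAST n. (n \<in> S) \<noteq> (n \<in> T))"
  have n: "(n \<in> S) \<noteq> (n \<in> T)" unfolding n_def by (rule LeastI_ex[OF ex])
  have less: "(k \<in> S) = (k \<in> T)" if "k < n" for k using not_less_Least[of k "\<lambda>n. (n \<in> S) \<noteq> (n \<in> T)"] that unfolding n_def by blast
  define d where "d k = ?t S k - ?t T k" for k
  have geo: "summable (\<lambda>k. (1 / 3 :: real) ^ k)" by (rule summable_geometric) simp
  have st: "summable (?t S)" for S by (rule summable_comparison_test'[OF geo, of 0]) auto
  have sd: "summable d" unfolding d_def by (rule summable_diff[OF st st])
  have "suminf d = 0" unfolding d_def suminf_diff[OF st st, symmetric] using eq by simp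
  then have "(suminf (\<lambda>k. d (k + Suc n))) + (\<Sum>k<Suc n. d k) = 0" using suminf_split_initial_segment[OF sd, of "Suc n"] by simp
  moreover have "(\<Sum>k<Suc n. d k) = d n" using less by (simp add: d_def)
  ultimately have "\<bar>suminf (\<lambda>k. d (k + Suc n))\<bar> = \<bar>d n\<bar>" by linarith
  also have "\<bar>d n\<bar> = (1 / 3) ^ n" using n by (auto simp: d_def)
  finally have t: "\<bar>suminf (\<lambda>k. d (k + Suc n))\<bar> = (1 / 3) ^ n" .
  have sg: "(\<lambda>k. (1 / 3) ^ (k + Suc n)) sums ((1 / 3) ^ Suc n * (1 / (1 - 1 / 3)) :: real)"
    using sums_mult[OF geometric_sums[of "1 / 3 :: real"], of "(1 / 3) ^ Suc n"] by (simp add: power_add mult.commute)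
  have "norm (suminf (\<lambda>k. d (k + Suc n))) \<le> suminf (\<lambda>k. (1 / 3) ^ (k + Suc n))"
    by (rule norm_suminf_le[OF _ sums_summable[OF sg]]) (auto simp: d_def)
  also have "\<dots> = (1 / 3) ^ n / 2" unfolding sums_unique[OF sg, symmetric] by simp
  also have "\<dots> < (1 / 3) ^ n" by simp
  finally show False using t by simp
qed

text \<open>Coordinates are given by countably many complex numbers, and each of these by the
  rationals below its real and its imaginary part. So they are coded by a set of natural numbers and
  then by a real number, for which the universe has room.\<close>

lemma coords_into_universe:
  assumes e: "inj (e :: 'l \<Rightarrow> nat)" and "\<exists>f :: complex \<Rightarrow> 'u. inj f"
  shows "\<exists>\<iota> :: 'l coords \<Rightarrow> 'u. inj \<iota>"
proof -
  obtain f :: "complex \<Rightarrow> 'u" where f: "inj f" using assms by blast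
  define part :: "bool \<Rightarrow> complex \<Rightarrow> real" where "part b = (if b then Re else Im)" for b
  define cut where "cut g = {(l, k, b, q). real_of_rat q < part b (coeff (lookup g l) k)}" for g :: "'l coords"
  define code where "code = (\<lambda>(l, k, b, q). to_nat (e l, k :: nat, b :: bool, q :: rat))"
  have "inj code" using e by (auto simp: inj_def code_def)
  moreover have "inj cut"
  proof (rule injI)
    fix g h assume gh: "cut g = cut h"
    have "part b (coeff (lookup g l) k) = part b (coeff (lookup h l) k)" for b l k
    proof (rule real_eqI_rat)
      fix q
      have "(l, k, b, q) \<in> cut g \<longleftrightarrow> (l, k, b, q) \<in> cut h" using gh by simp
      then show "real_of_rat q < part b (coeff (lookup g l) k) \<longleftrightarrow> real_of_rat q < part b (coeff (lookup h l) k)"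
        by (simp add: cut_def)
    qed
    from this[of True] this[of False] show "g = h"
      by (intro poly_mapping_eqI poly_eqI complex_eqI) (simp_all add: part_def)
  qed
  ultimately have "inj (\<lambda>g. code ` cut g)" by (simp add: inj_def inj_image_eq_iff)
  then have "inj (f \<circ> of_real \<circ> (\<lambda>S. suminf (\<lambda>n. if n \<in> S then (1 / 3) ^ n else 0)) \<circ> (\<lambda>g. code ` cut g))"
    by (intro inj_compose f nat_set_into_real) (simp add: inj_def)
  then show ?thesis by blast
qed

theorem lemma6p10:
  fixes n :: nat and a :: int
  assumes "CARD('i::finite) = n + 1"
    and "n \<ge> 1"
    and "a \<ge> 0 \<or> (- int n - 1 < a \<and> a < 0)"
    and "\<exists>f :: complex \<Rightarrow> 'u. inj f"
    and "\<exists>g :: complex \<Rightarrow> 'v. inj g"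
  shows "equivalent_categories
    (weight_category (of_int a) :: (('i operator, 'u) module, 'u \<Rightarrow> 'u) category)
    (nilpotent_category a :: ((('i path \<Rightarrow>\<^sub>0 complex) set, 'v) module, 'v \<Rightarrow> 'v) category)"
proof -
  obtain \<iota> :: "('i \<Rightarrow> int) coords \<Rightarrow> 'u" where "inj \<iota>"
    using coords_into_universe[OF inj_to_nat assms(4)] by blast
  then interpret W: weight_functor a n \<iota>
    by unfold_locales (use assms in \<open>auto intro: inj_on_subset\<close>)
  obtain e :: "'i set \<Rightarrow> nat" where "inj e" using finite_imp_inj_to_nat_seg[of "UNIV :: 'i set set"] by auto
  then obtain \<kappa> :: "'i set coords \<Rightarrow> 'v" where "inj \<kappa>"
    using coords_into_universe[OF _ assms(5)] by blast
  then interpret N: nilpotent_functor a \<kappa>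
    by unfold_locales (auto intro: inj_on_subset)
  show ?thesis
  proof (rule equivalent_categories_span)
    show "is_category (weight_category (of_int a) :: (('i operator, 'u) module, 'u \<Rightarrow> 'u) category)"
      unfolding weight_category_def by (rule is_category_module_category)
    show "is_category (nilpotent_category a :: ((('i path \<Rightarrow>\<^sub>0 complex) set, 'v) module, 'v \<Rightarrow> 'v) category)"
      unfolding nilpotent_category_def by (rule is_category_module_category)
    show "is_category (sys_category (vertices a :: 'i set set) excess)" by (rule is_category_sys)
    show "is_functor (sys_category (vertices a :: 'i set set) excess) (weight_category (of_int a)) W.Fo W.Fm" by (rule W.weight_leg(1))
    show "is_functor (sys_category (vertices a :: 'i set set) excess) (nilpotent_category a) N.Fo N.Fm" by (rule N.nilpotent_leg(1))
  qed (use W.weight_leg(2,3) N.nilpotent_leg(2,3) in blast)+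
qed

end
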